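(* Let $\lambda>0$, $m\in\{0,1,2,\ldots\}$, and let $(P_{\ell}(\lambda))\sim\mathbb{P}^{[m]}_{1/2}(\lambda)$, with corresponding $1/2$-diversity $\sqrt{2}\,L_{1,m}(\lambda)\overset{d}{=}S_{1/2,m}(\lambda)^{-1/2}$. Then the size-biased re-arrangement $(\tilde{P}_{\ell}(\lambda))$ of $(P_\ell(\lambda))$ is equivalent in (joint) distribution to $$(\hat{P}_{\ell}(L_{1,m}(\lambda));\ \ell\ge1),$$ where, for $s>0$ and $\ell\ge1$, $$\hat{P}_{\ell}(s)=\frac{s^{2}}{Q_{\ell-1}+s^{2}}-\frac{s^{2}}{Q_{\ell}+s^{2}},$$ with $Q_{0}=0$, $Q_{\ell}=\sum_{i=1}^{\ell}X_{i}$, the $X_{i}$ being i.i.d. with the law of the square of a standard normal variable, and $L_{1,m}(\lambda)$ independent of $(X_i)$. Furthermore, for $\theta>-1/2$ with $m+\theta>0$, $(\hat{P}_{\ell}(L_{1,m}(G^{2}_{2\theta+K_{m}})))_{\ell\ge1}\sim\mathrm{GEM}(1/2,\theta)$, where $K_m$ is the number of blocks in a random partition of $[m]$ under the $\mathrm{PD}(1/2,\theta)$ distribution (with $K_0=0$) and, given $K_m=k$, $G_{2\theta+K_m}$ has a $\mathrm{Gamma}(2\theta+k,1)$ distribution.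
   Context: $S_{1/2}$ is the positive $1/2$-stable random variable with $\mathbb{E}[e^{-\lambda S_{1/2}}]=e^{-\sqrt{\lambda}}$ and density $f_{1/2}$. For $\lambda>0$, $S_{1/2,m}(\lambda)$ has density $f^{[m]}_{1/2}(t|\lambda)=t^me^{-\lambda t}f_{1/2}(t)/\mathbb{E}[S_{1/2}^me^{-\lambda S_{1/2}}]$. Let $(A_k)$ be the ranked jumps on $[0,1]$ of a stable subordinator of index $1/2$ with $\sum_kA_k=S_{1/2}$; $\mathrm{PD}(1/2,0)$ is the law of $(A_\ell/S_{1/2})$ and $\mathrm{PD}(1/2|t)$ is its conditional law given $S_{1/2}=t$. Set $\mathbb{P}^{[m]}_{1/2}(\lambda)=\int_0^\infty\mathrm{PD}(1/2|t)f^{[m]}_{1/2}(t|\lambda)\,dt$. The size-biased re-arrangement of a random mass partition is obtained by sampling its masses without replacement, successively, with probability proportional to size. $L_{1,m}(\lambda)$ is a positive random variable with law given by $\sqrt{2}L_{1,m}(\lambda)\overset{d}{=}S_{1/2,m}(\lambda)^{-1/2}$; when the argument $\lambda$ is replaced by a positive random variable $Z$ (independent of $(X_i)$), $L_{1,m}(Z)$ given $Z=\lambda$ has the law of $L_{1,m}(\lambda)$. $\mathrm{PD}(1/2,\theta)=\int_0^\infty \mathrm{PD}(1/2|t)\,\frac{t^{-\theta}f_{1/2}(t)}{\mathbb{E}[S_{1/2}^{-\theta}]}\,dt$; the random partition of $[m]=\{1,\dots,m\}$ under it has $i,j$ in the same block iff $Y_i=Y_j$, where $(Y_i)$ are conditionally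 i.i.d. from the random discrete distribution $\sum_kP_k\delta_{U_k}$ with $(P_k)\sim\mathrm{PD}(1/2,\theta)$ and $(U_k)$ independent i.i.d. uniform. $\mathrm{GEM}(1/2,\theta)$ is the law of $((1-W_\ell)\prod_{i<\ell}W_i)_{\ell\ge1}$ with $W_i$ independent $\mathrm{Beta}(\theta+i/2,1/2)$. *)

theory Defs
  imports "HOL-Probability.Probability"
begin

text \<open>
  Sequences indexed by \<open>\<ell> = 1, 2, \<dots>\<close> are functions on \<^typ>\<open>nat\<close> starting at index 0, so entry
  \<open>\<ell>\<close> of a formal sequence is entry \<open>\<ell> + 1\<close> of the mathematical one.  A random sequence is a map
  \<open>'w \<Rightarrow> nat \<Rightarrow> real\<close>.
\<close>

abbreviation seq_space :: "(nat \<Rightarrow> real) measure" where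
  "seq_space \<equiv> PiM UNIV (\<lambda>_. borel)"

text \<open>The library's \<open>indep_var\<close> forces both variables to have the same type, hence this
  version, which is what \<open>indep_var\<close> amounts to by \<open>prob_space.indep_var_eq\<close>.\<close>

definition indep_rv ::
  "'w measure \<Rightarrow> 's measure \<Rightarrow> ('w \<Rightarrow> 's) \<Rightarrow> 't measure \<Rightarrow> ('w \<Rightarrow> 't) \<Rightarrow> bool" where
  "indep_rv M S X T Y \<longleftrightarrow>
     X \<in> measurable M S \<and> Y \<in> measurable M T \<and>
     prob_space.indep_set M {X -` A \<inter> space M |A. A \<in> sets S} {Y -` B \<inter> space M |B. B \<in> sets T}"

definition iid_seq :: "'w measure \<Rightarrow> real measure \<Rightarrow> ('w \<Rightarrow> nat \<Rightarrow> real) \<Rightarrow> bool" where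
  "iid_seq M D X \<longleftrightarrow>
     prob_space.indep_vars M (\<lambda>_. borel) (\<lambda>i \<omega>. X \<omega> i) UNIV \<and>
     (\<forall>i. distr M borel (\<lambda>\<omega>. X \<omega> i) = D)"

text \<open>\<open>conditional_law M T Z N R \<kappa>\<close>: given \<open>Z = z\<close>, the variable \<open>R\<close> has law \<open>\<kappa> z\<close>.  The kernel
  only matters for almost every \<open>z\<close> with respect to the law of \<open>Z\<close>, so it may be
  meaningless (not a probability measure) on a null set.\<close>

definition conditional_law ::
  "'w measure \<Rightarrow> 't measure \<Rightarrow> ('w \<Rightarrow> 't) \<Rightarrow> 'r measure \<Rightarrow> ('w \<Rightarrow> 'r) \<Rightarrow> ('t \<Rightarrow> 'r measure) \<Rightarrow> bool"
  where
  "conditional_law M T Z N R \<kappa> \<longleftrightarrow>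
     Z \<in> measurable M T \<and> R \<in> measurable M N \<and>
     (\<forall>B\<in>sets T. \<forall>C\<in>sets N.
        emeasure M {\<omega> \<in> space M. Z \<omega> \<in> B \<and> R \<omega> \<in> C}
          = (\<integral>\<^sup>+z\<in>B. emeasure (\<kappa> z) C \<partial>(distr M T Z)))"

definition stable_subordinator :: "'w measure \<Rightarrow> real \<Rightarrow> (real \<Rightarrow> 'w \<Rightarrow> real) \<Rightarrow> bool" where
  "stable_subordinator M \<alpha> \<xi> \<longleftrightarrow>
     prob_space M \<and>
     (\<forall>t\<ge>0. \<xi> t \<in> borel_measurable M) \<and>
     (AE \<omega> in M. \<xi> 0 \<omega> = 0 \<and> mono_on {0..} (\<lambda>t. \<xi> t \<omega>) \<and>
        (\<forall>t\<ge>0. continuous (at_right t) (\<lambda>s. \<xi> s \<omega>))) \<and>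
     (\<forall>(n::nat) (\<tau>::nat \<Rightarrow> real). 0 \<le> \<tau> 0 \<and> mono \<tau> \<longrightarrow>
        prob_space.indep_vars M (\<lambda>_. borel) (\<lambda>i \<omega>. \<xi> (\<tau> (Suc i)) \<omega> - \<xi> (\<tau> i) \<omega>) {..<n}) \<and>
     (\<forall>s t. 0 \<le> s \<and> s \<le> t \<longrightarrow>
        distr M borel (\<lambda>\<omega>. \<xi> t \<omega> - \<xi> s \<omega>) = distr M borel (\<xi> (t - s))) \<and>
     (\<forall>t\<ge>0. \<forall>u>0. (\<integral>\<omega>. exp (- u * \<xi> t \<omega>) \<partial>M) = exp (- t * u powr \<alpha>))"

definition jump :: "(real \<Rightarrow> 'w \<Rightarrow> real) \<Rightarrow> 'w \<Rightarrow> real \<Rightarrow> real" where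
  "jump \<xi> \<omega> t = \<xi> t \<omega> - Lim (at_left t) (\<lambda>s. \<xi> s \<omega>)"

text \<open>\<open>A \<omega>\<close> lists the jumps of \<open>\<xi>\<close> on \<open>[0,1]\<close> in decreasing order, with multiplicity.  Time 0
  carries no jump because \<open>\<xi> 0 = 0\<close>; a stable subordinator has infinitely many jumps, so the
  enumeration is by all of \<^typ>\<open>nat\<close>.\<close>

definition ranked_jumps ::
  "'w measure \<Rightarrow> (real \<Rightarrow> 'w \<Rightarrow> real) \<Rightarrow> ('w \<Rightarrow> nat \<Rightarrow> real) \<Rightarrow> bool" where
  "ranked_jumps M \<xi> A \<longleftrightarrow>
     A \<in> measurable M seq_space \<and>
     (AE \<omega> in M. decseq (A \<omega>) \<and>
        (\<exists>\<tau>. bij_betw \<tau> (UNIV :: nat set) {t \<in> {0<..1}. jump \<xi> \<omega> t > 0} \<and>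
             (\<forall>k. A \<omega> k = jump \<xi> \<omega> (\<tau> k))))"

text \<open>Below \<open>S\<close> is a random variable on \<open>M\<close> with density \<open>f\<close>, playing the role of \<open>S\<^sub>1\<^sub>/\<^sub>2\<close>, and
  \<open>\<kappa> t\<close> plays the role of \<open>PD(1/2|t)\<close>.\<close>

definition tilted_density ::
  "'w measure \<Rightarrow> ('w \<Rightarrow> real) \<Rightarrow> (real \<Rightarrow> real) \<Rightarrow> nat \<Rightarrow> real \<Rightarrow> real \<Rightarrow> real" where
  "tilted_density M S f m lam t =
     t ^ m * exp (- lam * t) * f t / (\<integral>\<omega>. S \<omega> ^ m * exp (- lam * S \<omega>) \<partial>M)"

definition tilted_law ::
  "'w measure \<Rightarrow> ('w \<Rightarrow> real) \<Rightarrow> (real \<Rightarrow> real) \<Rightarrow> nat \<Rightarrow> real \<Rightarrow> real measure" where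
  "tilted_law M S f m lam = density lborel (\<lambda>t. ennreal (tilted_density M S f m lam t))"

definition tilted_PD ::
  "'w measure \<Rightarrow> ('w \<Rightarrow> real) \<Rightarrow> (real \<Rightarrow> real) \<Rightarrow> (real \<Rightarrow> (nat \<Rightarrow> real) measure)
     \<Rightarrow> nat \<Rightarrow> real \<Rightarrow> (nat \<Rightarrow> real) measure" where
  "tilted_PD M S f \<kappa> m lam = bind (tilted_law M S f m lam) \<kappa>"

definition PD_half ::
  "'w measure \<Rightarrow> ('w \<Rightarrow> real) \<Rightarrow> (real \<Rightarrow> real) \<Rightarrow> (real \<Rightarrow> (nat \<Rightarrow> real) measure)
     \<Rightarrow> real \<Rightarrow> (nat \<Rightarrow> real) measure" where
  "PD_half M S f \<kappa> \<theta> =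
     bind (density lborel
             (\<lambda>t. ennreal (t powr (- \<theta>) * f t / (\<integral>\<omega>. S \<omega> powr (- \<theta>) \<partial>M)))) \<kappa>"

text \<open>The law of \<open>L\<^sub>1\<^sub>,\<^sub>m(\<lambda>)\<close>, defined by \<open>\<surd>2 L\<^sub>1\<^sub>,\<^sub>m(\<lambda>) = S\<^sub>1\<^sub>/\<^sub>2\<^sub>,\<^sub>m(\<lambda>) powr (-1/2)\<close> in law.\<close>

definition L_law ::
  "'w measure \<Rightarrow> ('w \<Rightarrow> real) \<Rightarrow> (real \<Rightarrow> real) \<Rightarrow> nat \<Rightarrow> real \<Rightarrow> real measure" where
  "L_law M S f m lam =
     distr (tilted_law M S f m lam) borel (\<lambda>t. t powr (- 1 / 2) / sqrt 2)"

text \<open>\<open>\<sigma> n \<omega>\<close> is the index of the mass picked at step \<open>n\<close>.  Given \<open>P\<close> and the first \<open>n\<close> picks,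
  an index not yet picked is chosen with probability its mass divided by the remaining mass.
  This is for random mass partitions, of total mass 1, with infinitely many non-zero masses, so
  that the remaining mass never vanishes.\<close>

definition size_biased_rearrangement ::
  "'w measure \<Rightarrow> ('w \<Rightarrow> nat \<Rightarrow> real) \<Rightarrow> ('w \<Rightarrow> nat \<Rightarrow> real) \<Rightarrow> bool" where
  "size_biased_rearrangement M P R \<longleftrightarrow>
     P \<in> measurable M seq_space \<and> R \<in> measurable M seq_space \<and>
     (\<exists>\<sigma> :: nat \<Rightarrow> 'w \<Rightarrow> nat.
        (\<forall>n. \<sigma> n \<in> measurable M (count_space UNIV)) \<and>
        (AE \<omega> in M. \<forall>n. R \<omega> n = P \<omega> (\<sigma> n \<omega>)) \<and>
        (\<forall>C\<in>sets seq_space. \<forall>(n::nat) (k::nat \<Rightarrow> nat).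
           emeasure M {\<omega> \<in> space M. P \<omega> \<in> C \<and> (\<forall>i\<le>n. \<sigma> i \<omega> = k i)} =
             (if k n \<in> k ` {..<n} then 0
              else \<integral>\<^sup>+\<omega>\<in>{\<omega> \<in> space M. P \<omega> \<in> C \<and> (\<forall>i<n. \<sigma> i \<omega> = k i)}.
                     ennreal (P \<omega> (k n) / (1 - (\<Sum>i<n. P \<omega> (k i)))) \<partial>M)))"

definition sq_normal_law :: "real measure" where
  "sq_normal_law = distr (density lborel (\<lambda>x. ennreal (std_normal_density x))) borel (\<lambda>x. x\<^sup>2)"

definition P_hat :: "real \<Rightarrow> (nat \<Rightarrow> real) \<Rightarrow> nat \<Rightarrow> real" where
  "P_hat s x l = s\<^sup>2 / ((\<Sum>i<l. x i) + s\<^sup>2) - s\<^sup>2 / ((\<Sum>i<Suc l. x i) + s\<^sup>2)"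

definition gamma_law :: "real \<Rightarrow> real measure" where
  "gamma_law a = density lborel
     (\<lambda>x. ennreal (if x > 0 then x powr (a - 1) * exp (- x) / Gamma a else 0))"

definition beta_law :: "real \<Rightarrow> real \<Rightarrow> real measure" where
  "beta_law a b = density lborel
     (\<lambda>x. ennreal (if 0 < x \<and> x < 1 then x powr (a - 1) * (1 - x) powr (b - 1) / Beta a b else 0))"

definition GEM_half :: "real \<Rightarrow> (nat \<Rightarrow> real) measure" where
  "GEM_half \<theta> =
     distr (PiM UNIV (\<lambda>i::nat. beta_law (\<theta> + real (Suc i) / 2) (1 / 2))) seq_space
       (\<lambda>w l. (1 - w l) * (\<Prod>i<l. w i))"

text \<open>The discrete measure \<open>\<Sum>k. p k \<delta>(u k)\<close>, as the image under \<open>u\<close> of the measure on \<^typ>\<open>nat\<close>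
  with weights \<open>p\<close>.\<close>

definition discrete_distribution :: "(nat \<Rightarrow> real) \<Rightarrow> (nat \<Rightarrow> real) \<Rightarrow> real measure" where
  "discrete_distribution p u = distr (density (count_space UNIV) (\<lambda>k. ennreal (p k))) borel u"

definition species_sample ::
  "'w measure \<Rightarrow> (nat \<Rightarrow> real) measure
     \<Rightarrow> ('w \<Rightarrow> nat \<Rightarrow> real) \<Rightarrow> ('w \<Rightarrow> nat \<Rightarrow> real) \<Rightarrow> ('w \<Rightarrow> nat \<Rightarrow> real) \<Rightarrow> bool" where
  "species_sample M D P U Y \<longleftrightarrow>
     prob_space M \<and>
     distr M seq_space P = D \<and>
     iid_seq M (uniform_measure lborel {0..1}) U \<and>
     indep_rv M seq_space P seq_space U \<and>
     conditional_law M (seq_space \<Otimes>\<^sub>M seq_space) (\<lambda>\<omega>. (P \<omega>, U \<omega>)) seq_space Y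
       (\<lambda>(p, u). PiM UNIV (\<lambda>_. discrete_distribution p u))"

text \<open>The sample \<open>Y\<close> is read at the indices \<open>1, \<dots>, m\<close>; its entry 0 is not used.\<close>

definition partition_blocks :: "nat \<Rightarrow> (nat \<Rightarrow> real) \<Rightarrow> nat set set" where
  "partition_blocks m y = {1..m} // {(i, j). i \<in> {1..m} \<and> j \<in> {1..m} \<and> y i = y j}"

end

theory Submission
  imports Defs "HOL-Real_Asymp.Real_Asymp"
begin

text \<open>
  Let \<open>\<xi>\<close> be the subordinator, \<open>A\<close> its jumps on \<open>[0,1]\<close> and \<open>S\<close> their sum.

  Cutting \<open>[0,1]\<close> into \<open>N\<close> cells and letting \<open>N\<close> grow in expectations of products of independent
  increments yields the Mecke formula \<open>mecke\<close>: when tuples of jumps with distinct indices are weighted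
  by the product of their sizes, the picked jumps and the mass that is left over become
  independent.  Each picked jump follows the \<open>\<sigma>\<close>-finite measure with density
  \<open>1 / (2 \<surd>(\<pi> x))\<close>, which is the size-biased Levy measure, and the mass left over has the law of \<open>S\<close>
  itself.  The limit is computed for exponential functions; uniqueness of multivariate Laplace
  transforms gives the formula for all measurable functions.

  A size-biased pick selects a jump with probability proportional to its size, so the masses
  \<open>S = R\<^sub>0 > R\<^sub>1 > \<dots>\<close> remaining after successive picks form a Markov chain whose steps the formula
  describes.  Since \<open>1 / (2 S)\<close> is distributed like a squared normal variable, an identity of explicit
  densities (\<open>pick_step\<close>) shows that \<open>1 / (2 R\<^sub>1) - 1 / (2 R\<^sub>0)\<close> is again a squared normal variable,
  independent of \<open>R\<^sub>0\<close>.  By induction (\<open>chain\<close>) the numbers \<open>1 / (2 R\<^sub>i)\<close> form a random walk whose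
  steps \<open>X\<^sub>1, X\<^sub>2, \<dots>\<close> are squared normal variables independent of \<open>S\<close>.  With \<open>L\<^sup>2 = 1 / (2 S)\<close> the
  picked fraction \<open>(R\<^sub>i - R\<^bsub>i+1\<^esub>) / R\<^sub>0\<close> equals \<open>P_hat L X i\<close>.  The steps are independent of \<open>S\<close>, hence
  a change of the law of \<open>S\<close> alone, such as the passage to \<open>f\<^bsup>[m]\<^esup>(\<cdot>|\<lambda>)\<close>, changes only the law of \<open>L\<close>; this
  is the first half of the theorem (\<open>size_biased_tilted_PD\<close>).

  For the second half, the Mecke formula also gives
  \<open>E[exp (- g\<^sup>2 S) B\<^sub>k(A)] = c\<^sub>k g\<^bsup>k - 2m\<^esup> e\<^bsup>-g\<^esup>\<close>, where \<open>B\<^sub>k(A)\<close> is the total weight of the samples of size \<open>m\<close>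
  showing exactly \<open>k\<close> different jumps (\<open>block_laplace\<close>).  Therefore the joint law of \<open>(K, G)\<close> has, up to a
  constant, the density \<open>g\<^bsup>2(m+\<theta>)-1\<^esup> E[exp (- g\<^sup>2 S) B\<^sub>k(A)]\<close>, in which the Gamma functions have cancelled.
  Summed over \<open>k\<close> this is \<open>g\<^bsup>2(m+\<theta>)-1\<^esup> E[S\<^sup>m exp (- g\<^sup>2 S)]\<close>, whose expectation is precisely the
  normalising constant in the density of \<open>S\<^bsub>1/2,m\<^esub>(g\<^sup>2)\<close>.  Integrating \<open>t\<^sup>m exp (- g\<^sup>2 t)\<close> against
  \<open>g\<^bsup>2(m+\<theta>)-1\<^esup> dg\<close> leaves a multiple of \<open>t\<^bsup>-\<theta>\<^esup>\<close>, so the mixture makes \<open>L\<close> distributed as under the density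
  proportional to \<open>t\<^bsup>-\<theta>\<^esup> f(t)\<close> (\<open>mixed_L_law\<close>); then \<open>L\<^sup>2\<close> has a Gamma law of shape \<open>\<theta> + 1/2\<close> and rate
  \<open>1/2\<close>.  The beta-gamma algebra turns the ratios of successive partial sums
  \<open>L\<^sup>2 + X\<^sub>1 + \<dots> + X\<^sub>i\<close> into the independent Beta factors of \<open>GEM(1/2, \<theta>)\<close> (\<open>GEM_cylinder\<close>).
\<close>

section \<open>Uniqueness of Laplace transforms\<close>

text \<open>The substitution \<open>y = exp (- x)\<close> turns integer values of the Laplace transform into moments on
  \<open>[0,1]\<close>, where polynomials are dense, so both measures integrate continuous functions of \<open>y\<close>
  equally; half-lines are limits of such functions.\<close>

lemma laplace_unique_real:
  fixes \<mu> \<nu> :: "real measure"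
  assumes sets: "sets \<mu> = sets borel" "sets \<nu> = sets borel"
    and fin: "finite_measure \<mu>" "finite_measure \<nu>"
    and nonneg: "AE x in \<mu>. 0 \<le> x" "AE x in \<nu>. 0 \<le> x"
    and eq: "\<And>n::nat. (\<integral>\<^sup>+x. ennreal (exp (- real n * x)) \<partial>\<mu>) = (\<integral>\<^sup>+x. ennreal (exp (- real n * x)) \<partial>\<nu>)"
  shows "\<mu> = \<nu>"
proof -
  \<comment> \<open>the maximum keeps \<open>y\<close> inside \<open>[0,1]\<close> also on the null set of negative \<open>x\<close>\<close>
  define y where "y x = exp (- max 0 x)" for x :: real
  have y01: "y x \<in> {0..1}" for x by (auto simp: y_def)
  have [measurable]: "y \<in> borel_measurable borel" by (simp add: y_def[abs_def])
  have M1: "f \<in> borel_measurable \<mu> \<longleftrightarrow> f \<in> borel_measurable borel"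
    and M2: "f \<in> borel_measurable \<nu> \<longleftrightarrow> f \<in> borel_measurable borel" for f :: "real \<Rightarrow> real"
    by (simp_all add: sets cong: measurable_cong_sets)
  interpret m: finite_measure \<mu> by fact
  interpret n: finite_measure \<nu> by fact
  have int: "integrable \<mu> f" "integrable \<nu> f"
    if "f \<in> borel_measurable borel" "\<And>x. \<bar>f x\<bar> \<le> B" for f :: "real \<Rightarrow> real" and B
    using that by (auto intro!: m.integrable_const_bound[of _ B] n.integrable_const_bound[of _ B] simp: M1 M2)
  have pw: "(\<integral>x. y x ^ k \<partial>\<mu>) = (\<integral>x. y x ^ k \<partial>\<nu>)" for k :: nat
  proof -
    have yk: "y x ^ k = exp (- real k * x)" if "0 \<le> x" for x
      using that by (simp add: y_def exp_of_nat_mult[symmetric])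
    have "(\<integral>\<^sup>+x. ennreal (y x ^ k) \<partial>\<mu>) = (\<integral>\<^sup>+x. ennreal (exp (- real k * x)) \<partial>\<mu>)"
      using nonneg(1) by (intro nn_integral_cong_AE) (auto simp: yk elim!: eventually_mono)
    moreover have "(\<integral>\<^sup>+x. ennreal (y x ^ k) \<partial>\<nu>) = (\<integral>\<^sup>+x. ennreal (exp (- real k * x)) \<partial>\<nu>)"
      using nonneg(2) by (intro nn_integral_cong_AE) (auto simp: yk elim!: eventually_mono)
    ultimately show ?thesis
      using y01 eq[of k] by (subst (1 2) integral_eq_nn_integral) (auto simp: M1 M2)
  qed
  have cont_eq: "(\<integral>x. h (y x) \<partial>\<mu>) = (\<integral>x. h (y x) \<partial>\<nu>)"
    if h: "continuous_on {0..1} h" and hm[measurable]: "h \<in> borel_measurable borel" for h :: "real \<Rightarrow> real"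
  proof -
    have "compact (h ` {0..1})" using h by (intro compact_continuous_image) auto
    then obtain B where B: "\<And>z. z \<in> {0..1} \<Longrightarrow> \<bar>h z\<bar> \<le> B"
      unfolding real_norm_def[symmetric] by (metis bounded_iff compact_imp_bounded imageI)
    have ih: "integrable \<mu> (\<lambda>x. h (y x))" "integrable \<nu> (\<lambda>x. h (y x))"
      using B y01 by (auto intro!: int[of _ B])
    have bnd: "\<bar>(\<integral>x. h (y x) \<partial>\<mu>) - (\<integral>x. h (y x) \<partial>\<nu>)\<bar> \<le> e * (measure \<mu> (space \<mu>) + measure \<nu> (space \<nu>))"
      if e: "0 < e" for e
    proof -
      obtain p where p: "real_polynomial_function p" and pe: "\<And>z. z \<in> {0..1} \<Longrightarrow> \<bar>h z - p z\<bar> < e"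
        using Stone_Weierstrass_real_polynomial_function[OF _ h e] by blast
      obtain a k where pa: "p = (\<lambda>x. \<Sum>i\<le>k. a i * x ^ i)"
        using p by (auto simp: real_polynomial_function_iff_sum)
      have ipw: "integrable \<mu> (\<lambda>x. a i * y x ^ i)" "integrable \<nu> (\<lambda>x. a i * y x ^ i)" for i
        using y01 by (auto intro!: integrable_mult_right int[of _ 1] simp: power_le_one)
      have ip: "integrable \<mu> (\<lambda>x. p (y x))" "integrable \<nu> (\<lambda>x. p (y x))"
        unfolding pa using ipw by (auto intro!: Bochner_Integration.integrable_sum)
      have peq: "(\<integral>x. p (y x) \<partial>\<mu>) = (\<integral>x. p (y x) \<partial>\<nu>)"
        unfolding pa using ipw by (simp add: Bochner_Integration.integral_sum pw)
      have close: "\<bar>(\<integral>x. h (y x) \<partial>\<kappa>) - (\<integral>x. p (y x) \<partial>\<kappa>)\<bar> \<le> e * measure \<kappa> (space \<kappa>)"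
        if "finite_measure \<kappa>" "integrable \<kappa> (\<lambda>x. h (y x))" "integrable \<kappa> (\<lambda>x. p (y x))" for \<kappa>
      proof -
        interpret finite_measure \<kappa> by fact
        have "\<bar>(\<integral>x. h (y x) \<partial>\<kappa>) - (\<integral>x. p (y x) \<partial>\<kappa>)\<bar> = \<bar>\<integral>x. h (y x) - p (y x) \<partial>\<kappa>\<bar>"
          using that by (simp add: Bochner_Integration.integral_diff)
        also have "\<dots> \<le> (\<integral>x. \<bar>h (y x) - p (y x)\<bar> \<partial>\<kappa>)" by (rule integral_abs_bound)
        also have "\<dots> \<le> (\<integral>x. e \<partial>\<kappa>)"
          using that pe y01 by (intro integral_mono) (auto intro: less_imp_le)
        finally show ?thesis by (simp add: mult.commute)
      qed
      note 1 = close[OF fin(1) ih(1) ip(1)] and 2 = close[OF fin(2) ih(2) ip(2)]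
      show ?thesis using 1 2 peq by (simp add: ring_distribs)
    qed
    have "\<bar>(\<integral>x. h (y x) \<partial>\<mu>) - (\<integral>x. h (y x) \<partial>\<nu>)\<bar> \<le> 0"
    proof (rule field_le_epsilon)
      fix e :: real assume "0 < e"
      define c where "c = measure \<mu> (space \<mu>) + measure \<nu> (space \<nu>)"
      have "0 \<le> c" by (simp add: c_def)
      have "e / (c + 1) * c \<le> e" using \<open>0 < e\<close> \<open>0 \<le> c\<close> by (simp add: field_simps)
      then show "\<bar>(\<integral>x. h (y x) \<partial>\<mu>) - (\<integral>x. h (y x) \<partial>\<nu>)\<bar> \<le> 0 + e"
        using bnd[of "e / (c + 1)"] \<open>0 < e\<close> \<open>0 \<le> c\<close> unfolding c_def[symmetric] by simp
    qed
    then show ?thesis by simp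
  qed
  have ioi: "measure \<mu> {a<..} = measure \<nu> {a<..}" for a
  proof -
    define c where "c = exp (- a)"
    \<comment> \<open>piecewise linear functions increasing to the indicator of \<open>{..<c}\<close>; the boundary \<open>c\<close> corresponds to \<open>x = a\<close>\<close>
    define h where "h k z = min 1 (max 0 (real k * (c - z)))" for k :: nat and z :: real
    have hm[measurable]: "h k \<in> borel_measurable borel" for k by (simp add: h_def[abs_def])
    have lim: "(\<lambda>k. h k z) \<longlonglongrightarrow> indicator {..<c} z" for z
    proof (cases "z < c")
      case True
      obtain K where K: "1 / (c - z) < real K" using reals_Archimedean2 by blast
      have "h k z = 1" if "K \<le> k" for k
      proof -
        have "1 / (c - z) \<le> real k" using K that by (meson le_less_trans less_imp_le of_nat_le_iff order_less_le_trans)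
        then have "1 \<le> real k * (c - z)" using True by (simp add: field_simps)
        then show ?thesis by (simp add: h_def)
      qed
      then show ?thesis using True
        by (intro tendsto_eventually) (auto simp: eventually_sequentially)
    next
      case False
      then have "real k * (c - z) \<le> 0" for k by (simp add: mult_nonneg_nonpos)
      then have "h k z = 0" for k by (simp add: h_def max_absorb1)
      then show ?thesis using False by simp
    qed
    have "(\<lambda>k. \<integral>x. h k (y x) \<partial>\<mu>) \<longlonglongrightarrow> (\<integral>x. indicator {..<c} (y x) \<partial>\<mu>)"
      by (rule integral_dominated_convergence[where w="\<lambda>_. 1"])
         (auto simp: M1 lim, auto simp: h_def)
    moreover have "(\<lambda>k. \<integral>x. h k (y x) \<partial>\<nu>) \<longlonglongrightarrow> (\<integral>x. indicator {..<c} (y x) \<partial>\<nu>)"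
      by (rule integral_dominated_convergence[where w="\<lambda>_. 1"])
         (auto simp: M2 lim, auto simp: h_def)
    moreover have "(\<integral>x. h k (y x) \<partial>\<mu>) = (\<integral>x. h k (y x) \<partial>\<nu>)" for k
      by (rule cont_eq) (auto simp: h_def[abs_def] intro!: continuous_intros)
    ultimately have lim_eq: "(\<integral>x. indicator {..<c} (y x) \<partial>\<mu>) = (\<integral>x. (indicator {..<c} (y x) :: real) \<partial>\<nu>)"
      using LIMSEQ_unique by fastforce
    have ind: "indicator {..<c} (y x) = (indicator {a<..} x :: real)" if "0 \<le> x" for x
      using that by (auto simp: y_def c_def indicator_def)
    have "(\<integral>x. indicator {..<c} (y x) \<partial>\<mu>) = (\<integral>x. (indicator {a<..} x :: real) \<partial>\<mu>)"
      using nonneg(1) by (intro integral_cong_AE) (auto simp: M1 ind elim!: eventually_mono)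
    moreover have "(\<integral>x. indicator {..<c} (y x) \<partial>\<nu>) = (\<integral>x. (indicator {a<..} x :: real) \<partial>\<nu>)"
      using nonneg(2) by (intro integral_cong_AE) (auto simp: M2 ind elim!: eventually_mono)
    moreover have "(\<integral>x. (indicator {a<..} x :: real) \<partial>\<mu>) = measure \<mu> {a<..}"
      "(\<integral>x. (indicator {a<..} x :: real) \<partial>\<nu>) = measure \<nu> {a<..}"
      by (subst Bochner_Integration.integral_indicator; simp add: sets sets_eq_imp_space_eq[OF sets(1)] sets_eq_imp_space_eq[OF sets(2)])+
    ultimately show ?thesis using lim_eq by simp
  qed
  show ?thesis
    by (rule measure_eqI_lessThan)
       (auto simp: sets m.emeasure_eq_measure n.emeasure_eq_measure ioi)
qed

text \<open>The factors \<open>exp (- n\<^sub>i x\<^sub>i)\<close> are replaced by indicators one coordinate at a time: with the other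
  factors collected in a density, the one-dimensional uniqueness applies to the image under that coordinate.\<close>

lemma laplace_unique_PiM:
  fixes \<mu> \<nu> :: "('i \<Rightarrow> real) measure"
  assumes I: "finite I"
    and sets: "sets \<mu> = sets (PiM I (\<lambda>_. borel))" "sets \<nu> = sets (PiM I (\<lambda>_. borel))"
    and fin: "finite_measure \<mu>" "finite_measure \<nu>"
    and nonneg: "AE x in \<mu>. \<forall>i\<in>I. 0 \<le> x i" "AE x in \<nu>. \<forall>i\<in>I. 0 \<le> x i"
    and eq: "\<And>n::'i \<Rightarrow> nat. (\<integral>\<^sup>+x. (\<Prod>i\<in>I. ennreal (exp (- real (n i) * x i))) \<partial>\<mu>)
               = (\<integral>\<^sup>+x. (\<Prod>i\<in>I. ennreal (exp (- real (n i) * x i))) \<partial>\<nu>)"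
  shows "\<mu> = \<nu>"
proof -
  interpret m: finite_measure \<mu> by fact
  interpret n: finite_measure \<nu> by fact
  have M1: "f \<in> measurable \<mu> K \<longleftrightarrow> f \<in> measurable (PiM I (\<lambda>_. borel)) K"
    and M2: "f \<in> measurable \<nu> K \<longleftrightarrow> f \<in> measurable (PiM I (\<lambda>_. borel)) K" for f and K :: "'z measure"
    by (simp_all add: sets cong: measurable_cong_sets)
  \<comment> \<open>\<open>J\<close> is the set of coordinates in which exponentials have already become indicators\<close>
  have claim: "(\<integral>\<^sup>+x. (\<Prod>i\<in>J. indicator (B i) (x i)) * (\<Prod>i\<in>I - J. ennreal (exp (- real (n i) * x i))) \<partial>\<mu>)
      = (\<integral>\<^sup>+x. (\<Prod>i\<in>J. indicator (B i) (x i)) * (\<Prod>i\<in>I - J. ennreal (exp (- real (n i) * x i))) \<partial>\<nu>)"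
    if "finite J" "J \<subseteq> I" "\<And>i. i \<in> J \<Longrightarrow> B i \<in> sets borel" for J B n
    using that
  proof (induction J arbitrary: n)
    case empty
    then show ?case using eq by simp
  next
    case (insert j J)
    have jI: "j \<in> I" "J \<subseteq> I" using insert by auto
    define w where "w x = (\<Prod>i\<in>J. indicator (B i) (x i)) * (\<Prod>i\<in>I - insert j J. ennreal (exp (- real (n i) * x i)))"
      for x :: "'i \<Rightarrow> real"
    have [measurable]: "(\<lambda>x. x j) \<in> measurable (PiM I (\<lambda>_. borel)) borel"
      using jI by measurable
    have Bm: "(\<lambda>x. indicator (B i) (x i) :: ennreal) \<in> borel_measurable (PiM I (\<lambda>_. borel))"
      if "i \<in> J" for i
    proof -
      have "i \<in> I" using that jI by auto
      have "B i \<in> sets borel" using insert.prems(2)[of i] that by auto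
      then have [measurable]: "(indicator (B i) :: real \<Rightarrow> ennreal) \<in> borel_measurable borel" by simp
      show ?thesis using \<open>i \<in> I\<close> by measurable
    qed
    have wm[measurable]: "w \<in> borel_measurable (PiM I (\<lambda>_. borel))"
      unfolding w_def[abs_def] using Bm by (intro borel_measurable_times_ennreal borel_measurable_prod_ennreal) auto
    define m1 where "m1 = distr (density \<mu> w) borel (\<lambda>x. x j)"
    define n1 where "n1 = distr (density \<nu> w) borel (\<lambda>x. x j)"
    have i1: "(\<integral>\<^sup>+z. f z \<partial>m1) = (\<integral>\<^sup>+x. w x * f (x j) \<partial>\<mu>)" if [measurable]: "f \<in> borel_measurable borel" for f
      unfolding m1_def by (subst nn_integral_distr) (auto simp: M1 nn_integral_density)
    have i2: "(\<integral>\<^sup>+z. f z \<partial>n1) = (\<integral>\<^sup>+x. w x * f (x j) \<partial>\<nu>)" if [measurable]: "f \<in> borel_measurable borel" for f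
      unfolding n1_def by (subst nn_integral_distr) (auto simp: M2 nn_integral_density)
    have w_le: "w x \<le> 1" if "\<forall>i\<in>I. 0 \<le> x i" for x
    proof -
      have "(\<Prod>i\<in>I - insert j J. ennreal (exp (- real (n i) * x i))) \<le> 1"
        using that by (intro prod_le_1) (auto intro!: mult_nonneg_nonneg simp: ennreal_le_1)
      moreover have "(\<Prod>i\<in>J. indicator (B i) (x i)) \<le> (1::ennreal)"
        by (intro prod_le_1) (auto simp: indicator_def)
      ultimately show ?thesis unfolding w_def using mult_mono[of _ "1::ennreal" _ 1] by fastforce
    qed
    have exp_step: "w x * ennreal (exp (- real k * x j)) = 
       (\<Prod>i\<in>J. indicator (B i) (x i)) * (\<Prod>i\<in>I - J. ennreal (exp (- real ((n(j:=k)) i) * x i)))" for x k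
    proof -
      have IJ: "I - J = insert j (I - insert j J)" using insert.hyps jI by auto
      have rest: "(\<Prod>i\<in>I - insert j J. ennreal (exp (- real ((n(j:=k)) i) * x i)))
         = (\<Prod>i\<in>I - insert j J. ennreal (exp (- real (n i) * x i)))"
        by (intro prod.cong) auto
      have "(\<Prod>i\<in>I - J. ennreal (exp (- real ((n(j:=k)) i) * x i)))
          = ennreal (exp (- real k * x j)) * (\<Prod>i\<in>I - insert j J. ennreal (exp (- real (n i) * x i)))"
        unfolding IJ using I by (subst prod.insert) (auto simp: rest[simplified])
      then show ?thesis unfolding w_def by (simp add: mult_ac)
    qed
    have "m1 = n1"
    proof (rule laplace_unique_real)
      show "sets m1 = sets borel" "sets n1 = sets borel" by (auto simp: m1_def n1_def)
      have "emeasure m1 (space m1) = (\<integral>\<^sup>+x. w x \<partial>\<mu>)"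
        using i1[of "\<lambda>_. 1"] by simp
      also have "\<dots> \<le> (\<integral>\<^sup>+x. 1 \<partial>\<mu>)"
        using nonneg(1) by (intro nn_integral_mono_AE) (auto simp: w_le elim!: eventually_mono)
      finally show "finite_measure m1" using m.emeasure_finite[of "space \<mu>"]
        by (intro finite_measureI) (auto simp: top_unique)
      have "emeasure n1 (space n1) = (\<integral>\<^sup>+x. w x \<partial>\<nu>)"
        using i2[of "\<lambda>_. 1"] by simp
      also have "\<dots> \<le> (\<integral>\<^sup>+x. 1 \<partial>\<nu>)"
        using nonneg(2) by (intro nn_integral_mono_AE) (auto simp: w_le elim!: eventually_mono)
      finally show "finite_measure n1" using n.emeasure_finite[of "space \<nu>"]
        by (intro finite_measureI) (auto simp: top_unique)
      show "AE x in m1. 0 \<le> x" unfolding m1_def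
        using nonneg(1) jI by (subst AE_distr_iff) (auto simp: M1 AE_density elim!: eventually_mono)
      show "AE x in n1. 0 \<le> x" unfolding n1_def
        using nonneg(2) jI by (subst AE_distr_iff) (auto simp: M2 AE_density elim!: eventually_mono)
      fix k :: nat
      show "(\<integral>\<^sup>+x. ennreal (exp (- real k * x)) \<partial>m1) = (\<integral>\<^sup>+x. ennreal (exp (- real k * x)) \<partial>n1)"
        using insert.IH[of "n(j:=k)"] insert.prems
        by (subst i1, simp, subst i2, simp) (subst (1 2) exp_step, auto)
    qed
    have Bj: "B j \<in> sets borel" using insert.prems by auto
    have "(\<integral>\<^sup>+z. indicator (B j) z \<partial>m1) = (\<integral>\<^sup>+z. indicator (B j) z \<partial>n1)" using \<open>m1 = n1\<close> by simp
    then have "(\<integral>\<^sup>+x. w x * indicator (B j) (x j) \<partial>\<mu>) = (\<integral>\<^sup>+x. w x * indicator (B j) (x j) \<partial>\<nu>)"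
      using Bj by (subst (asm) i1, simp, subst (asm) i2, simp)
    moreover have "w x * indicator (B j) (x j) = (\<Prod>i\<in>insert j J. indicator (B i) (x i)) *
        (\<Prod>i\<in>I - insert j J. ennreal (exp (- real (n i) * x i)))" for x
      using insert.hyps unfolding w_def by (simp add: mult_ac)
    ultimately show ?case by simp
  qed
  have emb: "emeasure \<mu> (Pi\<^sub>E I B) = emeasure \<nu> (Pi\<^sub>E I B)" if B: "\<And>i. i \<in> I \<Longrightarrow> B i \<in> sets borel" for B
  proof -
    have ind: "indicator (Pi\<^sub>E I B) x = (\<Prod>i\<in>I. indicator (B i) (x i) :: ennreal)" if "x \<in> extensional I" for x
      using that I by (auto simp: indicator_def PiE_def Pi_def)
    have s: "Pi\<^sub>E I B \<in> sets (PiM I (\<lambda>_. borel))" using I B by (intro sets_PiM_I_finite) auto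
    have sp: "x \<in> extensional I" if "x \<in> space \<mu> \<or> x \<in> space \<nu>" for x
      using that sets_eq_imp_space_eq[OF sets(1)] sets_eq_imp_space_eq[OF sets(2)]
      by (auto simp: space_PiM PiE_def)
    have "(\<integral>\<^sup>+x. indicator (Pi\<^sub>E I B) x \<partial>\<mu>) = (\<integral>\<^sup>+x. (\<Prod>i\<in>I. indicator (B i) (x i)) \<partial>\<mu>)"
      by (rule nn_integral_cong) (use sp ind in auto)
    moreover have "(\<integral>\<^sup>+x. indicator (Pi\<^sub>E I B) x \<partial>\<nu>) = (\<integral>\<^sup>+x. (\<Prod>i\<in>I. indicator (B i) (x i)) \<partial>\<nu>)"
      by (rule nn_integral_cong) (use sp ind in auto)
    ultimately show ?thesis using claim[OF I subset_refl B] s sets by simp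
  qed
  show ?thesis
  proof (rule measure_eqI_PiM_finite[OF I sets])
    show "emeasure \<mu> (Pi\<^sub>E I A) = emeasure \<nu> (Pi\<^sub>E I A)" if "\<And>i. i \<in> I \<Longrightarrow> A i \<in> sets borel" for A
      using emb that by auto
    show "range (\<lambda>_::nat. Pi\<^sub>E I (\<lambda>_. UNIV)) \<subseteq> prod_algebra I (\<lambda>_. borel)"
      using I by (auto intro!: prod_algebraI_finite)
    show "(\<Union>i::nat. Pi\<^sub>E I (\<lambda>_. UNIV)) = space (PiM I (\<lambda>_. borel))" by (simp add: space_PiM)
    show "emeasure \<mu> (Pi\<^sub>E I (\<lambda>_. UNIV)) \<noteq> \<infinity>" for i :: nat using m.emeasure_finite by simp
  qed
qed

text \<open>Without the value at \<open>0\<close> the total masses are recovered by letting \<open>u = 1 / (k + 1)\<close> tend to \<open>0\<close>.\<close>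

lemma laplace_unique_real_pos:
  fixes \<mu> \<nu> :: "real measure"
  assumes sets: "sets \<mu> = sets borel" "sets \<nu> = sets borel"
    and fin: "finite_measure \<mu>" "finite_measure \<nu>"
    and nonneg: "AE x in \<mu>. 0 \<le> x" "AE x in \<nu>. 0 \<le> x"
    and eq: "\<And>u. 0 < u \<Longrightarrow> (\<integral>\<^sup>+x. ennreal (exp (- u * x)) \<partial>\<mu>) = (\<integral>\<^sup>+x. ennreal (exp (- u * x)) \<partial>\<nu>)"
  shows "\<mu> = \<nu>"
proof (rule laplace_unique_real[OF sets fin nonneg])
  fix n :: nat
  have lim: "(\<lambda>k. \<integral>\<^sup>+x. ennreal (exp (- (1 / real (Suc k)) * x)) \<partial>\<kappa>) \<longlonglongrightarrow> emeasure \<kappa> (space \<kappa>)"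
    if [simp]: "sets \<kappa> = sets borel" and "finite_measure \<kappa>" "AE x in \<kappa>. 0 \<le> x" for \<kappa> :: "real measure"
  proof -
    interpret finite_measure \<kappa> by fact
    have m: "f \<in> borel_measurable borel \<Longrightarrow> f \<in> borel_measurable \<kappa>" for f :: "real \<Rightarrow> ennreal"
      by (simp cong: measurable_cong_sets)
    have m': "f \<in> borel_measurable borel \<Longrightarrow> f \<in> borel_measurable \<kappa>" for f :: "real \<Rightarrow> real"
      by (simp cong: measurable_cong_sets)
    have l: "(\<lambda>k. ennreal (exp (- (1 / real (Suc k)) * x))) \<longlonglongrightarrow> 1" for x
    proof -
      have "(\<lambda>k. exp (- (1 / real (Suc k)) * x)) \<longlonglongrightarrow> exp (- 0 * x)"
        by (intro tendsto_intros LIMSEQ_inverse_real_of_nat[unfolded inverse_eq_divide])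
      then show ?thesis by (auto intro!: tendsto_ennrealI simp flip: ennreal_1)
    qed
    have "(\<lambda>k. \<integral>\<^sup>+x. ennreal (exp (- (1 / real (Suc k)) * x)) \<partial>\<kappa>) \<longlonglongrightarrow> (\<integral>\<^sup>+x. 1 \<partial>\<kappa>)"
    proof (rule nn_integral_dominated_convergence[where w="\<lambda>_. 1"])
      show "AE x in \<kappa>. ennreal (exp (- (1 / real (Suc k)) * x)) \<le> 1" for k
        using that(3) by (auto elim!: eventually_mono)
      show "(\<integral>\<^sup>+x. 1 \<partial>\<kappa>) < \<infinity>" using emeasure_finite[of "space \<kappa>"] by (simp add: less_top[symmetric])
    qed (auto intro!: m m' simp: l[simplified])
    then show ?thesis by simp
  qed
  have "emeasure \<mu> (space \<mu>) = emeasure \<nu> (space \<nu>)"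
    using lim[OF sets(1) fin(1) nonneg(1)] lim[OF sets(2) fin(2) nonneg(2)] eq[of "1 / real (Suc k)" for k]
    by (intro LIMSEQ_unique) auto
  then show "(\<integral>\<^sup>+x. ennreal (exp (- real n * x)) \<partial>\<mu>) = (\<integral>\<^sup>+x. ennreal (exp (- real n * x)) \<partial>\<nu>)"
    using eq[of "real n"] by (cases "n = 0") auto
qed

section \<open>The one-sided stable density of index one half\<close>

lemma nn_integral_FTC_Ioi:
  fixes f F :: "real \<Rightarrow> real"
  assumes F: "\<And>x. 0 < x \<Longrightarrow> (F has_real_derivative f x) (at x)"
    and f: "\<And>x. 0 < x \<Longrightarrow> isCont f x" and nonneg: "\<And>x. 0 < x \<Longrightarrow> 0 \<le> f x"
    and A: "(F \<longlongrightarrow> A) (at_right 0)" and B: "(F \<longlongrightarrow> B) at_top"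
  shows "(\<integral>\<^sup>+x. ennreal (f x) * indicator {0<..} x \<partial>lborel) = ennreal (B - A)"
proof -
  have 1: "set_integrable lborel (einterval (ereal 0) \<infinity>) f" and 2: "(LBINT x=(ereal 0)..\<infinity>. f x) = B - A"
    by (rule interval_integral_FTC_nonneg[of "ereal 0" \<infinity> F f A B];
        use F f nonneg A B in \<open>auto simp: ereal_tendsto_simps\<close>)+
  have e: "einterval (ereal 0) \<infinity> = {0<..}" by (auto simp: einterval_def)
  have 3: "integrable lborel (\<lambda>x. indicator {0<..} x * f x)"
    using 1 unfolding e set_integrable_def by simp
  have "(\<integral>\<^sup>+x. ennreal (f x) * indicator {0<..} x \<partial>lborel) = (\<integral>\<^sup>+x. ennreal (indicator {0<..} x * f x) \<partial>lborel)"
    by (intro nn_integral_cong) (auto simp: indicator_def)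
  also have "\<dots> = ennreal (\<integral>x. indicator {0<..} x * f x \<partial>lborel)"
    using 3 by (intro nn_integral_eq_integral) (auto simp: indicator_def nonneg)
  also have "(\<integral>x. indicator {0<..} x * f x \<partial>lborel) = B - A"
    using 2 unfolding interval_lebesgue_integral_def e set_lebesgue_integral_def by simp
  finally show ?thesis .
qed

lemma cdf_std_normal_deriv:
  "(cdf std_normal_distribution has_real_derivative std_normal_density z) (at z)"
proof -
  interpret real_distribution std_normal_distribution by (rule real_dist_normal_dist)
  define a where "a = z - 1"
  have eq: "cdf std_normal_distribution y = cdf std_normal_distribution a + (LBINT x=a..y. std_normal_density x)"
    if "a < y" for y
  proof -
    have "cdf std_normal_distribution y - cdf std_normal_distribution a = measure std_normal_distribution {a<..y}"
      using that by (rule cdf_diff_eq)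
    also have "\<dots> = (\<integral>x. indicator {a<..y} x * std_normal_density x \<partial>lborel)"
    proof -
      have "measure std_normal_distribution {a<..y} = (\<integral>x. indicator {a<..y} x \<partial>std_normal_distribution)"
        by simp
      also have "\<dots> = (\<integral>x. indicator {a<..y} x * std_normal_density x \<partial>lborel)"
        by (subst integral_density) (auto simp: mult.commute)
      finally show ?thesis .
    qed
    also have "\<dots> = (LBINT x=a..y. std_normal_density x)"
      using that by (simp add: interval_integral_Ioc set_lebesgue_integral_def)
    finally show ?thesis by simp
  qed
  have "((\<lambda>y. LBINT x=a..y. std_normal_density x) has_vector_derivative std_normal_density z) (at z within {a..z+1})"
    by (rule interval_integral_FTC2) (auto simp: a_def std_normal_density_def intro!: continuous_intros)
  then have "((\<lambda>y. LBINT x=a..y. std_normal_density x) has_real_derivative std_normal_density z) (at z within {a<..<z+1})"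
    unfolding has_real_derivative_iff_has_vector_derivative
    by (rule has_vector_derivative_within_subset) auto
  then have "((\<lambda>y. LBINT x=a..y. std_normal_density x) has_real_derivative std_normal_density z) (at z)"
    by (subst (asm) at_within_open) (auto simp: a_def)
  then have "((\<lambda>y. cdf std_normal_distribution a + (LBINT x=a..y. std_normal_density x)) has_real_derivative std_normal_density z) (at z)"
    by (auto intro!: derivative_eq_intros)
  then show ?thesis
    by (rule has_field_derivative_transform_within_open[where S="{a<..}"]) (auto simp: a_def eq)
qed

text \<open>The density \<open>f\<^bsub>1/2\<^esub>\<close> of the law with Laplace transform \<open>exp (- \<surd>u)\<close>.\<close>

definition levy_density :: "real \<Rightarrow> real" where
  "levy_density t = (if 0 < t then t powr (- 3 / 2) * exp (- 1 / (4 * t)) / (2 * sqrt pi) else 0)"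

lemma levy_density_measurable[measurable]: "levy_density \<in> borel_measurable borel"
  unfolding levy_density_def[abs_def] by measurable

lemma levy_density_nonneg[simp]: "0 \<le> levy_density t"
  by (simp add: levy_density_def)

lemma levy_density_nonpos: "t \<le> 0 \<Longrightarrow> levy_density t = 0"
  by (simp add: levy_density_def)

text \<open>Both integrands have elementary antiderivatives in terms of the normal distribution function,
  as is familiar from the inverse Gaussian law.  The parameter \<open>a = \<surd>u\<close> avoids square roots inside the arguments.\<close>

lemma levy_laplace_aux:
  fixes a :: real
  assumes a: "0 < a"
  shows "(\<integral>\<^sup>+t. ennreal (levy_density t * exp (- a\<^sup>2 * t)) \<partial>lborel) = ennreal (exp (- a))" (is ?A)
    and "(\<integral>\<^sup>+t. ennreal (t * levy_density t * exp (- a\<^sup>2 * t)) \<partial>lborel) = ennreal (exp (- a) / (2 * a))" (is ?B)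
proof -
  interpret real_distribution std_normal_distribution by (rule real_dist_normal_dist)
  define \<Phi> where "\<Phi> = cdf std_normal_distribution"
  have \<Phi>': "(\<Phi> has_real_derivative std_normal_density z) (at z)" for z
    unfolding \<Phi>_def by (rule cdf_std_normal_deriv)
  have top: "(\<Phi> \<longlongrightarrow> 1) at_top" unfolding \<Phi>_def by (rule cdf_lim_at_top_prob)
  have bot: "(\<Phi> \<longlongrightarrow> 0) at_bot" unfolding \<Phi>_def by (rule cdf_lim_at_bot)
  \<comment> \<open>chosen such that \<open>p\<^sup>2 / 2\<close> and \<open>q\<^sup>2 / 2\<close> differ from \<open>a\<^sup>2 t + 1 / (4 t)\<close> by \<open>- a\<close> and \<open>a\<close>, so that
  \<open>exp (- a) \<phi>(p)\<close> and \<open>exp a \<phi>(q)\<close> coincide, \<open>\<phi>\<close> being the normal density\<close>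
  define p where "p t = sqrt 2 * (a * sqrt t - 1 / (2 * sqrt t))" for t
  define q where "q t = - sqrt 2 * (a * sqrt t + 1 / (2 * sqrt t))" for t
  define p' where "p' t = sqrt 2 * (a / (2 * sqrt t) + 1 / (4 * t * sqrt t))" for t
  define q' where "q' t = sqrt 2 * (- a / (2 * sqrt t) + 1 / (4 * t * sqrt t))" for t
  have dp: "(p has_real_derivative p' t) (at t)" if "0 < t" for t
    using that unfolding p_def p'_def
    by (auto intro!: derivative_eq_intros simp: field_simps power2_eq_square)
  have dq: "(q has_real_derivative q' t) (at t)" if "0 < t" for t
    using that unfolding q_def q'_def
    by (auto intro!: derivative_eq_intros simp: field_simps power2_eq_square)
  have p2: "(p t)\<^sup>2 / 2 = a\<^sup>2 * t - a + 1 / (4 * t)" if "0 < t" for t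
    using that unfolding p_def by (simp add: power_mult_distrib power2_diff) (simp add: field_simps power2_eq_square)
  have q2: "(q t)\<^sup>2 / 2 = a\<^sup>2 * t + a + 1 / (4 * t)" if "0 < t" for t
    using that unfolding q_def by (simp add: power_mult_distrib power2_sum) (simp add: field_simps power2_eq_square)
  have np: "exp (- a) * std_normal_density (p t) = exp (- a\<^sup>2 * t - 1 / (4 * t)) / sqrt (2 * pi)" if "0 < t" for t
  proof -
    have e: "- a - (p t)\<^sup>2 / 2 = - a\<^sup>2 * t - 1 / (4 * t)" unfolding p2[OF that] by simp
    have "exp (- a - (p t)\<^sup>2 / 2) = exp (- a) * exp (- (p t)\<^sup>2 / 2)"
      unfolding exp_add[symmetric] by simp
    then have "exp (- a) * std_normal_density (p t) = exp (- a - (p t)\<^sup>2 / 2) / sqrt (2 * pi)"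
      by (simp add: std_normal_density_def)
    then show ?thesis unfolding e .
  qed
  have nq: "exp a * std_normal_density (q t) = exp (- a\<^sup>2 * t - 1 / (4 * t)) / sqrt (2 * pi)" if "0 < t" for t
  proof -
    have e: "a - (q t)\<^sup>2 / 2 = - a\<^sup>2 * t - 1 / (4 * t)" unfolding q2[OF that] by simp
    have "exp (a - (q t)\<^sup>2 / 2) = exp (a) * exp (- (q t)\<^sup>2 / 2)"
      unfolding exp_add[symmetric] by simp
    then have "exp (a) * std_normal_density (q t) = exp (a - (q t)\<^sup>2 / 2) / sqrt (2 * pi)"
      by (simp add: std_normal_density_def)
    then show ?thesis unfolding e .
  qed
  have p0: "filterlim p at_bot (at_right 0)" and q0: "filterlim q at_bot (at_right 0)"
    and pT: "filterlim p at_top at_top" and qT: "filterlim q at_bot at_top"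
    using a unfolding p_def q_def by real_asymp+
  have lev: "levy_density t = 1 / (t * sqrt t) * exp (- 1 / (4 * t)) / (2 * sqrt pi)" if "0 < t" for t
  proof -
    have "t powr (- 3 / 2) = t powr (-1) * t powr (-(1/2))"
      by (subst powr_add[symmetric]) simp
    also have "\<dots> = 1 / (t * sqrt t)"
      using that by (simp add: powr_minus powr_half_sqrt field_simps)
    finally show ?thesis using that by (simp add: levy_density_def)
  qed
  have "(\<integral>\<^sup>+t. ennreal (levy_density t * exp (- a\<^sup>2 * t)) \<partial>lborel)
     = (\<integral>\<^sup>+t. ennreal (1 / (t * sqrt t) * exp (- a\<^sup>2 * t - 1 / (4 * t)) / (2 * sqrt pi)) * indicator {0<..} t \<partial>lborel)"
    by (intro nn_integral_cong) (auto simp: indicator_def lev exp_diff exp_minus field_simps levy_density_nonpos)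
  also have "\<dots> = ennreal ((exp (- a) * 1 + exp a * 0) - (exp (- a) * 0 + exp a * 0))"
  proof (rule nn_integral_FTC_Ioi[where F="\<lambda>t. exp (- a) * \<Phi> (p t) + exp a * \<Phi> (q t)"])
    fix t :: real assume t: "0 < t"
    have "((\<lambda>t. exp (- a) * \<Phi> (p t) + exp a * \<Phi> (q t)) has_real_derivative
        exp (- a) * (std_normal_density (p t) * p' t) + exp a * (std_normal_density (q t) * q' t)) (at t)"
      using DERIV_chain2[OF \<Phi>' dp[OF t]] DERIV_chain2[OF \<Phi>' dq[OF t]] by (auto intro!: derivative_eq_intros)
    also have "exp (- a) * (std_normal_density (p t) * p' t) + exp a * (std_normal_density (q t) * q' t)
       = exp (- a\<^sup>2 * t - 1 / (4 * t)) / sqrt (2 * pi) * (p' t + q' t)"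
      unfolding mult.assoc[symmetric] np[OF t] nq[OF t] by (simp add: ring_distribs)
    also have "p' t + q' t = sqrt 2 * (1 / (2 * t * sqrt t))"
      by (simp add: p'_def q'_def field_simps)
    finally show "((\<lambda>t. exp (- a) * \<Phi> (p t) + exp a * \<Phi> (q t)) has_real_derivative
        1 / (t * sqrt t) * exp (- a\<^sup>2 * t - 1 / (4 * t)) / (2 * sqrt pi)) (at t)"
      by (simp add: real_sqrt_mult field_simps)
  next
    show "((\<lambda>t. exp (- a) * \<Phi> (p t) + exp a * \<Phi> (q t)) \<longlongrightarrow> exp (- a) * 0 + exp a * 0) (at_right 0)"
      by (intro tendsto_intros filterlim_compose[OF bot] p0 q0)
    show "((\<lambda>t. exp (- a) * \<Phi> (p t) + exp a * \<Phi> (q t)) \<longlongrightarrow> exp (- a) * 1 + exp a * 0) at_top"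
      by (intro tendsto_intros filterlim_compose[OF bot] filterlim_compose[OF top] pT qT)
  qed (auto intro!: continuous_intros)
  finally show ?A by simp
  have "(\<integral>\<^sup>+t. ennreal (t * levy_density t * exp (- a\<^sup>2 * t)) \<partial>lborel)
     = (\<integral>\<^sup>+t. ennreal (1 / sqrt t * exp (- a\<^sup>2 * t - 1 / (4 * t)) / (2 * sqrt pi)) * indicator {0<..} t \<partial>lborel)"
    by (intro nn_integral_cong) (auto simp: indicator_def lev exp_diff exp_minus field_simps levy_density_nonpos)
  also have "\<dots> = ennreal ((exp (- a) * 1 - exp a * 0) / (2 * a) - (exp (- a) * 0 - exp a * 0) / (2 * a))"
  proof (rule nn_integral_FTC_Ioi[where F="\<lambda>t. (exp (- a) * \<Phi> (p t) - exp a * \<Phi> (q t)) / (2 * a)"])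
    fix t :: real assume t: "0 < t"
    have "((\<lambda>t. (exp (- a) * \<Phi> (p t) - exp a * \<Phi> (q t)) / (2 * a)) has_real_derivative
        (exp (- a) * (std_normal_density (p t) * p' t) - exp a * (std_normal_density (q t) * q' t)) / (2 * a)) (at t)"
      using DERIV_chain2[OF \<Phi>' dp[OF t]] DERIV_chain2[OF \<Phi>' dq[OF t]]
      by (intro DERIV_cdivide DERIV_diff DERIV_cmult) auto
    also have "exp (- a) * (std_normal_density (p t) * p' t) - exp a * (std_normal_density (q t) * q' t)
       = exp (- a\<^sup>2 * t - 1 / (4 * t)) / sqrt (2 * pi) * (p' t - q' t)"
      unfolding mult.assoc[symmetric] np[OF t] nq[OF t] by (simp add: ring_distribs)
    also have "p' t - q' t = sqrt 2 * (a / sqrt t)"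
      by (simp add: p'_def q'_def field_simps)
    finally show "((\<lambda>t. (exp (- a) * \<Phi> (p t) - exp a * \<Phi> (q t)) / (2 * a)) has_real_derivative
        1 / sqrt t * exp (- a\<^sup>2 * t - 1 / (4 * t)) / (2 * sqrt pi)) (at t)"
      using a by (simp add: real_sqrt_mult field_simps)
  next
    show "((\<lambda>t. (exp (- a) * \<Phi> (p t) - exp a * \<Phi> (q t)) / (2 * a)) \<longlongrightarrow> (exp (- a) * 0 - exp a * 0) / (2 * a)) (at_right 0)"
      using a by (intro tendsto_intros filterlim_compose[OF bot] p0 q0) auto
    show "((\<lambda>t. (exp (- a) * \<Phi> (p t) - exp a * \<Phi> (q t)) / (2 * a)) \<longlongrightarrow> (exp (- a) * 1 - exp a * 0) / (2 * a)) at_top"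
      using a by (intro tendsto_intros filterlim_compose[OF bot] filterlim_compose[OF top] pT qT) auto
  qed (auto intro!: continuous_intros)
  finally show ?B by simp
qed

lemma levy_laplace:
  assumes "0 < u"
  shows "(\<integral>\<^sup>+t. ennreal (levy_density t * exp (- u * t)) \<partial>lborel) = ennreal (exp (- sqrt u))"
    and "(\<integral>\<^sup>+t. ennreal (t * levy_density t * exp (- u * t)) \<partial>lborel) = ennreal (exp (- sqrt u) / (2 * sqrt u))"
  using levy_laplace_aux[of "sqrt u"] assms by auto

lemma nn_integral_Gamma_scaled:
  fixes s b :: real
  assumes s: "0 < s" and b: "0 < b"
  shows "(\<integral>\<^sup>+x. ennreal (x powr (s - 1) * exp (- b * x)) * indicator {0<..} x \<partial>lborel) = ennreal (Gamma s * b powr (- s))"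
proof -
  have "ennreal (Gamma s) = (\<integral>\<^sup>+t. ennreal (indicator {0..} t * t powr (s - 1) / exp t) \<partial>lborel)"
    by (rule Gamma_conv_nn_integral_real[OF s])
  also have "\<dots> = (\<integral>\<^sup>+t. ennreal (t powr (s - 1) * exp (- t)) * indicator {0<..} t \<partial>lborel)"
    by (intro nn_integral_cong) (auto simp: indicator_def exp_minus field_simps)
  also have "\<dots> = ennreal b * (\<integral>\<^sup>+x. ennreal ((b * x) powr (s - 1) * exp (- (b * x))) * indicator {0<..} (b * x) \<partial>lborel)"
    using b by (subst nn_integral_real_affine[where c=b and t=0]) auto
  also have "\<dots> = (\<integral>\<^sup>+x. ennreal (b powr s) * (ennreal (x powr (s - 1) * exp (- b * x)) * indicator {0<..} x) \<partial>lborel)"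
    using b by (subst nn_integral_cmult[symmetric])
      (auto intro!: nn_integral_cong simp: indicator_def zero_less_mult_iff powr_mult powr_diff ennreal_mult[symmetric])
  also have "\<dots> = ennreal (b powr s) * (\<integral>\<^sup>+x. ennreal (x powr (s - 1) * exp (- b * x)) * indicator {0<..} x \<partial>lborel)"
    by (rule nn_integral_cmult) simp
  finally have "ennreal (b powr (- s)) * ennreal (Gamma s) =
     (ennreal (b powr (- s)) * ennreal (b powr s)) * (\<integral>\<^sup>+x. ennreal (x powr (s - 1) * exp (- b * x)) * indicator {0<..} x \<partial>lborel)"
    by (simp add: mult.assoc)
  moreover have "ennreal (b powr (- s)) * ennreal (b powr s) = 1"
    using b by (simp add: ennreal_mult[symmetric] powr_add[symmetric])
  ultimately show ?thesis using s by (simp add: ennreal_mult[symmetric] mult.commute)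
qed

text \<open>Exhausting \<open>{0<..}\<close> by the intervals from \<open>1 / (n + 2)\<close> to \<open>n + 2\<close> extends the substitution rule
  for compact intervals; \<open>B\<close> is the union of the images.\<close>

lemma nn_integral_substitution_Ioi:
  fixes F :: "real \<Rightarrow> ennreal" and g g' :: "real \<Rightarrow> real"
  assumes F[measurable]: "F \<in> borel_measurable borel"
    and g: "\<And>x. 0 < x \<Longrightarrow> (g has_real_derivative g' x) (at x)"
    and g': "continuous_on {0<..} g'" "\<And>x. 0 < x \<Longrightarrow> 0 \<le> g' x"
    and [measurable]: "g \<in> borel_measurable borel" "g' \<in> borel_measurable borel"
    and B: "B = (\<Union>n. {g (1 / real (n + 2))..g (real (n + 2))})"
  shows "(\<integral>\<^sup>+y. F y * indicator B y \<partial>lborel)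
    = (\<integral>\<^sup>+x. F (g x) * ennreal (g' x) * indicator {0<..} x \<partial>lborel)"
proof -
  define a where "a n = 1 / real (n + 2)" for n
  define b where "b n = real (n + 2)" for n
  have ab: "0 < a n" "a n < b n" for n
  proof -
    show "0 < a n" by (simp add: a_def)
    have "a n < 1" "1 < b n" by (auto simp: a_def b_def)
    then show "a n < b n" by simp
  qed
  have mono_a: "a (Suc n) \<le> a n" and mono_b: "b n \<le> b (Suc n)" for n
    by (auto simp: a_def b_def field_simps)
  have mono_g: "g x \<le> g y" if "0 < x" "x \<le> y" for x y
    by (rule DERIV_nonneg_imp_nondecreasing[OF that(2)])
       (use g g'(2) that in \<open>metis order_less_le_trans\<close>)
  have union: "(\<Union>n. {a n..b n}) = {0<..}"
  proof (intro set_eqI iffI)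
    fix x assume "x \<in> (\<Union>n. {a n..b n})" then show "x \<in> {0<..}" using ab by (auto intro: less_le_trans)
  next
    fix x :: real assume x: "x \<in> {0<..}"
    obtain n where n: "max x (1 / x) < real n" using reals_Archimedean2 by blast
    have "1 / x \<le> real (n + 2)" using n by simp
    then have "a n \<le> x" using x by (simp add: a_def field_simps)
    moreover have "x \<le> b n" using n by (simp add: b_def)
    ultimately show "x \<in> (\<Union>n. {a n..b n})" by auto
  qed
  have SUP_int: "(\<integral>\<^sup>+x. h x * indicator (\<Union>n. D n) x \<partial>lborel) = (SUP n. \<integral>\<^sup>+x. h x * indicator (D n) x \<partial>lborel)"
    if "incseq D" "\<And>n. D n \<in> sets borel" and [measurable]: "h \<in> borel_measurable borel"
    for h :: "real \<Rightarrow> ennreal" and D :: "nat \<Rightarrow> real set"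
    using SUP_emeasure_incseq[of D "density lborel h"] that by (simp add: emeasure_density image_subset_iff)
  have B': "B = (\<Union>n. {g (a n)..g (b n)})" unfolding B a_def b_def ..
  have "(\<integral>\<^sup>+y. F y * indicator B y \<partial>lborel) = (SUP n. \<integral>\<^sup>+y. F y * indicator {g (a n)..g (b n)} y \<partial>lborel)"
    unfolding B' 
  proof (rule SUP_int)
    have "g (a (Suc n)) \<le> g (a n)" "g (b n) \<le> g (b (Suc n))" for n
      using mono_a mono_b ab[of n] ab(1)[of "Suc n"] by (auto intro!: mono_g)
    then show "incseq (\<lambda>n. {g (a n)..g (b n)})"
      by (intro incseq_SucI) (auto intro: order_trans)
  qed auto
  also have "\<dots> = (SUP n. \<integral>\<^sup>+x. F (g x) * ennreal (g' x) * indicator {a n..b n} x \<partial>lborel)"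
  proof (intro SUP_cong refl nn_integral_substitution_aux)
    fix n
    have pos: "0 < x" if "x \<in> {a n..b n}" for x using that ab(1)[of n] by auto
    show "(g has_real_derivative g' x) (at x)" if "x \<in> {a n..b n}" for x using g pos that by auto
    show "continuous_on {a n..b n} g'" by (rule continuous_on_subset[OF g'(1)]) (use pos in auto)
    show "0 \<le> g' x" if "x \<in> {a n..b n}" for x using g' pos that by auto
  qed (use ab in auto)
  also have "\<dots> = (\<integral>\<^sup>+x. F (g x) * ennreal (g' x) * indicator (\<Union>n. {a n..b n}) x \<partial>lborel)"
    by (rule SUP_int[symmetric]) (use mono_a mono_b in \<open>auto simp: incseq_SucI[OF iffD2[OF atLeastatMost_subset_iff]]\<close>)
  finally show ?thesis unfolding union .
qed

text \<open>The substitution \<open>y = 1 / (2 v)\<close> links a remaining mass with the corresponding position of the random walk.\<close>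

lemma nn_integral_Ioi_inverse:
  fixes F :: "real \<Rightarrow> ennreal"
  assumes [measurable]: "F \<in> borel_measurable borel"
  shows "(\<integral>\<^sup>+y. F y * indicator {0<..} y \<partial>lborel)
    = (\<integral>\<^sup>+v. F (1 / (2 * v)) * ennreal (1 / (2 * v\<^sup>2)) * indicator {0<..} v \<partial>lborel)"
proof -
  \<comment> \<open>the substitution rule is for increasing maps, hence the detour through \<open>- 1 / (2 v)\<close>\<close>
  have B: "{..<0} = (\<Union>n. {- 1 / (2 * (1 / real (n + 2)))..- 1 / (2 * real (n + 2))})"
  proof (intro set_eqI iffI)
    fix x :: real assume x: "x \<in> {..<0}"
    obtain k where k: "2 * max (- x) (- 1 / x) < real k" using reals_Archimedean2 by blast
    have 1: "- 1 / (2 * (1 / real (k + 2))) \<le> x" using k by simp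
    have "- 1 / x \<le> 2 * real (k + 2)" using k by simp
    then have "x \<le> - 1 / (2 * real (k + 2))" using x by (simp add: field_simps)
    then show "x \<in> (\<Union>n. {- 1 / (2 * (1 / real (n + 2)))..- 1 / (2 * real (n + 2))})" using 1 by auto
  next
    fix x :: real assume "x \<in> (\<Union>n. {- 1 / (2 * (1 / real (n + 2)))..- 1 / (2 * real (n + 2))})"
    then obtain n where "x \<le> - 1 / (2 * real (n + 2))" by auto
    also have "\<dots> < 0" by simp
    finally show "x \<in> {..<0}" by simp
  qed
  have "(\<integral>\<^sup>+y. F y * indicator {0<..} y \<partial>lborel) = (\<integral>\<^sup>+y. F (- y) * indicator {..<0} y \<partial>lborel)"
    by (subst nn_integral_real_affine[where c="- 1" and t=0]) (auto intro!: nn_integral_cong simp: indicator_def)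
  also have "\<dots> = (\<integral>\<^sup>+v. F (- (- 1 / (2 * v))) * ennreal (1 / (2 * v\<^sup>2)) * indicator {0<..} v \<partial>lborel)"
    by (rule nn_integral_substitution_Ioi)
       (auto simp: B intro!: derivative_eq_intros continuous_intros simp: power2_eq_square)
  finally show ?thesis by simp
qed

lemma nn_integral_Ioi_square:
  fixes F :: "real \<Rightarrow> ennreal"
  assumes [measurable]: "F \<in> borel_measurable borel"
  shows "(\<integral>\<^sup>+y. F y * indicator {0<..} y \<partial>lborel)
    = (\<integral>\<^sup>+x. F (x\<^sup>2) * ennreal (2 * x) * indicator {0<..} x \<partial>lborel)"
proof -
  have B: "{0<..} = (\<Union>n. {(1 / real (n + 2))\<^sup>2..(real (n + 2))\<^sup>2})"
  proof (intro set_eqI iffI)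
    fix x :: real assume x: "x \<in> {0<..}"
    obtain k where k: "max x (1 / x) < real k" using reals_Archimedean2 by blast
    have sq: "real (k + 2) \<le> (real (k + 2))\<^sup>2" by (rule self_le_power) auto
    have 1: "x \<le> (real (k + 2))\<^sup>2" using k sq by simp
    have "1 / x \<le> (real (k + 2))\<^sup>2" using k sq by simp
    then have "(1 / real (k + 2))\<^sup>2 \<le> x" using x by (simp add: field_simps power_divide)
    then show "x \<in> (\<Union>n. {(1 / real (n + 2))\<^sup>2..(real (n + 2))\<^sup>2})" using 1 by auto
  next
    fix x :: real assume "x \<in> (\<Union>n. {(1 / real (n + 2))\<^sup>2..(real (n + 2))\<^sup>2})"
    then obtain n where n: "(1 / real (n + 2))\<^sup>2 \<le> x" by auto
    have "0 < (1 / real (n + 2))\<^sup>2" by simp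
    then show "x \<in> {0<..}" using n unfolding greaterThan_iff by linarith
  qed
  show ?thesis
    by (rule nn_integral_substitution_Ioi) (auto simp: B intro!: derivative_eq_intros continuous_intros)
qed

section \<open>Paths that grow only by jumps\<close>

context
  fixes x :: "real \<Rightarrow> real"
  assumes mono: "mono_on {0..} x"
begin

lemma mono_left_limit:
  assumes t: "0 < t"
  shows "(x \<longlongrightarrow> Lim (at_left t) x) (at_left t)"
    and "\<And>u. 0 \<le> u \<Longrightarrow> u < t \<Longrightarrow> x u \<le> Lim (at_left t) x"
proof -
  define l where "l = Sup (x ` {0..<t})"
  have bdd: "bdd_above (x ` {0..<t})"
    using mono t by (intro bdd_aboveI[of _ "x t"]) (auto simp: mono_on_def)
  have le: "x u \<le> l" if "0 \<le> u" "u < t" for u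
    unfolding l_def using bdd that by (intro cSup_upper) auto
  have nb: "at_left t \<noteq> bot" by simp
  have "(x \<longlongrightarrow> l) (at_left t)"
  proof (rule increasing_tendsto)
    show "\<forall>\<^sub>F u in at_left t. x u \<le> l"
      using t by (auto simp: eventually_at_left[OF t] intro!: exI[of _ 0] le)
    fix y assume "y < l"
    then obtain v where v: "0 \<le> v" "v < t" "y < x v"
      unfolding l_def using t bdd by (subst (asm) less_cSup_iff) auto
    have "y < x u" if "v < u" "u < t" for u
      using v that mono by (auto simp: mono_on_def intro: less_le_trans)
    then show "\<forall>\<^sub>F u in at_left t. y < x u"
      using v by (auto simp: eventually_at_left[OF t] intro!: exI[of _ v])
  qed
  moreover from this have "Lim (at_left t) x = l" by (intro tendsto_Lim) auto
  ultimately show "(x \<longlongrightarrow> Lim (at_left t) x) (at_left t)"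
    and "\<And>u. 0 \<le> u \<Longrightarrow> u < t \<Longrightarrow> x u \<le> Lim (at_left t) x"
    using le by auto
qed

text \<open>Induction from the left: the left limit at the last jump time is at least the value of the path just
  after the earlier jumps.\<close>

lemma sum_jumps_le:
  assumes "finite F" and "0 \<le> a" "F \<subseteq> {a<..b}" "a \<le> b"
  shows "(\<Sum>t\<in>F. x t - Lim (at_left t) x) \<le> x b - x a"
  using assms
proof (induction F arbitrary: b rule: finite_linorder_max_induct)
  case empty
  then show ?case using mono by (auto simp: mono_on_def)
next
  case (insert t F)
  define u where "u = Max (insert a F)"
  have u: "a \<le> u" "F \<subseteq> {a<..u}" "u < t"
    using insert unfolding u_def by auto
  have "(\<Sum>t\<in>F. x t - Lim (at_left t) x) \<le> x u - x a"
    using insert u by blast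
  moreover have "x u \<le> Lim (at_left t) x"
    using mono_left_limit(2)[of t u] insert.prems u by auto
  moreover have "x t \<le> x b" using mono insert.prems by (auto simp: mono_on_def)
  moreover have "t \<notin> F" using insert.hyps by auto
  ultimately show ?case using insert.hyps by simp
qed

end

text \<open>The index \<open>j\<close> of the cell \<open>(j / N, (j + 1) / N]\<close> containing \<open>t > 0\<close>.\<close>

definition cell :: "nat \<Rightarrow> real \<Rightarrow> nat" where
  "cell N t = nat (\<lceil>real N * t\<rceil> - 1)"

lemma cell_bounds:
  assumes "0 < t" "0 < N"
  shows "real (cell N t) / real N < t" "t \<le> real (Suc (cell N t)) / real N"
proof -
  have "0 < real N * t" using assms by simp
  then have "0 < \<lceil>real N * t\<rceil>" by (simp add: less_ceiling_iff)
  then have r: "real (cell N t) = of_int \<lceil>real N * t\<rceil> - 1" by (simp add: cell_def)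
  then have "real (cell N t) < real N * t" "real N * t \<le> real (Suc (cell N t))"
    by linarith+
  then show "real (cell N t) / real N < t" "t \<le> real (Suc (cell N t)) / real N"
    using assms by (auto simp: field_simps)
qed

lemma cell_less:
  assumes "0 < t" "t \<le> 1" "0 < N"
  shows "cell N t < N"
proof -
  have "real (cell N t) / real N < 1" using cell_bounds(1)[OF assms(1,3)] assms(2) by simp
  then show ?thesis using assms by simp
qed

lemma cell_limits:
  assumes t: "0 < t"
  shows "filterlim (\<lambda>N. real (cell (Suc N) t) / real (Suc N)) (at_left t) sequentially"
    and "(\<lambda>N. real (Suc (cell (Suc N) t)) / real (Suc N)) \<longlonglongrightarrow> t"
proof -
  have inv: "(\<lambda>N. 1 / real (Suc N)) \<longlonglongrightarrow> 0"
    by (rule LIMSEQ_inverse_real_of_nat[unfolded inverse_eq_divide])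
  have b: "real (cell (Suc N) t) / real (Suc N) < t" "t \<le> real (cell (Suc N) t) / real (Suc N) + 1 / real (Suc N)" for N
    using cell_bounds[OF t, of "Suc N"] by (auto simp: add_divide_distrib)
  have l: "(\<lambda>N. real (cell (Suc N) t) / real (Suc N)) \<longlonglongrightarrow> t"
  proof (rule tendsto_sandwich[OF _ _ _ tendsto_const])
    show "(\<lambda>N. t - 1 / real (Suc N)) \<longlonglongrightarrow> t" using tendsto_diff[OF tendsto_const inv, of t] by simp
    show "\<forall>\<^sub>F N in sequentially. t - 1 / real (Suc N) \<le> real (cell (Suc N) t) / real (Suc N)"
      using b(2) by (intro always_eventually allI) (simp add: algebra_simps)
    show "\<forall>\<^sub>F N in sequentially. real (cell (Suc N) t) / real (Suc N) \<le> t"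
      using b(1) by (intro always_eventually allI less_imp_le)
  qed
  then show "filterlim (\<lambda>N. real (cell (Suc N) t) / real (Suc N)) (at_left t) sequentially"
    using b(1) by (auto simp: filterlim_at less_imp_neq intro!: always_eventually simp del: of_nat_Suc)
  show "(\<lambda>N. real (Suc (cell (Suc N) t)) / real (Suc N)) \<longlonglongrightarrow> t"
    using tendsto_add[OF l inv] by (simp add: add_divide_distrib[symmetric] add.commute)
qed

text \<open>The jumps \<open>a\<close> at the times \<open>\<tau>\<close> may leave room for continuous growth: that they exhaust it, \<open>s = x 1\<close>,
  holds for the subordinator only by a probabilistic argument, and is a hypothesis of the lemmas
  that depend on it.\<close>

locale pure_jump_path =
  fixes x :: "real \<Rightarrow> real" and a :: "nat \<Rightarrow> real" and \<tau> :: "nat \<Rightarrow> real" and s :: real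
  assumes mono: "mono_on {0..} x" and x0: "x 0 = 0"
    and right_cont: "\<And>t. 0 \<le> t \<Longrightarrow> continuous (at_right t) x"
    and inj: "inj \<tau>" and \<tau>01: "\<And>k. 0 < \<tau> k" "\<And>k. \<tau> k \<le> 1"
    and a: "\<And>k. a k = x (\<tau> k) - Lim (at_left (\<tau> k)) x"
    and a_pos: "\<And>k. 0 < a k"
    and sums: "a sums s"
begin

lemma sum_le_increment:
  assumes "finite K" "0 \<le> l" "l \<le> r" "\<And>k. k \<in> K \<Longrightarrow> \<tau> k \<in> {l<..r}"
  shows "(\<Sum>k\<in>K. a k) \<le> x r - x l"
proof -
  have "(\<Sum>k\<in>K. a k) = (\<Sum>t\<in>\<tau> ` K. x t - Lim (at_left t) x)"
    using inj by (subst sum.reindex) (auto simp: a inj_on_def)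
  also have "\<dots> \<le> x r - x l"
    using assms by (intro sum_jumps_le[OF mono]) auto
  finally show ?thesis .
qed

lemma s_le: "s \<le> x 1"
proof (rule LIMSEQ_le_const2)
  show "(\<lambda>n. \<Sum>k<n. a k) \<longlonglongrightarrow> s" using sums by (simp add: sums_def)
  have "(\<Sum>k<n. a k) \<le> x 1 - x 0" for n
    using \<tau>01 by (intro sum_le_increment) auto
  then show "\<exists>N. \<forall>n\<ge>N. (\<Sum>k<n. a k) \<le> x 1" using x0 by auto
qed

definition inc :: "nat \<Rightarrow> nat \<Rightarrow> real" where
  "inc N j = x (real (Suc j) / real N) - x (real j / real N)"

lemma inc_nonneg: "0 \<le> inc N j"
  unfolding inc_def using mono by (auto simp: mono_on_def divide_right_mono)

lemma sum_inc: "0 < N \<Longrightarrow> (\<Sum>j<N. inc N j) = x 1"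
  unfolding inc_def using sum_lessThan_telescope[of "\<lambda>j. x (real j / real N)" N] x0 by simp

lemma inc_tendsto: "(\<lambda>N. inc (Suc N) (cell (Suc N) (\<tau> k))) \<longlonglongrightarrow> a k"
proof -
  have "continuous (at (\<tau> k) within {\<tau> k..}) x"
    using right_cont[of "\<tau> k"] \<tau>01(1)[of k] by (simp add: continuous_within at_within_Ici_at_right)
  then have "(\<lambda>N. x (real (Suc (cell (Suc N) (\<tau> k))) / real (Suc N))) \<longlonglongrightarrow> x (\<tau> k)"
    using cell_limits(2)[OF \<tau>01(1)] cell_bounds(2)[OF \<tau>01(1) zero_less_Suc]
    unfolding continuous_within_sequentially comp_def
    by (elim allE[of _ "\<lambda>N. real (Suc (cell (Suc N) (\<tau> k))) / real (Suc N)"]) auto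
  moreover have "(\<lambda>N. x (real (cell (Suc N) (\<tau> k)) / real (Suc N))) \<longlonglongrightarrow> Lim (at_left (\<tau> k)) x"
    by (rule filterlim_compose[OF mono_left_limit(1)[OF mono \<tau>01(1)] cell_limits(1)[OF \<tau>01(1)]])
  ultimately show ?thesis unfolding inc_def a by (rule tendsto_diff)
qed

text \<open>In every cell the jumps sum up to at most the increment of the path.  The totals over all cells
  agree by \<open>s = x 1\<close>, so there is equality in each cell.\<close>

lemma cell_sums:
  assumes N: "0 < N" and s: "s = x 1" and j: "j < N"
  shows "(\<lambda>k. if cell N (\<tau> k) = j then a k else 0) sums inc N j"
proof -
  define f where "f j k = (if cell N (\<tau> k) = j then a k else 0)" for j k
  have f0: "0 \<le> f j k" "f j k \<le> a k" for j k using a_pos[of k] by (auto simp: f_def)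
  have sm: "summable (f j)" for j
  proof (rule summable_comparison_test'[of a 0])
    show "summable a" using sums by (rule sums_summable)
    show "norm (f j k) \<le> a k" for k using f0[of j k] by simp
  qed
  have le: "suminf (f j) \<le> inc N j" for j
  proof (rule suminf_le_const[OF sm])
    fix n
    have "(\<Sum>k<n. f j k) = (\<Sum>k\<in>{k\<in>{..<n}. cell N (\<tau> k) = j}. a k)"
      unfolding f_def by (rule sum.inter_filter[symmetric]) simp
    also have "\<dots> \<le> inc N j"
      unfolding inc_def
    proof (rule sum_le_increment)
      fix k assume "k \<in> {k\<in>{..<n}. cell N (\<tau> k) = j}"
      then show "\<tau> k \<in> {real j / real N<..real (Suc j) / real N}"
        using cell_bounds[OF \<tau>01(1)[of k] N] by (simp del: of_nat_Suc)
    qed (auto simp: divide_right_mono)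
    finally show "(\<Sum>k<n. f j k) \<le> inc N j" .
  qed
  have "(\<Sum>j<N. suminf (f j)) = (\<Sum>k. \<Sum>j<N. f j k)"
    by (rule suminf_sum[symmetric]) (rule sm)
  also have "\<dots> = (\<Sum>k. a k)"
  proof (rule suminf_cong)
    fix k
    have "(\<Sum>j<N. f j k) = (\<Sum>j\<in>{cell N (\<tau> k)}. f j k)"
      using cell_less[OF \<tau>01 N] by (intro sum.mono_neutral_right) (auto simp: f_def)
    then show "(\<Sum>j<N. f j k) = a k" by (simp add: f_def)
  qed
  also have "\<dots> = (\<Sum>j<N. inc N j)" using sums s sum_inc[OF N] by (simp add: sums_iff)
  finally have "(\<Sum>j<N. inc N j - suminf (f j)) = 0" by (simp add: sum_subtractf)
  then have "inc N j - suminf (f j) = 0"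
    using le j by (subst (asm) sum_nonneg_eq_0_iff) auto
  then have "f j sums inc N j" using sm[of j] by (simp add: sums_iff)
  then show ?thesis unfolding f_def .
qed

end

section \<open>Tuples of jumps as limits of tuples of increments\<close>

abbreviation tuples :: "nat \<Rightarrow> (nat \<Rightarrow> nat) set" where
  "tuples n \<equiv> {..<n} \<rightarrow>\<^sub>E UNIV"

lemma countable_tuples: "countable (tuples n)"
  by (rule countable_PiE) auto

lemma nn_integral_PiE_prod:
  fixes h :: "nat \<Rightarrow> nat \<Rightarrow> ennreal"
  assumes "finite I"
  shows "(\<integral>\<^sup>+k. (\<Prod>i\<in>I. h i (k i)) \<partial>count_space (I \<rightarrow>\<^sub>E UNIV)) = (\<Prod>i\<in>I. \<integral>\<^sup>+l. h i l \<partial>count_space UNIV)"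
proof -
  interpret product_sigma_finite "\<lambda>_::nat. count_space (UNIV::nat set)"
    by (simp add: product_sigma_finite_def sigma_finite_measure_count_space)
  have "count_space (I \<rightarrow>\<^sub>E (UNIV::nat set)) = PiM I (\<lambda>_. count_space UNIV)"
    using assms by (intro count_space_PiM_finite[symmetric]) auto
  then show ?thesis using assms by (simp add: product_nn_integral_prod)
qed

text \<open>The test functions for the joint Laplace transform of the picked masses \<open>y\<^sub>i\<close>, with
  parameters \<open>b\<^sub>i\<close>, and of the mass left over, with parameter \<open>u\<close>.\<close>

definition weight :: "nat \<Rightarrow> (nat \<Rightarrow> real) \<Rightarrow> real \<Rightarrow> real \<Rightarrow> (nat \<Rightarrow> real) \<Rightarrow> real" where
  "weight n b u s y = exp (- (\<Sum>i<n. b i * y i) - u * (s - (\<Sum>i<n. y i)))"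

lemma weight_cong: "(\<And>i. i < n \<Longrightarrow> y i = y' i) \<Longrightarrow> weight n b u s y = weight n b u s y'"
  by (simp add: weight_def)

context pure_jump_path
begin

lemma s_pos: "0 < s"
  using sums a_pos by (metis sums_iff suminf_pos)

lemma ennreal_sum_a: "(\<integral>\<^sup>+k. ennreal (a k) \<partial>count_space UNIV) = ennreal s"
proof -
  have "(\<Sum>k. ennreal (a k)) = ennreal s"
    by (rule suminf_ennreal_eq[OF _ sums]) (simp add: a_pos less_imp_le)
  then show ?thesis by (simp add: nn_integral_count_space_nat)
qed

lemma ennreal_sum_tuples: "(\<integral>\<^sup>+k. (\<Prod>i<n. ennreal (a (k i))) \<partial>count_space (tuples n)) = ennreal (s ^ n)"
  using s_pos by (simp add: nn_integral_PiE_prod[where h="\<lambda>_ l. ennreal (a l)"] ennreal_sum_a ennreal_power)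

lemma ennreal_sum_cell:
  assumes "0 < N" "s = x 1" "j < N"
  shows "(\<integral>\<^sup>+k. (if cell N (\<tau> k) = j then ennreal (a k) else 0) \<partial>count_space UNIV) = ennreal (inc N j)"
proof -
  have "(\<integral>\<^sup>+k. (if cell N (\<tau> k) = j then ennreal (a k) else 0) \<partial>count_space UNIV)
     = (\<Sum>k. ennreal (if cell N (\<tau> k) = j then a k else 0))"
    by (auto simp: nn_integral_count_space_nat intro!: suminf_cong)
  also have "\<dots> = ennreal (inc N j)"
    using cell_sums[OF assms] a_pos by (intro suminf_ennreal_eq) (auto simp: less_imp_le)
  finally show ?thesis .
qed

text \<open>Every increment on the left is the sum of the jumps in its cell.  Multiplying out, a choice of
  distinct cells and of one jump in each of them is the same as a choice of jumps whose cells are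
  distinct.\<close>

lemma cell_expand:
  assumes N: "0 < N" and s: "s = x 1"
  shows "(\<Sum>j\<in>{j\<in>{..<n} \<rightarrow>\<^sub>E {..<N}. inj_on j {..<n}}. ennreal ((\<Prod>i<n. inc N (j i)) * weight n b u s (\<lambda>i. inc N (j i))))
    = (\<integral>\<^sup>+k. (\<Prod>i<n. ennreal (a (k i))) * (if inj_on (\<lambda>i. cell N (\<tau> (k i))) {..<n} then
          ennreal (weight n b u s (\<lambda>i. inc N (cell N (\<tau> (k i))))) else 0) \<partial>count_space (tuples n))"
    (is "?L = ?R")
proof -
  define c where "c k = restrict (\<lambda>i. cell N (\<tau> (k i))) {..<n}" for k :: "nat \<Rightarrow> nat"
  define w where "w j = (if inj_on j {..<n} then ennreal (weight n b u s (\<lambda>i. inc N (j i))) else 0)" for j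
  define J where "J = {..<n} \<rightarrow>\<^sub>E {..<N}"
  have finJ: "finite J" unfolding J_def by (intro finite_PiE) auto
  have cJ: "c k \<in> J" for k
    using cell_less[OF \<tau>01 N] by (auto simp: c_def J_def)
  have wc: "w (c k) = (if inj_on (\<lambda>i. cell N (\<tau> (k i))) {..<n} then
          ennreal (weight n b u s (\<lambda>i. inc N (cell N (\<tau> (k i))))) else 0)" for k
  proof -
    have "inj_on (c k) {..<n} \<longleftrightarrow> inj_on (\<lambda>i. cell N (\<tau> (k i))) {..<n}"
      by (rule inj_on_cong) (simp add: c_def)
    moreover have "weight n b u s (\<lambda>i. inc N (c k i)) = weight n b u s (\<lambda>i. inc N (cell N (\<tau> (k i))))"
      by (rule weight_cong) (simp add: c_def)
    ultimately show ?thesis by (simp add: w_def)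
  qed
  have expand: "(\<Prod>i<n. ennreal (a (k i))) * w (c k)
     = (\<Sum>j\<in>J. w j * (\<Prod>i<n. if cell N (\<tau> (k i)) = j i then ennreal (a (k i)) else 0))" for k
  proof -
    have "(\<Sum>j\<in>J. w j * (\<Prod>i<n. if cell N (\<tau> (k i)) = j i then ennreal (a (k i)) else 0))
       = (\<Sum>j\<in>{c k}. w j * (\<Prod>i<n. if cell N (\<tau> (k i)) = j i then ennreal (a (k i)) else 0))"
    proof (rule sum.mono_neutral_right[OF finJ])
      show "\<forall>j\<in>J - {c k}. w j * (\<Prod>i<n. if cell N (\<tau> (k i)) = j i then ennreal (a (k i)) else 0) = 0"
      proof
        fix j assume j: "j \<in> J - {c k}"
        have "\<exists>i<n. cell N (\<tau> (k i)) \<noteq> j i"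
        proof (rule ccontr)
          assume "\<not> ?thesis"
          then have "j = c k" using j by (auto simp: J_def c_def PiE_def extensional_def restrict_def fun_eq_iff)
          then show False using j by simp
        qed
        then show "w j * (\<Prod>i<n. if cell N (\<tau> (k i)) = j i then ennreal (a (k i)) else 0) = 0"
          by (auto intro!: prod_zero)
      qed
    qed (use cJ in auto)
    then show ?thesis by (simp add: c_def mult.commute)
  qed
  have "?R = (\<integral>\<^sup>+k. (\<Sum>j\<in>J. w j * (\<Prod>i<n. if cell N (\<tau> (k i)) = j i then ennreal (a (k i)) else 0)) \<partial>count_space (tuples n))"
    unfolding wc[symmetric] expand ..
  also have "\<dots> = (\<Sum>j\<in>J. w j * (\<integral>\<^sup>+k. (\<Prod>i<n. if cell N (\<tau> (k i)) = j i then ennreal (a (k i)) else 0) \<partial>count_space (tuples n)))"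
    by (subst nn_integral_sum) (auto simp: nn_integral_cmult)
  also have "\<dots> = (\<Sum>j\<in>J. w j * ennreal (\<Prod>i<n. inc N (j i)))"
  proof (rule sum.cong[OF refl])
    fix j assume "j \<in> J"
    then have "j i < N" if "i < n" for i using that by (auto simp: J_def)
    then show "w j * (\<integral>\<^sup>+k. (\<Prod>i<n. if cell N (\<tau> (k i)) = j i then ennreal (a (k i)) else 0) \<partial>count_space (tuples n))
      = w j * ennreal (\<Prod>i<n. inc N (j i))"
      by (subst nn_integral_PiE_prod[where h="\<lambda>i l. if cell N (\<tau> l) = j i then ennreal (a l) else 0"])
         (simp_all add: ennreal_sum_cell[OF N s] prod_ennreal[symmetric] inc_nonneg)
  qed
  also have "\<dots> = (\<Sum>j\<in>J. if inj_on j {..<n} then ennreal ((\<Prod>i<n. inc N (j i)) * weight n b u s (\<lambda>i. inc N (j i))) else 0)"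
    by (intro sum.cong) (auto simp: w_def ennreal_mult prod_nonneg inc_nonneg mult.commute weight_def)
  also have "\<dots> = ?L"
    unfolding J_def[symmetric] using finJ by (subst sum.inter_filter) auto
  finally show ?thesis by simp
qed

lemma weight_le:
  assumes c: "\<And>i. i < n \<Longrightarrow> c \<le> b i" "c \<le> u" and y: "\<And>i. i < n \<Longrightarrow> 0 \<le> y i" "(\<Sum>i<n. y i) \<le> s"
  shows "weight n b u s y \<le> exp (- c * s)"
proof -
  have "(\<Sum>i<n. c * y i) \<le> (\<Sum>i<n. b i * y i)" using c y by (intro sum_mono mult_right_mono) auto
  moreover have "c * (s - (\<Sum>i<n. y i)) \<le> u * (s - (\<Sum>i<n. y i))" using c y by (intro mult_right_mono) auto
  ultimately show ?thesis by (simp add: weight_def sum_distrib_left[symmetric] algebra_simps)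
qed

lemma discrete_term_le:
  assumes N: "0 < N" and s: "s = x 1" and c: "\<And>i. i < n \<Longrightarrow> c \<le> b i" "c \<le> u"
  shows "(if inj_on (\<lambda>i. cell N (\<tau> (k i))) {..<n} then
          ennreal (weight n b u s (\<lambda>i. inc N (cell N (\<tau> (k i))))) else 0) \<le> ennreal (exp (- c * s))"
proof (cases "inj_on (\<lambda>i. cell N (\<tau> (k i))) {..<n}")
  case True
  have "(\<Sum>i<n. inc N (cell N (\<tau> (k i)))) = (\<Sum>j\<in>(\<lambda>i. cell N (\<tau> (k i))) ` {..<n}. inc N j)"
    using True by (simp add: sum.reindex)
  also have "\<dots> \<le> (\<Sum>j<N. inc N j)"
    using cell_less[OF \<tau>01 N] by (intro sum_mono2) (auto simp: inc_nonneg)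
  also have "\<dots> = s" using sum_inc[OF N] s by simp
  finally have "weight n b u s (\<lambda>i. inc N (cell N (\<tau> (k i)))) \<le> exp (- c * s)"
    using c by (intro weight_le) (auto simp: inc_nonneg)
  then show ?thesis using True by (simp add: ennreal_leI)
qed simp

lemma discrete_bound:
  assumes N: "0 < N" and s: "s = x 1" and c: "\<And>i. i < n \<Longrightarrow> c \<le> b i" "c \<le> u"
  shows "(\<Sum>j\<in>{j\<in>{..<n} \<rightarrow>\<^sub>E {..<N}. inj_on j {..<n}}. ennreal ((\<Prod>i<n. inc N (j i)) * weight n b u s (\<lambda>i. inc N (j i))))
    \<le> ennreal (s ^ n * exp (- c * s))"
proof -
  have "(\<Sum>j\<in>{j\<in>{..<n} \<rightarrow>\<^sub>E {..<N}. inj_on j {..<n}}. ennreal ((\<Prod>i<n. inc N (j i)) * weight n b u s (\<lambda>i. inc N (j i))))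
    \<le> (\<integral>\<^sup>+k. (\<Prod>i<n. ennreal (a (k i))) * ennreal (exp (- c * s)) \<partial>count_space (tuples n))"
    unfolding cell_expand[OF N s]
    by (intro nn_integral_mono mult_left_mono discrete_term_le N s c) auto
  also have "\<dots> = ennreal (s ^ n) * ennreal (exp (- c * s))"
    by (simp add: nn_integral_multc ennreal_sum_tuples)
  finally show ?thesis using s_pos by (simp add: ennreal_mult)
qed

lemma cell_eventually_neq:
  assumes "k \<noteq> l"
  shows "\<forall>\<^sub>F N in sequentially. cell (Suc N) (\<tau> k) \<noteq> cell (Suc N) (\<tau> l)"
proof -
  have "\<tau> k \<noteq> \<tau> l" using inj assms by (auto dest: injD)
  define d where "d N = real (Suc (cell (Suc N) (\<tau> k))) / real (Suc N) - real (Suc (cell (Suc N) (\<tau> l))) / real (Suc N)" for N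
  have "d \<longlonglongrightarrow> \<tau> k - \<tau> l"
    unfolding d_def by (intro tendsto_diff cell_limits(2) \<tau>01)
  then have "\<forall>\<^sub>F N in sequentially. d N \<noteq> 0"
    by (rule tendsto_imp_eventually_ne) (use \<open>\<tau> k \<noteq> \<tau> l\<close> in simp)
  then show ?thesis by (rule eventually_mono) (auto simp: d_def)
qed

text \<open>Distinct jumps lie in distinct cells eventually, and the increment over the cell of a jump tends to
  that jump.  The weights are at most \<open>1\<close>, so the product of the jumps dominates, which is summable over
  all tuples because the jumps are.\<close>

lemma discrete_tendsto:
  assumes s: "s = x 1" and b: "\<And>i. i < n \<Longrightarrow> 0 \<le> b i" "0 \<le> u"
  shows "(\<lambda>N. \<Sum>j\<in>{j\<in>{..<n} \<rightarrow>\<^sub>E {..<Suc N}. inj_on j {..<n}}.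
        ennreal ((\<Prod>i<n. inc (Suc N) (j i)) * weight n b u s (\<lambda>i. inc (Suc N) (j i))))
    \<longlonglongrightarrow> (\<integral>\<^sup>+k. (\<Prod>i<n. ennreal (a (k i))) * (if inj_on k {..<n} then
          ennreal (weight n b u s (\<lambda>i. a (k i))) else 0) \<partial>count_space (tuples n))"
  unfolding cell_expand[OF zero_less_Suc s]
proof (rule nn_integral_dominated_convergence[where w="\<lambda>k. \<Prod>i<n. ennreal (a (k i))"])
  fix N
  show "AE k in count_space (tuples n). (\<Prod>i<n. ennreal (a (k i))) * (if inj_on (\<lambda>i. cell (Suc N) (\<tau> (k i))) {..<n} then
          ennreal (weight n b u s (\<lambda>i. inc (Suc N) (cell (Suc N) (\<tau> (k i))))) else 0) \<le> (\<Prod>i<n. ennreal (a (k i)))"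
    using mult_left_mono[OF discrete_term_le[OF zero_less_Suc s b(1) b(2)]] by (intro AE_I2) (simp only: mult_zero_left minus_zero exp_zero ennreal_1 mult_1_right zero_le)
next
  show "(\<integral>\<^sup>+k. (\<Prod>i<n. ennreal (a (k i))) \<partial>count_space (tuples n)) < \<infinity>"
    by (simp add: ennreal_sum_tuples)
next
  show "AE k in count_space (tuples n). (\<lambda>N. (\<Prod>i<n. ennreal (a (k i))) * (if inj_on (\<lambda>i. cell (Suc N) (\<tau> (k i))) {..<n} then
          ennreal (weight n b u s (\<lambda>i. inc (Suc N) (cell (Suc N) (\<tau> (k i))))) else 0)) \<longlonglongrightarrow>
       (\<Prod>i<n. ennreal (a (k i))) * (if inj_on k {..<n} then ennreal (weight n b u s (\<lambda>i. a (k i))) else 0)"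
  proof (intro AE_I2)
    fix k
    have w: "(\<lambda>N. weight n b u s (\<lambda>i. inc (Suc N) (cell (Suc N) (\<tau> (k i))))) \<longlonglongrightarrow> weight n b u s (\<lambda>i. a (k i))"
      unfolding weight_def by (intro tendsto_intros inc_tendsto)
    have "\<forall>\<^sub>F N in sequentially. inj_on (\<lambda>i. cell (Suc N) (\<tau> (k i))) {..<n} \<longleftrightarrow> inj_on k {..<n}"
    proof (cases "inj_on k {..<n}")
      case True
      have "\<forall>\<^sub>F N in sequentially. \<forall>i\<in>{..<n}. \<forall>j\<in>{..<n}. i \<noteq> j \<longrightarrow> cell (Suc N) (\<tau> (k i)) \<noteq> cell (Suc N) (\<tau> (k j))"
      proof (intro eventually_ball_finite ballI finite_lessThan)
        fix i j assume "i \<in> {..<n}" "j \<in> {..<n}"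
        then show "\<forall>\<^sub>F N in sequentially. i \<noteq> j \<longrightarrow> cell (Suc N) (\<tau> (k i)) \<noteq> cell (Suc N) (\<tau> (k j))"
          using True cell_eventually_neq[of "k i" "k j"] by (cases "i = j") (auto simp: inj_on_def)
      qed
      then show ?thesis by (rule eventually_mono) (use True in \<open>auto simp: inj_on_def\<close>)
    next
      case False
      then show ?thesis by (intro always_eventually allI) (auto simp: inj_on_def)
    qed
    then have "\<forall>\<^sub>F N in sequentially. (if inj_on k {..<n} then ennreal (weight n b u s (\<lambda>i. inc (Suc N) (cell (Suc N) (\<tau> (k i))))) else 0)
       = (if inj_on (\<lambda>i. cell (Suc N) (\<tau> (k i))) {..<n} then ennreal (weight n b u s (\<lambda>i. inc (Suc N) (cell (Suc N) (\<tau> (k i))))) else 0)"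
      by (rule eventually_mono) simp
    moreover have "(\<lambda>N. if inj_on k {..<n} then ennreal (weight n b u s (\<lambda>i. inc (Suc N) (cell (Suc N) (\<tau> (k i))))) else 0)
      \<longlonglongrightarrow> (if inj_on k {..<n} then ennreal (weight n b u s (\<lambda>i. a (k i))) else 0)"
      using w by auto
    ultimately have "(\<lambda>N. if inj_on (\<lambda>i. cell (Suc N) (\<tau> (k i))) {..<n} then
          ennreal (weight n b u s (\<lambda>i. inc (Suc N) (cell (Suc N) (\<tau> (k i))))) else 0) \<longlonglongrightarrow>
       (if inj_on k {..<n} then ennreal (weight n b u s (\<lambda>i. a (k i))) else 0)"
      by (rule Lim_transform_eventually[rotated])
    then show "(\<lambda>N. (\<Prod>i<n. ennreal (a (k i))) * (if inj_on (\<lambda>i. cell (Suc N) (\<tau> (k i))) {..<n} then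
          ennreal (weight n b u s (\<lambda>i. inc (Suc N) (cell (Suc N) (\<tau> (k i))))) else 0)) \<longlonglongrightarrow>
       (\<Prod>i<n. ennreal (a (k i))) * (if inj_on k {..<n} then ennreal (weight n b u s (\<lambda>i. a (k i))) else 0)"
      by (intro tendsto_mult_ennreal tendsto_const) (auto simp: ennreal_prod_eq_top)
  qed
qed auto

end

section \<open>Laplace transforms of tuples of jumps\<close>

lemma power_le_fact_exp:
  fixes x :: real
  assumes "0 \<le> x"
  shows "x ^ n \<le> fact n * exp x"
proof -
  have "(\<Sum>k\<in>{n}. x ^ k /\<^sub>R fact k) \<le> (\<Sum>k. x ^ k /\<^sub>R fact k)"
    using assms by (intro sum_le_suminf summable_exp_generic) (auto intro: divide_nonneg_pos)
  also have "\<dots> = exp x" by (simp add: exp_def)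
  finally show ?thesis by (simp add: field_simps)
qed

lemma borel_measurable_nn_integral_countable:
  assumes "countable I" "\<And>k. k \<in> I \<Longrightarrow> (\<lambda>\<omega>. f \<omega> k) \<in> borel_measurable M"
  shows "(\<lambda>\<omega>. \<integral>\<^sup>+k. f \<omega> k \<partial>count_space I) \<in> borel_measurable M"
proof -
  have "(\<lambda>(k, \<omega>). f \<omega> k) \<in> borel_measurable (count_space I \<Otimes>\<^sub>M M)"
    using assms by (intro measurable_pair_measure_countable1) auto
  then have "(\<lambda>(\<omega>, k). f \<omega> k) \<in> borel_measurable (M \<Otimes>\<^sub>M count_space I)"
    by (subst measurable_pair_swap_iff) (simp add: case_prod_beta' comp_def)
  then show ?thesis
    by (intro sigma_finite_measure.borel_measurable_nn_integral sigma_finite_measure_count_space_countable assms(1))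
qed

text \<open>The density of \<open>1 / (2 S)\<close> is that of a squared standard normal variable.\<close>

lemma levy_density_inverse:
  assumes "0 < v"
  shows "levy_density (1 / (2 * v)) * (1 / (2 * v\<^sup>2)) = v powr (- 1 / 2) * exp (- v / 2) / sqrt (2 * pi)"
proof -
  have "(1 / (2 * v)) powr (- 3 / 2) = (2 * v) powr (3 / 2)"
    using assms by (simp add: powr_divide powr_minus field_simps)
  also have "\<dots> = (2 * v) powr (1 + 1 / 2)" by simp
  also have "\<dots> = (2 * v) * sqrt (2 * v)"
    using assms by (subst powr_add) (simp add: powr_half_sqrt)
  finally have e: "(1 / (2 * v)) powr (- 3 / 2) = 2 * v * sqrt 2 * sqrt v" by (simp add: real_sqrt_mult)
  have e': "v powr (- 1 / 2) = 1 / sqrt v" using assms by (simp add: powr_minus powr_half_sqrt field_simps)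
  define r where "r = sqrt v"
  have r: "0 < r" "v = r\<^sup>2" "sqrt v = r" using assms by (auto simp: r_def)
  have "levy_density (1 / (2 * v)) = 2 * v * sqrt 2 * sqrt v * exp (- v / 2) / (2 * sqrt pi)"
    using assms by (simp add: levy_density_def e[simplified])
  also have "\<dots> * (1 / (2 * v\<^sup>2)) = 1 / sqrt v * exp (- v / 2) * sqrt 2 / (2 * sqrt pi)"
    unfolding r(2) using r(1) by (simp add: field_simps power2_eq_square)
  also have "\<dots> = 1 / sqrt v * exp (- v / 2) / sqrt (2 * pi)"
  proof -
    have h: "sqrt 2 / 2 = 1 / sqrt (2::real)" by (simp add: field_simps)
    have "1 / sqrt v * exp (- v / 2) * sqrt 2 / (2 * sqrt pi) = 1 / sqrt v * exp (- v / 2) * (sqrt 2 / 2) / sqrt pi"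
      by simp
    then show ?thesis unfolding h by (simp add: real_sqrt_mult)
  qed
  finally show ?thesis unfolding e' .
qed

lemma nn_integral_levy_density: "(\<integral>\<^sup>+t. ennreal (levy_density t) \<partial>lborel) = 1"
proof -
  have "(\<integral>\<^sup>+t. ennreal (levy_density t) \<partial>lborel) = (\<integral>\<^sup>+t. ennreal (levy_density t) * indicator {0<..} t \<partial>lborel)"
    by (intro nn_integral_cong) (auto simp: indicator_def levy_density_nonpos)
  also have "\<dots> = (\<integral>\<^sup>+v. ennreal (levy_density (1 / (2 * v))) * ennreal (1 / (2 * v\<^sup>2)) * indicator {0<..} v \<partial>lborel)"
    by (rule nn_integral_Ioi_inverse) simp
  also have "\<dots> = (\<integral>\<^sup>+v. ennreal (1 / sqrt (2 * pi)) * (ennreal (v powr (1 / 2 - 1) * exp (- (1 / 2) * v)) * indicator {0<..} v) \<partial>lborel)"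
  proof (intro nn_integral_cong)
    fix v :: real
    show "ennreal (levy_density (1 / (2 * v))) * ennreal (1 / (2 * v\<^sup>2)) * indicator {0<..} v
      = ennreal (1 / sqrt (2 * pi)) * (ennreal (v powr (1 / 2 - 1) * exp (- (1 / 2) * v)) * indicator {0<..} v)"
    proof (cases "0 < v")
      case True
      then show ?thesis using levy_density_inverse[OF True]
        by (simp add: ennreal_mult[symmetric] del: times_divide_eq_right)
    qed simp
  qed
  also have "\<dots> = ennreal (1 / sqrt (2 * pi)) * ennreal (Gamma (1 / 2) * (1 / 2) powr (- (1 / 2)))"
    by (subst nn_integral_cmult, simp, subst nn_integral_Gamma_scaled) simp_all
  also have "\<dots> = ennreal (1 / sqrt (2 * pi) * (Gamma (1 / 2) * (1 / 2) powr (- (1 / 2))))"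
    by (subst ennreal_mult) auto
  also have "1 / sqrt (2 * pi) * (Gamma (1 / 2) * (1 / 2) powr (- (1 / 2))) = 1"
    by (simp add: Gamma_one_half_real powr_minus powr_half_sqrt real_sqrt_mult real_sqrt_divide)
  finally show ?thesis by simp
qed

abbreviation levy_law :: "real measure" where
  "levy_law \<equiv> density lborel (\<lambda>t. ennreal (levy_density t))"

lemma prob_space_levy_law: "prob_space levy_law"
  by (rule prob_spaceI) (simp add: emeasure_density nn_integral_levy_density)

lemma levy_law_pos: "AE t in levy_law. 0 < t"
  by (auto simp: AE_density levy_density_def split: if_splits)

text \<open>Scaling by \<open>t\<^sup>2\<close> turns the transform \<open>exp (- \<surd>u)\<close> into \<open>exp (- t \<surd>u)\<close>, that of an increment of the
  subordinator over a time interval of length \<open>t\<close>.\<close>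

lemma distr_levy_scaled:
  assumes "prob_space M" and [measurable]: "X \<in> borel_measurable M" and nonneg: "AE \<omega> in M. 0 \<le> X \<omega>"
    and t: "0 < t" and lap: "\<And>u. 0 < u \<Longrightarrow> (\<integral>\<omega>. exp (- u * X \<omega>) \<partial>M) = exp (- t * sqrt u)"
  shows "distr M borel X = distr levy_law borel (\<lambda>x. t\<^sup>2 * x)"
proof (rule laplace_unique_real_pos)
  interpret prob_space M by fact
  interpret levy: prob_space levy_law by (rule prob_space_levy_law)
  show "finite_measure (distr M borel X)" "finite_measure (distr levy_law borel (\<lambda>x. t\<^sup>2 * x))"
    by (auto intro!: prob_space.finite_measure prob_space_distr levy.prob_space_distr)
  show "AE x in distr M borel X. 0 \<le> x" using nonneg by (subst AE_distr_iff) auto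
  show "AE x in distr levy_law borel (\<lambda>x. t\<^sup>2 * x). 0 \<le> x"
    using levy_law_pos by (subst AE_distr_iff) (auto elim!: eventually_mono)
  fix u :: real assume u: "0 < u"
  have "AE \<omega> in M. norm (exp (- u * X \<omega>)) \<le> 1" using nonneg u by (auto elim!: eventually_mono)
  then have int: "integrable M (\<lambda>\<omega>. exp (- u * X \<omega>))" by (intro integrable_const_bound[of _ 1]) auto
  have "(\<integral>\<^sup>+x. ennreal (exp (- u * x)) \<partial>distr M borel X) = (\<integral>\<^sup>+\<omega>. ennreal (exp (- u * X \<omega>)) \<partial>M)"
    by (subst nn_integral_distr) auto
  also have "\<dots> = ennreal (exp (- t * sqrt u))"
    using int lap[OF u] by (subst nn_integral_eq_integral) auto
  also have "\<dots> = ennreal (exp (- sqrt (u * t\<^sup>2)))" using t by (simp add: real_sqrt_mult mult.commute)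
  also have "\<dots> = (\<integral>\<^sup>+x. ennreal (levy_density x * exp (- (u * t\<^sup>2) * x)) \<partial>lborel)"
    using u t by (subst levy_laplace) auto
  also have "\<dots> = (\<integral>\<^sup>+x. ennreal (exp (- u * x)) \<partial>distr levy_law borel (\<lambda>x. t\<^sup>2 * x))"
    by (subst nn_integral_distr) (auto simp: nn_integral_density ennreal_mult mult.assoc)
  finally show "(\<integral>\<^sup>+x. ennreal (exp (- u * x)) \<partial>distr M borel X)
      = (\<integral>\<^sup>+x. ennreal (exp (- u * x)) \<partial>distr levy_law borel (\<lambda>x. t\<^sup>2 * x))" .
qed auto

locale stable_half =
  fixes M :: "'w measure" and S :: "'w \<Rightarrow> real" and f :: "real \<Rightarrow> real"
    and \<xi> :: "real \<Rightarrow> 'w \<Rightarrow> real" and A :: "'w \<Rightarrow> nat \<Rightarrow> real"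
  assumes subordinator: "stable_subordinator M (1 / 2) \<xi>"
    and jumps: "ranked_jumps M \<xi> A"
    and S_sum: "AE \<omega> in M. A \<omega> sums S \<omega>"
    and S_pos: "AE \<omega> in M. 0 < S \<omega>"
    and S_laplace: "\<And>u. 0 < u \<Longrightarrow> (\<integral>\<omega>. exp (- u * S \<omega>) \<partial>M) = exp (- sqrt u)"
    and S_density: "distributed M lborel S (\<lambda>t. ennreal (f t))"
    and f_nonneg: "\<And>t. 0 \<le> f t"

sublocale stable_half \<subseteq> prob_space M
  using subordinator by (simp add: stable_subordinator_def)

context stable_half
begin

lemma S_measurable[measurable]: "S \<in> borel_measurable M"
  using S_density by (simp add: distributed_def)

lemma f_measurable[measurable]: "f \<in> borel_measurable borel"
proof -
  have "(\<lambda>t. ennreal (f t)) \<in> borel_measurable borel" using S_density by (simp add: distributed_def)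
  then have "(\<lambda>t. enn2real (ennreal (f t))) \<in> borel_measurable borel" by measurable
  then show ?thesis by (simp add: f_nonneg)
qed

lemma \<xi>_measurable[measurable]: "0 \<le> t \<Longrightarrow> \<xi> t \<in> borel_measurable M"
  using subordinator by (simp add: stable_subordinator_def)

lemma A_measurable[measurable]: "A \<in> measurable M seq_space"
  using jumps by (simp add: ranked_jumps_def)

lemma A_measurable_component[measurable]: "(\<lambda>\<omega>. A \<omega> k) \<in> borel_measurable M"
  by (rule measurable_compose[OF A_measurable]) simp

lemma \<xi>_path: "AE \<omega> in M. \<xi> 0 \<omega> = 0 \<and> mono_on {0..} (\<lambda>t. \<xi> t \<omega>) \<and> (\<forall>t\<ge>0. continuous (at_right t) (\<lambda>s. \<xi> s \<omega>))"
  using subordinator by (simp add: stable_subordinator_def)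

lemma \<xi>_laplace: "0 \<le> t \<Longrightarrow> 0 < u \<Longrightarrow> (\<integral>\<omega>. exp (- u * \<xi> t \<omega>) \<partial>M) = exp (- t * sqrt u)"
  using subordinator by (simp add: stable_subordinator_def powr_half_sqrt)

lemma law_S: "distr M borel S = levy_law"
proof -
  have "distr M borel S = distr levy_law borel (\<lambda>x. 1\<^sup>2 * x)"
  proof (rule distr_levy_scaled[OF prob_space_axioms])
    show "(\<integral>\<omega>. exp (- u * S \<omega>) \<partial>M) = exp (- 1 * sqrt u)" if "0 < u" for u
      using S_laplace[OF that] by simp
  qed (use S_pos in \<open>auto elim!: eventually_mono\<close>)
  then show ?thesis by (simp add: distr_id2)
qed

lemma \<xi>_nonneg: "0 \<le> t \<Longrightarrow> AE \<omega> in M. 0 \<le> \<xi> t \<omega>"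
  using \<xi>_path by (rule eventually_mono) (metis atLeast_iff mono_onD order_refl)

lemma law_\<xi>: "0 < t \<Longrightarrow> distr M borel (\<xi> t) = distr levy_law borel (\<lambda>x. t\<^sup>2 * x)"
  by (rule distr_levy_scaled[OF prob_space_axioms]) (use \<xi>_nonneg[of t] \<xi>_laplace[of t] in auto)

lemma law_increment:
  "0 \<le> s \<Longrightarrow> s < t \<Longrightarrow> distr M borel (\<lambda>\<omega>. \<xi> t \<omega> - \<xi> s \<omega>) = distr levy_law borel (\<lambda>x. (t - s)\<^sup>2 * x)"
  using subordinator by (subst law_\<xi>[symmetric]) (auto simp: stable_subordinator_def)

lemma increment_laplace:
  assumes "0 \<le> s" "s < t" "0 < u"
  shows "(\<integral>\<^sup>+\<omega>. ennreal (exp (- u * (\<xi> t \<omega> - \<xi> s \<omega>))) \<partial>M) = ennreal (exp (- (t - s) * sqrt u))"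
    and "(\<integral>\<^sup>+\<omega>. ennreal ((\<xi> t \<omega> - \<xi> s \<omega>) * exp (- u * (\<xi> t \<omega> - \<xi> s \<omega>))) \<partial>M)
      = ennreal ((t - s) * exp (- (t - s) * sqrt u) / (2 * sqrt u))"
proof -
  have tr: "(\<integral>\<^sup>+\<omega>. g (\<xi> t \<omega> - \<xi> s \<omega>) \<partial>M) = (\<integral>\<^sup>+x. ennreal (levy_density x) * g ((t - s)\<^sup>2 * x) \<partial>lborel)"
    if [measurable]: "g \<in> borel_measurable borel" for g
  proof -
    have "(\<integral>\<^sup>+\<omega>. g (\<xi> t \<omega> - \<xi> s \<omega>) \<partial>M) = (\<integral>\<^sup>+x. g x \<partial>distr M borel (\<lambda>\<omega>. \<xi> t \<omega> - \<xi> s \<omega>))"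
      using assms by (subst nn_integral_distr) auto
    also have "\<dots> = (\<integral>\<^sup>+x. ennreal (levy_density x) * g ((t - s)\<^sup>2 * x) \<partial>lborel)"
      unfolding law_increment[OF assms(1,2)] by (subst nn_integral_distr) (auto simp: nn_integral_density)
    finally show ?thesis .
  qed
  have v: "0 < u * (t - s)\<^sup>2" using assms by simp
  have sq: "sqrt (u * (t - s)\<^sup>2) = (t - s) * sqrt u" using assms by (simp add: real_sqrt_mult)
  show "(\<integral>\<^sup>+\<omega>. ennreal (exp (- u * (\<xi> t \<omega> - \<xi> s \<omega>))) \<partial>M) = ennreal (exp (- (t - s) * sqrt u))"
    using levy_laplace(1)[OF v] by (subst tr) (auto simp: ennreal_mult[symmetric] sq mult.assoc algebra_simps)
  have "(\<integral>\<^sup>+x. ennreal (levy_density x) * ennreal ((t - s)\<^sup>2 * x * exp (- u * ((t - s)\<^sup>2 * x))) \<partial>lborel)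
     = (\<integral>\<^sup>+x. ennreal ((t - s)\<^sup>2) * ennreal (x * levy_density x * exp (- (u * (t - s)\<^sup>2) * x)) \<partial>lborel)"
    by (intro nn_integral_cong) (auto simp: ennreal_mult'[symmetric] mult_ac)
  also have "\<dots> = ennreal ((t - s)\<^sup>2 * (exp (- (t - s) * sqrt u) / (2 * ((t - s) * sqrt u))))"
    by (subst nn_integral_cmult, measurable, subst levy_laplace(2)[OF v], unfold sq)
       (use assms in \<open>simp add: ennreal_mult'[symmetric] minus_mult_left[symmetric] del: mult_minus_left minus_diff_eq\<close>)
  also have "(t - s)\<^sup>2 * (exp (- (t - s) * sqrt u) / (2 * ((t - s) * sqrt u))) = (t - s) * exp (- (t - s) * sqrt u) / (2 * sqrt u)"
    using assms by (simp add: power2_eq_square)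
  finally show "(\<integral>\<^sup>+\<omega>. ennreal ((\<xi> t \<omega> - \<xi> s \<omega>) * exp (- u * (\<xi> t \<omega> - \<xi> s \<omega>))) \<partial>M)
      = ennreal ((t - s) * exp (- (t - s) * sqrt u) / (2 * sqrt u))"
    by (subst tr) simp_all
qed

text \<open>The enumeration of the jump times may depend on \<open>\<omega>\<close> in a non-measurable way; it is used only for
  pathwise statements about \<open>A\<close> and \<open>S\<close>.\<close>

lemma AE_pure_jump_path:
  "AE \<omega> in M. \<exists>\<tau>. pure_jump_path (\<lambda>t. \<xi> t \<omega>) (A \<omega>) \<tau> (S \<omega>)"
proof -
  have "AE \<omega> in M. \<exists>\<tau>. bij_betw \<tau> (UNIV :: nat set) {t \<in> {0<..1}. jump \<xi> \<omega> t > 0} \<and> (\<forall>k. A \<omega> k = jump \<xi> \<omega> (\<tau> k))"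
    using jumps by (auto simp: ranked_jumps_def)
  with \<xi>_path S_sum show ?thesis
  proof eventually_elim
    case (elim \<omega>)
    then obtain \<tau> where \<tau>: "bij_betw \<tau> (UNIV :: nat set) {t \<in> {0<..1}. jump \<xi> \<omega> t > 0}" "\<And>k. A \<omega> k = jump \<xi> \<omega> (\<tau> k)"
      by auto
    have mem: "\<tau> k \<in> {t \<in> {0<..1}. jump \<xi> \<omega> t > 0}" for k using \<tau>(1) by (auto simp: bij_betw_def)
    have "pure_jump_path (\<lambda>t. \<xi> t \<omega>) (A \<omega>) \<tau> (S \<omega>)"
      using elim \<tau> mem by unfold_locales (auto simp: bij_betw_def jump_def)
    then show ?case by blast
  qed
qed

text \<open>The subordinator has no drift: \<open>S\<close> is at most \<open>\<xi> 1\<close>, and both have the same Laplace transform, hence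
  equal expectations of \<open>exp (- \<cdot>)\<close>.\<close>

lemma S_eq: "AE \<omega> in M. S \<omega> = \<xi> 1 \<omega>"
proof -
  have le: "AE \<omega> in M. S \<omega> \<le> \<xi> 1 \<omega>"
    using AE_pure_jump_path by (rule eventually_mono) (auto dest: pure_jump_path.s_le)
  have iS: "integrable M (\<lambda>\<omega>. exp (- S \<omega>))"
    using S_pos by (intro integrable_const_bound[of _ 1]) (auto elim!: eventually_mono)
  have i\<xi>: "integrable M (\<lambda>\<omega>. exp (- \<xi> 1 \<omega>))"
    using \<xi>_nonneg[of 1] by (intro integrable_const_bound[of _ 1]) (auto elim!: eventually_mono)
  have "(\<integral>\<omega>. exp (- S \<omega>) - exp (- \<xi> 1 \<omega>) \<partial>M) = 0"
    using iS i\<xi> S_laplace[of 1] \<xi>_laplace[of 1 1] by simp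
  then have "AE \<omega> in M. exp (- S \<omega>) - exp (- \<xi> 1 \<omega>) = 0"
    using iS i\<xi> le by (subst (asm) integral_nonneg_eq_0_iff_AE) (auto elim!: eventually_mono)
  then show ?thesis by (rule eventually_mono) simp
qed

text \<open>Increments over different cells are independent.  A picked cell contributes minus the
  derivative of the Laplace transform of its increment, any other cell the transform itself.\<close>

lemma expectation_discrete_term:
  assumes j: "j \<in> {..<n} \<rightarrow>\<^sub>E {..<N}" "inj_on j {..<n}" and b: "\<And>i. i < n \<Longrightarrow> 0 < b i" and u: "0 < u" and N: "0 < N"
  defines "D \<equiv> \<lambda>l \<omega>. \<xi> (real (Suc l) / real N) \<omega> - \<xi> (real l / real N) \<omega>"
  shows "(\<integral>\<^sup>+\<omega>. ennreal ((\<Prod>i<n. D (j i) \<omega>) * weight n b u (S \<omega>) (\<lambda>i. D (j i) \<omega>)) \<partial>M)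
    = ennreal ((\<Prod>i<n. 1 / real N * exp (- (1 / real N) * sqrt (b i)) / (2 * sqrt (b i)))
        * exp (- (1 / real N) * sqrt u) ^ (N - n))"
proof -
  let ?q = "\<lambda>i. 1 / real N * exp (- (1 / real N) * sqrt (b i)) / (2 * sqrt (b i))"
  let ?rest = "{..<N} - j ` {..<n}"
  define v where "v = the_inv_into {..<n} j"
  have vj: "v (j i) = i" if "i < n" for i unfolding v_def using j(2) that by (intro the_inv_into_f_f) auto
  \<comment> \<open>\<open>v\<close> inverts \<open>j\<close>, so a picked cell finds its own parameter \<open>b\<close>\<close>
  define g where "g l y = (if l \<in> j ` {..<n} then ennreal (y * exp (- b (v l) * y)) else ennreal (exp (- u * y)))" for l y
  have [measurable]: "g l \<in> borel_measurable borel" for l unfolding g_def by simp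
  have jN: "j ` {..<n} \<subseteq> {..<N}" using j(1) by auto
  have Dl: "D l \<omega> = \<xi> (real (Suc l) / real N) \<omega> - \<xi> (real l / real N) \<omega>" for l \<omega> by (simp add: D_def)
  have D_meas[measurable]: "D l \<in> borel_measurable M" for l unfolding D_def by measurable
  have D_nonneg: "AE \<omega> in M. \<forall>l. 0 \<le> D l \<omega>"
    using \<xi>_path by (rule eventually_mono) (auto simp: D_def mono_on_def divide_right_mono)
  have D_sum: "AE \<omega> in M. (\<Sum>l<N. D l \<omega>) = S \<omega>"
    using \<xi>_path S_eq
  proof eventually_elim
    case (elim \<omega>)
    then show ?case
      unfolding D_def using sum_lessThan_telescope[of "\<lambda>l. \<xi> (real l / real N) \<omega>" N] N by simp
  qed
  have ind: "indep_vars (\<lambda>_. borel) (\<lambda>l \<omega>. g l (D l \<omega>)) {..<N}"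
  proof (rule indep_vars_compose2[where M'="\<lambda>_. borel" and X=D and Y=g])
    have "mono (\<lambda>l. real l / real N)" by (auto simp: mono_def divide_right_mono)
    then show "indep_vars (\<lambda>_. borel) D {..<N}"
      using subordinator unfolding stable_subordinator_def D_def
      by (elim conjE allE[of _ N] allE[of _ "\<lambda>l. real l / real N"]) auto
  qed simp
  have step: "real (Suc l) / real N - real l / real N = 1 / real N" for l by (simp add: diff_divide_distrib[symmetric])
  have lt: "0 \<le> real l / real N" "real l / real N < real (Suc l) / real N" for l using N by (auto simp: divide_strict_right_mono)
  have Eg1: "(\<integral>\<^sup>+\<omega>. g (j i) (D (j i) \<omega>) \<partial>M) = ennreal ((?q i))" if "i < n" for i
    using increment_laplace(2)[OF lt b[OF that], of "j i"] that unfolding g_def Dl[symmetric] step by (simp add: vj)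
  have Eg2: "(\<integral>\<^sup>+\<omega>. g l (D l \<omega>) \<partial>M) = ennreal (exp (- (1 / real N) * sqrt u))" if "l \<in> ?rest" for l
    using increment_laplace(1)[OF lt u, of l] that unfolding g_def Dl[symmetric] step by simp
  have split: "(\<Prod>l<N. h l) = (\<Prod>i<n. h (j i)) * (\<Prod>l\<in>?rest. h l)" for h :: "nat \<Rightarrow> ennreal"
  proof -
    have "(\<Prod>l<N. h l) = (\<Prod>l\<in>j ` {..<n}. h l) * (\<Prod>l\<in>?rest. h l)"
      using prod.subset_diff[OF jN, of h] by (simp add: mult.commute)
    then show ?thesis using j(2) by (simp add: prod.reindex)
  qed
  have "(\<integral>\<^sup>+\<omega>. ennreal ((\<Prod>i<n. D (j i) \<omega>) * weight n b u (S \<omega>) (\<lambda>i. D (j i) \<omega>)) \<partial>M) = (\<integral>\<^sup>+\<omega>. (\<Prod>l<N. g l (D l \<omega>)) \<partial>M)"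
  proof (rule nn_integral_cong_AE)
    show "AE \<omega> in M. ennreal ((\<Prod>i<n. D (j i) \<omega>) * weight n b u (S \<omega>) (\<lambda>i. D (j i) \<omega>)) = (\<Prod>l<N. g l (D l \<omega>))"
    using D_nonneg D_sum
  proof eventually_elim
    case (elim \<omega>)
    have sumS: "S \<omega> - (\<Sum>i<n. D (j i) \<omega>) = (\<Sum>l\<in>?rest. D l \<omega>)"
      using elim(2) sum_diff[OF finite_lessThan jN, of "\<lambda>l. D l \<omega>"] j(2) by (simp add: sum.reindex)
    have "(\<Prod>l<N. g l (D l \<omega>)) = (\<Prod>i<n. ennreal (D (j i) \<omega> * exp (- b i * D (j i) \<omega>))) * (\<Prod>l\<in>?rest. ennreal (exp (- u * D l \<omega>)))"
      unfolding split by (intro arg_cong2[of _ _ _ _ "(*)"] prod.cong refl) (auto simp: g_def vj)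
    also have "\<dots> = ennreal ((\<Prod>i<n. D (j i) \<omega> * exp (- b i * D (j i) \<omega>)) * (\<Prod>l\<in>?rest. exp (- u * D l \<omega>)))"
      using elim(1) by (subst (1 2) prod_ennreal) (simp_all add: ennreal_mult[symmetric] prod_nonneg)
    also have "(\<Prod>i<n. D (j i) \<omega> * exp (- b i * D (j i) \<omega>)) * (\<Prod>l\<in>?rest. exp (- u * D l \<omega>))
       = (\<Prod>i<n. D (j i) \<omega>) * (exp (\<Sum>i<n. - b i * D (j i) \<omega>) * exp (\<Sum>l\<in>?rest. - u * D l \<omega>))"
      by (simp add: exp_sum prod.distrib)
    also have "exp (\<Sum>i<n. - b i * D (j i) \<omega>) * exp (\<Sum>l\<in>?rest. - u * D l \<omega>) = weight n b u (S \<omega>) (\<lambda>i. D (j i) \<omega>)"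
      unfolding weight_def sumS exp_add[symmetric] by (simp add: sum_negf sum_distrib_left)
    finally show ?case by simp
  qed
  qed
  also have "\<dots> = (\<Prod>l<N. \<integral>\<^sup>+\<omega>. g l (D l \<omega>) \<partial>M)"
    by (rule indep_vars_nn_integral[OF _ ind]) auto
  also have "\<dots> = (\<Prod>i<n. ennreal ((?q i)))
      * (\<Prod>l\<in>?rest. ennreal (exp (- (1 / real N) * sqrt u)))"
    unfolding split by (intro arg_cong2[of _ _ _ _ "(*)"] prod.cong refl Eg1 Eg2) auto
  also have "card (?rest) = N - n"
    using jN j(2) by (subst card_Diff_subset) (auto simp: card_image)
  then have "(\<Prod>l\<in>?rest. ennreal (exp (- (1 / real N) * sqrt u))) = ennreal (exp (- (1 / real N) * sqrt u) ^ (N - n))"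
    by (simp add: ennreal_power)
  also have "(\<Prod>i<n. ennreal ((?q i)))
     = ennreal (\<Prod>i<n. (?q i))"
    using b by (subst prod_ennreal) (auto simp: less_imp_le)
  finally show ?thesis
    using b by (subst ennreal_mult) (auto intro!: prod_nonneg simp: less_imp_le)
qed

text \<open>Summing over the \<open>N (N - 1) \<cdots> (N - n + 1)\<close> choices of distinct cells and letting \<open>N\<close> tend to infinity,
  the factors \<open>1 / N\<close> cancel against the number of choices and the \<open>N - n\<close> remaining cells give
  \<open>exp (- \<surd>u)\<close>.  On the side of the jumps dominated convergence applies pathwise and in expectation.\<close>

lemma mecke_laplace:
  assumes b: "\<And>i. i < n \<Longrightarrow> 0 < b i" and u: "0 < u"
  shows "(\<integral>\<^sup>+\<omega>. (\<integral>\<^sup>+k. (\<Prod>i<n. ennreal (A \<omega> (k i))) * (if inj_on k {..<n} then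
          ennreal (weight n b u (S \<omega>) (\<lambda>i. A \<omega> (k i))) else 0) \<partial>count_space (tuples n)) \<partial>M)
     = ennreal ((\<Prod>i<n. 1 / (2 * sqrt (b i))) * exp (- sqrt u))"
proof -
  define D where "D N l \<omega> = \<xi> (real (Suc l) / real N) \<omega> - \<xi> (real l / real N) \<omega>" for N l \<omega>
  define J where "J N = {j\<in>{..<n} \<rightarrow>\<^sub>E {..<N}. inj_on j {..<n}}" for N :: nat
  define Z where "Z N \<omega> = (\<Sum>j\<in>J (Suc N). ennreal ((\<Prod>i<n. D (Suc N) (j i) \<omega>) * weight n b u (S \<omega>) (\<lambda>i. D (Suc N) (j i) \<omega>)))" for N \<omega>
  define Zl where "Zl \<omega> = (\<integral>\<^sup>+k. (\<Prod>i<n. ennreal (A \<omega> (k i))) * (if inj_on k {..<n} then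
          ennreal (weight n b u (S \<omega>) (\<lambda>i. A \<omega> (k i))) else 0) \<partial>count_space (tuples n))" for \<omega>
  have [measurable]: "D N l \<in> borel_measurable M" for N l unfolding D_def by measurable
  have [measurable]: "Z N \<in> borel_measurable M" for N unfolding Z_def weight_def by measurable
  have [measurable]: "Zl \<in> borel_measurable M"
    unfolding Zl_def weight_def
    by (rule borel_measurable_nn_integral_countable[OF countable_tuples]) measurable
  \<comment> \<open>the smallest of the parameters: \<open>s\<^sup>n exp (- c s)\<close> dominates the sums and is bounded in \<open>s\<close>\<close>
  define c where "c = Min (insert u (b ` {..<n}))"
  have c: "0 < c" "c \<le> u" "\<And>i. i < n \<Longrightarrow> c \<le> b i" using b u by (auto simp: c_def)
  have path: "AE \<omega> in M. (\<lambda>N. Z N \<omega>) \<longlonglongrightarrow> Zl \<omega> \<and> (\<forall>N. Z N \<omega> \<le> ennreal (fact n / c ^ n))"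
    using AE_pure_jump_path S_eq
  proof eventually_elim
    case (elim \<omega>)
    then obtain \<tau> where "pure_jump_path (\<lambda>t. \<xi> t \<omega>) (A \<omega>) \<tau> (S \<omega>)" by blast
    then interpret pure_jump_path "\<lambda>t. \<xi> t \<omega>" "A \<omega>" \<tau> "S \<omega>" .
    have D: "D N l \<omega> = inc N l" for N l by (simp add: D_def inc_def)
    have "(c * S \<omega>) ^ n \<le> fact n * exp (c * S \<omega>)" using c s_pos by (intro power_le_fact_exp) auto
    then have "S \<omega> ^ n * exp (- c * S \<omega>) \<le> fact n / c ^ n"
      using c by (simp add: power_mult_distrib exp_minus field_simps)
    moreover have "Z N \<omega> \<le> ennreal (S \<omega> ^ n * exp (- c * S \<omega>))" for N
      unfolding Z_def J_def D by (intro discrete_bound zero_less_Suc elim(2) c)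
    ultimately have "Z N \<omega> \<le> ennreal (fact n / c ^ n)" for N
      by (meson ennreal_leI order_trans)
    moreover have "(\<lambda>N. Z N \<omega>) \<longlonglongrightarrow> Zl \<omega>"
      unfolding Z_def Zl_def J_def D using b u by (intro discrete_tendsto elim) (auto simp: less_imp_le)
    ultimately show ?case by blast
  qed
  have lim1: "(\<lambda>N. \<integral>\<^sup>+\<omega>. Z N \<omega> \<partial>M) \<longlonglongrightarrow> (\<integral>\<^sup>+\<omega>. Zl \<omega> \<partial>M)"
  proof (rule nn_integral_dominated_convergence[where w="\<lambda>_. ennreal (fact n / c ^ n)"])
    show "AE \<omega> in M. Z N \<omega> \<le> ennreal (fact n / c ^ n)" for N using path by (rule eventually_mono) auto
    show "AE \<omega> in M. (\<lambda>N. Z N \<omega>) \<longlonglongrightarrow> Zl \<omega>" using path by (rule eventually_mono) auto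
    show "(\<integral>\<^sup>+\<omega>. ennreal (fact n / c ^ n) \<partial>M) < \<infinity>" by (simp add: emeasure_space_1)
  qed auto
  define R where "R N = (\<Prod>i<n. 1 / real N * exp (- (1 / real N) * sqrt (b i)) / (2 * sqrt (b i)))
        * exp (- (1 / real N) * sqrt u) ^ (N - n)" for N
  have cardJ: "card (J N) = (\<Prod>q<n. N - q)" for N
    unfolding J_def using card_inj_on_subset_funcset[of "{..<n}" "{..<N}" "{..<n}"]
    by (simp add: atLeast0LessThan)
  have R0: "0 \<le> R N" for N unfolding R_def using b by (auto intro!: mult_nonneg_nonneg prod_nonneg simp: less_imp_le)
  have EZ: "(\<integral>\<^sup>+\<omega>. Z N \<omega> \<partial>M) = ennreal (real (card (J (Suc N))) * R (Suc N))" for N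
  proof -
    have "(\<integral>\<^sup>+\<omega>. Z N \<omega> \<partial>M) = (\<Sum>j\<in>J (Suc N). \<integral>\<^sup>+\<omega>. ennreal ((\<Prod>i<n. D (Suc N) (j i) \<omega>) * weight n b u (S \<omega>) (\<lambda>i. D (Suc N) (j i) \<omega>)) \<partial>M)"
      unfolding Z_def weight_def by (rule nn_integral_sum) measurable
    also have "\<dots> = (\<Sum>j\<in>J (Suc N). ennreal (R (Suc N)))"
      unfolding D_def R_def by (intro sum.cong refl expectation_discrete_term b u zero_less_Suc) (auto simp: J_def)
    also have "\<dots> = ennreal (real (card (J (Suc N))) * R (Suc N))"
      using R0 by (simp add: ennreal_mult ennreal_of_nat_eq_real_of_nat)
    finally show ?thesis .
  qed
  have lim2: "(\<lambda>N. real (card (J N)) * R N) \<longlonglongrightarrow> (\<Prod>i<n. 1 / (2 * sqrt (b i))) * exp (- sqrt u)"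
  proof -
    have fac: "(\<lambda>N. real (N - q) * (1 / real N)) \<longlonglongrightarrow> 1" for q
      by real_asymp
    have e1: "(\<lambda>N. exp (- (1 / real N) * sqrt (b i)) / (2 * sqrt (b i))) \<longlonglongrightarrow> 1 / (2 * sqrt (b i))" for i
    proof -
      have "(\<lambda>N. exp (- (1 / real N) * sqrt (b i)) / (2 * sqrt (b i))) \<longlonglongrightarrow> exp (- 0 * sqrt (b i)) / (2 * sqrt (b i))"
        by (cases "sqrt (b i) = 0") (auto intro!: tendsto_eq_intros lim_1_over_n)
      then show ?thesis by simp
    qed
    have e2: "(\<lambda>N. exp (- (real (N - n) * (1 / real N) * sqrt u))) \<longlonglongrightarrow> exp (- (1 * sqrt u))"
      by (intro tendsto_intros fac)
    have "(\<lambda>N. (\<Prod>q<n. real (N - q) * (1 / real N)) * (\<Prod>i<n. exp (- (1 / real N) * sqrt (b i)) / (2 * sqrt (b i)))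
        * exp (- (real (N - n) * (1 / real N) * sqrt u))) \<longlonglongrightarrow> (\<Prod>q<n. 1) * (\<Prod>i<n. 1 / (2 * sqrt (b i))) * exp (- (1 * sqrt u))"
      by (intro tendsto_mult tendsto_prod fac e1 e2)
    moreover have "(\<Prod>q<n. real (N - q) * (1 / real N)) * (\<Prod>i<n. exp (- (1 / real N) * sqrt (b i)) / (2 * sqrt (b i)))
        * exp (- (real (N - n) * (1 / real N) * sqrt u)) = real (card (J N)) * R N" for N
    proof -
      have "exp (- (real (N - n) * (1 / real N) * sqrt u)) = exp (- (1 / real N) * sqrt u) ^ (N - n)"
        by (simp add: exp_of_nat_mult[symmetric])
      moreover have "(\<Prod>i<n. 1 / real N * exp (- (1 / real N) * sqrt (b i)) / (2 * sqrt (b i)))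
         = (\<Prod>i<n. 1 / real N) * (\<Prod>i<n. exp (- (1 / real N) * sqrt (b i)) / (2 * sqrt (b i)))"
        unfolding prod.distrib[symmetric] by simp
      ultimately show ?thesis unfolding R_def cardJ of_nat_prod prod.distrib by (simp only: mult.assoc)
    qed
    ultimately show ?thesis by simp
  qed
  have "(\<lambda>N. \<integral>\<^sup>+\<omega>. Z N \<omega> \<partial>M) \<longlonglongrightarrow> ennreal ((\<Prod>i<n. 1 / (2 * sqrt (b i))) * exp (- sqrt u))"
    unfolding EZ by (intro tendsto_ennrealI LIMSEQ_Suc[OF lim2])
  from LIMSEQ_unique[OF lim1 this] show ?thesis unfolding Zl_def .
qed

end

section \<open>The Mecke formula\<close>

text \<open>The density \<open>x \<nu>(x)\<close>, where \<open>\<nu>(x) = x powr (- 3 / 2) / (2 \<surd>\<pi>)\<close> is the density of the Levy measure of the subordinator.\<close>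

definition sblevy_density :: "real \<Rightarrow> real" where
  "sblevy_density x = (if 0 < x then x powr (- 1 / 2) / (2 * sqrt pi) else 0)"

abbreviation sblevy :: "real measure" where
  "sblevy \<equiv> density lborel (\<lambda>x. ennreal (sblevy_density x))"

lemma sblevy_density_measurable[measurable]: "sblevy_density \<in> borel_measurable borel"
  unfolding sblevy_density_def[abs_def] by measurable

lemma sblevy_density_nonneg[simp]: "0 \<le> sblevy_density t"
  by (simp add: sblevy_density_def)

lemma sigma_finite_sblevy: "sigma_finite_measure sblevy"
  by (subst sigma_finite_measure.sigma_finite_iff_density_finite[OF sigma_finite_lborel]) auto

lemma sblevy_laplace:
  assumes "0 < b"
  shows "(\<integral>\<^sup>+x. ennreal (exp (- b * x)) \<partial>sblevy) = ennreal (1 / (2 * sqrt b))"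
proof -
  have "(\<integral>\<^sup>+x. ennreal (exp (- b * x)) \<partial>sblevy) = (\<integral>\<^sup>+x. ennreal (1 / (2 * sqrt pi)) *
      (ennreal (x powr (1 / 2 - 1) * exp (- b * x)) * indicator {0<..} x) \<partial>lborel)"
    by (subst nn_integral_density) (auto intro!: nn_integral_cong simp: sblevy_density_def ennreal_mult[symmetric] indicator_def)
  also have "\<dots> = ennreal (1 / (2 * sqrt pi)) * ennreal (Gamma (1 / 2) * b powr (- (1 / 2)))"
    using assms by (subst nn_integral_cmult, simp, subst nn_integral_Gamma_scaled) simp_all
  also have "\<dots> = ennreal (1 / (2 * sqrt pi) * (Gamma (1 / 2) * b powr (- (1 / 2))))"
    by (subst ennreal_mult) auto
  also have "1 / (2 * sqrt pi) * (Gamma (1 / 2) * b powr (- (1 / 2))) = 1 / (2 * sqrt b)"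
    using assms by (simp add: Gamma_one_half_real powr_minus powr_half_sqrt field_simps)
  finally show ?thesis .
qed

lemma measurable_pair_countable2:
  assumes "countable I" "\<And>k. k \<in> I \<Longrightarrow> (\<lambda>\<omega>. f \<omega> k) \<in> measurable M K"
  shows "(\<lambda>(\<omega>, k). f \<omega> k) \<in> measurable (M \<Otimes>\<^sub>M count_space I) K"
proof -
  have "(\<lambda>(k, \<omega>). f \<omega> k) \<in> measurable (count_space I \<Otimes>\<^sub>M M) K"
    using assms by (intro measurable_pair_measure_countable1) auto
  then show ?thesis
    by (subst measurable_pair_swap_iff) (simp add: case_prod_beta' comp_def)
qed

context stable_half
begin

text \<open>The two sides are integrals of \<open>F\<close> against measures that agree on exponential functions.  Both
  measures are infinite for \<open>n > 0\<close>; multiplied by \<open>e = exp (- \<Sum>x\<^sub>i)\<close> they become finite, so that uniqueness of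
  Laplace transforms applies, and the factor is removed again with \<open>e' = 1 / e\<close>.  The last of the
  \<open>n + 1\<close> coordinates is the mass left over.\<close>

lemma mecke_PiM:
  fixes F :: "(nat \<Rightarrow> real) \<Rightarrow> ennreal"
  assumes F: "F \<in> borel_measurable (PiM {..n} (\<lambda>_. borel))"
  defines "B \<equiv> \<lambda>i. if i < n then sblevy else levy_law"
  shows "(\<integral>\<^sup>+\<omega>. (\<integral>\<^sup>+k. (\<Prod>i<n. ennreal (A \<omega> (k i))) * (if inj_on k {..<n} then
          F (\<lambda>i\<in>{..n}. if i < n then A \<omega> (k i) else S \<omega> - (\<Sum>i<n. A \<omega> (k i))) else 0) \<partial>count_space (tuples n)) \<partial>M)
     = (\<integral>\<^sup>+x. F x \<partial>PiM {..n} B)"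
proof -
  interpret C: sigma_finite_measure "count_space (tuples n)"
    by (rule sigma_finite_measure_count_space_countable[OF countable_tuples])
  interpret levy: prob_space levy_law by (rule prob_space_levy_law)
  interpret P: product_sigma_finite B
    using sigma_finite_sblevy levy.sigma_finite_measure_axioms by (auto simp: product_sigma_finite_def B_def)
  let ?P = "PiM {..n} (\<lambda>_. borel) :: (nat \<Rightarrow> real) measure"
  define V where "V \<omega> k = (\<lambda>i\<in>{..n}. if i < n then A \<omega> (k i) else S \<omega> - (\<Sum>i<n. A \<omega> (k i)))" for \<omega> and k :: "nat \<Rightarrow> nat"
  define w where "w \<omega> k = (if inj_on k {..<n} then (\<Prod>i<n. ennreal (A \<omega> (k i))) else 0)" for \<omega> and k :: "nat \<Rightarrow> nat"
  have V[measurable]: "(\<lambda>(\<omega>, k). V \<omega> k) \<in> measurable (M \<Otimes>\<^sub>M count_space (tuples n)) ?P"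
    unfolding V_def by (rule measurable_pair_countable2[OF countable_tuples]) measurable
  have w[measurable]: "(\<lambda>(\<omega>, k). w \<omega> k) \<in> borel_measurable (M \<Otimes>\<^sub>M count_space (tuples n))"
    unfolding w_def by (rule measurable_pair_countable2[OF countable_tuples]) measurable
  define \<mu> where "\<mu> = distr (density (M \<Otimes>\<^sub>M count_space (tuples n)) (\<lambda>(\<omega>, k). w \<omega> k)) ?P (\<lambda>(\<omega>, k). V \<omega> k)"
  have sets_\<mu>: "sets \<mu> = sets ?P" by (simp add: \<mu>_def)
  have sets_B: "sets (PiM {..n} B) = sets ?P" by (intro sets_PiM_cong) (auto simp: B_def)
  have nn: "(\<integral>\<^sup>+x. G x \<partial>\<mu>) = (\<integral>\<^sup>+\<omega>. \<integral>\<^sup>+k. w \<omega> k * G (V \<omega> k) \<partial>count_space (tuples n) \<partial>M)"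
    if [measurable]: "G \<in> borel_measurable ?P" for G
  proof -
    have "(\<integral>\<^sup>+x. G x \<partial>\<mu>) = (\<integral>\<^sup>+z. (case z of (\<omega>, k) \<Rightarrow> w \<omega> k) * G (case z of (\<omega>, k) \<Rightarrow> V \<omega> k) \<partial>(M \<Otimes>\<^sub>M count_space (tuples n)))"
      unfolding \<mu>_def by (subst nn_integral_distr) (auto intro!: nn_integral_density)
    also have "\<dots> = (\<integral>\<^sup>+\<omega>. \<integral>\<^sup>+k. w \<omega> k * G (V \<omega> k) \<partial>count_space (tuples n) \<partial>M)"
      by (subst C.nn_integral_fst[symmetric]) auto
    finally show ?thesis .
  qed
  define e where "e x = (\<Prod>i\<le>n. ennreal (exp (- x i)))" for x :: "nat \<Rightarrow> real"
  have e[measurable]: "e \<in> borel_measurable ?P" unfolding e_def by measurable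
  define e' where "e' x = (\<Prod>i\<le>n. ennreal (exp (x i)))" for x :: "nat \<Rightarrow> real"
  have e'[measurable]: "e' \<in> borel_measurable ?P" unfolding e'_def by measurable
  have ee': "e x * e' x = 1" for x
    unfolding e_def e'_def prod.distrib[symmetric] by (simp add: ennreal_mult[symmetric] exp_add[symmetric])
  have me: "e \<in> borel_measurable \<mu>" "e \<in> borel_measurable (PiM {..n} B)"
    using e by (simp_all add: measurable_cong_sets[OF sets_\<mu> refl] measurable_cong_sets[OF sets_B refl])
  have eL: "e x * (\<Prod>i\<le>n. ennreal (exp (- real (m i) * x i))) = (\<Prod>i\<le>n. ennreal (exp (- (1 + real (m i)) * x i)))" for x m
    unfolding e_def prod.distrib[symmetric] by (simp add: ennreal_mult[symmetric] exp_add[symmetric] algebra_simps)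
  have lap\<mu>: "(\<integral>\<^sup>+x. (\<Prod>i\<le>n. ennreal (exp (- (1 + real (m i)) * x i))) \<partial>\<mu>)
     = ennreal ((\<Prod>i<n. 1 / (2 * sqrt (1 + real (m i)))) * exp (- sqrt (1 + real (m n))))" for m
  proof -
    have "(\<Prod>i\<le>n. ennreal (exp (- (1 + real (m i)) * V \<omega> k i))) =
       ennreal (weight n (\<lambda>i. 1 + real (m i)) (1 + real (m n)) (S \<omega>) (\<lambda>i. A \<omega> (k i)))" for \<omega> k
    proof -
      have "(\<Prod>i\<le>n. ennreal (exp (- (1 + real (m i)) * V \<omega> k i))) = ennreal (exp (\<Sum>i\<le>n. - ((1 + real (m i)) * V \<omega> k i)))"
        by (simp add: prod_ennreal exp_sum algebra_simps)
      also have "(\<Sum>i\<le>n. - ((1 + real (m i)) * V \<omega> k i)) = (\<Sum>i<n. - ((1 + real (m i)) * A \<omega> (k i))) - (1 + real (m n)) * (S \<omega> - (\<Sum>i<n. A \<omega> (k i)))"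
        unfolding lessThan_Suc_atMost[symmetric] by (simp add: V_def algebra_simps)
      finally show ?thesis by (simp add: weight_def sum_negf)
    qed
    then have "w \<omega> k * (\<Prod>i\<le>n. ennreal (exp (- (1 + real (m i)) * V \<omega> k i))) =
       (\<Prod>i<n. ennreal (A \<omega> (k i))) * (if inj_on k {..<n} then
          ennreal (weight n (\<lambda>i. 1 + real (m i)) (1 + real (m n)) (S \<omega>) (\<lambda>i. A \<omega> (k i))) else 0)" for \<omega> k
      by (simp add: w_def)
    then show ?thesis
      by (subst nn, measurable) (simp only: mecke_laplace[of n "\<lambda>i. 1 + real (m i)" "1 + real (m n)"] add_pos_nonneg zero_less_one of_nat_0_le_iff)
  qed
  have lapB: "(\<integral>\<^sup>+x. (\<Prod>i\<le>n. ennreal (exp (- (1 + real (m i)) * x i))) \<partial>PiM {..n} B)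
     = ennreal ((\<Prod>i<n. 1 / (2 * sqrt (1 + real (m i)))) * exp (- sqrt (1 + real (m n))))" for m
  proof -
    have "(\<integral>\<^sup>+x. (\<Prod>i\<le>n. ennreal (exp (- (1 + real (m i)) * x i))) \<partial>PiM {..n} B)
       = (\<Prod>i\<le>n. \<integral>\<^sup>+y. ennreal (exp (- (1 + real (m i)) * y)) \<partial>B i)"
      by (rule P.product_nn_integral_prod) (auto simp: B_def)
    also have "\<dots> = (\<Prod>i<n. ennreal (1 / (2 * sqrt (1 + real (m i))))) * ennreal (exp (- sqrt (1 + real (m n))))"
    proof -
      have l: "(\<integral>\<^sup>+y. ennreal (exp (- (1 + real (m n)) * y)) \<partial>B n) = ennreal (exp (- sqrt (1 + real (m n))))"
        using levy_laplace(1)[of "1 + real (m n)"] by (simp add: B_def nn_integral_density ennreal_mult[symmetric])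
      have "(\<Prod>i<n. \<integral>\<^sup>+y. ennreal (exp (- (1 + real (m i)) * y)) \<partial>B i) = (\<Prod>i<n. ennreal (1 / (2 * sqrt (1 + real (m i)))))"
      proof (intro prod.cong refl)
        fix i assume "i \<in> {..<n}"
        then show "(\<integral>\<^sup>+y. ennreal (exp (- (1 + real (m i)) * y)) \<partial>B i) = ennreal (1 / (2 * sqrt (1 + real (m i))))"
          using sblevy_laplace[of "1 + real (m i)"] by (simp add: B_def)
      qed
      with l show ?thesis unfolding lessThan_Suc_atMost[symmetric] by (simp del: minus_add_distrib)
    qed
    finally show ?thesis by (simp add: prod_ennreal ennreal_mult prod_nonneg)
  qed
  have neg0: "AE x in \<kappa>. \<forall>i\<in>{..n}. 0 \<le> x i"
    if s: "sets \<kappa> = sets ?P" and z: "\<And>i. i \<le> n \<Longrightarrow> (\<integral>\<^sup>+x. indicator {..<0} (x i) \<partial>\<kappa>) = 0" for \<kappa> :: "(nat \<Rightarrow> real) measure"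
  proof (intro AE_finite_allI)
    fix i assume i: "i \<in> {..n}"
    have m: "(\<lambda>x. indicator {..<0} (x i) :: ennreal) \<in> borel_measurable \<kappa>"
      unfolding measurable_cong_sets[OF s refl]
      by (rule measurable_compose[OF measurable_component_singleton[OF i]]) simp
    have "AE x in \<kappa>. (indicator {..<0} (x i) :: ennreal) = 0"
      using z[of i] i nn_integral_0_iff_AE[OF m] by auto
    then show "AE x in \<kappa>. 0 \<le> x i" by (rule eventually_mono) (auto simp: indicator_def split: if_splits)
  qed simp
  have "density \<mu> e = density (PiM {..n} B) e"
  proof (rule laplace_unique_PiM[of "{..n}"])
    show "sets (density \<mu> e) = sets ?P" "sets (density (PiM {..n} B) e) = sets ?P"
      using sets_\<mu> sets_B by auto
    have nnd: "(\<integral>\<^sup>+x. (\<Prod>i\<le>n. ennreal (exp (- real (m i) * x i))) \<partial>density \<kappa> e)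
       = (\<integral>\<^sup>+x. (\<Prod>i\<le>n. ennreal (exp (- (1 + real (m i)) * x i))) \<partial>\<kappa>)"
      if "sets \<kappa> = sets ?P" for \<kappa> m
    proof -
      have "e \<in> borel_measurable \<kappa>" unfolding measurable_cong_sets[OF that refl] by (rule e)
      moreover have "(\<lambda>x. \<Prod>i\<le>n. ennreal (exp (- real (m i) * x i))) \<in> borel_measurable \<kappa>"
        unfolding measurable_cong_sets[OF that refl] by measurable
      ultimately show ?thesis by (simp only: nn_integral_density eL)
    qed
    note nnd\<mu> = nnd[OF sets_\<mu>, unfolded lap\<mu>] and nndB = nnd[OF sets_B, unfolded lapB]
    show "(\<integral>\<^sup>+x. (\<Prod>i\<le>n. ennreal (exp (- real (m i) * x i))) \<partial>density \<mu> e)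
      = (\<integral>\<^sup>+x. (\<Prod>i\<le>n. ennreal (exp (- real (m i) * x i))) \<partial>density (PiM {..n} B) e)" for m
      unfolding nnd\<mu> nndB ..
    show "finite_measure (density \<mu> e)" "finite_measure (density (PiM {..n} B) e)"
      using nnd\<mu>[of "\<lambda>_. 0"] nndB[of "\<lambda>_. 0"] by (auto intro!: finite_measureI)
    have "(\<integral>\<^sup>+x. indicator {..<0} (x i) \<partial>\<mu>) = 0" if i: "i \<le> n" for i
    proof -
      have [measurable]: "(\<lambda>x. x i) \<in> measurable ?P borel"
        by (rule measurable_component_singleton) (use i in simp)
      have "(\<integral>\<^sup>+x. indicator {..<0} (x i) \<partial>\<mu>)
        = (\<integral>\<^sup>+\<omega>. \<integral>\<^sup>+k. w \<omega> k * indicator {..<0} (V \<omega> k i) \<partial>count_space (tuples n) \<partial>M)"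
        by (rule nn) measurable
      also have "\<dots> = (\<integral>\<^sup>+\<omega>. 0 \<partial>M)"
      proof (rule nn_integral_cong_AE)
        show "AE \<omega> in M. (\<integral>\<^sup>+k. w \<omega> k * indicator {..<0} (V \<omega> k i) \<partial>count_space (tuples n)) = 0"
          using AE_pure_jump_path
        proof eventually_elim
          case (elim \<omega>)
          then obtain \<tau> where "pure_jump_path (\<lambda>t. \<xi> t \<omega>) (A \<omega>) \<tau> (S \<omega>)" by blast
          then interpret pure_jump_path "\<lambda>t. \<xi> t \<omega>" "A \<omega>" \<tau> "S \<omega>" .
          have "w \<omega> k * indicator {..<0} (V \<omega> k i) = 0" for k
          proof (cases "inj_on k {..<n}")
            case True
            have "(\<Sum>i<n. A \<omega> (k i)) = (\<Sum>l\<in>k ` {..<n}. A \<omega> l)" using True by (simp add: sum.reindex)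
            also have "\<dots> \<le> (\<Sum>l. A \<omega> l)"
              using sums a_pos by (intro sum_le_suminf) (auto simp: sums_iff less_imp_le)
            finally have "(\<Sum>i<n. A \<omega> (k i)) \<le> S \<omega>" using sums by (simp add: sums_iff)
            then have "0 \<le> V \<omega> k i" using i a_pos[of "k i"] by (auto simp: V_def)
            then show ?thesis by simp
          qed (simp add: w_def)
          then have "(\<integral>\<^sup>+k. w \<omega> k * indicator {..<0} (V \<omega> k i) \<partial>count_space (tuples n)) = (\<integral>\<^sup>+k. 0 \<partial>count_space (tuples n))"
            by (intro nn_integral_cong)
          then show ?case by simp
        qed
      qed
      finally show ?thesis by simp
    qed
    then have "AE x in \<mu>. \<forall>i\<in>{..n}. 0 \<le> x i" by (rule neg0[OF sets_\<mu>])
    then show "AE x in density \<mu> e. \<forall>i\<in>{..n}. 0 \<le> x i"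
      by (subst AE_density[OF me(1)]) (auto elim!: eventually_mono)
    have "(\<integral>\<^sup>+x. indicator {..<0} (x i) \<partial>PiM {..n} B) = 0" if i: "i \<le> n" for i
    proof -
      have "(\<integral>\<^sup>+x. indicator {..<0} (x i) \<partial>PiM {..n} B)
        = (\<integral>\<^sup>+x. (\<Prod>l\<le>n. if l = i then indicator {..<0} (x l) else 1) \<partial>PiM {..n} B)"
        using i by (simp add: prod.delta)
      also have "\<dots> = (\<Prod>l\<le>n. \<integral>\<^sup>+y. (if l = i then indicator {..<0} y else 1) \<partial>B l)"
        by (rule P.product_nn_integral_prod[where f="\<lambda>l y. if l = i then indicator {..<0} y else 1"]) (auto simp: B_def)
      also have "\<dots> = 0"
      proof (rule prod_zero)
        have "(\<integral>\<^sup>+y. indicator {..<0::real} y \<partial>B i) = 0"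
        proof -
          have "AE y in sblevy. \<not> y < 0" by (auto simp: AE_density sblevy_density_def)
          moreover have "AE y in levy_law. \<not> y < 0" using levy_law_pos by (rule eventually_mono) simp
          ultimately have "AE y in B i. \<not> y < 0" unfolding B_def by (cases "i < n") simp_all
          moreover have "sets (B i) = sets borel" by (simp add: B_def)
          ultimately show ?thesis
            by (subst nn_integral_0_iff_AE) (auto simp: indicator_def cong: measurable_cong_sets)
        qed
        then show "\<exists>l\<in>{..n}. (\<integral>\<^sup>+y. (if l = i then indicator {..<0} y else 1) \<partial>B l) = 0"
          by (intro bexI[of _ i]) (use i in simp_all)
      qed simp
      finally show ?thesis .
    qed
    then have "AE x in PiM {..n} B. \<forall>i\<in>{..n}. 0 \<le> x i" by (rule neg0[OF sets_B])
    then show "AE x in density (PiM {..n} B) e. \<forall>i\<in>{..n}. 0 \<le> x i"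
      by (subst AE_density[OF me(2)]) (auto elim!: eventually_mono)
  qed simp
  then have "(\<integral>\<^sup>+x. e' x * F x \<partial>density \<mu> e) = (\<integral>\<^sup>+x. e' x * F x \<partial>density (PiM {..n} B) e)" by simp
  moreover have "(\<integral>\<^sup>+x. e' x * F x \<partial>density \<kappa> e) = (\<integral>\<^sup>+x. F x \<partial>\<kappa>)" if "sets \<kappa> = sets ?P" for \<kappa>
  proof -
    have "e \<in> borel_measurable \<kappa>" unfolding measurable_cong_sets[OF that refl] by (rule e)
    moreover have "(\<lambda>x. e' x * F x) \<in> borel_measurable \<kappa>"
      unfolding measurable_cong_sets[OF that refl] using F by measurable
    ultimately show ?thesis by (simp add: nn_integral_density mult.assoc[symmetric] ee')
  qed
  ultimately have "(\<integral>\<^sup>+x. F x \<partial>\<mu>) = (\<integral>\<^sup>+x. F x \<partial>PiM {..n} B)" using sets_\<mu> sets_B by simp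
  then show ?thesis unfolding nn[OF F]
    by (simp add: w_def V_def if_distrib[of "\<lambda>z. z * _"] if_distrib[of "\<lambda>z. _ * z"] cong: if_cong)
qed

text \<open>The form of \<open>mecke_PiM\<close> for functions in which the mass left over is separated from the picked jumps.\<close>

lemma mecke:
  fixes F :: "(nat \<Rightarrow> real) \<Rightarrow> real \<Rightarrow> ennreal"
  assumes F[measurable]: "(\<lambda>(x, y). F x y) \<in> borel_measurable (PiM {..<n} (\<lambda>_. borel) \<Otimes>\<^sub>M borel)"
  shows "(\<integral>\<^sup>+\<omega>. (\<integral>\<^sup>+k. (\<Prod>i<n. ennreal (A \<omega> (k i))) * (if inj_on k {..<n} then
          F (\<lambda>i\<in>{..<n}. A \<omega> (k i)) (S \<omega> - (\<Sum>i<n. A \<omega> (k i))) else 0) \<partial>count_space (tuples n)) \<partial>M)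
     = (\<integral>\<^sup>+x. \<integral>\<^sup>+y. F x y \<partial>levy_law \<partial>PiM {..<n} (\<lambda>_. sblevy))"
proof -
  interpret levy: prob_space levy_law by (rule prob_space_levy_law)
  define B where "B i = (if i < n then sblevy else levy_law)" for i
  interpret P: product_sigma_finite B
    using sigma_finite_sblevy levy.sigma_finite_measure_axioms by (auto simp: product_sigma_finite_def B_def)
  define F' where "F' z = F (restrict z {..<n}) (z n)" for z
  have F'[measurable]: "F' \<in> borel_measurable (PiM {..n} (\<lambda>_. borel))"
  proof -
    have [measurable]: "(\<lambda>z. restrict z {..<n}) \<in> measurable (PiM {..n} (\<lambda>_. borel)) (PiM {..<n} (\<lambda>_. borel :: real measure))"
      by (rule measurable_restrict_subset) auto
    have "(\<lambda>z. (\<lambda>(x, y). F x y) (restrict z {..<n}, z n)) \<in> borel_measurable (PiM {..n} (\<lambda>_. borel))"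
      by measurable
    then show ?thesis by (simp add: F'_def[abs_def])
  qed
  have "sets (PiM {..n} B) = sets (PiM {..n} (\<lambda>_. borel))" by (intro sets_PiM_cong) (auto simp: B_def)
  then have F'B: "F' \<in> borel_measurable (PiM {..n} B)" using F' by (simp cong: measurable_cong_sets)
  have ins: "{..n} = insert n {..<n}" by auto
  have r: "F (\<lambda>i\<in>{..<n}. A \<omega> (k i)) (S \<omega> - (\<Sum>i<n. A \<omega> (k i)))
     = F' (\<lambda>i\<in>{..n}. if i < n then A \<omega> (k i) else S \<omega> - (\<Sum>i<n. A \<omega> (k i)))" for \<omega> k
    by (auto simp: F'_def intro!: arg_cong2[of _ _ _ _ F])
  have "(\<integral>\<^sup>+x. F' x \<partial>PiM {..n} B) = (\<integral>\<^sup>+x. \<integral>\<^sup>+y. F' (x(n := y)) \<partial>B n \<partial>PiM {..<n} B)"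
    unfolding ins by (rule P.product_nn_integral_insert)
      (use F'B in \<open>auto simp: ins[symmetric]\<close>)
  also have "PiM {..<n} B = PiM {..<n} (\<lambda>_. sblevy)" by (rule PiM_cong) (auto simp: B_def)
  also have "(\<integral>\<^sup>+x. \<integral>\<^sup>+y. F' (x(n := y)) \<partial>B n \<partial>PiM {..<n} (\<lambda>_. sblevy)) = (\<integral>\<^sup>+x. \<integral>\<^sup>+y. F x y \<partial>levy_law \<partial>PiM {..<n} (\<lambda>_. sblevy))"
  proof (rule nn_integral_cong)
    fix x assume "x \<in> space (PiM {..<n} (\<lambda>_. sblevy))"
    then have "restrict (x(n := y)) {..<n} = x" for y by (auto simp: space_PiM PiE_def extensional_def restrict_def fun_eq_iff)
    then show "(\<integral>\<^sup>+y. F' (x(n := y)) \<partial>B n) = (\<integral>\<^sup>+y. F x y \<partial>levy_law)" by (simp add: F'_def B_def)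
  qed
  finally show ?thesis unfolding r mecke_PiM[OF F'] B_def .
qed

end

section \<open>A single size-biased pick\<close>

definition chisq_density :: "real \<Rightarrow> real" where
  "chisq_density v = (if 0 < v then v powr (- 1 / 2) * exp (- v / 2) / sqrt (2 * pi) else 0)"

lemma chisq_density_measurable[measurable]: "chisq_density \<in> borel_measurable borel"
  unfolding chisq_density_def[abs_def] by measurable

lemma chisq_density_nonneg[simp]: "0 \<le> chisq_density t"
  by (simp add: chisq_density_def)

lemma nn_integral_levy_law:
  assumes [measurable]: "F \<in> borel_measurable borel"
  shows "(\<integral>\<^sup>+t. F t \<partial>levy_law) = (\<integral>\<^sup>+v. ennreal (chisq_density v) * F (1 / (2 * v)) \<partial>lborel)"
proof -
  have "(\<integral>\<^sup>+t. F t \<partial>levy_law) = (\<integral>\<^sup>+t. (ennreal (levy_density t) * F t) * indicator {0<..} t \<partial>lborel)"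
    by (subst nn_integral_density) (auto intro!: nn_integral_cong simp: indicator_def levy_density_nonpos)
  also have "\<dots> = (\<integral>\<^sup>+v. ennreal (levy_density (1 / (2 * v))) * F (1 / (2 * v)) * ennreal (1 / (2 * v\<^sup>2)) * indicator {0<..} v \<partial>lborel)"
    by (rule nn_integral_Ioi_inverse) simp
  also have "\<dots> = (\<integral>\<^sup>+v. ennreal (chisq_density v) * F (1 / (2 * v)) \<partial>lborel)"
  proof (rule nn_integral_cong)
    fix v :: real
    show "ennreal (levy_density (1 / (2 * v))) * F (1 / (2 * v)) * ennreal (1 / (2 * v\<^sup>2)) * indicator {0<..} v
       = ennreal (chisq_density v) * F (1 / (2 * v))"
    proof (cases "0 < v")
      case True
      have "ennreal (levy_density (1 / (2 * v))) * F (1 / (2 * v)) * ennreal (1 / (2 * v\<^sup>2))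
        = ennreal (levy_density (1 / (2 * v)) * (1 / (2 * v\<^sup>2))) * F (1 / (2 * v))"
        by (subst ennreal_mult) (auto simp: mult_ac)
      then show ?thesis using True unfolding levy_density_inverse[OF True] by (simp add: chisq_density_def)
    qed (simp add: chisq_density_def)
  qed
  finally show ?thesis .
qed

text \<open>Positive and negative normal values contribute equally, which gives the factor \<open>2\<close> in the Jacobian \<open>2 x\<close> of squaring.\<close>

lemma sq_normal_law_eq: "sq_normal_law = density lborel (\<lambda>v. ennreal (chisq_density v))"
proof (rule measure_eqI)
  show "sets sq_normal_law = sets (density lborel (\<lambda>v. ennreal (chisq_density v)))" by (simp add: sq_normal_law_def)
  fix C assume "C \<in> sets sq_normal_law"
  then have C[measurable]: "C \<in> sets borel" by (simp add: sq_normal_law_def)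
  define h where "h x = ennreal (std_normal_density x) * indicator C (x\<^sup>2)" for x :: real
  have [measurable]: "h \<in> borel_measurable borel" unfolding h_def by measurable
  have even: "h (- x) = h x" for x by (simp add: h_def std_normal_density_def)
  have "emeasure sq_normal_law C = (\<integral>\<^sup>+y. indicator C y \<partial>sq_normal_law)"
    by (simp add: sq_normal_law_def)
  also have "\<dots> = (\<integral>\<^sup>+x. h x \<partial>lborel)"
    unfolding sq_normal_law_def by (subst nn_integral_distr) (auto simp: nn_integral_density h_def[abs_def])
  also have "\<dots> = (\<integral>\<^sup>+x. h x * indicator {0<..} x + h x * indicator {..<0} x \<partial>lborel)"
    using AE_lborel_singleton[of "0::real"] by (intro nn_integral_cong_AE) (auto simp: indicator_def elim!: eventually_mono)
  also have "\<dots> = (\<integral>\<^sup>+x. h x * indicator {0<..} x \<partial>lborel) + (\<integral>\<^sup>+x. h x * indicator {..<0} x \<partial>lborel)"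
    by (rule nn_integral_add) auto
  also have "(\<integral>\<^sup>+x. h x * indicator {..<0} x \<partial>lborel) = (\<integral>\<^sup>+x. h x * indicator {0<..} x \<partial>lborel)"
    by (subst nn_integral_real_affine[where c="- 1" and t=0])
       (auto intro!: nn_integral_cong simp: indicator_def even)
  also have "(\<integral>\<^sup>+x. h x * indicator {0<..} x \<partial>lborel) + (\<integral>\<^sup>+x. h x * indicator {0<..} x \<partial>lborel)
     = (\<integral>\<^sup>+x. 2 * (h x * indicator {0<..} x) \<partial>lborel)"
    by (subst nn_integral_cmult) (auto simp: mult_2)
  also have "\<dots> = (\<integral>\<^sup>+x. (ennreal (chisq_density (x\<^sup>2)) * indicator C (x\<^sup>2)) * ennreal (2 * x) * indicator {0<..} x \<partial>lborel)"
  proof (rule nn_integral_cong)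
    fix x :: real
    have "ennreal (chisq_density (x\<^sup>2)) * ennreal (2 * x) = 2 * ennreal (std_normal_density x)" if x: "0 < x"
    proof -
      have "x\<^sup>2 powr (- 1 / 2) = 1 / x" using x by (simp add: powr_minus powr_half_sqrt field_simps)
      then have "chisq_density (x\<^sup>2) * (2 * x) = 2 * std_normal_density x"
        using x by (simp add: chisq_density_def std_normal_density_def)
      then show ?thesis using x by (simp add: ennreal_mult[symmetric] ennreal_mult'[symmetric] flip: ennreal_numeral)
    qed
    then show "2 * (h x * indicator {0<..} x) = (ennreal (chisq_density (x\<^sup>2)) * indicator C (x\<^sup>2)) * ennreal (2 * x) * indicator {0<..} x"
      by (auto simp: h_def indicator_def)
  qed
  also have "\<dots> = (\<integral>\<^sup>+y. (ennreal (chisq_density y) * indicator C y) * indicator {0<..} y \<partial>lborel)"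
    by (rule nn_integral_Ioi_square[symmetric]) simp
  also have "\<dots> = emeasure (density lborel (\<lambda>v. ennreal (chisq_density v))) C"
    by (subst emeasure_density) (auto intro!: nn_integral_cong simp: chisq_density_def indicator_def)
  finally show "emeasure sq_normal_law C = emeasure (density lborel (\<lambda>v. ennreal (chisq_density v))) C" .
qed

lemma prob_space_sq_normal_law: "prob_space sq_normal_law"
  unfolding sq_normal_law_def
  by (intro prob_space.prob_space_distr prob_space_normal_density) auto

lemma sets_sq_normal_law[simp, measurable_cong]: "sets sq_normal_law = sets borel"
  by (simp add: sq_normal_law_def)

text \<open>The factor \<open>2 v\<close> is the reciprocal of the total mass \<open>1 / (2 v)\<close>, turning size-weighting into a
  probability; \<open>1 / (2 v\<^sup>2)\<close> is the Jacobian of \<open>v \<mapsto> 1 / (2 v)\<close>.\<close>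

lemma pick_density_identity:
  assumes v: "0 < v" and z: "0 < z"
  shows "chisq_density (v + z) * (sblevy_density (1 / (2 * v) - 1 / (2 * (v + z))) * (2 * v) * (1 / (2 * v\<^sup>2)))
     = chisq_density v * chisq_density z"
proof -
  define p q r where "p = sqrt v" and "q = sqrt z" and "r = sqrt (v + z)"
  have pq: "0 < p" "0 < q" "0 < r" "v = p\<^sup>2" "z = q\<^sup>2" "v + z = r\<^sup>2" using v z by (auto simp: p_def q_def r_def)
  have half: "x powr (- (1 / 2)) = 1 / sqrt x" if "0 < x" for x :: real
    using that by (simp add: powr_minus powr_half_sqrt field_simps)
  have d: "1 / (2 * v) - 1 / (2 * (v + z)) = z / (2 * v * (v + z))" using v z by (simp add: field_simps)
  have "0 < z / (2 * v * (v + z))" using v z by simp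
  then have "sblevy_density (1 / (2 * v) - 1 / (2 * (v + z))) = 1 / sqrt (z / (2 * v * (v + z))) / (2 * sqrt pi)"
    unfolding d sblevy_density_def by (simp add: half)
  also have "sqrt (z / (2 * v * (v + z))) = q / (sqrt 2 * p * r)"
    by (simp add: real_sqrt_divide real_sqrt_mult p_def q_def r_def)
  finally have s: "sblevy_density (1 / (2 * v) - 1 / (2 * (v + z))) = sqrt 2 * p * r / q / (2 * sqrt pi)" by simp
  have "exp (- v / 2) * exp (- z / 2) = exp (- (v + z) / 2)" by (simp add: exp_add[symmetric] field_simps)
  moreover have "chisq_density (v + z) = 1 / r * exp (- (v + z) / 2) / sqrt (2 * pi)"
    "chisq_density v = 1 / p * exp (- v / 2) / sqrt (2 * pi)" "chisq_density z = 1 / q * exp (- z / 2) / sqrt (2 * pi)"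
    using v z unfolding chisq_density_def by (simp_all add: half p_def q_def r_def)
  ultimately have R: "chisq_density v * chisq_density z = 1 / (p * q) * exp (- (v + z) / 2) / (2 * pi)"
    and L: "chisq_density (v + z) = 1 / r * exp (- (v + z) / 2) / (sqrt 2 * sqrt pi)"
    by (simp_all add: real_sqrt_mult field_simps)
  have "chisq_density (v + z) * (sqrt 2 * p * r / q / (2 * sqrt pi) * (2 * v) * (1 / (2 * v\<^sup>2)))
     = exp (- (v + z) / 2) / (2 * (sqrt pi * sqrt pi)) * (p / q / v)"
    unfolding L using pq(1-3) v by (simp add: field_simps power2_eq_square)
  also have "p / q / v = 1 / (p * q)" unfolding pq(4) using pq(1,2) by (simp add: field_simps power2_eq_square)
  finally show ?thesis unfolding s R by simp
qed

text \<open>Here \<open>y\<close> is the mass left over after picking \<open>x\<close>, so \<open>r = x + y\<close> is the mass before the pick.  In the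
  coordinates \<open>v = 1 / (2 r)\<close> and \<open>t = 1 / (2 y)\<close> the joint density factorises into squared normal densities
  of \<open>v\<close> and of \<open>z = t - v\<close>.\<close>

lemma pick_step:
  fixes \<Psi> :: "real \<Rightarrow> real \<Rightarrow> ennreal"
  assumes [measurable]: "(\<lambda>(r, z). \<Psi> r z) \<in> borel_measurable (borel \<Otimes>\<^sub>M borel)"
  shows "(\<integral>\<^sup>+x. \<integral>\<^sup>+y. ennreal (1 / (x + y)) * \<Psi> (x + y) (1 / (2 * y) - 1 / (2 * (x + y))) \<partial>levy_law \<partial>sblevy)
    = (\<integral>\<^sup>+r. \<integral>\<^sup>+z. \<Psi> r z \<partial>sq_normal_law \<partial>levy_law)"
proof -
  let ?w = "\<lambda>v t. ennreal (sblevy_density (1 / (2 * v) - 1 / (2 * t)) * (2 * v) * (1 / (2 * v\<^sup>2)))"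
  define G where "G r t = ennreal (1 / r) * \<Psi> r (t - 1 / (2 * r))" for r t
  have G[measurable]: "(\<lambda>(r, t). G r t) \<in> borel_measurable (borel \<Otimes>\<^sub>M borel)" unfolding G_def by measurable
  have Gp: "(\<lambda>x. G (f x) (g x)) \<in> borel_measurable N" if "f \<in> borel_measurable N" "g \<in> borel_measurable N" for f g N
    using measurable_compose[OF measurable_Pair[OF that] G] by simp
  note Gp[measurable (raw)]
  interpret levy: prob_space levy_law by (rule prob_space_levy_law)
  have "(\<integral>\<^sup>+x. \<integral>\<^sup>+y. ennreal (1 / (x + y)) * \<Psi> (x + y) (1 / (2 * y) - 1 / (2 * (x + y))) \<partial>levy_law \<partial>sblevy)
    = (\<integral>\<^sup>+x. \<integral>\<^sup>+y. G (x + y) (1 / (2 * y)) \<partial>levy_law \<partial>sblevy)"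
    by (simp add: G_def)
  also have "\<dots> = (\<integral>\<^sup>+x. \<integral>\<^sup>+t. ennreal (chisq_density t) * G (x + 1 / (2 * t)) t \<partial>lborel \<partial>sblevy)"
    by (subst nn_integral_levy_law) (auto intro!: nn_integral_cong)
  also have "\<dots> = (\<integral>\<^sup>+x. \<integral>\<^sup>+t. ennreal (sblevy_density x) * (ennreal (chisq_density t) * G (x + 1 / (2 * t)) t) \<partial>lborel \<partial>lborel)"
    by (subst nn_integral_density) (auto simp: nn_integral_cmult)
  also have "\<dots> = (\<integral>\<^sup>+t. \<integral>\<^sup>+x. ennreal (sblevy_density x) * (ennreal (chisq_density t) * G (x + 1 / (2 * t)) t) \<partial>lborel \<partial>lborel)"
    by (rule lborel_pair.Fubini') measurable
  also have "\<dots> = (\<integral>\<^sup>+t. \<integral>\<^sup>+v. ennreal (chisq_density t) * (?w v t)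
        * \<Psi> (1 / (2 * v)) (t - v) * indicator {0<..<t} v \<partial>lborel \<partial>lborel)"
  proof (rule nn_integral_cong)
    fix t :: real
    show "(\<integral>\<^sup>+x. ennreal (sblevy_density x) * (ennreal (chisq_density t) * G (x + 1 / (2 * t)) t) \<partial>lborel)
      = (\<integral>\<^sup>+v. ennreal (chisq_density t) * (?w v t)
        * \<Psi> (1 / (2 * v)) (t - v) * indicator {0<..<t} v \<partial>lborel)"
    proof (cases "0 < t")
      case False
      then show ?thesis by (simp add: chisq_density_def)
    next
      case True
      have "(\<integral>\<^sup>+x. ennreal (sblevy_density x) * (ennreal (chisq_density t) * G (x + 1 / (2 * t)) t) \<partial>lborel)
        = (\<integral>\<^sup>+r. ennreal (sblevy_density (r - 1 / (2 * t))) * (ennreal (chisq_density t) * G r t) \<partial>lborel)"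
        by (subst nn_integral_real_affine[where c=1 and t="- 1 / (2 * t)"]) (auto simp: algebra_simps)
      also have "\<dots> = (\<integral>\<^sup>+r. (ennreal (sblevy_density (r - 1 / (2 * t))) * (ennreal (chisq_density t) * G r t)) * indicator {0<..} r \<partial>lborel)"
      proof (rule nn_integral_cong)
        fix r :: real
        have "sblevy_density (r - 1 / (2 * t)) = 0" if "r \<le> 0"
        proof -
          have "r - 1 / (2 * t) \<le> 0" using that True by (simp add: order_trans[OF that])
          then show ?thesis by (simp add: sblevy_density_def)
        qed
        then show "ennreal (sblevy_density (r - 1 / (2 * t))) * (ennreal (chisq_density t) * G r t)
           = (ennreal (sblevy_density (r - 1 / (2 * t))) * (ennreal (chisq_density t) * G r t)) * indicator {0<..} r"
          by (cases "0 < r") auto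
      qed
      also have "\<dots> = (\<integral>\<^sup>+v. (ennreal (sblevy_density (1 / (2 * v) - 1 / (2 * t))) * (ennreal (chisq_density t) * G (1 / (2 * v)) t)) * ennreal (1 / (2 * v\<^sup>2)) * indicator {0<..} v \<partial>lborel)"
        by (rule nn_integral_Ioi_inverse) measurable
      also have "\<dots> = (\<integral>\<^sup>+v. ennreal (chisq_density t) * (?w v t)
        * \<Psi> (1 / (2 * v)) (t - v) * indicator {0<..<t} v \<partial>lborel)"
      proof (rule nn_integral_cong)
        fix v :: real
        show "(ennreal (sblevy_density (1 / (2 * v) - 1 / (2 * t))) * (ennreal (chisq_density t) * G (1 / (2 * v)) t)) * ennreal (1 / (2 * v\<^sup>2)) * indicator {0<..} v
          = ennreal (chisq_density t) * (?w v t)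
        * \<Psi> (1 / (2 * v)) (t - v) * indicator {0<..<t} v"
        proof (cases "0 < v")
          case v: True
          show ?thesis
          proof (cases "v < t")
            case True
            have e: "ennreal (a * b * c) = ennreal a * ennreal b * ennreal c" if "0 \<le> a" "0 \<le> b" "0 \<le> c" for a b c
              using that by (simp add: ennreal_mult)
            have "(?w v t)
              = ennreal (sblevy_density (1 / (2 * v) - 1 / (2 * t))) * ennreal (2 * v) * ennreal (1 / (2 * v\<^sup>2))"
              using v by (intro e) auto
            then show ?thesis using v True by (simp add: G_def mult_ac)
          next
            case False
            then have "1 / (2 * v) - 1 / (2 * t) \<le> 0" using v True by (simp add: field_simps)
            then have "sblevy_density (1 / (2 * v) - 1 / (2 * t)) = 0" by (simp add: sblevy_density_def)
            then show ?thesis by simp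
          qed
        qed simp
      qed
      finally show ?thesis .
    qed
  qed
  also have "\<dots> = (\<integral>\<^sup>+v. \<integral>\<^sup>+t. ennreal (chisq_density t) * (?w v t)
        * \<Psi> (1 / (2 * v)) (t - v) * indicator {0<..<t} v \<partial>lborel \<partial>lborel)"
  proof (rule lborel_pair.Fubini')
    have "(\<lambda>(y, x). ennreal (chisq_density x) * (?w y x) *
             \<Psi> (1 / (2 * y)) (x - y) * indicator {z :: real \<times> real. 0 < snd z \<and> snd z < fst z} (x, y)) \<in> borel_measurable (borel \<Otimes>\<^sub>M borel)"
      by measurable
    then show "(\<lambda>(y, x). ennreal (chisq_density x) * (?w y x) *
             \<Psi> (1 / (2 * y)) (x - y) * indicator {0<..<x} y) \<in> borel_measurable (lborel \<Otimes>\<^sub>M lborel)"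
      by (simp add: indicator_def case_prod_beta')
  qed
  also have "\<dots> = (\<integral>\<^sup>+v. \<integral>\<^sup>+z. ennreal (chisq_density v) * (ennreal (chisq_density z) * \<Psi> (1 / (2 * v)) z) \<partial>lborel \<partial>lborel)"
  proof (rule nn_integral_cong)
    fix v :: real
    have "(\<integral>\<^sup>+t. ennreal (chisq_density t) * (?w v t)
        * \<Psi> (1 / (2 * v)) (t - v) * indicator {0<..<t} v \<partial>lborel)
      = (\<integral>\<^sup>+z. ennreal (chisq_density (v + z)) * (?w v ((v + z)))
        * \<Psi> (1 / (2 * v)) z * indicator {0<..<v + z} v \<partial>lborel)"
    proof -
      have "(\<lambda>t. indicator {0<..<t} v :: ennreal) = (\<lambda>t. if 0 < v \<and> v < t then 1 else 0)" by (auto simp: indicator_def)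
      then have [measurable]: "(\<lambda>t. indicator {0<..<t} v :: ennreal) \<in> borel_measurable borel" by simp
      show ?thesis by (subst nn_integral_real_affine[where c=1 and t=v]) auto
    qed
    also have "\<dots> = (\<integral>\<^sup>+z. ennreal (chisq_density v) * (ennreal (chisq_density z) * \<Psi> (1 / (2 * v)) z) \<partial>lborel)"
    proof (rule nn_integral_cong)
      fix z :: real
      show "ennreal (chisq_density (v + z)) * (?w v ((v + z)))
        * \<Psi> (1 / (2 * v)) z * indicator {0<..<v + z} v = ennreal (chisq_density v) * (ennreal (chisq_density z) * \<Psi> (1 / (2 * v)) z)"
      proof (cases "0 < v \<and> 0 < z")
        case True
        have "ennreal (chisq_density (v + z)) * (?w v ((v + z)))
           = ennreal (chisq_density v) * ennreal (chisq_density z)"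
          using True pick_density_identity[of v z] by (simp only: ennreal_mult'[symmetric] chisq_density_nonneg)
        then show ?thesis using True by (simp add: mult.assoc)
      next
        case False
        then show ?thesis by (auto simp: chisq_density_def)
      qed
    qed
    finally show "(\<integral>\<^sup>+t. ennreal (chisq_density t) * (?w v t)
        * \<Psi> (1 / (2 * v)) (t - v) * indicator {0<..<t} v \<partial>lborel)
      = (\<integral>\<^sup>+z. ennreal (chisq_density v) * (ennreal (chisq_density z) * \<Psi> (1 / (2 * v)) z) \<partial>lborel)" .
  qed
  also have "\<dots> = (\<integral>\<^sup>+r. \<integral>\<^sup>+z. \<Psi> r z \<partial>sq_normal_law \<partial>levy_law)"
  proof -
    interpret chi: prob_space sq_normal_law by (rule prob_space_sq_normal_law)
    have [measurable]: "(\<lambda>r. \<integral>\<^sup>+z. \<Psi> r z \<partial>sq_normal_law) \<in> borel_measurable borel"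
      by measurable
    show ?thesis
      by (subst nn_integral_levy_law, measurable)
         (auto simp: sq_normal_law_eq nn_integral_density nn_integral_cmult intro!: nn_integral_cong)
  qed
  finally show ?thesis .
qed

section \<open>The random walk of reciprocal remaining masses\<close>

text \<open>The mass left before pick \<open>i\<close>, when \<open>x\<^sub>0, \<dots>, x\<^bsub>n-1\<^esub>\<close> are picked in this order and \<open>y\<close> is left at the end.\<close>

definition remaining :: "(nat \<Rightarrow> real) \<Rightarrow> real \<Rightarrow> nat \<Rightarrow> nat \<Rightarrow> real" where
  "remaining x y n i = y + (\<Sum>j\<in>{i..<n}. x j)"

text \<open>The first \<open>n\<close> steps of the walk \<open>1 / (2 r)\<close>, as a function with the finite domain \<open>{..<n}\<close>.\<close>

definition increments :: "(nat \<Rightarrow> real) \<Rightarrow> nat \<Rightarrow> nat \<Rightarrow> real" where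
  "increments r n = (\<lambda>i\<in>{..<n}. 1 / (2 * r (Suc i)) - 1 / (2 * r i))"

text \<open>Induction on the number of picks.  The last pick is integrated out first: given the earlier
  ones, the mass it leaves and its own size are as in \<open>pick_step\<close>, which replaces the pair by the mass \<open>r\<close>
  before the pick and a squared normal step, and \<open>r\<close> is the mass left over by the shorter chain.\<close>

lemma chain_integral:
  fixes F :: "real \<Rightarrow> (nat \<Rightarrow> real) \<Rightarrow> ennreal"
  assumes "(\<lambda>(s, x). F s x) \<in> borel_measurable (borel \<Otimes>\<^sub>M PiM {..<n} (\<lambda>_. borel))"
  shows "(\<integral>\<^sup>+x. \<integral>\<^sup>+y. (\<Prod>i<n. ennreal (1 / remaining x y n i)) * F (remaining x y n 0) (increments (remaining x y n) n) \<partial>levy_law \<partial>PiM {..<n} (\<lambda>_. sblevy))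
     = (\<integral>\<^sup>+s. \<integral>\<^sup>+x. F s x \<partial>PiM {..<n} (\<lambda>_. sq_normal_law) \<partial>levy_law)"
  using assms
proof (induction n arbitrary: F)
  case 0
  show ?case by (simp add: remaining_def increments_def PiM_empty nn_integral_count_space_finite)
next
  case (Suc n)
  let ?R = "(borel :: real measure)"
  interpret sb: product_sigma_finite "\<lambda>_::nat. sblevy" using sigma_finite_sblevy by (simp add: product_sigma_finite_def)
  interpret chi: prob_space sq_normal_law by (rule prob_space_sq_normal_law)
  interpret chip: product_sigma_finite "\<lambda>_::nat. sq_normal_law" using chi.sigma_finite_measure_axioms by (simp add: product_sigma_finite_def)
  interpret levy: prob_space levy_law by (rule prob_space_levy_law)
  note Suc.prems[measurable]
  have ins: "{..<Suc n} = insert n {..<n}" by auto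
  have upd[measurable]: "(\<lambda>(w, z). w(n := z)) \<in> measurable (PiM {..<n} (\<lambda>_. borel) \<Otimes>\<^sub>M borel) (PiM {..<Suc n} (\<lambda>_. borel :: real measure))"
    unfolding ins by (rule measurable_add_dim)
  define F' where "F' s w = (\<integral>\<^sup>+z. F s (w(n := z)) \<partial>sq_normal_law)" for s w
  have Fz[measurable]: "(\<lambda>((s, w), z). F s (w(n := z))) \<in> borel_measurable ((borel \<Otimes>\<^sub>M PiM {..<n} (\<lambda>_. borel)) \<Otimes>\<^sub>M borel)"
  proof -
    have "(\<lambda>p. (snd (fst p), snd p)) \<in> measurable ((?R \<Otimes>\<^sub>M PiM {..<n} (\<lambda>_. borel :: real measure)) \<Otimes>\<^sub>M ?R) (PiM {..<n} (\<lambda>_. borel :: real measure) \<Otimes>\<^sub>M ?R)"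
      by measurable
    from measurable_compose[OF this upd]
    have "(\<lambda>p. (snd (fst p))(n := snd p)) \<in> measurable ((?R \<Otimes>\<^sub>M PiM {..<n} (\<lambda>_. borel :: real measure)) \<Otimes>\<^sub>M ?R) (PiM {..<Suc n} (\<lambda>_. borel :: real measure))"
      by simp
    then have "(\<lambda>p. (fst (fst p), (snd (fst p))(n := snd p))) \<in> measurable ((?R \<Otimes>\<^sub>M PiM {..<n} (\<lambda>_. borel :: real measure)) \<Otimes>\<^sub>M ?R) (?R \<Otimes>\<^sub>M PiM {..<Suc n} (\<lambda>_. borel :: real measure))"
      by (intro measurable_Pair) measurable
    from measurable_compose[OF this Suc.prems] show ?thesis by (simp add: case_prod_beta')
  qed
  have F'[measurable]: "(\<lambda>(s, w). F' s w) \<in> borel_measurable (borel \<Otimes>\<^sub>M PiM {..<n} (\<lambda>_. borel))"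
  proof -
    have "(\<lambda>p. \<integral>\<^sup>+z. F (fst p) ((snd p)(n := z)) \<partial>sq_normal_law) \<in> borel_measurable (borel \<Otimes>\<^sub>M PiM {..<n} (\<lambda>_. borel))"
      using Fz by (intro chi.borel_measurable_nn_integral) (simp add: case_prod_beta' cong: measurable_cong_sets)
    then show ?thesis by (simp add: F'_def case_prod_beta')
  qed
  have rem: "remaining (x(n := a)) y (Suc n) i = remaining x (a + y) n i" if "i \<le> n" for x a y i
    using that by (simp add: remaining_def)
  have rem': "remaining (x(n := a)) y (Suc n) (Suc n) = y" for x a y by (simp add: remaining_def)
  have rn: "remaining x y n n = y" for x y by (simp add: remaining_def)
  have inc: "increments (remaining (x(n := a)) y (Suc n)) (Suc n)
     = (increments (remaining x (a + y) n) n)(n := 1 / (2 * y) - 1 / (2 * (a + y)))" for x a y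
    by (auto simp: increments_def fun_eq_iff rem rem' rn less_Suc_eq restrict_def)
  define \<Psi> where "\<Psi> x r z = (\<Prod>i<n. ennreal (1 / remaining x r n i)) * F (remaining x r n 0) ((increments (remaining x r n) n)(n := z))" for x r z
  have incm[measurable]: "(\<lambda>r. increments (remaining x r n) n) \<in> measurable borel (PiM {..<n} (\<lambda>_. borel))" for x
    unfolding increments_def remaining_def by measurable
  have \<Psi>[measurable]: "(\<lambda>(r, z). \<Psi> x r z) \<in> borel_measurable (borel \<Otimes>\<^sub>M borel)" for x
  proof -
    have "(\<lambda>p. ((remaining x (fst p) n 0, increments (remaining x (fst p) n) n), snd p))
        \<in> measurable (borel \<Otimes>\<^sub>M borel) ((borel \<Otimes>\<^sub>M PiM {..<n} (\<lambda>_. borel)) \<Otimes>\<^sub>M borel)"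
      unfolding remaining_def by (intro measurable_Pair) (auto intro: measurable_compose[OF _ incm[unfolded remaining_def]])
    from measurable_compose[OF this Fz] have [measurable]: "(\<lambda>p. F (remaining x (fst p) n 0) ((increments (remaining x (fst p) n) n)(n := snd p))) \<in> borel_measurable (borel \<Otimes>\<^sub>M borel)"
      by simp
    have [measurable]: "(\<lambda>r. remaining x r n i) \<in> borel_measurable borel" for i unfolding remaining_def by measurable
    show ?thesis unfolding \<Psi>_def case_prod_beta' by measurable
  qed
  define Q where "Q x = (\<integral>\<^sup>+y. (\<Prod>i<Suc n. ennreal (1 / remaining x y (Suc n) i)) * F (remaining x y (Suc n) 0) (increments (remaining x y (Suc n)) (Suc n)) \<partial>levy_law)" for x
  have Q[measurable]: "Q \<in> borel_measurable (PiM {..<Suc n} (\<lambda>_. sblevy))"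
  proof -
    have [measurable]: "(\<lambda>p. remaining (fst p) (snd p) (Suc n) i) \<in> borel_measurable (PiM {..<Suc n} (\<lambda>_. borel) \<Otimes>\<^sub>M borel)" for i
      unfolding remaining_def by measurable
    have [measurable]: "(\<lambda>p. increments (remaining (fst p) (snd p) (Suc n)) (Suc n)) \<in> measurable (PiM {..<Suc n} (\<lambda>_. borel) \<Otimes>\<^sub>M borel) (PiM {..<Suc n} (\<lambda>_. borel))"
      unfolding increments_def by measurable
    have "(\<lambda>p. (remaining (fst p) (snd p) (Suc n) 0, increments (remaining (fst p) (snd p) (Suc n)) (Suc n))) \<in> measurable (PiM {..<Suc n} (\<lambda>_. borel) \<Otimes>\<^sub>M borel) (borel \<Otimes>\<^sub>M PiM {..<Suc n} (\<lambda>_. borel))"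
      by measurable
    from measurable_compose[OF this Suc.prems]
    have [measurable]: "(\<lambda>p. F (remaining (fst p) (snd p) (Suc n) 0) (increments (remaining (fst p) (snd p) (Suc n)) (Suc n))) \<in> borel_measurable (PiM {..<Suc n} (\<lambda>_. borel) \<Otimes>\<^sub>M borel)"
      by simp
    have "(\<lambda>(x, y). (\<Prod>i<Suc n. ennreal (1 / remaining x y (Suc n) i)) * F (remaining x y (Suc n) 0) (increments (remaining x y (Suc n)) (Suc n))) \<in> borel_measurable (PiM {..<Suc n} (\<lambda>_. borel) \<Otimes>\<^sub>M borel)"
      unfolding case_prod_beta' by measurable
    then have "Q \<in> borel_measurable (PiM {..<Suc n} (\<lambda>_. borel))"
      unfolding Q_def by (intro levy.borel_measurable_nn_integral) (simp cong: measurable_cong_sets)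
    moreover have "sets (PiM {..<Suc n} (\<lambda>_. sblevy)) = sets (PiM {..<Suc n} (\<lambda>_. borel :: real measure))"
      by (intro sets_PiM_cong) auto
    ultimately show ?thesis by (simp cong: measurable_cong_sets)
  qed
  have "(\<integral>\<^sup>+x. Q x \<partial>PiM {..<Suc n} (\<lambda>_. sblevy)) = (\<integral>\<^sup>+x. \<integral>\<^sup>+a. Q (x(n := a)) \<partial>sblevy \<partial>PiM {..<n} (\<lambda>_. sblevy))"
    unfolding ins by (rule sb.product_nn_integral_insert) (use Q in \<open>auto simp: ins\<close>)
  also have "\<dots> = (\<integral>\<^sup>+x. \<integral>\<^sup>+a. \<integral>\<^sup>+y. ennreal (1 / (a + y)) * \<Psi> x (a + y) (1 / (2 * y) - 1 / (2 * (a + y))) \<partial>levy_law \<partial>sblevy \<partial>PiM {..<n} (\<lambda>_. sblevy))"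
    by (intro nn_integral_cong) (simp add: Q_def \<Psi>_def inc rem rn mult_ac)
  also have "\<dots> = (\<integral>\<^sup>+x. \<integral>\<^sup>+r. \<integral>\<^sup>+z. \<Psi> x r z \<partial>sq_normal_law \<partial>levy_law \<partial>PiM {..<n} (\<lambda>_. sblevy))"
    by (intro nn_integral_cong pick_step \<Psi>)
  also have "\<dots> = (\<integral>\<^sup>+x. \<integral>\<^sup>+r. (\<Prod>i<n. ennreal (1 / remaining x r n i)) * F' (remaining x r n 0) (increments (remaining x r n) n) \<partial>levy_law \<partial>PiM {..<n} (\<lambda>_. sblevy))"
  proof (intro nn_integral_cong)
    fix x :: "nat \<Rightarrow> real" and r :: real
    have "(\<lambda>z. (remaining x r n 0, (\<lambda>(w, z). w(n := z)) (increments (remaining x r n) n, z))) \<in> measurable borel (borel \<Otimes>\<^sub>M PiM {..<Suc n} (\<lambda>_. borel))"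
      using measurable_space[OF incm, of r x] by (intro measurable_Pair measurable_compose[OF _ upd]) auto
    from measurable_compose[OF this Suc.prems]
    have "(\<lambda>z. F (remaining x r n 0) ((increments (remaining x r n) n)(n := z))) \<in> borel_measurable sq_normal_law"
      by (simp cong: measurable_cong_sets)
    then show "(\<integral>\<^sup>+z. \<Psi> x r z \<partial>sq_normal_law) = (\<Prod>i<n. ennreal (1 / remaining x r n i)) * F' (remaining x r n 0) (increments (remaining x r n) n)"
      unfolding \<Psi>_def F'_def by (rule nn_integral_cmult)
  qed
  also have "\<dots> = (\<integral>\<^sup>+s. \<integral>\<^sup>+w. F' s w \<partial>PiM {..<n} (\<lambda>_. sq_normal_law) \<partial>levy_law)"
    by (rule Suc.IH[OF F'])
  also have "\<dots> = (\<integral>\<^sup>+s. \<integral>\<^sup>+x. F s x \<partial>PiM {..<Suc n} (\<lambda>_. sq_normal_law) \<partial>levy_law)"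
  proof (rule nn_integral_cong)
    fix s :: real
    have "(\<lambda>x. F s x) \<in> borel_measurable (PiM {..<Suc n} (\<lambda>_. borel))" by measurable
    moreover have "sets (PiM {..<Suc n} (\<lambda>_. sq_normal_law)) = sets (PiM {..<Suc n} (\<lambda>_. borel :: real measure))"
      by (intro sets_PiM_cong) auto
    ultimately have "(\<lambda>x. F s x) \<in> borel_measurable (PiM (insert n {..<n}) (\<lambda>_. sq_normal_law))"
      unfolding ins by (simp cong: measurable_cong_sets)
    then show "(\<integral>\<^sup>+w. F' s w \<partial>PiM {..<n} (\<lambda>_. sq_normal_law)) = (\<integral>\<^sup>+x. F s x \<partial>PiM {..<Suc n} (\<lambda>_. sq_normal_law))"
      unfolding ins F'_def by (intro chip.product_nn_integral_insert[symmetric]) auto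
  qed
  finally show ?case unfolding Q_def .
qed

context stable_half
begin

text \<open>Dividing the product of the picked jumps by the product of the masses remaining before the picks turns the
  weights of the Mecke formula into the probabilities of successive size-biased picks.\<close>

lemma chain:
  fixes F :: "real \<Rightarrow> (nat \<Rightarrow> real) \<Rightarrow> ennreal"
  assumes F: "(\<lambda>(s, x). F s x) \<in> borel_measurable (borel \<Otimes>\<^sub>M PiM {..<n} (\<lambda>_. borel))"
  defines "r \<equiv> \<lambda>\<omega> k i. S \<omega> - (\<Sum>j<i. A \<omega> (k j))"
  shows "(\<integral>\<^sup>+\<omega>. \<integral>\<^sup>+k. (if inj_on k {..<n} then (\<Prod>i<n. ennreal (A \<omega> (k i) / r \<omega> k i)) * F (S \<omega>) (increments (r \<omega> k) n) else 0)
            \<partial>count_space (tuples n) \<partial>M)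
     = (\<integral>\<^sup>+s. \<integral>\<^sup>+x. F s x \<partial>PiM {..<n} (\<lambda>_. sq_normal_law) \<partial>levy_law)"
proof -
  define G where "G x y = (\<Prod>i<n. ennreal (1 / remaining x y n i)) * F (remaining x y n 0) (increments (remaining x y n) n)" for x y
  have Gm: "(\<lambda>(x, y). G x y) \<in> borel_measurable (PiM {..<n} (\<lambda>_. borel) \<Otimes>\<^sub>M borel)"
  proof -
    have [measurable]: "(\<lambda>p. remaining (fst p) (snd p) n i) \<in> borel_measurable (PiM {..<n} (\<lambda>_. borel) \<Otimes>\<^sub>M borel)" for i
      unfolding remaining_def by measurable
    have [measurable]: "(\<lambda>p. increments (remaining (fst p) (snd p) n) n) \<in> measurable (PiM {..<n} (\<lambda>_. borel) \<Otimes>\<^sub>M borel) (PiM {..<n} (\<lambda>_. borel))"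
      unfolding increments_def by measurable
    have "(\<lambda>p. (remaining (fst p) (snd p) n 0, increments (remaining (fst p) (snd p) n) n)) \<in> measurable (PiM {..<n} (\<lambda>_. borel) \<Otimes>\<^sub>M borel) (borel \<Otimes>\<^sub>M PiM {..<n} (\<lambda>_. borel))"
      by measurable
    from measurable_compose[OF this F]
    have [measurable]: "(\<lambda>p. F (remaining (fst p) (snd p) n 0) (increments (remaining (fst p) (snd p) n) n)) \<in> borel_measurable (PiM {..<n} (\<lambda>_. borel) \<Otimes>\<^sub>M borel)"
      by simp
    show ?thesis unfolding G_def case_prod_beta' by measurable
  qed
  have rem: "remaining (\<lambda>i\<in>{..<n}. A \<omega> (k i)) (S \<omega> - (\<Sum>i<n. A \<omega> (k i))) n i = r \<omega> k i" if "i \<le> n" for \<omega> k i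
  proof -
    have "(\<Sum>i<n. A \<omega> (k i)) = (\<Sum>j<i. A \<omega> (k j)) + (\<Sum>j\<in>{i..<n}. A \<omega> (k j))"
      using sum.atLeastLessThan_concat[of 0 i n "\<lambda>j. A \<omega> (k j)"] that by (simp add: atLeast0LessThan)
    then show ?thesis by (simp add: remaining_def r_def)
  qed
  have "AE \<omega> in M. \<forall>k. 0 \<le> A \<omega> k"
    using AE_pure_jump_path by (rule eventually_mono) (auto dest: pure_jump_path.a_pos intro: less_imp_le)
  then have "(\<integral>\<^sup>+\<omega>. \<integral>\<^sup>+k. (if inj_on k {..<n} then (\<Prod>i<n. ennreal (A \<omega> (k i) / r \<omega> k i)) * F (S \<omega>) (increments (r \<omega> k) n) else 0)
            \<partial>count_space (tuples n) \<partial>M)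
     = (\<integral>\<^sup>+\<omega>. (\<integral>\<^sup>+k. (\<Prod>i<n. ennreal (A \<omega> (k i))) * (if inj_on k {..<n} then
          G (\<lambda>i\<in>{..<n}. A \<omega> (k i)) (S \<omega> - (\<Sum>i<n. A \<omega> (k i))) else 0) \<partial>count_space (tuples n)) \<partial>M)"
  proof (intro nn_integral_cong_AE, elim eventually_mono, intro nn_integral_cong)
    fix \<omega> k assume pos: "\<forall>k. 0 \<le> A \<omega> k"
    let ?x = "\<lambda>i\<in>{..<n}. A \<omega> (k i)" and ?y = "S \<omega> - (\<Sum>i<n. A \<omega> (k i))"
    have "(\<Prod>i<n. ennreal (A \<omega> (k i) / r \<omega> k i)) = (\<Prod>i<n. ennreal (A \<omega> (k i))) * (\<Prod>i<n. ennreal (1 / remaining ?x ?y n i))"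
      unfolding prod.distrib[symmetric] using pos by (intro prod.cong refl) (simp add: rem ennreal_mult'[symmetric])
    moreover have "increments (remaining ?x ?y n) n = increments (r \<omega> k) n"
      by (auto simp: increments_def fun_eq_iff rem)
    moreover have "remaining ?x ?y n 0 = S \<omega>" by (simp add: rem) (simp add: r_def)
    ultimately show "(if inj_on k {..<n} then (\<Prod>i<n. ennreal (A \<omega> (k i) / r \<omega> k i)) * F (S \<omega>) (increments (r \<omega> k) n) else 0)
      = (\<Prod>i<n. ennreal (A \<omega> (k i))) * (if inj_on k {..<n} then G ?x ?y else 0)"
      by (simp add: G_def mult.assoc)
  qed
  also have "\<dots> = (\<integral>\<^sup>+x. \<integral>\<^sup>+y. G x y \<partial>levy_law \<partial>PiM {..<n} (\<lambda>_. sblevy))" by (rule mecke[OF Gm])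
  also have "\<dots> = (\<integral>\<^sup>+s. \<integral>\<^sup>+x. F s x \<partial>PiM {..<n} (\<lambda>_. sq_normal_law) \<partial>levy_law)"
    unfolding G_def by (rule chain_integral[OF F])
  finally show ?thesis .
qed

end

section \<open>Conditional laws and size-biased rearrangements\<close>

text \<open>A conditional law is specified through rectangles \<open>Z \<in> B\<close>, \<open>R \<in> C\<close>.  For fixed \<open>C\<close> this identifies the image
  under \<open>Z\<close> of the restriction to \<open>R \<in> C\<close>, so that the weight \<open>w (Z)\<close> can be integrated; then \<open>C\<close> varies.\<close>

lemma nn_integral_bind_conditional_law:
  assumes "conditional_law M T Z N R \<kappa>" and \<kappa>: "\<kappa> \<in> measurable T (subprob_algebra N)"
    and w[measurable]: "w \<in> borel_measurable T" and \<Phi>: "\<Phi> \<in> borel_measurable N" and "prob_space M"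
  shows "(\<integral>\<^sup>+r. \<Phi> r \<partial>(density (distr M T Z) w \<bind> \<kappa>)) = (\<integral>\<^sup>+\<omega>. w (Z \<omega>) * \<Phi> (R \<omega>) \<partial>M)"
proof -
  interpret prob_space M by fact
  have Z[measurable]: "Z \<in> measurable M T" and R[measurable]: "R \<in> measurable M N"
    and cond: "\<And>B C. B \<in> sets T \<Longrightarrow> C \<in> sets N \<Longrightarrow> emeasure M {\<omega> \<in> space M. Z \<omega> \<in> B \<and> R \<omega> \<in> C}
          = (\<integral>\<^sup>+z\<in>B. emeasure (\<kappa> z) C \<partial>(distr M T Z))"
    using assms(1) by (auto simp: conditional_law_def)
  have km[measurable]: "(\<lambda>z. emeasure (\<kappa> z) C) \<in> borel_measurable T" if "C \<in> sets N" for C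
    using measurable_emeasure_kernel[OF \<kappa> that] .
  have \<kappa>': "\<kappa> \<in> measurable (density (distr M T Z) w) (subprob_algebra N)"
    using \<kappa> by (simp cong: measurable_cong_sets)
  have intC: "(\<integral>\<^sup>+\<omega>. w (Z \<omega>) * indicator C (R \<omega>) \<partial>M) = (\<integral>\<^sup>+z. w z * emeasure (\<kappa> z) C \<partial>distr M T Z)" if C[measurable]: "C \<in> sets N" for C
  proof -
    have "distr (density M (\<lambda>\<omega>. indicator C (R \<omega>))) T Z = density (distr M T Z) (\<lambda>z. emeasure (\<kappa> z) C)"
    proof (rule measure_eqI)
      fix B assume "B \<in> sets (distr (density M (\<lambda>\<omega>. indicator C (R \<omega>))) T Z)"
      then have B[measurable]: "B \<in> sets T" by simp
      have "emeasure (distr (density M (\<lambda>\<omega>. indicator C (R \<omega>))) T Z) B = (\<integral>\<^sup>+\<omega>. indicator C (R \<omega>) * indicator (Z -` B \<inter> space M) \<omega> \<partial>M)"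
        by (subst emeasure_distr) (auto simp: emeasure_density)
      also have "\<dots> = (\<integral>\<^sup>+\<omega>. indicator {\<omega> \<in> space M. Z \<omega> \<in> B \<and> R \<omega> \<in> C} \<omega> \<partial>M)"
        by (intro nn_integral_cong) (auto simp: indicator_def)
      also have "\<dots> = emeasure M {\<omega> \<in> space M. Z \<omega> \<in> B \<and> R \<omega> \<in> C}"
        by (rule nn_integral_indicator) measurable
      also have "\<dots> = emeasure (density (distr M T Z) (\<lambda>z. emeasure (\<kappa> z) C)) B"
        unfolding cond[OF B C] by (subst emeasure_density) auto
      finally show "emeasure (distr (density M (\<lambda>\<omega>. indicator C (R \<omega>))) T Z) B = emeasure (density (distr M T Z) (\<lambda>z. emeasure (\<kappa> z) C)) B" .
    qed simp
    then have "(\<integral>\<^sup>+z. w z \<partial>distr (density M (\<lambda>\<omega>. indicator C (R \<omega>))) T Z) = (\<integral>\<^sup>+z. w z \<partial>density (distr M T Z) (\<lambda>z. emeasure (\<kappa> z) C))"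
      by simp
    then show ?thesis
      by (simp add: nn_integral_distr nn_integral_density mult.commute)
  qed
  have "density (distr M T Z) w \<bind> \<kappa> = distr (density M (\<lambda>\<omega>. w (Z \<omega>))) N R"
  proof (rule measure_eqI)
    have ne: "space (density (distr M T Z) w) \<noteq> {}" using measurable_space[OF Z] not_empty by auto
      show s: "sets (density (distr M T Z) w \<bind> \<kappa>) = sets (distr (density M (\<lambda>\<omega>. w (Z \<omega>))) N R)"
        using sets_bind[OF sets_kernel[OF \<kappa>'] ne] by simp
      fix C assume "C \<in> sets (density (distr M T Z) w \<bind> \<kappa>)"
      then have C[measurable]: "C \<in> sets N" using s by simp
      have "emeasure (density (distr M T Z) w \<bind> \<kappa>) C = (\<integral>\<^sup>+z. w z * emeasure (\<kappa> z) C \<partial>distr M T Z)"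
        using emeasure_bind[OF ne \<kappa>' C] by (simp add: nn_integral_density)
      also have "\<dots> = (\<integral>\<^sup>+\<omega>. w (Z \<omega>) * indicator (R -` C \<inter> space M) \<omega> \<partial>M)"
        unfolding intC[OF C, symmetric] by (intro nn_integral_cong) (auto simp: indicator_def)
      also have "\<dots> = emeasure (distr (density M (\<lambda>\<omega>. w (Z \<omega>))) N R) C"
        by (subst emeasure_distr) (auto simp: emeasure_density)
      finally show "emeasure (density (distr M T Z) w \<bind> \<kappa>) C = emeasure (distr (density M (\<lambda>\<omega>. w (Z \<omega>))) N R) C" .
  qed
  then show ?thesis using \<Phi> by (simp add: nn_integral_distr nn_integral_density)
qed

definition pick_prob :: "(nat \<Rightarrow> nat) \<Rightarrow> nat \<Rightarrow> (nat \<Rightarrow> real) \<Rightarrow> ennreal" where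
  "pick_prob k i p = ennreal (p (k i) / (1 - (\<Sum>j<i. p (k j))))"

lemma seq_component_measurable[measurable]: "(\<lambda>p. p k) \<in> borel_measurable seq_space"
  by (rule measurable_component_singleton) simp

lemma pick_prob_measurable[measurable]: "pick_prob k i \<in> borel_measurable seq_space"
  unfolding pick_prob_def[abs_def] by measurable

text \<open>The probability that the first \<open>n\<close> size-biased picks from the masses \<open>p\<close> lie in \<open>C 0, \<dots>, C (n - 1)\<close>.\<close>

definition sb_kernel :: "nat \<Rightarrow> (nat \<Rightarrow> real set) \<Rightarrow> (nat \<Rightarrow> real) \<Rightarrow> ennreal" where
  "sb_kernel n C p = (\<integral>\<^sup>+k. (if inj_on k {..<n} then
     (\<Prod>i<n. pick_prob k i p) * (\<Prod>i<n. indicator (C i) (p (k i))) else 0) \<partial>count_space (tuples n))"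

lemma sb_kernel_measurable:
  assumes [measurable]: "\<And>i. C i \<in> sets borel"
  shows "sb_kernel n C \<in> borel_measurable seq_space"
  unfolding sb_kernel_def[abs_def]
  by (rule borel_measurable_nn_integral_countable[OF countable_tuples]) measurable

text \<open>The joint law of masses and picks is built up one pick at a time.  The events that the first \<open>n\<close>
  picks are given by \<open>k\<close> partition the space, and there the rearranged masses are \<open>p (k 0), \<dots>, p (k (n - 1))\<close>.\<close>

lemma size_biased_cylinder:
  assumes "prob_space N" and sbr: "size_biased_rearrangement N P P'" and C[measurable]: "\<And>i. C i \<in> sets borel"
  shows "(\<integral>\<^sup>+\<omega>. (\<Prod>i<n. indicator (C i) (P' \<omega> i)) \<partial>N) = (\<integral>\<^sup>+\<omega>. sb_kernel n C (P \<omega>) \<partial>N)"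
proof -
  interpret prob_space N by fact
  obtain \<sigma> :: "nat \<Rightarrow> 'a \<Rightarrow> nat" where P[measurable]: "P \<in> measurable N seq_space"
    and \<sigma>[measurable]: "\<And>n. \<sigma> n \<in> measurable N (count_space UNIV)"
    and P': "AE \<omega> in N. \<forall>n. P' \<omega> n = P \<omega> (\<sigma> n \<omega>)"
    and pick: "\<And>C n k. C \<in> sets seq_space \<Longrightarrow> emeasure N {\<omega> \<in> space N. P \<omega> \<in> C \<and> (\<forall>i\<le>n. \<sigma> i \<omega> = k i)} =
             (if k n \<in> k ` {..<n} then 0
              else \<integral>\<^sup>+\<omega>\<in>{\<omega> \<in> space N. P \<omega> \<in> C \<and> (\<forall>i<n. \<sigma> i \<omega> = k i)}.
                     ennreal (P \<omega> (k n) / (1 - (\<Sum>i<n. P \<omega> (k i)))) \<partial>N)"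
    using sbr unfolding size_biased_rearrangement_def by blast
  define E where "E n k \<omega> = (if \<forall>i<n. \<sigma> i \<omega> = k i then 1 else 0 :: ennreal)" for n k \<omega>
  have Em[measurable]: "E n k \<in> borel_measurable N" for n k unfolding E_def[abs_def] by measurable
  have step: "(\<integral>\<^sup>+\<omega>. G (P \<omega>) * E (Suc n) k \<omega> \<partial>N) = (if k n \<in> k ` {..<n} then 0 else \<integral>\<^sup>+\<omega>. (G (P \<omega>) * pick_prob k n (P \<omega>)) * E n k \<omega> \<partial>N)"
    if G[measurable]: "G \<in> borel_measurable seq_space" for G n k
  proof -
    define c where "c = (if k n \<in> k ` {..<n} then 0 else 1 :: ennreal)"
    let ?D2 = "distr (density N (\<lambda>\<omega>. c * (pick_prob k n (P \<omega>) * E n k \<omega>))) seq_space P"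
    let ?D1 = "distr (density N (E (Suc n) k)) seq_space P"
    have "?D1 = ?D2"
    proof (rule measure_eqI)
      fix D assume "D \<in> sets (?D1)"
      then have D[measurable]: "D \<in> sets seq_space" by simp
      have "emeasure (?D1) D = (\<integral>\<^sup>+\<omega>. E (Suc n) k \<omega> * indicator (P -` D \<inter> space N) \<omega> \<partial>N)"
        by (subst emeasure_distr) (auto simp: emeasure_density)
      also have "\<dots> = (\<integral>\<^sup>+\<omega>. indicator {\<omega> \<in> space N. P \<omega> \<in> D \<and> (\<forall>i\<le>n. \<sigma> i \<omega> = k i)} \<omega> \<partial>N)"
        by (intro nn_integral_cong) (auto simp: indicator_def E_def less_Suc_eq_le)
      also have "\<dots> = emeasure N {\<omega> \<in> space N. P \<omega> \<in> D \<and> (\<forall>i\<le>n. \<sigma> i \<omega> = k i)}"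
        by (rule nn_integral_indicator) measurable
      also have "\<dots> = c * (\<integral>\<^sup>+\<omega>. pick_prob k n (P \<omega>) * indicator {\<omega> \<in> space N. P \<omega> \<in> D \<and> (\<forall>i<n. \<sigma> i \<omega> = k i)} \<omega> \<partial>N)"
        unfolding pick[OF D] by (simp add: c_def pick_prob_def)
      also have "\<dots> = c * (\<integral>\<^sup>+\<omega>. pick_prob k n (P \<omega>) * E n k \<omega> * indicator (P -` D \<inter> space N) \<omega> \<partial>N)"
      proof (rule arg_cong2[where f="(*)"], rule refl, rule nn_integral_cong)
        fix \<omega> assume "\<omega> \<in> space N"
        then show "pick_prob k n (P \<omega>) * indicator {\<omega> \<in> space N. P \<omega> \<in> D \<and> (\<forall>i<n. \<sigma> i \<omega> = k i)} \<omega>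
          = pick_prob k n (P \<omega>) * E n k \<omega> * indicator (P -` D \<inter> space N) \<omega>"
          by (cases "\<forall>i<n. \<sigma> i \<omega> = k i"; cases "P \<omega> \<in> D") (auto simp: E_def)
      qed
      also have "\<dots> = emeasure (?D2) D"
        by (subst emeasure_distr) (auto simp: emeasure_density nn_integral_cmult[symmetric] mult.assoc)
      finally show "emeasure (?D1) D = emeasure (?D2) D" .
    qed simp
    then have "(\<integral>\<^sup>+p. G p \<partial>?D1) = (\<integral>\<^sup>+p. G p \<partial>?D2)"
      by simp
    then have "(\<integral>\<^sup>+\<omega>. E (Suc n) k \<omega> * G (P \<omega>) \<partial>N) = (\<integral>\<^sup>+\<omega>. c * (pick_prob k n (P \<omega>) * E n k \<omega>) * G (P \<omega>) \<partial>N)"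
      by (simp add: nn_integral_distr nn_integral_density)
    then show ?thesis by (auto simp: c_def mult_ac)
  qed
  have iter: "(\<integral>\<^sup>+\<omega>. G (P \<omega>) * E n k \<omega> \<partial>N) = (if inj_on k {..<n} then \<integral>\<^sup>+\<omega>. (\<Prod>i<n. pick_prob k i (P \<omega>)) * G (P \<omega>) \<partial>N else 0)"
    if "G \<in> borel_measurable seq_space" for G k
    using that
  proof (induction n arbitrary: G)
    case 0
    then show ?case by (simp add: E_def)
  next
    case (Suc n)
    note Suc.prems[measurable]
    have ins: "{..<Suc n} = insert n {..<n}" by auto
    have "(\<integral>\<^sup>+\<omega>. (G (P \<omega>) * pick_prob k n (P \<omega>)) * E n k \<omega> \<partial>N) =
      (if inj_on k {..<n} then \<integral>\<^sup>+\<omega>. (\<Prod>i<n. pick_prob k i (P \<omega>)) * (G (P \<omega>) * pick_prob k n (P \<omega>)) \<partial>N else 0)"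
      by (rule Suc.IH) measurable
    then show ?case unfolding step[OF Suc.prems] ins by (auto simp: mult_ac)
  qed
  interpret C: sigma_finite_measure "count_space (tuples n)"
    by (rule sigma_finite_measure_count_space_countable[OF countable_tuples])
  interpret NC: pair_sigma_finite N "count_space (tuples n)" ..
  define I where "I k p = (\<Prod>i<n. indicator (C i) (p (k i)) :: ennreal)" for k :: "nat \<Rightarrow> nat" and p :: "nat \<Rightarrow> real"
  have I[measurable]: "I k \<in> borel_measurable seq_space" for k unfolding I_def by measurable
  have "AE \<omega> in N. (\<Prod>i<n. indicator (C i) (P' \<omega> i)) = (\<integral>\<^sup>+k. I k (P \<omega>) * E n k \<omega> \<partial>count_space (tuples n))"
    using P'
  proof eventually_elim
    case (elim \<omega>)
    define k0 where "k0 = restrict (\<lambda>i. \<sigma> i \<omega>) {..<n}"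
    have k0: "k0 \<in> tuples n" by (auto simp: k0_def)
    have "E n k \<omega> = indicator {k0} k" if "k \<in> tuples n" for k
    proof -
      have "k = k0 \<longleftrightarrow> (\<forall>i\<in>{..<n}. k i = \<sigma> i \<omega>)"
        using that unfolding k0_def by (auto simp: PiE_def intro!: extensionalityI[of _ "{..<n}"])
      then show ?thesis by (auto simp: E_def indicator_def)
    qed
    then have "(\<integral>\<^sup>+k. I k (P \<omega>) * E n k \<omega> \<partial>count_space (tuples n)) = (\<integral>\<^sup>+k. I k (P \<omega>) * indicator {k0} k \<partial>count_space (tuples n))"
      by (intro nn_integral_cong) auto
    also have "\<dots> = I k0 (P \<omega>)"
      using k0 by (subst nn_integral_indicator_singleton) auto
    also have "\<dots> = (\<Prod>i<n. indicator (C i) (P' \<omega> i))" by (simp add: I_def k0_def elim)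
    finally show ?case by simp
  qed
  then have "(\<integral>\<^sup>+\<omega>. (\<Prod>i<n. indicator (C i) (P' \<omega> i)) \<partial>N) = (\<integral>\<^sup>+\<omega>. \<integral>\<^sup>+k. I k (P \<omega>) * E n k \<omega> \<partial>count_space (tuples n) \<partial>N)"
    by (rule nn_integral_cong_AE)
  also have "\<dots> = (\<integral>\<^sup>+k. \<integral>\<^sup>+\<omega>. I k (P \<omega>) * E n k \<omega> \<partial>N \<partial>count_space (tuples n))"
    by (rule NC.Fubini'[symmetric], rule measurable_pair_countable2[OF countable_tuples]) measurable
  also have "\<dots> = (\<integral>\<^sup>+k. \<integral>\<^sup>+\<omega>. (if inj_on k {..<n} then (\<Prod>i<n. pick_prob k i (P \<omega>)) * I k (P \<omega>) else 0) \<partial>N \<partial>count_space (tuples n))"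
  proof (rule nn_integral_cong)
    fix k
    show "(\<integral>\<^sup>+\<omega>. I k (P \<omega>) * E n k \<omega> \<partial>N) = (\<integral>\<^sup>+\<omega>. (if inj_on k {..<n} then (\<Prod>i<n. pick_prob k i (P \<omega>)) * I k (P \<omega>) else 0) \<partial>N)"
      unfolding iter[OF I] by (cases "inj_on k {..<n}") simp_all
  qed
  also have "\<dots> = (\<integral>\<^sup>+\<omega>. \<integral>\<^sup>+k. (if inj_on k {..<n} then (\<Prod>i<n. pick_prob k i (P \<omega>)) * I k (P \<omega>) else 0) \<partial>count_space (tuples n) \<partial>N)"
    by (rule NC.Fubini', rule measurable_pair_countable2[OF countable_tuples]) measurable
  finally show ?thesis unfolding sb_kernel_def I_def .
qed

text \<open>Cylinders based on initial segments suffice, since any finite set of indices is contained in one and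
  the other coordinates may be left unrestricted.\<close>

lemma measure_eqI_seq_space:
  assumes sets: "sets \<mu> = sets seq_space" "sets \<nu> = sets seq_space" and "finite_measure \<mu>"
    and eq: "\<And>n C. (\<And>i. C i \<in> sets borel) \<Longrightarrow>
      (\<integral>\<^sup>+p. (\<Prod>i<n. indicator (C i) (p i)) \<partial>\<mu>) = (\<integral>\<^sup>+p. (\<Prod>i<n. indicator (C i) (p i)) \<partial>\<nu>)"
  shows "\<mu> = \<nu>"
proof (rule measure_eqI_PiM_infinite[OF sets])
  fix A :: "nat \<Rightarrow> real set" and J :: "nat set"
  assume J: "finite J" and A: "\<And>i. i \<in> J \<Longrightarrow> A i \<in> sets borel"
  obtain n where n: "J \<subseteq> {..<n}" using finite_nat_bounded[OF J] by blast
  define C where "C i = (if i \<in> J then A i else UNIV)" for i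
  have C: "C i \<in> sets borel" for i using A by (simp add: C_def)
  have s: "prod_emb UNIV (\<lambda>_. borel) J (Pi\<^sub>E J A) \<in> sets seq_space"
    using J A by (intro sets_PiM_I) auto
  have ind: "indicator (prod_emb UNIV (\<lambda>_. borel) J (Pi\<^sub>E J A)) p = (\<Prod>i<n. indicator (C i) (p i) :: ennreal)" for p :: "nat \<Rightarrow> real"
  proof (cases "\<forall>i\<in>J. p i \<in> A i")
    case True
    then have "(\<Prod>i<n. indicator (C i) (p i) :: ennreal) = 1" by (intro prod.neutral) (auto simp: C_def)
    then show ?thesis using True by (auto simp: prod_emb_def indicator_def PiE_def)
  next
    case False
    then obtain i where i: "i \<in> J" "p i \<notin> A i" by auto
    then have "(\<Prod>i<n. indicator (C i) (p i) :: ennreal) = 0"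
      using n by (intro prod_zero) (auto simp: C_def intro!: bexI[of _ i])
    moreover have "p \<notin> prod_emb UNIV (\<lambda>_. borel) J (Pi\<^sub>E J A)"
      using i by (auto simp: prod_emb_def PiE_def Pi_def)
    then have "indicator (prod_emb UNIV (\<lambda>_. borel) J (Pi\<^sub>E J A)) p = (0 :: ennreal)" by simp
    ultimately show ?thesis by (simp only:)
  qed
  show "emeasure \<mu> (prod_emb UNIV (\<lambda>_. borel) J (Pi\<^sub>E J A)) = emeasure \<nu> (prod_emb UNIV (\<lambda>_. borel) J (Pi\<^sub>E J A))"
    using eq[where n=n and C=C, OF C] s unfolding ind[symmetric] by (simp add: sets)
qed fact

lemma distr_pair_indep_rv:
  assumes "prob_space M" and ind: "indep_rv M S X T Y"
  shows "distr M (S \<Otimes>\<^sub>M T) (\<lambda>\<omega>. (X \<omega>, Y \<omega>)) = distr M S X \<Otimes>\<^sub>M distr M T Y"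
proof -
  interpret prob_space M by fact
  have X[measurable]: "X \<in> measurable M S" and Y[measurable]: "Y \<in> measurable M T"
    and ins: "indep_set {X -` A \<inter> space M |A. A \<in> sets S} {Y -` B \<inter> space M |B. B \<in> sets T}"
    using ind by (auto simp: indep_rv_def)
  interpret DX: prob_space "distr M S X" by (rule prob_space_distr) simp
  interpret DY: prob_space "distr M T Y" by (rule prob_space_distr) simp
  show ?thesis
  proof (rule pair_measure_eqI[symmetric])
    fix A B assume "A \<in> sets (distr M S X)" "B \<in> sets (distr M T Y)"
    then have AB[measurable]: "A \<in> sets S" "B \<in> sets T" by auto
    have "prob ((X -` A \<inter> space M) \<inter> (Y -` B \<inter> space M)) = prob (X -` A \<inter> space M) * prob (Y -` B \<inter> space M)"
      using AB by (intro indep_setD[OF ins]) auto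
    moreover have "(\<lambda>\<omega>. (X \<omega>, Y \<omega>)) -` (A \<times> B) \<inter> space M = (X -` A \<inter> space M) \<inter> (Y -` B \<inter> space M)" by auto
    ultimately show "emeasure (distr M S X) A * emeasure (distr M T Y) B = emeasure (distr M (S \<Otimes>\<^sub>M T) (\<lambda>\<omega>. (X \<omega>, Y \<omega>))) (A \<times> B)"
      by (simp add: emeasure_distr emeasure_eq_measure ennreal_mult)
  qed (auto intro: DX.sigma_finite_measure_axioms DY.sigma_finite_measure_axioms)
qed

lemma iid_seq_distr:
  assumes "prob_space M" and iid: "iid_seq M D X" and D: "sets D = sets borel"
  shows "X \<in> measurable M seq_space" "distr M seq_space X = PiM UNIV (\<lambda>_. D)"
proof -
  interpret prob_space M by fact
  have iv: "indep_vars (\<lambda>_. borel) (\<lambda>i \<omega>. X \<omega> i) UNIV" and d: "\<And>i. distr M borel (\<lambda>\<omega>. X \<omega> i) = D"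
    using iid by (auto simp: iid_seq_def)
  have rv: "(\<lambda>\<omega>. X \<omega> i) \<in> borel_measurable M" for i using iv by (auto simp: indep_vars_def)
  have "(\<lambda>\<omega>. \<lambda>i\<in>UNIV. X \<omega> i) \<in> measurable M seq_space" using rv by (intro measurable_restrict) auto
  then show "X \<in> measurable M seq_space" by (simp add: restrict_UNIV)
  show "distr M seq_space X = PiM UNIV (\<lambda>_. D)"
    using indep_vars_iff_distr_eq_PiM[THEN iffD1, OF _ rv iv] by (simp add: d restrict_UNIV)
qed

text \<open>Only the first \<open>n\<close> steps of the random walk matter for the first \<open>n\<close> masses.\<close>

lemma P_hat_cylinder:
  assumes N: "prob_space N" and X: "iid_seq N sq_normal_law X" and ind: "indep_rv N borel L seq_space X"
    and C[measurable]: "\<And>i. C i \<in> sets borel"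
  shows "(\<integral>\<^sup>+\<omega>. (\<Prod>i<n. indicator (C i) (P_hat (L \<omega>) (X \<omega>) i)) \<partial>N)
    = (\<integral>\<^sup>+l. \<integral>\<^sup>+x. (\<Prod>i<n. indicator (C i) (P_hat l x i)) \<partial>PiM {..<n} (\<lambda>_. sq_normal_law) \<partial>distr N borel L)"
proof -
  interpret prob_space N by fact
  interpret chi: prob_space sq_normal_law by (rule prob_space_sq_normal_law)
  interpret P: product_prob_space "\<lambda>_::nat. sq_normal_law" UNIV
    by (simp add: product_prob_space_def product_prob_space_axioms_def product_sigma_finite_def chi.prob_space_axioms chi.sigma_finite_measure_axioms)
  have L[measurable]: "L \<in> borel_measurable N" using ind by (simp add: indep_rv_def)
  note Xm[measurable] = iid_seq_distr(1)[OF N X sets_sq_normal_law]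
  note Xd = iid_seq_distr(2)[OF N X sets_sq_normal_law]
  define J where "J l x = (\<Prod>i<n. indicator (C i) (P_hat l x i) :: ennreal)" for l and x :: "nat \<Rightarrow> real"
  have Jm: "(\<lambda>(l, x). J l x) \<in> borel_measurable (borel \<Otimes>\<^sub>M seq_space)"
    unfolding J_def P_hat_def by measurable
  have Jn: "(\<lambda>x. J l x) \<in> borel_measurable (PiM {..<n} (\<lambda>_. sq_normal_law))" for l
  proof -
    have c: "(\<lambda>x. \<Sum>j<i. x j) \<in> borel_measurable (PiM {..<n} (\<lambda>_. borel :: real measure))" if "i \<le> n" for i
      using that by (intro borel_measurable_sum measurable_component_singleton) auto
    have P: "(\<lambda>x. P_hat l x i) \<in> borel_measurable (PiM {..<n} (\<lambda>_. borel))" if "i < n" for i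
      unfolding P_hat_def using c[of i] c[of "Suc i"] that
      by (intro borel_measurable_diff borel_measurable_divide borel_measurable_add borel_measurable_const) auto
    have "J l \<in> borel_measurable (PiM {..<n} (\<lambda>_. borel))" unfolding J_def
      by (intro borel_measurable_prod_ennreal) (auto intro!: measurable_compose[OF P] borel_measurable_indicator)
    moreover have "sets (PiM {..<n} (\<lambda>_. sq_normal_law)) = sets (PiM {..<n} (\<lambda>_. borel :: real measure))"
      by (intro sets_PiM_cong) auto
    ultimately show ?thesis by (simp cong: measurable_cong_sets)
  qed
  have Jr: "J l (restrict x {..<n}) = J l x" for l x
    unfolding J_def P_hat_def by (intro prod.cong refl) (simp add: sum.cong[of "{..<_}" "{..<_}" "restrict x {..<n}" x])
  have PX: "sigma_finite_measure (PiM UNIV (\<lambda>_::nat. sq_normal_law))"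
    by (intro prob_space_imp_sigma_finite prob_space_PiM prob_space_sq_normal_law)
  have setsP: "sets (PiM UNIV (\<lambda>_::nat. sq_normal_law)) = sets seq_space" by (intro sets_PiM_cong) auto
  have "(\<integral>\<^sup>+\<omega>. J (L \<omega>) (X \<omega>) \<partial>N) = (\<integral>\<^sup>+z. (case z of (l, x) \<Rightarrow> J l x) \<partial>distr N (borel \<Otimes>\<^sub>M seq_space) (\<lambda>\<omega>. (L \<omega>, X \<omega>)))"
    using Jm by (subst nn_integral_distr) auto
  also have "\<dots> = (\<integral>\<^sup>+z. (case z of (l, x) \<Rightarrow> J l x) \<partial>(distr N borel L \<Otimes>\<^sub>M PiM UNIV (\<lambda>_. sq_normal_law)))"
    unfolding distr_pair_indep_rv[OF N ind] Xd ..
  also have "\<dots> = (\<integral>\<^sup>+l. \<integral>\<^sup>+x. J l x \<partial>PiM UNIV (\<lambda>_. sq_normal_law) \<partial>distr N borel L)"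
  proof -
    have "(\<lambda>(l, x). J l x) \<in> borel_measurable (distr N borel L \<Otimes>\<^sub>M PiM UNIV (\<lambda>_. sq_normal_law))"
      using Jm by (subst measurable_cong_sets[OF sets_pair_measure_cong[OF sets_distr setsP] refl])
    from sigma_finite_measure.nn_integral_fst[OF PX this] show ?thesis by simp
  qed
  also have "\<dots> = (\<integral>\<^sup>+l. \<integral>\<^sup>+x. J l x \<partial>PiM {..<n} (\<lambda>_. sq_normal_law) \<partial>distr N borel L)"
  proof (rule nn_integral_cong)
    fix l
    have "(\<integral>\<^sup>+x. J l x \<partial>PiM {..<n} (\<lambda>_. sq_normal_law)) = (\<integral>\<^sup>+x. J l x \<partial>distr (PiM UNIV (\<lambda>_. sq_normal_law)) (PiM {..<n} (\<lambda>_. sq_normal_law)) (\<lambda>x. restrict x {..<n}))"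
      by (subst P.distr_PiM_restrict_finite) auto
    also have "\<dots> = (\<integral>\<^sup>+x. J l x \<partial>PiM UNIV (\<lambda>_. sq_normal_law))"
      by (subst nn_integral_distr) (auto intro!: Jn measurable_restrict_subset simp: Jr)
    finally show "(\<integral>\<^sup>+x. J l x \<partial>PiM UNIV (\<lambda>_. sq_normal_law)) = (\<integral>\<^sup>+x. J l x \<partial>PiM {..<n} (\<lambda>_. sq_normal_law))" by simp
  qed
  finally show ?thesis unfolding J_def .
qed

section \<open>Size-biased rearrangement under a change of the law of the total mass\<close>

lemma P_hat_random_measurable:
  assumes L[measurable]: "L \<in> borel_measurable N" and X: "X \<in> measurable N seq_space"
  shows "(\<lambda>\<omega>. P_hat (L \<omega>) (X \<omega>)) \<in> measurable N seq_space"
proof -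
  have [measurable]: "(\<lambda>\<omega>. X \<omega> i) \<in> borel_measurable N" for i
    by (rule measurable_compose[OF X]) simp
  have "(\<lambda>\<omega>. \<lambda>i\<in>UNIV. P_hat (L \<omega>) (X \<omega>) i) \<in> measurable N seq_space"
    unfolding P_hat_def by (intro measurable_restrict) measurable
  then show ?thesis by (simp add: restrict_UNIV)
qed

text \<open>The partial sums of the increments telescope, and \<open>L\<^sup>2 = 1 / (2 r\<^sub>0)\<close> is the start of the random walk.\<close>

lemma P_hat_increments:
  fixes r :: "nat \<Rightarrow> real"
  assumes r0: "0 < r 0" and i: "i < n"
  shows "P_hat (r 0 powr (- 1 / 2) / sqrt 2) (increments r n) i = (r i - r (Suc i)) / r 0"
proof -
  have s2: "(r 0 powr (- 1 / 2) / sqrt 2)\<^sup>2 = 1 / (2 * r 0)"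
    using r0 by (simp add: power_divide powr_power powr_minus field_simps)
  have sum: "(\<Sum>j<l. increments r n j) = 1 / (2 * r l) - 1 / (2 * r 0)" if "l \<le> n" for l
  proof -
    have "(\<Sum>j<l. increments r n j) = (\<Sum>j<l. 1 / (2 * r (Suc j)) - 1 / (2 * r j))"
      using that by (intro sum.cong) (auto simp: increments_def)
    then show ?thesis using sum_lessThan_telescope[of "\<lambda>j. 1 / (2 * r j)" l] by simp
  qed
  have q: "1 / (2 * r 0) / ((1 / (2 * r l) - 1 / (2 * r 0)) + 1 / (2 * r 0)) = r l / r 0" for l
    using r0 by (cases "r l = 0") (auto simp: field_simps)
  show ?thesis
    unfolding P_hat_def s2 using i by (simp only: sum less_imp_le Suc_le_eq q diff_divide_distrib)
qed

locale stable_half_PD = stable_half M S f \<xi> A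
  for M :: "'w measure" and S f \<xi> A +
  fixes PD_cond :: "real \<Rightarrow> (nat \<Rightarrow> real) measure"
  assumes PD_cond_kernel: "PD_cond \<in> measurable borel (prob_algebra seq_space)"
    and PD_cond: "conditional_law M borel S seq_space (\<lambda>\<omega> k. A \<omega> k / S \<omega>) PD_cond"
begin

text \<open>The density of \<open>S\<close> is determined by its Laplace transform up to null sets.\<close>

lemma f_eq: "AE t in lborel. f t = levy_density t"
proof -
  have "density lborel (\<lambda>t. ennreal (f t)) = distr M borel S"
    using S_density by (simp add: distributed_def cong: distr_cong)
  then have "density lborel (\<lambda>t. ennreal (f t)) = levy_law" using law_S by simp
  then have "AE t in lborel. ennreal (f t) = ennreal (levy_density t)"
    by (intro sigma_finite_measure.density_unique[OF sigma_finite_lborel]) auto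
  then show ?thesis by (rule eventually_mono) (simp add: f_nonneg)
qed

text \<open>Only the values of \<open>f\<close> almost everywhere enter, and these are given by \<open>levy_density\<close>.\<close>

lemma density_tilt:
  assumes [measurable]: "h \<in> borel_measurable borel" and h: "\<And>t. 0 < t \<Longrightarrow> 0 \<le> h t" and c: "0 \<le> c"
  shows "density lborel (\<lambda>t. ennreal (h t * f t / c)) = density levy_law (\<lambda>t. ennreal (h t / c))"
proof -
  have "density lborel (\<lambda>t. ennreal (h t * f t / c)) = density lborel (\<lambda>t. ennreal (levy_density t) * ennreal (h t / c))"
  proof (rule density_cong)
    show "AE t in lborel. ennreal (h t * f t / c) = ennreal (levy_density t) * ennreal (h t / c)"
      using f_eq
    proof eventually_elim
      case (elim t)
      show ?case
      proof (cases "0 < t")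
        case True
        then show ?thesis using h[OF True] c elim by (simp add: ennreal_mult'[symmetric] mult.commute)
      qed (simp add: elim levy_density_nonpos)
    qed
  qed auto
  then show ?thesis by (simp add: density_density_eq)
qed

lemma nn_integral_tilt_bind:
  assumes h[measurable]: "h \<in> borel_measurable borel" "\<And>t. 0 < t \<Longrightarrow> 0 \<le> h t" and c: "0 \<le> c"
    and \<Phi>: "\<Phi> \<in> borel_measurable seq_space"
  shows "(\<integral>\<^sup>+p. \<Phi> p \<partial>(density lborel (\<lambda>t. ennreal (h t * f t / c)) \<bind> PD_cond))
    = (\<integral>\<^sup>+\<omega>. ennreal (h (S \<omega>) / c) * \<Phi> (\<lambda>k. A \<omega> k / S \<omega>) \<partial>M)"
proof -
  have "density lborel (\<lambda>t. ennreal (h t * f t / c)) = density (distr M borel S) (\<lambda>t. ennreal (h t / c))"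
    using density_tilt[of h c] h c by (simp add: law_S)
  then show ?thesis
    using nn_integral_bind_conditional_law[OF PD_cond measurable_prob_algebraD[OF PD_cond_kernel] _ \<Phi> prob_space_axioms,
        of "\<lambda>t. ennreal (h t / c)"] by simp
qed

definition norm_const :: "nat \<Rightarrow> real \<Rightarrow> real" where
  "norm_const m lam = (\<integral>\<omega>. S \<omega> ^ m * exp (- lam * S \<omega>) \<partial>M)"

lemma norm_const_nonneg: "0 \<le> norm_const m lam"
  unfolding norm_const_def using S_pos by (intro integral_nonneg_AE) (auto elim!: eventually_mono)

lemma tilted_law_eq: "tilted_law M S f m lam = density levy_law (\<lambda>t. ennreal (t ^ m * exp (- lam * t) / norm_const m lam))"
  unfolding tilted_law_def tilted_density_def norm_const_def[symmetric]
  by (rule density_tilt) (auto simp: norm_const_nonneg)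

text \<open>Picking from the normalised masses \<open>A / S\<close> is picking from the jumps, so the Markov chain of remaining
  masses applies; an arbitrary weight \<open>w (S)\<close> passes through, since the steps of the walk are
  independent of \<open>S\<close>.\<close>

lemma sb_kernel_jumps:
  assumes w[measurable]: "w \<in> borel_measurable borel" and C[measurable]: "\<And>i. C i \<in> sets borel"
  shows "(\<integral>\<^sup>+\<omega>. w (S \<omega>) * sb_kernel n C (\<lambda>k. A \<omega> k / S \<omega>) \<partial>M)
    = (\<integral>\<^sup>+s. w s * (\<integral>\<^sup>+x. (\<Prod>i<n. indicator (C i) (P_hat (s powr (- 1 / 2) / sqrt 2) x i)) \<partial>PiM {..<n} (\<lambda>_. sq_normal_law)) \<partial>levy_law)"
proof -
  define F where "F s x = w s * (\<Prod>i<n. indicator (C i) (P_hat (s powr (- 1 / 2) / sqrt 2) x i))" for s x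
  let ?P = "PiM {..<n} (\<lambda>_. borel :: real measure)"
  have Pm: "(\<lambda>z. P_hat (fst z powr (- 1 / 2) / sqrt 2) (snd z) i) \<in> borel_measurable (borel \<Otimes>\<^sub>M ?P)" if "i < n" for i
  proof -
    have c: "(\<lambda>z. \<Sum>j<l. snd z j) \<in> borel_measurable (borel \<Otimes>\<^sub>M ?P)" if "l \<le> n" for l
      using that by (intro borel_measurable_sum measurable_compose[OF measurable_snd] measurable_component_singleton) auto
    show ?thesis
      unfolding P_hat_def using c[of i] c[of "Suc i"] that
      by (intro borel_measurable_diff borel_measurable_divide borel_measurable_add) measurable
  qed
  have Fm: "(\<lambda>(s, x). F s x) \<in> borel_measurable (borel \<Otimes>\<^sub>M ?P)"
    unfolding F_def case_prod_beta'
    by (intro borel_measurable_times_ennreal borel_measurable_prod_ennreal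
        measurable_compose[OF Pm borel_measurable_indicator[OF C]] measurable_compose[OF measurable_fst w]) simp
  define r where "r \<omega> k i = S \<omega> - (\<Sum>j<i. A \<omega> (k j))" for \<omega> and k :: "nat \<Rightarrow> nat" and i
  have "(\<integral>\<^sup>+\<omega>. w (S \<omega>) * sb_kernel n C (\<lambda>k. A \<omega> k / S \<omega>) \<partial>M)
    = (\<integral>\<^sup>+\<omega>. \<integral>\<^sup>+k. (if inj_on k {..<n} then (\<Prod>i<n. ennreal (A \<omega> (k i) / r \<omega> k i)) * F (S \<omega>) (increments (r \<omega> k) n) else 0)
            \<partial>count_space (tuples n) \<partial>M)"
  proof (rule nn_integral_cong_AE)
    show "AE \<omega> in M. w (S \<omega>) * sb_kernel n C (\<lambda>k. A \<omega> k / S \<omega>)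
      = (\<integral>\<^sup>+k. (if inj_on k {..<n} then (\<Prod>i<n. ennreal (A \<omega> (k i) / r \<omega> k i)) * F (S \<omega>) (increments (r \<omega> k) n) else 0)
            \<partial>count_space (tuples n))"
      using S_pos
    proof eventually_elim
      case (elim \<omega>)
      have r0: "r \<omega> k 0 = S \<omega>" for k by (simp add: r_def)
      have pp: "pick_prob k i (\<lambda>k. A \<omega> k / S \<omega>) = ennreal (A \<omega> (k i) / r \<omega> k i)" for k i
      proof -
        have "1 - (\<Sum>j<i. A \<omega> (k j) / S \<omega>) = r \<omega> k i / S \<omega>"
          using elim by (simp add: r_def sum_divide_distrib[symmetric] diff_divide_distrib)
        then show ?thesis using elim by (simp add: pick_prob_def)
      qed
      have ph: "P_hat (S \<omega> powr (- 1 / 2) / sqrt 2) (increments (r \<omega> k) n) i = A \<omega> (k i) / S \<omega>" if "i < n" for k i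
        using P_hat_increments[of "r \<omega> k" i n] that elim unfolding r0 by (simp add: r_def)
      have Fk: "F (S \<omega>) (increments (r \<omega> k) n) = w (S \<omega>) * (\<Prod>i<n. indicator (C i) (A \<omega> (k i) / S \<omega>))" for k
        unfolding F_def by (intro arg_cong2[where f="(*)"] refl prod.cong) (simp only: ph lessThan_iff)
      have "w (S \<omega>) * sb_kernel n C (\<lambda>k. A \<omega> k / S \<omega>) = (\<integral>\<^sup>+k. w (S \<omega>) * (if inj_on k {..<n} then
         (\<Prod>i<n. pick_prob k i (\<lambda>k. A \<omega> k / S \<omega>)) * (\<Prod>i<n. indicator (C i) (A \<omega> (k i) / S \<omega>)) else 0) \<partial>count_space (tuples n))"
        unfolding sb_kernel_def by (rule nn_integral_cmult[symmetric]) simp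
      also have "\<dots> = (\<integral>\<^sup>+k. (if inj_on k {..<n} then (\<Prod>i<n. ennreal (A \<omega> (k i) / r \<omega> k i)) * F (S \<omega>) (increments (r \<omega> k) n) else 0)
            \<partial>count_space (tuples n))"
        by (intro nn_integral_cong) (simp add: Fk pp mult_ac)
      finally show ?case .
    qed
  qed
  also have "\<dots> = (\<integral>\<^sup>+s. \<integral>\<^sup>+x. F s x \<partial>PiM {..<n} (\<lambda>_. sq_normal_law) \<partial>levy_law)"
    unfolding r_def by (rule chain[OF Fm])
  also have "\<dots> = (\<integral>\<^sup>+s. w s * (\<integral>\<^sup>+x. (\<Prod>i<n. indicator (C i) (P_hat (s powr (- 1 / 2) / sqrt 2) x i)) \<partial>PiM {..<n} (\<lambda>_. sq_normal_law)) \<partial>levy_law)"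
  proof (rule nn_integral_cong)
    fix s
    have P: "(\<lambda>x. P_hat (s powr (- 1 / 2) / sqrt 2) x i) \<in> borel_measurable ?P" if "i < n" for i
      using measurable_compose[OF measurable_Pair1' Pm[OF that], of s] by simp
    have "(\<lambda>x. \<Prod>i<n. indicator (C i) (P_hat (s powr (- 1 / 2) / sqrt 2) x i) :: ennreal) \<in> borel_measurable ?P"
      by (intro borel_measurable_prod_ennreal measurable_compose[OF P borel_measurable_indicator[OF C]]) simp
    moreover have "sets (PiM {..<n} (\<lambda>_. sq_normal_law)) = sets ?P" by (intro sets_PiM_cong) auto
    ultimately show "(\<integral>\<^sup>+x. F s x \<partial>PiM {..<n} (\<lambda>_. sq_normal_law)) = w s * (\<integral>\<^sup>+x. (\<Prod>i<n. indicator (C i) (P_hat (s powr (- 1 / 2) / sqrt 2) x i)) \<partial>PiM {..<n} (\<lambda>_. sq_normal_law))"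
      unfolding F_def by (intro nn_integral_cmult) (simp cong: measurable_cong_sets)
  qed
  finally show ?thesis .
qed

lemma P_hat_cylinder_measurable:
  assumes C[measurable]: "\<And>i. C i \<in> sets borel"
  shows "(\<lambda>l. \<integral>\<^sup>+x. (\<Prod>i<n. indicator (C i) (P_hat l x i)) \<partial>PiM {..<n} (\<lambda>_. sq_normal_law)) \<in> borel_measurable borel"
proof -
  let ?P = "PiM {..<n} (\<lambda>_. borel :: real measure)"
  have sP: "sets (PiM {..<n} (\<lambda>_. sq_normal_law)) = sets ?P" by (intro sets_PiM_cong) auto
  have Pm: "(\<lambda>z. P_hat (fst z) (snd z) i) \<in> borel_measurable (borel \<Otimes>\<^sub>M ?P)" if "i < n" for i
  proof -
    have c: "(\<lambda>z. \<Sum>j<l. snd z j) \<in> borel_measurable (borel \<Otimes>\<^sub>M ?P)" if "l \<le> n" for l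
      using that by (intro borel_measurable_sum measurable_compose[OF measurable_snd] measurable_component_singleton) auto
    show ?thesis
      unfolding P_hat_def using c[of i] c[of "Suc i"] that
      by (intro borel_measurable_diff borel_measurable_divide borel_measurable_add) measurable
  qed
  have "(\<lambda>z. \<Prod>i<n. indicator (C i) (P_hat (fst z) (snd z) i) :: ennreal) \<in> borel_measurable (borel \<Otimes>\<^sub>M ?P)"
    by (intro borel_measurable_prod_ennreal measurable_compose[OF Pm borel_measurable_indicator[OF C]]) simp
  then have "(\<lambda>(l, x). \<Prod>i<n. indicator (C i) (P_hat l x i) :: ennreal) \<in> borel_measurable (borel \<Otimes>\<^sub>M PiM {..<n} (\<lambda>_. sq_normal_law))"
    by (simp add: case_prod_beta' measurable_cong_sets[OF sets_pair_measure_cong[OF refl sP] refl])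
  then show ?thesis
    by (intro sigma_finite_measure.borel_measurable_nn_integral prob_space_imp_sigma_finite prob_space_PiM prob_space_sq_normal_law)
qed

text \<open>Both laws are compared on cylinder sets, where each is the integral of the same function of \<open>L\<close>.\<close>

lemma size_biased_tilted_PD:
  assumes N: "prob_space N" and P: "P \<in> measurable N seq_space"
    and lawP: "distr N seq_space P = tilted_PD M S f PD_cond m lam"
    and sbr: "size_biased_rearrangement N P P'"
    and N': "prob_space N'"
    and lawL: "distr N' borel L = L_law M S f m lam"
    and X: "iid_seq N' sq_normal_law X" and ind: "indep_rv N' borel L seq_space X"
  shows "distr N seq_space P' = distr N' seq_space (\<lambda>\<omega>. P_hat (L \<omega>) (X \<omega>))"
proof (rule measure_eqI_seq_space)
  interpret N: prob_space N by fact
  have P'[measurable]: "P' \<in> measurable N seq_space" using sbr by (simp add: size_biased_rearrangement_def)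
  have L[measurable]: "L \<in> borel_measurable N'" using ind by (simp add: indep_rv_def)
  note Xm[measurable] = iid_seq_distr(1)[OF N' X sets_sq_normal_law]
  note PX[measurable] = P_hat_random_measurable[OF L Xm]
  show "finite_measure (distr N seq_space P')" by (intro prob_space.finite_measure N.prob_space_distr) simp
  fix n and C :: "nat \<Rightarrow> real set" assume C: "\<And>i. C i \<in> sets borel"
  note C[measurable]
  define c where "c = norm_const m lam"
  define J where "J l = (\<integral>\<^sup>+x. (\<Prod>i<n. indicator (C i) (P_hat l x i)) \<partial>PiM {..<n} (\<lambda>_. sq_normal_law) :: ennreal)" for l
  have J[measurable]: "J \<in> borel_measurable borel" unfolding J_def by (rule P_hat_cylinder_measurable[OF C])
  have "(\<integral>\<^sup>+p. (\<Prod>i<n. indicator (C i) (p i)) \<partial>distr N seq_space P') = (\<integral>\<^sup>+\<omega>. (\<Prod>i<n. indicator (C i) (P' \<omega> i)) \<partial>N)"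
    by (rule nn_integral_distr) measurable
  also have "\<dots> = (\<integral>\<^sup>+\<omega>. sb_kernel n C (P \<omega>) \<partial>N)"
    by (rule size_biased_cylinder[OF N sbr C])
  also have "\<dots> = (\<integral>\<^sup>+p. sb_kernel n C p \<partial>distr N seq_space P)"
    by (rule nn_integral_distr[symmetric]) (use P sb_kernel_measurable[OF C] in auto)
  also have "\<dots> = (\<integral>\<^sup>+\<omega>. ennreal (S \<omega> ^ m * exp (- lam * S \<omega>) / c) * sb_kernel n C (\<lambda>k. A \<omega> k / S \<omega>) \<partial>M)"
    unfolding lawP tilted_PD_def tilted_law_def tilted_density_def norm_const_def[symmetric] c_def
    by (rule nn_integral_tilt_bind) (auto simp: norm_const_nonneg sb_kernel_measurable[OF C])
  also have "\<dots> = (\<integral>\<^sup>+s. ennreal (s ^ m * exp (- lam * s) / c) * J (s powr (- 1 / 2) / sqrt 2) \<partial>levy_law)"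
    unfolding J_def by (rule sb_kernel_jumps) (auto simp: C)
  also have "\<dots> = (\<integral>\<^sup>+l. J l \<partial>L_law M S f m lam)"
    unfolding L_law_def tilted_law_eq c_def[symmetric]
    by (subst nn_integral_distr) (auto simp: nn_integral_density)
  also have "\<dots> = (\<integral>\<^sup>+\<omega>. (\<Prod>i<n. indicator (C i) (P_hat (L \<omega>) (X \<omega>) i)) \<partial>N')"
    unfolding P_hat_cylinder[OF N' X ind C] lawL J_def ..
  also have "\<dots> = (\<integral>\<^sup>+p. (\<Prod>i<n. indicator (C i) (p i)) \<partial>distr N' seq_space (\<lambda>\<omega>. P_hat (L \<omega>) (X \<omega>)))"
    by (rule nn_integral_distr[symmetric]) measurable
  finally show "(\<integral>\<^sup>+p. (\<Prod>i<n. indicator (C i) (p i)) \<partial>distr N seq_space P')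
     = (\<integral>\<^sup>+p. (\<Prod>i<n. indicator (C i) (p i)) \<partial>distr N' seq_space (\<lambda>\<omega>. P_hat (L \<omega>) (X \<omega>)))" .
qed auto

end

section \<open>The number of blocks given the masses\<close>

lemma quotient_eq_image: "A // r = (\<lambda>x. r `` {x}) ` A"
  unfolding quotient_def by (rule UNION_singleton_eq_range)

lemma card_partition_blocks: "card (partition_blocks m y) = card (y ` {1..m})"
proof -
  let ?r = "{(i, j). i \<in> {1..m} \<and> j \<in> {1..m} \<and> y i = y j}"
  define block where "block v = {j. j \<in> {1..m} \<and> y j = v}" for v
  have block_iff: "j \<in> block v \<longleftrightarrow> j \<in> {1..m} \<and> y j = v" for j v
    unfolding block_def mem_Collect_eq by (rule refl)
  have "?r `` {x} = block (y x)" if "x \<in> {1..m}" for x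
    apply (rule set_eqI)
    apply (unfold Image_singleton_iff mem_Collect_eq case_prod_conv block_iff)
    using that by metis
  then have "partition_blocks m y = (\<lambda>x. block (y x)) ` {1..m}"
    unfolding partition_blocks_def quotient_eq_image by (rule image_cong[OF refl])
  then have "partition_blocks m y = block ` (y ` {1..m})" by (simp only: image_image)
  moreover have "inj_on block (y ` {1..m})"
  proof (rule inj_onI)
    fix v w assume "v \<in> y ` {1..m}" and vw: "block v = block w"
    from \<open>v \<in> y ` {1..m}\<close> obtain x where "v = y x" "x \<in> {1..m}" by (rule imageE)
    then have "x \<in> block v" by (simp only: block_iff)
    then have "x \<in> block w" by (simp only: vw)
    then show "v = w" using \<open>v = y x\<close> by (simp only: block_iff)
  qed
  ultimately show ?thesis by (simp only: card_image)
qed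

text \<open>By induction on \<open>m\<close>: the next observation opens a new block unless it equals an earlier one.\<close>

lemma measurable_card_partition_blocks[measurable]:
  "(\<lambda>y. card (partition_blocks m y)) \<in> measurable seq_space (count_space UNIV)"
  unfolding card_partition_blocks
proof (induction m)
  case (Suc m)
  have e: "card (y ` {1..Suc m}) = (if \<exists>i\<in>{1..m}. y i = y (Suc m) then card (y ` {1..m}) else Suc (card (y ` {1..m})))"
    for y :: "nat \<Rightarrow> real"
  proof -
    have "y ` {1..Suc m} = insert (y (Suc m)) (y ` {1..m})" by (simp add: atLeastAtMostSuc_conv)
    moreover have "y (Suc m) \<in> y ` {1..m} \<longleftrightarrow> (\<exists>i\<in>{1..m}. y i = y (Suc m))"
      unfolding image_iff by metis
    ultimately show ?thesis by (simp only: card_insert_if finite_imageI finite_atLeastAtMost if_True)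
  qed
  have "{y \<in> space seq_space. \<exists>i\<in>{1..m}. y i = y (Suc m)} = (\<Union>i\<in>{1..m}. {y \<in> space seq_space. y i = (y (Suc m) :: real)})"
    by blast
  also have "\<dots> \<in> sets seq_space"
    by (intro sets.finite_UN finite_atLeastAtMost borel_measurable_eq seq_component_measurable)
  finally have "{y \<in> space seq_space. \<exists>i\<in>{1..m}. y i = (y (Suc m) :: real)} \<in> sets seq_space" .
  then show ?case
    unfolding e
  proof (rule measurable_If[rotated 2])
    show "(\<lambda>y. Suc (card (y ` {1..m}))) \<in> measurable seq_space (count_space UNIV)"
      by (rule measurable_compose[OF Suc]) simp
  qed (rule Suc)
qed simp

text \<open>The total weight of the samples of size \<open>m\<close> from the masses \<open>p\<close> that show exactly \<open>k\<close> different species; for masses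
  of total \<open>1\<close> this is the probability of \<open>k\<close> blocks.\<close>

definition block_weight :: "nat \<Rightarrow> nat \<Rightarrow> (nat \<Rightarrow> real) \<Rightarrow> ennreal" where
  "block_weight m k p = (\<integral>\<^sup>+i. (if card (i ` {1..m}) = k then \<Prod>j\<in>{1..m}. ennreal (p (i j)) else 0)
      \<partial>count_space ({1..m} \<rightarrow>\<^sub>E UNIV))"

lemma countable_samples: "countable ({1..m::nat} \<rightarrow>\<^sub>E (UNIV :: nat set))"
  by (rule countable_PiE) auto

lemma block_weight_measurable[measurable]: "block_weight m k \<in> borel_measurable seq_space"
  unfolding block_weight_def[abs_def]
proof (rule borel_measurable_nn_integral_countable[OF countable_samples])
  fix i :: "nat \<Rightarrow> nat"
  have "(\<lambda>p. \<Prod>j\<in>{1..m}. ennreal (p (i j))) \<in> borel_measurable seq_space" by measurable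
  then show "(\<lambda>p. if card (i ` {1..m}) = k then \<Prod>j\<in>{1..m}. ennreal (p (i j)) else 0) \<in> borel_measurable seq_space"
    by (cases "card (i ` {1..m}) = k") simp_all
qed

lemma emeasure_discrete_distribution:
  assumes u: "inj u"
  shows "emeasure (discrete_distribution p u) {u l} = ennreal (p l)"
    and "emeasure (discrete_distribution p u) (- range u) = 0"
proof -
  have m: "u \<in> measurable (density (count_space UNIV) (\<lambda>k. ennreal (p k))) borel" by simp
  have "u -` {u l} = {l}" using u by (auto dest: injD)
  then show "emeasure (discrete_distribution p u) {u l} = ennreal (p l)"
    unfolding discrete_distribution_def by (subst emeasure_distr[OF m]) (auto simp: emeasure_density)
  have e: "u -` (- range u) = {}" by auto
  have "countable (range u)" by simp
  then have "- range u \<in> sets borel" using sets.countable[of "range u" borel] by (auto simp: borel_comp)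
  then show "emeasure (discrete_distribution p u) (- range u) = 0"
    unfolding discrete_distribution_def by (subst emeasure_distr[OF m]) (auto simp: e)
qed

text \<open>With distinct labels \<open>u\<close> the observed values identify the sampled indices.\<close>

lemma block_count_given_masses:
  assumes u: "inj u" and p: "(\<integral>\<^sup>+k. ennreal (p k) \<partial>count_space UNIV) = 1"
  shows "emeasure (PiM UNIV (\<lambda>_. discrete_distribution p u)) {y. card (partition_blocks m y) = k} = block_weight m k p"
proof -
  define \<mu> where "\<mu> = discrete_distribution p u"
  have sets_\<mu>[simp, measurable_cong]: "sets \<mu> = sets borel" by (simp add: \<mu>_def discrete_distribution_def)
  have "prob_space \<mu>"
    unfolding \<mu>_def discrete_distribution_def
    by (intro prob_space.prob_space_distr prob_spaceI) (auto simp: emeasure_density p)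
  interpret P: product_prob_space "\<lambda>_::nat. \<mu>" UNIV
    using \<open>prob_space \<mu>\<close>
    by (simp add: product_prob_space_def product_prob_space_axioms_def product_sigma_finite_def prob_space_imp_sigma_finite)
  let ?Q = "PiM UNIV (\<lambda>_::nat. \<mu>)"
  let ?I = "{1..m} \<rightarrow>\<^sub>E (UNIV :: nat set)"
  have setsQ: "sets ?Q = sets seq_space" by (intro sets_PiM_cong) auto
  have sf: "sigma_finite_measure ?Q" by (intro prob_space_imp_sigma_finite prob_space_PiM \<open>prob_space \<mu>\<close>)
  have sfc: "sigma_finite_measure (count_space ?I)" by (rule sigma_finite_measure_count_space_countable[OF countable_samples])
  interpret QC: pair_sigma_finite ?Q "count_space ?I" using sf sfc by (simp add: pair_sigma_finite_def)
  define E where "E i = prod_emb UNIV (\<lambda>_. \<mu>) {1..m} (PiE {1..m} (\<lambda>j. {u (i j)}))" for i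
  have E_iff: "y \<in> E i \<longleftrightarrow> (\<forall>j\<in>{1..m}. y j = u (i j))" for y i
    using sets_eq_imp_space_eq[OF sets_\<mu>] by (auto simp: E_def prod_emb_def PiE_def Pi_def extensional_def)
  have E_sets[measurable]: "E i \<in> sets ?Q" for i unfolding E_def by (intro sets_PiM_I) auto
  have E_prob: "emeasure ?Q (E i) = (\<Prod>j\<in>{1..m}. ennreal (p (i j)))" for i
  proof -
    have "emeasure ?Q (E i) = (\<Prod>j\<in>{1..m}. emeasure \<mu> {u (i j)})"
      unfolding E_def by (rule P.emeasure_PiM_emb) auto
    then show ?thesis by (simp add: \<mu>_def emeasure_discrete_distribution[OF u])
  qed
  have "AE y in ?Q. \<forall>j\<in>{1..m}. y j \<in> range u"
  proof (intro AE_finite_allI)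
    fix j assume "j \<in> {1..m}"
    have d: "distr ?Q \<mu> (\<lambda>y. y j) = \<mu>" by (rule P.PiM_component) simp
    have "AE z in \<mu>. z \<in> range u"
    proof (rule AE_I)
      show "{z \<in> space \<mu>. z \<notin> range u} \<subseteq> - range u" by auto
      show "emeasure \<mu> (- range u) = 0" unfolding \<mu>_def by (rule emeasure_discrete_distribution[OF u])
      have "countable (range u)" by simp
      then show "- range u \<in> sets \<mu>" using sets.countable[of "range u" borel] by (auto simp: borel_comp)
    qed
    then have "AE z in distr ?Q \<mu> (\<lambda>y. y j). z \<in> range u" unfolding d .
    then show "AE y in ?Q. y j \<in> range u"
      by (rule AE_distrD[rotated]) simp
  qed simp
  then have ae: "AE y in ?Q. indicator {y. card (partition_blocks m y) = k} y
      = (\<integral>\<^sup>+i. (if card (i ` {1..m}) = k then 1 else 0) * indicator (E i) y \<partial>count_space ?I)"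
  proof eventually_elim
    case (elim y)
    then have "\<forall>j\<in>{1..m}. \<exists>l. y j = u l" by auto
    then obtain i0 where i0: "\<And>j. j \<in> {1..m} \<Longrightarrow> y j = u (i0 j)" by (auto dest!: bchoice)
    define i where "i = restrict i0 {1..m}"
    have i: "i \<in> ?I" "\<And>j. j \<in> {1..m} \<Longrightarrow> y j = u (i j)" using i0 by (auto simp: i_def)
    have "indicator (E l) y = (indicator {i} l :: ennreal)" if "l \<in> ?I" for l
    proof -
      have "y \<in> E l \<longleftrightarrow> (\<forall>j\<in>{1..m}. l j = i j)" using i u by (auto simp: E_iff dest: injD)
      also have "\<dots> \<longleftrightarrow> l = i"
      proof
        assume "\<forall>j\<in>{1..m}. l j = i j"
        then show "l = i" by (intro PiE_ext[OF that i(1)]) auto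
      qed simp
      finally show ?thesis by (auto simp: indicator_def)
    qed
    then have "(\<integral>\<^sup>+l. (if card (l ` {1..m}) = k then 1 else 0) * indicator (E l) y \<partial>count_space ?I)
      = (\<integral>\<^sup>+l. (if card (l ` {1..m}) = k then 1 else 0) * indicator {i} l \<partial>count_space ?I)"
      by (intro nn_integral_cong) auto
    also have "\<dots> = (if card (i ` {1..m}) = k then 1 else 0)"
      using i by (subst nn_integral_indicator_singleton) auto
    also have "card (i ` {1..m}) = card (partition_blocks m y)"
    proof -
      have "y ` {1..m} = u ` i ` {1..m}" using i(2) by force
      then show ?thesis unfolding card_partition_blocks
        using card_image[OF inj_on_subset[OF u subset_UNIV], of "i ` {1..m}"] by simp
    qed
    finally show ?case by (simp add: indicator_def)
  qed
  have s: "{y. card (partition_blocks m y) = k} \<in> sets ?Q"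
  proof -
    have "(\<lambda>y. card (partition_blocks m y)) -` {k} \<inter> space seq_space \<in> sets seq_space"
      by (rule measurable_sets[OF measurable_card_partition_blocks]) simp
    then show ?thesis unfolding setsQ by (simp add: space_PiM vimage_def)
  qed
  have "emeasure ?Q {y. card (partition_blocks m y) = k} = (\<integral>\<^sup>+y. indicator {y. card (partition_blocks m y) = k} y \<partial>?Q)"
    using s by simp
  also have "\<dots> = (\<integral>\<^sup>+y. \<integral>\<^sup>+i. (if card (i ` {1..m}) = k then 1 else 0) * indicator (E i) y \<partial>count_space ?I \<partial>?Q)"
    by (rule nn_integral_cong_AE[OF ae])
  also have "\<dots> = (\<integral>\<^sup>+i. \<integral>\<^sup>+y. (if card (i ` {1..m}) = k then 1 else 0) * indicator (E i) y \<partial>?Q \<partial>count_space ?I)"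
    by (rule QC.Fubini'[symmetric], rule measurable_pair_countable2[OF countable_samples]) measurable
  also have "\<dots> = block_weight m k p"
    unfolding block_weight_def by (intro nn_integral_cong) (simp add: nn_integral_cmult E_prob)
  finally show ?thesis unfolding \<mu>_def .
qed

text \<open>For each of the countably many pairs of indices the diagonal is a null set for the joint law.\<close>

lemma AE_uniform_inj:
  assumes "prob_space N" and U: "iid_seq N (uniform_measure lborel {0..1}) U"
  shows "AE \<omega> in N. inj (U \<omega>)"
proof -
  interpret prob_space N by fact
  define \<mu> where "\<mu> = uniform_measure lborel {0..1::real}"
  have iv: "indep_vars (\<lambda>_. borel) (\<lambda>i \<omega>. U \<omega> i) UNIV" and d: "\<And>i. distr N borel (\<lambda>\<omega>. U \<omega> i) = \<mu>"
    using U by (auto simp: iid_seq_def \<mu>_def)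
  have rv[measurable]: "(\<lambda>\<omega>. U \<omega> i) \<in> borel_measurable N" for i using iv by (auto simp: indep_vars_def)
  have sets_\<mu>[simp, measurable_cong]: "sets \<mu> = sets borel" by (simp add: \<mu>_def)
  have "prob_space \<mu>" unfolding d[of 0, symmetric] by (rule prob_space_distr) simp
  then have sf: "sigma_finite_measure \<mu>" by (rule prob_space_imp_sigma_finite)
  have "AE \<omega> in N. U \<omega> i \<noteq> U \<omega> j" if "i \<noteq> j" for i j
  proof -
    have "indep_var borel (\<lambda>\<omega>. U \<omega> i) borel (\<lambda>\<omega>. U \<omega> j)"
      using indep_var_compose[OF indep_var_restrict[OF iv, of "{i}" "{j}"], of "\<lambda>f. f i" borel "\<lambda>f. f j" borel] that
      by (simp add: comp_def)
    then have pair: "distr N (borel \<Otimes>\<^sub>M borel) (\<lambda>\<omega>. (U \<omega> i, U \<omega> j)) = \<mu> \<Otimes>\<^sub>M \<mu>"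
      using d by (simp add: indep_var_distribution_eq)
    let ?D = "{z :: real \<times> real. fst z = snd z}"
    have "{z \<in> space (borel \<Otimes>\<^sub>M borel). fst z = (snd z :: real)} \<in> sets (borel \<Otimes>\<^sub>M borel)" by measurable
    then have D[measurable]: "?D \<in> sets (borel \<Otimes>\<^sub>M borel)" by (simp add: space_pair_measure)
    have D': "?D \<in> sets (\<mu> \<Otimes>\<^sub>M \<mu>)" unfolding sets_pair_measure_cong[OF sets_\<mu> sets_\<mu>] by (rule D)
    have "emeasure N {\<omega> \<in> space N. U \<omega> i = U \<omega> j} = emeasure (distr N (borel \<Otimes>\<^sub>M borel) (\<lambda>\<omega>. (U \<omega> i, U \<omega> j))) ?D"
      by (subst emeasure_distr) (auto intro!: arg_cong[where f="emeasure N"])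
    also have "\<dots> = (\<integral>\<^sup>+x. emeasure \<mu> (Pair x -` ?D) \<partial>\<mu>)"
      unfolding pair by (rule sigma_finite_measure.emeasure_pair_measure_alt[OF sf D'])
    also have "\<dots> = (\<integral>\<^sup>+x. 0 \<partial>\<mu>)"
    proof (rule nn_integral_cong)
      fix x
      have "Pair x -` ?D = {x}" by auto
      moreover have "emeasure \<mu> {x} = 0" unfolding \<mu>_def by (subst emeasure_uniform_measure) (auto simp: emeasure_lborel_countable)
      ultimately show "emeasure \<mu> (Pair x -` ?D) = 0" by simp
    qed
    finally have "emeasure N {\<omega> \<in> space N. U \<omega> i = U \<omega> j} = 0" by simp
    then show ?thesis by (intro AE_I[where N="{\<omega> \<in> space N. U \<omega> i = U \<omega> j}"]) auto
  qed
  then have "AE \<omega> in N. \<forall>i j. i \<noteq> j \<longrightarrow> U \<omega> i \<noteq> U \<omega> j"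
    by (simp add: AE_all_countable)
  then show ?thesis by (rule eventually_mono) (auto simp: inj_def)
qed

text \<open>The labels \<open>U\<close> are almost surely distinct, so the conditional probability of \<open>k\<close> blocks given
  masses and labels depends on the masses only.\<close>

lemma species_sample_block_count:
  assumes sp: "species_sample N D P U Y"
    and P1: "AE \<omega> in N. (\<integral>\<^sup>+k. ennreal (P \<omega> k) \<partial>count_space UNIV) = 1"
    and P[measurable]: "P \<in> measurable N seq_space"
  shows "emeasure N {\<omega> \<in> space N. card (partition_blocks m (Y \<omega>)) = k} = (\<integral>\<^sup>+\<omega>. block_weight m k (P \<omega>) \<partial>N)"
    and "Y \<in> measurable N seq_space"
proof -
  let ?Z = "distr N (seq_space \<Otimes>\<^sub>M seq_space) (\<lambda>\<omega>. (P \<omega>, U \<omega>))"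
  have N: "prob_space N" and U: "iid_seq N (uniform_measure lborel {0..1}) U"
    and cl: "conditional_law N (seq_space \<Otimes>\<^sub>M seq_space) (\<lambda>\<omega>. (P \<omega>, U \<omega>)) seq_space Y
       (\<lambda>(p, u). PiM UNIV (\<lambda>_. discrete_distribution p u))"
    using sp by (auto simp: species_sample_def)
  show Y: "Y \<in> measurable N seq_space" using cl by (simp add: conditional_law_def)
  have PU[measurable]: "(\<lambda>\<omega>. (P \<omega>, U \<omega>)) \<in> measurable N (seq_space \<Otimes>\<^sub>M seq_space)"
    using cl by (simp add: conditional_law_def)
  let ?C = "{y. card (partition_blocks m y) = k}"
  have C: "?C \<in> sets seq_space"
  proof -
    have "(\<lambda>y. card (partition_blocks m y)) -` {k} \<inter> space seq_space \<in> sets seq_space"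
      by (rule measurable_sets[OF measurable_card_partition_blocks]) simp
    then show ?thesis by (simp add: space_PiM vimage_def)
  qed
  have u: "space (seq_space \<Otimes>\<^sub>M seq_space) = (UNIV :: ((nat \<Rightarrow> real) \<times> (nat \<Rightarrow> real)) set)"
    by (simp add: space_pair_measure space_PiM)
  have top: "UNIV \<in> sets (seq_space \<Otimes>\<^sub>M seq_space :: ((nat \<Rightarrow> real) \<times> (nat \<Rightarrow> real)) measure)"
    using sets.top[of "seq_space \<Otimes>\<^sub>M seq_space :: ((nat \<Rightarrow> real) \<times> (nat \<Rightarrow> real)) measure"] unfolding u .
  have "emeasure N {\<omega> \<in> space N. card (partition_blocks m (Y \<omega>)) = k}
    = emeasure N {\<omega> \<in> space N. (P \<omega>, U \<omega>) \<in> UNIV \<and> Y \<omega> \<in> ?C}" by simp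
  also have "\<dots> = (\<integral>\<^sup>+z\<in>UNIV. emeasure (case z of (p, u) \<Rightarrow> PiM UNIV (\<lambda>_. discrete_distribution p u)) ?C
       \<partial>?Z)"
    by (rule cl[unfolded conditional_law_def, THEN conjunct2, THEN conjunct2, rule_format, OF top C])
  also have "\<dots> = (\<integral>\<^sup>+z. block_weight m k (fst z) \<partial>?Z)"
  proof (rule nn_integral_cong_AE)
    define Q where "Q p = (\<integral>\<^sup>+k. ennreal (p k) \<partial>count_space UNIV)" for p :: "nat \<Rightarrow> real"
    have [measurable]: "Q \<in> borel_measurable seq_space"
      unfolding Q_def by (rule borel_measurable_nn_integral_countable) auto
    have "AE \<omega> in N. Q (P \<omega>) = 1 \<and> inj (U \<omega>)"
      using P1 AE_uniform_inj[OF N U] by (auto simp: Q_def)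
    then have ae: "AE \<omega> in N. Q (fst (P \<omega>, U \<omega>)) = 1 \<and> (\<forall>i j. snd (P \<omega>, U \<omega>) i = snd (P \<omega>, U \<omega>) j \<longrightarrow> i = j)"
      by (rule eventually_mono) (auto simp: inj_def)
    have "AE z in ?Z. Q (fst z) = 1 \<and> (\<forall>i j. snd z i = snd z j \<longrightarrow> i = j)"
    proof (subst AE_distr_iff[OF PU])
      show "{z \<in> space (seq_space \<Otimes>\<^sub>M seq_space). Q (fst z) = 1 \<and> (\<forall>i j. snd z i = snd z j \<longrightarrow> i = j)} \<in> sets (seq_space \<Otimes>\<^sub>M seq_space)"
        by measurable
    qed (rule ae)
    then show "AE z in ?Z.
      emeasure (case z of (p, u) \<Rightarrow> PiM UNIV (\<lambda>_. discrete_distribution p u)) ?C * indicator UNIV z = block_weight m k (fst z)"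
    proof (rule eventually_mono)
      fix z :: "(nat \<Rightarrow> real) \<times> (nat \<Rightarrow> real)"
      assume z: "Q (fst z) = 1 \<and> (\<forall>i j. snd z i = snd z j \<longrightarrow> i = j)"
      have "emeasure (PiM UNIV (\<lambda>_. discrete_distribution (fst z) (snd z))) ?C = block_weight m k (fst z)"
        by (rule block_count_given_masses) (use z in \<open>auto simp: Q_def inj_def\<close>)
      then show "emeasure (case z of (p, u) \<Rightarrow> PiM UNIV (\<lambda>_. discrete_distribution p u)) ?C * indicator UNIV z = block_weight m k (fst z)"
        by (simp add: case_prod_beta')
    qed
  qed
  also have "\<dots> = (\<integral>\<^sup>+\<omega>. block_weight m k (fst (P \<omega>, U \<omega>)) \<partial>N)"
    by (rule nn_integral_distr[OF PU], simp only: measurable_distr_eq1) (rule measurable_compose[OF measurable_fst block_weight_measurable])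
  also have "\<dots> = (\<integral>\<^sup>+\<omega>. block_weight m k (P \<omega>) \<partial>N)" by simp
  finally show "emeasure N {\<omega> \<in> space N. card (partition_blocks m (Y \<omega>)) = k} = (\<integral>\<^sup>+\<omega>. block_weight m k (P \<omega>) \<partial>N)" .
qed

section \<open>Counting samples by surjections\<close>

definition surjections :: "nat \<Rightarrow> nat \<Rightarrow> (nat \<Rightarrow> nat) set" where
  "surjections m k = {\<phi> \<in> {1..m} \<rightarrow>\<^sub>E {..<k}. \<phi> ` {1..m} = {..<k}}"

lemma finite_surjections: "finite (surjections m k)"
  by (rule finite_subset[of _ "{1..m} \<rightarrow>\<^sub>E {..<k}"]) (auto simp: surjections_def intro!: finite_PiE)

text \<open>A sample with exactly \<open>k\<close> different values factors as an injection \<open>\<kappa>\<close> of \<open>{..<k}\<close> after a surjection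
  \<open>\<phi>\<close> onto \<open>{..<k}\<close> in \<open>k!\<close> ways, one for each ordering of its values; other samples do not factor.\<close>

lemma count_factorisations:
  assumes i: "i \<in> {1..m} \<rightarrow>\<^sub>E (UNIV :: nat set)"
  shows "(\<integral>\<^sup>+\<kappa>. (\<Sum>\<phi>\<in>surjections m k. if inj_on \<kappa> {..<k} \<and> i = restrict (\<kappa> \<circ> \<phi>) {1..m} then 1 else 0) \<partial>count_space (tuples k))
    = (if card (i ` {1..m}) = k then fact k else 0 :: ennreal)"
proof -
  let ?N = "\<lambda>\<kappa> i. (\<Sum>\<phi>\<in>surjections m k. if inj_on \<kappa> {..<k} \<and> i = restrict (\<kappa> \<circ> \<phi>) {1..m} then 1 else 0) :: ennreal"
  let ?B = "{\<kappa> \<in> {..<k} \<rightarrow>\<^sub>E i ` {1..m}. inj_on \<kappa> {..<k} \<and> \<kappa> ` {..<k} = i ` {1..m}}"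
  have one: "(?N \<kappa> i) = (indicator ?B \<kappa> :: ennreal)"
    if \<kappa>: "\<kappa> \<in> tuples k" for \<kappa>
  proof (cases "\<kappa> \<in> ?B")
    case False
    have "\<not> (inj_on \<kappa> {..<k} \<and> i = restrict (\<kappa> \<circ> \<phi>) {1..m})" if "\<phi> \<in> surjections m k" for \<phi>
    proof
      assume a: "inj_on \<kappa> {..<k} \<and> i = restrict (\<kappa> \<circ> \<phi>) {1..m}"
      then have "i ` {1..m} = \<kappa> ` \<phi> ` {1..m}" by (auto simp: image_iff)
      then have "i ` {1..m} = \<kappa> ` {..<k}" using that by (simp add: surjections_def)
      then have "\<kappa> \<in> ?B" using a \<kappa> by (auto simp: PiE_def)
      then show False using False by simp
    qed
    then have "(?N \<kappa> i) = (0 :: ennreal)"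
      by (intro sum.neutral ballI if_not_P)
    moreover have "indicator ?B \<kappa> = (0 :: ennreal)" using False by (rule indicator_simps(2))
    ultimately show ?thesis by (simp only:)
  next
    case True
    define v where "v = restrict (the_inv_into {..<k} \<kappa> \<circ> i) {1..m}"
    have inj: "inj_on \<kappa> {..<k}" and im: "\<kappa> ` {..<k} = i ` {1..m}" using True by auto
    have \<kappa>v: "\<kappa> (v j) = i j" and vk: "v j \<in> {..<k}" if "j \<in> {1..m}" for j
    proof -
      have "i j \<in> \<kappa> ` {..<k}" unfolding im using that by simp
      then show "\<kappa> (v j) = i j" "v j \<in> {..<k}"
        using that inj f_the_inv_into_f[OF inj] the_inv_into_into[OF inj _ subset_refl] by (auto simp: v_def)
    qed
    have vs: "v \<in> surjections m k"
    proof -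
      have "l \<in> v ` {1..m}" if l: "l \<in> {..<k}" for l
      proof -
        have "\<kappa> l \<in> i ` {1..m}" using im l by blast
        then obtain j where j: "j \<in> {1..m}" "i j = \<kappa> l" by auto
        then have "\<kappa> (v j) = \<kappa> l" using \<kappa>v by simp
        then have "v j = l" using inj vk[OF j(1)] l by (auto dest: inj_onD)
        then show ?thesis using j by blast
      qed
      moreover have "v \<in> {1..m} \<rightarrow>\<^sub>E {..<k}"
        using vk by (intro PiE_I) (auto simp: v_def)
      ultimately show ?thesis using vk by (auto simp: surjections_def)
    qed
    have "i = restrict (\<kappa> \<circ> \<phi>) {1..m} \<longleftrightarrow> \<phi> = v" if "\<phi> \<in> surjections m k" for \<phi>
    proof
      assume e: "i = restrict (\<kappa> \<circ> \<phi>) {1..m}"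
      have "\<phi> j = v j" if j: "j \<in> {1..m}" for j
      proof -
        have "\<kappa> (\<phi> j) = \<kappa> (v j)" using e \<kappa>v[OF j] j by simp
        moreover have "\<phi> j \<in> {..<k}" using \<open>\<phi> \<in> surjections m k\<close> j by (auto simp: surjections_def)
        ultimately show ?thesis using inj vk[OF j] by (auto dest: inj_onD)
      qed
      then show "\<phi> = v" using that vs by (intro PiE_ext[of \<phi> "{1..m}" "\<lambda>_. {..<k}"]) (auto simp: surjections_def)
    next
      assume "\<phi> = v"
      then show "i = restrict (\<kappa> \<circ> \<phi>) {1..m}"
        using i \<kappa>v by (auto simp: fun_eq_iff PiE_def extensional_def)
    qed
    then have "(?N \<kappa> i) = (\<Sum>\<phi>\<in>surjections m k. if \<phi> = v then 1 else 0 :: ennreal)"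
      using inj by (intro sum.cong) auto
    then show ?thesis using True vs finite_surjections by simp
  qed
  have finB: "finite ?B"
    by (rule finite_subset[of _ "{..<k} \<rightarrow>\<^sub>E i ` {1..m}"]) (auto intro!: finite_PiE)
  have cardB: "card ?B = (if card (i ` {1..m}) = k then fact k else 0)"
  proof (cases "card (i ` {1..m}) = k")
    case True
    have "?B = {\<kappa> \<in> {..<k} \<rightarrow>\<^sub>E i ` {1..m}. inj_on \<kappa> {..<k}}"
    proof (intro set_eqI iffI; clarsimp)
      fix \<kappa> assume \<kappa>: "\<kappa> \<in> {..<k} \<rightarrow>\<^sub>E i ` {Suc 0..m}" "inj_on \<kappa> {..<k}"
      show "\<kappa> ` {..<k} = i ` {Suc 0..m}"
        using \<kappa> True by (intro card_subset_eq) (auto simp: card_image)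
    qed
    then have "card ?B = prod ((-) k) {0..<k}"
      using card_inj_on_subset_funcset[of "{..<k}" "i ` {1..m}" "{..<k}"] True by simp
    then show ?thesis using True by (simp add: fact_prod_rev)
  next
    case False
    have B0: "?B = {}" using False card_image[of _ "{..<k}"] by force
    show ?thesis unfolding B0 using False by simp
  qed
  have "(\<integral>\<^sup>+\<kappa>. (?N \<kappa> i) \<partial>count_space (tuples k))
    = (\<integral>\<^sup>+\<kappa>. indicator ?B \<kappa> \<partial>count_space (tuples k))"
    by (intro nn_integral_cong one) simp
  also have "\<dots> = of_nat (card ?B)"
  proof -
    have "?B \<subseteq> tuples k" by (auto simp: PiE_def)
    then have "(\<integral>\<^sup>+\<kappa>. indicator ?B \<kappa> \<partial>count_space (tuples k)) = emeasure (count_space (tuples k)) ?B"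
      by (intro nn_integral_indicator) (simp only: sets_count_space Pow_iff)
    also have "\<dots> = of_nat (card ?B)" by (rule emeasure_count_space_finite) fact+
    finally show ?thesis .
  qed
  also have "\<dots> = (if card (i ` {1..m}) = k then fact k else 0)" unfolding cardB by simp
  finally show ?thesis .
qed

text \<open>Summing over injections \<open>\<kappa>\<close> brings the block weight into the form required by the Mecke formula, the
  exponents being the block sizes.\<close>

lemma block_weight_surjections:
  "fact k * block_weight m k p = (\<Sum>\<phi>\<in>surjections m k. \<integral>\<^sup>+\<kappa>. (if inj_on \<kappa> {..<k} then
     \<Prod>b<k. ennreal (p (\<kappa> b)) ^ card {j \<in> {1..m}. \<phi> j = b} else 0) \<partial>count_space (tuples k))"
proof -
  let ?N = "\<lambda>\<kappa> i. (\<Sum>\<phi>\<in>surjections m k. if inj_on \<kappa> {..<k} \<and> i = restrict (\<kappa> \<circ> \<phi>) {1..m} then 1 else 0) :: ennreal"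
  let ?I = "{1..m} \<rightarrow>\<^sub>E (UNIV :: nat set)"
  interpret CC: pair_sigma_finite "count_space ?I" "count_space (tuples k)"
    by (intro pair_sigma_finite.intro sigma_finite_measure_count_space_countable countable_samples countable_tuples)
  define w where "w i = (\<Prod>j\<in>{1..m}. ennreal (p (i j)))" for i
  let ?T = "\<lambda>\<kappa> \<phi>. (if inj_on \<kappa> {..<k} then w (restrict (\<kappa> \<circ> \<phi>) {1..m}) else 0)"
  have "fact k * block_weight m k p = (\<integral>\<^sup>+i. w i * (if card (i ` {1..m}) = k then fact k else 0) \<partial>count_space ?I)"
    unfolding block_weight_def w_def by (subst nn_integral_cmult[symmetric]) (auto intro!: nn_integral_cong simp: mult.commute)
  also have "\<dots> = (\<integral>\<^sup>+i. \<integral>\<^sup>+\<kappa>. w i * (?N \<kappa> i)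
      \<partial>count_space (tuples k) \<partial>count_space ?I)"
  proof (rule nn_integral_cong)
    fix i assume "i \<in> space (count_space ?I)"
    then have i: "i \<in> ?I" by simp
    show "w i * (if card (i ` {1..m}) = k then fact k else 0) = (\<integral>\<^sup>+\<kappa>. w i * (?N \<kappa> i)
      \<partial>count_space (tuples k))"
      unfolding count_factorisations[OF i, symmetric] by (rule nn_integral_cmult[symmetric]) simp
  qed
  also have "\<dots> = (\<integral>\<^sup>+\<kappa>. \<integral>\<^sup>+i. w i * (?N \<kappa> i)
      \<partial>count_space ?I \<partial>count_space (tuples k))"
    by (rule CC.Fubini'[symmetric], rule measurable_pair_countable2[OF countable_tuples]) simp
  also have "\<dots> = (\<integral>\<^sup>+\<kappa>. (\<Sum>\<phi>\<in>surjections m k. if inj_on \<kappa> {..<k} then w (restrict (\<kappa> \<circ> \<phi>) {1..m}) else 0) \<partial>count_space (tuples k))"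
  proof (rule nn_integral_cong)
    fix \<kappa>
    have "(\<integral>\<^sup>+i. w i * (?N \<kappa> i) \<partial>count_space ?I)
      = (\<Sum>\<phi>\<in>surjections m k. \<integral>\<^sup>+i. w i * (if inj_on \<kappa> {..<k} \<and> i = restrict (\<kappa> \<circ> \<phi>) {1..m} then 1 else 0) \<partial>count_space ?I)"
      unfolding sum_distrib_left by (rule nn_integral_sum) simp
    also have "\<dots> = (\<Sum>\<phi>\<in>surjections m k. if inj_on \<kappa> {..<k} then w (restrict (\<kappa> \<circ> \<phi>) {1..m}) else 0)"
    proof (rule sum.cong[OF refl])
      fix \<phi>
      have "(\<integral>\<^sup>+i. w i * (if inj_on \<kappa> {..<k} \<and> i = restrict (\<kappa> \<circ> \<phi>) {1..m} then 1 else 0) \<partial>count_space ?I)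
        = (\<integral>\<^sup>+i. (if inj_on \<kappa> {..<k} then w i else 0) * indicator {restrict (\<kappa> \<circ> \<phi>) {1..m}} i \<partial>count_space ?I)"
        by (intro nn_integral_cong) (auto simp: indicator_def)
      also have "\<dots> = (?T \<kappa> \<phi>)"
        by (subst nn_integral_indicator_singleton) auto
      finally show "(\<integral>\<^sup>+i. w i * (if inj_on \<kappa> {..<k} \<and> i = restrict (\<kappa> \<circ> \<phi>) {1..m} then 1 else 0) \<partial>count_space ?I)
        = (?T \<kappa> \<phi>)" .
    qed
    finally show "(\<integral>\<^sup>+i. w i * (?N \<kappa> i) \<partial>count_space ?I)
      = (\<Sum>\<phi>\<in>surjections m k. if inj_on \<kappa> {..<k} then w (restrict (\<kappa> \<circ> \<phi>) {1..m}) else 0)" .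
  qed
  also have "\<dots> = (\<Sum>\<phi>\<in>surjections m k. \<integral>\<^sup>+\<kappa>. (?T \<kappa> \<phi>) \<partial>count_space (tuples k))"
    by (rule nn_integral_sum) simp
  also have "\<dots> = (\<Sum>\<phi>\<in>surjections m k. \<integral>\<^sup>+\<kappa>. (if inj_on \<kappa> {..<k} then
     \<Prod>b<k. ennreal (p (\<kappa> b)) ^ card {j \<in> {1..m}. \<phi> j = b} else 0) \<partial>count_space (tuples k))"
  proof (rule sum.cong[OF refl])
    fix \<phi> assume \<phi>: "\<phi> \<in> surjections m k"
    have "w (restrict (\<kappa> \<circ> \<phi>) {1..m}) = (\<Prod>b<k. ennreal (p (\<kappa> b)) ^ card {j \<in> {1..m}. \<phi> j = b})" for \<kappa>
    proof -
      have "w (restrict (\<kappa> \<circ> \<phi>) {1..m}) = (\<Prod>j\<in>{1..m}. ennreal (p (\<kappa> (\<phi> j))))"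
        by (simp add: w_def)
      also have "\<dots> = (\<Prod>b<k. \<Prod>j\<in>{j \<in> {1..m}. \<phi> j = b}. ennreal (p (\<kappa> (\<phi> j))))"
        using \<phi> by (intro prod.group[symmetric]) (auto simp: surjections_def)
      also have "\<dots> = (\<Prod>b<k. ennreal (p (\<kappa> b)) ^ card {j \<in> {1..m}. \<phi> j = b})"
        by (intro prod.cong refl) simp
      finally show ?thesis .
    qed
    then show "(\<integral>\<^sup>+\<kappa>. (?T \<kappa> \<phi>) \<partial>count_space (tuples k))
      = (\<integral>\<^sup>+\<kappa>. (if inj_on \<kappa> {..<k} then \<Prod>b<k. ennreal (p (\<kappa> b)) ^ card {j \<in> {1..m}. \<phi> j = b} else 0) \<partial>count_space (tuples k))"
      by (simp only:)
  qed
  finally show ?thesis .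
qed

section \<open>Laplace transform of the block weights\<close>

text \<open>The pattern \<open>p k\<close> of this rule matches every function application, which would misdirect the proofs
  of measurability with respect to other spaces from here on.\<close>

declare seq_component_measurable[measurable del]

text \<open>Every sample has some number of different values, so the block weights expand a power of the total mass.\<close>

lemma sum_block_weight:
  "(\<integral>\<^sup>+k. block_weight m k p \<partial>count_space UNIV) = (\<integral>\<^sup>+k. ennreal (p k) \<partial>count_space UNIV) ^ m"
proof -
  let ?I = "{1..m} \<rightarrow>\<^sub>E (UNIV :: nat set)"
  define w where "w i = (\<Prod>j\<in>{1..m}. ennreal (p (i j)))" for i
  interpret CC: pair_sigma_finite "count_space ?I" "count_space (UNIV :: nat set)"
    by (intro pair_sigma_finite.intro sigma_finite_measure_count_space_countable countable_samples) simp
  have "(\<integral>\<^sup>+k. block_weight m k p \<partial>count_space UNIV)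
    = (\<integral>\<^sup>+i. \<integral>\<^sup>+k. (if card (i ` {1..m}) = k then w i else 0) \<partial>count_space UNIV \<partial>count_space ?I)"
    unfolding block_weight_def w_def[symmetric]
    by (rule CC.Fubini', rule measurable_pair_countable2) auto
  also have "\<dots> = (\<integral>\<^sup>+i. w i \<partial>count_space ?I)"
  proof (rule nn_integral_cong)
    fix i
    have "(\<integral>\<^sup>+k. (if card (i ` {1..m}) = k then w i else 0) \<partial>count_space UNIV)
      = (\<integral>\<^sup>+k. w i * indicator {card (i ` {1..m})} k \<partial>count_space UNIV)"
      by (intro nn_integral_cong) (simp add: indicator_def)
    also have "\<dots> = w i" by (subst nn_integral_indicator_singleton) auto
    finally show "(\<integral>\<^sup>+k. (if card (i ` {1..m}) = k then w i else 0) \<partial>count_space UNIV) = w i" .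
  qed
  also have "\<dots> = (\<integral>\<^sup>+k. ennreal (p k) \<partial>count_space UNIV) ^ m"
    unfolding w_def by (subst nn_integral_PiE_prod[where h="\<lambda>_ l. ennreal (p l)"]) auto
  finally show ?thesis .
qed

lemma block_weight_zero: "0 < m \<Longrightarrow> block_weight m 0 p = 0"
  unfolding block_weight_def by (simp add: card_eq_0_iff cong: if_cong)

lemma block_weight_scale:
  assumes "0 < s" "\<And>k. 0 \<le> p k"
  shows "block_weight m k (\<lambda>l. p l / s) = ennreal (s powr (- real m)) * block_weight m k p"
proof -
  have "(\<Prod>j\<in>{1..m}. ennreal (p (i j) / s)) = ennreal (s powr (- real m)) * (\<Prod>j\<in>{1..m}. ennreal (p (i j)))" for i
  proof -
    have "(\<Prod>j\<in>{1..m}. ennreal (p (i j) / s)) = (\<Prod>j\<in>{1..m}. ennreal (1 / s) * ennreal (p (i j)))"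
      using assms by (intro prod.cong refl) (simp add: ennreal_mult[symmetric])
    also have "\<dots> = ennreal (1 / s) ^ m * (\<Prod>j\<in>{1..m}. ennreal (p (i j)))" by (simp add: prod.distrib)
    also have "ennreal (1 / s) ^ m = ennreal (s powr (- real m))"
      using assms by (simp add: ennreal_power powr_minus powr_realpow power_divide field_simps)
    finally show ?thesis .
  qed
  then show ?thesis unfolding block_weight_def
    by (subst nn_integral_cmult[symmetric]) (auto intro!: nn_integral_cong)
qed

lemma borel_measurable_ennreal_power[measurable (raw)]:
  fixes f :: "'a \<Rightarrow> ennreal"
  shows "f \<in> borel_measurable M \<Longrightarrow> (\<lambda>x. f x ^ n) \<in> borel_measurable M"
  by (induction n) auto

lemma sblevy_moment:
  assumes b: "0 < b"
  shows "(\<integral>\<^sup>+x. ennreal x ^ j * ennreal (exp (- b * x)) \<partial>sblevy)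
    = ennreal (Gamma (real j + 1 / 2) / (2 * sqrt pi) * b powr (- (real j + 1 / 2)))"
proof -
  have "(\<integral>\<^sup>+x. ennreal x ^ j * ennreal (exp (- b * x)) \<partial>sblevy)
      = (\<integral>\<^sup>+x. ennreal (sblevy_density x) * (ennreal x ^ j * ennreal (exp (- b * x))) \<partial>lborel)"
    by (rule nn_integral_density) measurable
  also have "\<dots> = (\<integral>\<^sup>+x. ennreal (1 / (2 * sqrt pi)) * (ennreal (x powr (real j + 1 / 2 - 1) * exp (- b * x)) * indicator {0<..} x) \<partial>lborel)"
  proof (rule nn_integral_cong)
    fix x :: real
    show "ennreal (sblevy_density x) * (ennreal x ^ j * ennreal (exp (- b * x)))
      = ennreal (1 / (2 * sqrt pi)) * (ennreal (x powr (real j + 1 / 2 - 1) * exp (- b * x)) * indicator {0<..} x)"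
    proof (cases "0 < x")
      case True
      have "x powr (real j + 1 / 2 - 1) = x powr (real j + - (1 / 2))" by simp
      also have "\<dots> = x ^ j * x powr (- (1 / 2))" unfolding powr_add using True by (simp add: powr_realpow)
      finally show ?thesis using True
        by (simp add: sblevy_density_def ennreal_power ennreal_mult'[symmetric] mult_ac)
    qed (simp add: sblevy_density_def)
  qed
  also have "\<dots> = ennreal (1 / (2 * sqrt pi)) * ennreal (Gamma (real j + 1 / 2) * b powr (- (real j + 1 / 2)))"
    using b by (subst nn_integral_cmult, simp, subst nn_integral_Gamma_scaled) simp_all
  also have "\<dots> = ennreal (Gamma (real j + 1 / 2) / (2 * sqrt pi) * b powr (- (real j + 1 / 2)))"
    by (subst ennreal_mult[symmetric]) auto
  finally show ?thesis .
qed

lemma nn_integral_gauss_moment: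
  fixes a t :: real
  assumes a: "0 < a" and t: "0 < t"
  shows "(\<integral>\<^sup>+g. ennreal (g powr (2 * a - 1) * exp (- g\<^sup>2 * t)) * indicator {0<..} g \<partial>lborel) = ennreal (Gamma a / 2 * t powr (- a))"
proof -
  have "ennreal (Gamma a * t powr (- a)) = (\<integral>\<^sup>+y. ennreal (y powr (a - 1) * exp (- t * y)) * indicator {0<..} y \<partial>lborel)"
    by (rule nn_integral_Gamma_scaled[OF a t, symmetric])
  also have "\<dots> = (\<integral>\<^sup>+x. ennreal ((x\<^sup>2) powr (a - 1) * exp (- t * x\<^sup>2)) * ennreal (2 * x) * indicator {0<..} x \<partial>lborel)"
    by (rule nn_integral_Ioi_square) simp
  also have "\<dots> = (\<integral>\<^sup>+x. 2 * (ennreal (x powr (2 * a - 1) * exp (- x\<^sup>2 * t)) * indicator {0<..} x) \<partial>lborel)"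
  proof (rule nn_integral_cong)
    fix x :: real
    show "ennreal ((x\<^sup>2) powr (a - 1) * exp (- t * x\<^sup>2)) * ennreal (2 * x) * indicator {0<..} x
      = 2 * (ennreal (x powr (2 * a - 1) * exp (- x\<^sup>2 * t)) * indicator {0<..} x)"
    proof (cases "0 < x")
      case True
      have "(x\<^sup>2) powr (a - 1) * x = x powr (2 * (a - 1)) * x powr 1"
        using True by (simp add: powr_powr flip: powr_numeral)
      also have "\<dots> = x powr (2 * a - 1)" unfolding powr_add[symmetric] by simp
      finally have "(x\<^sup>2) powr (a - 1) * exp (- t * x\<^sup>2) * (2 * x) = 2 * (x powr (2 * a - 1) * exp (- x\<^sup>2 * t))"
        by (simp add: mult_ac)
      then show ?thesis using True by (simp add: ennreal_mult[symmetric] ennreal_mult'[symmetric] flip: ennreal_numeral)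
    qed simp
  qed
  also have "\<dots> = 2 * (\<integral>\<^sup>+x. ennreal (x powr (2 * a - 1) * exp (- x\<^sup>2 * t)) * indicator {0<..} x \<partial>lborel)"
    by (rule nn_integral_cmult) simp
  finally have "ennreal (1 / 2) * ennreal (Gamma a * t powr (- a)) = (ennreal (1 / 2) * 2) * (\<integral>\<^sup>+x. ennreal (x powr (2 * a - 1) * exp (- x\<^sup>2 * t)) * indicator {0<..} x \<partial>lborel)"
    by (simp add: mult.assoc)
  moreover have "ennreal (1 / 2) * 2 = 1"
  proof -
    have "ennreal (1 / 2) * ennreal 2 = ennreal (1 / 2 * 2)" by (rule ennreal_mult[symmetric]) auto
    then show ?thesis by simp
  qed
  moreover have "ennreal (1 / 2) * ennreal (Gamma a * t powr (- a)) = ennreal (Gamma a / 2 * t powr (- a))"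
    using a by (subst ennreal_mult[symmetric]) (auto simp: less_imp_le Gamma_real_pos)
  ultimately show ?thesis by simp
qed

context stable_half
begin

text \<open>For a surjection \<open>\<phi>\<close> with block sizes \<open>n\<^sub>b\<close>, one factor \<open>A\<close> of each block is spent on the Mecke
  formula, which leaves the product of moments \<open>\<integral> x\<^bsup>n\<^sub>b - 1\<^esup> exp (- g\<^sup>2 x)\<close> under \<open>sblevy\<close>, each proportional to
  \<open>g\<^bsup>1 - 2 n\<^sub>b\<^esup>\<close>.  The block sizes add up to \<open>m\<close>, so the power of \<open>g\<close> depends on \<open>k\<close> and \<open>m\<close> only.\<close>

lemma block_laplace:
  obtains c :: real where "0 \<le> c" "\<And>g. 0 < g \<Longrightarrow> (\<integral>\<^sup>+\<omega>. ennreal (exp (- g\<^sup>2 * S \<omega>)) * block_weight m k (A \<omega>) \<partial>M)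
     = ennreal (c * g powr (real k - 2 * real m) * exp (- g))"
proof -
  interpret levy: prob_space levy_law by (rule prob_space_levy_law)
  interpret sb: product_sigma_finite "\<lambda>_::nat. sblevy" using sigma_finite_sblevy by (simp add: product_sigma_finite_def)
  define n where "n \<phi> b = card {j \<in> {1..m}. \<phi> j = b}" for \<phi> :: "nat \<Rightarrow> nat" and b
  let ?W = "\<lambda>\<phi> \<omega>. (\<integral>\<^sup>+\<kappa>. (if inj_on \<kappa> {..<k} then \<Prod>b<k. ennreal (A \<omega> (\<kappa> b)) ^ n \<phi> b else 0) \<partial>count_space (tuples k))"
  define c\<phi> where "c\<phi> \<phi> = (\<Prod>b<k. Gamma (real (n \<phi> b) - 1 / 2) / (2 * sqrt pi))" for \<phi>
  have n_pos: "1 \<le> n \<phi> b" if "\<phi> \<in> surjections m k" "b < k" for \<phi> b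
  proof -
    have "b \<in> \<phi> ` {1..m}" using that by (simp add: surjections_def)
    then obtain j where "j \<in> {1..m}" "\<phi> j = b" by blast
    then have "{j \<in> {1..m}. \<phi> j = b} \<noteq> {}" by blast
    then show ?thesis unfolding n_def by (simp add: Suc_le_eq card_gt_0_iff)
  qed
  have c\<phi>0: "0 \<le> c\<phi> \<phi>" if "\<phi> \<in> surjections m k" for \<phi>
    unfolding c\<phi>_def
  proof (rule prod_nonneg)
    fix b assume "b \<in> {..<k}"
    then have "0 < real (n \<phi> b) - 1 / 2" using n_pos[OF that, of b] by simp
    then show "0 \<le> Gamma (real (n \<phi> b) - 1 / 2) / (2 * sqrt pi)" by (simp add: less_imp_le Gamma_real_pos)
  qed
  have factor: "(\<integral>\<^sup>+\<omega>. ennreal (exp (- g\<^sup>2 * S \<omega>)) * (?W \<phi> \<omega>) \<partial>M)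
      = ennreal (c\<phi> \<phi> * g powr (real k - 2 * real m) * exp (- g))" (is "?L = _")
    if \<phi>: "\<phi> \<in> surjections m k" and g: "0 < g" for \<phi> g
  proof -
    define F where "F x y = (\<Prod>b<k. ennreal (x b) ^ (n \<phi> b - 1) * ennreal (exp (- g\<^sup>2 * x b))) * ennreal (exp (- g\<^sup>2 * y))" for x y
    have Fm: "(\<lambda>(x, y). F x y) \<in> borel_measurable (PiM {..<k} (\<lambda>_. borel) \<Otimes>\<^sub>M borel)"
      unfolding F_def by measurable
    have pow: "ennreal (A \<omega> (\<kappa> b)) ^ n \<phi> b = ennreal (A \<omega> (\<kappa> b)) * ennreal (A \<omega> (\<kappa> b)) ^ (n \<phi> b - 1)" if "b < k" for b \<omega> \<kappa>
      using n_pos[OF \<phi> that] by (cases "n \<phi> b") auto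
    have F: "ennreal (exp (- g\<^sup>2 * S \<omega>)) * (\<Prod>b<k. ennreal (A \<omega> (\<kappa> b)) ^ n \<phi> b)
       = (\<Prod>b<k. ennreal (A \<omega> (\<kappa> b))) * F (\<lambda>i\<in>{..<k}. A \<omega> (\<kappa> i)) (S \<omega> - (\<Sum>i<k. A \<omega> (\<kappa> i)))" for \<omega> \<kappa>
    proof -
      have e: "exp (- g\<^sup>2 * S \<omega>) = (\<Prod>b<k. exp (- g\<^sup>2 * A \<omega> (\<kappa> b))) * exp (- g\<^sup>2 * (S \<omega> - (\<Sum>i<k. A \<omega> (\<kappa> i))))"
        by (simp add: exp_sum[symmetric] exp_add[symmetric] sum_negf sum_distrib_left algebra_simps)
      have "ennreal (exp (- g\<^sup>2 * S \<omega>)) = (\<Prod>b<k. ennreal (exp (- g\<^sup>2 * A \<omega> (\<kappa> b)))) * ennreal (exp (- g\<^sup>2 * (S \<omega> - (\<Sum>i<k. A \<omega> (\<kappa> i)))))"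
        unfolding e by (subst ennreal_mult) (auto simp: prod_ennreal prod_nonneg)
      moreover have "(\<Prod>b<k. ennreal (A \<omega> (\<kappa> b)) ^ n \<phi> b) = (\<Prod>b<k. ennreal (A \<omega> (\<kappa> b))) * (\<Prod>b<k. ennreal (A \<omega> (\<kappa> b)) ^ (n \<phi> b - 1))"
        unfolding prod.distrib[symmetric] by (intro prod.cong refl pow) simp
      ultimately show ?thesis unfolding F_def prod.distrib by (simp add: mult_ac)
    qed
    have "?L = (\<integral>\<^sup>+\<omega>. (\<integral>\<^sup>+\<kappa>. (\<Prod>b<k. ennreal (A \<omega> (\<kappa> b))) * (if inj_on \<kappa> {..<k} then
        F (\<lambda>i\<in>{..<k}. A \<omega> (\<kappa> i)) (S \<omega> - (\<Sum>i<k. A \<omega> (\<kappa> i))) else 0) \<partial>count_space (tuples k)) \<partial>M)"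
    proof (rule nn_integral_cong)
      fix \<omega>
      have "ennreal (exp (- g\<^sup>2 * S \<omega>)) * (if inj_on \<kappa> {..<k} then \<Prod>b<k. ennreal (A \<omega> (\<kappa> b)) ^ n \<phi> b else 0)
        = (\<Prod>b<k. ennreal (A \<omega> (\<kappa> b))) * (if inj_on \<kappa> {..<k} then F (\<lambda>i\<in>{..<k}. A \<omega> (\<kappa> i)) (S \<omega> - (\<Sum>i<k. A \<omega> (\<kappa> i))) else 0)" for \<kappa>
        by (cases "inj_on \<kappa> {..<k}") (simp_all only: F if_True if_False mult_zero_right)
      then show "ennreal (exp (- g\<^sup>2 * S \<omega>)) * (?W \<phi> \<omega>)
        = (\<integral>\<^sup>+\<kappa>. (\<Prod>b<k. ennreal (A \<omega> (\<kappa> b))) * (if inj_on \<kappa> {..<k} then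
          F (\<lambda>i\<in>{..<k}. A \<omega> (\<kappa> i)) (S \<omega> - (\<Sum>i<k. A \<omega> (\<kappa> i))) else 0) \<partial>count_space (tuples k))"
        by (subst nn_integral_cmult[symmetric], simp, simp only:)
    qed
    also have "\<dots> = (\<integral>\<^sup>+x. \<integral>\<^sup>+y. F x y \<partial>levy_law \<partial>PiM {..<k} (\<lambda>_. sblevy))" by (rule mecke[OF Fm])
    also have "\<dots> = (\<integral>\<^sup>+x. (\<Prod>b<k. ennreal (x b) ^ (n \<phi> b - 1) * ennreal (exp (- g\<^sup>2 * x b))) * ennreal (exp (- g)) \<partial>PiM {..<k} (\<lambda>_. sblevy))"
    proof (rule nn_integral_cong)
      fix x
      have "(\<integral>\<^sup>+y. ennreal (exp (- g\<^sup>2 * y)) \<partial>levy_law) = ennreal (exp (- g))"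
        using levy_laplace(1)[of "g\<^sup>2"] g by (simp add: nn_integral_density ennreal_mult[symmetric])
      then show "(\<integral>\<^sup>+y. F x y \<partial>levy_law) = (\<Prod>b<k. ennreal (x b) ^ (n \<phi> b - 1) * ennreal (exp (- g\<^sup>2 * x b))) * ennreal (exp (- g))"
        unfolding F_def by (subst nn_integral_cmult) simp_all
    qed
    also have "\<dots> = (\<integral>\<^sup>+x. (\<Prod>b<k. ennreal (x b) ^ (n \<phi> b - 1) * ennreal (exp (- g\<^sup>2 * x b))) \<partial>PiM {..<k} (\<lambda>_. sblevy)) * ennreal (exp (- g))"
      by (rule nn_integral_multc) measurable
    also have "(\<integral>\<^sup>+x. (\<Prod>b<k. ennreal (x b) ^ (n \<phi> b - 1) * ennreal (exp (- g\<^sup>2 * x b))) \<partial>PiM {..<k} (\<lambda>_. sblevy))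
      = (\<Prod>b<k. \<integral>\<^sup>+y. ennreal y ^ (n \<phi> b - 1) * ennreal (exp (- g\<^sup>2 * y)) \<partial>sblevy)"
      by (rule sb.product_nn_integral_prod[where f="\<lambda>b y. ennreal y ^ (n \<phi> b - 1) * ennreal (exp (- g\<^sup>2 * y))"]) auto
    also have "\<dots> = (\<Prod>b<k. ennreal (Gamma (real (n \<phi> b) - 1 / 2) / (2 * sqrt pi) * g powr (1 - 2 * real (n \<phi> b))))"
    proof (rule prod.cong[OF refl])
      fix b assume b: "b \<in> {..<k}"
      have r: "real (n \<phi> b - 1) + 1 / 2 = real (n \<phi> b) - 1 / 2" using n_pos[OF \<phi>, of b] b by (simp add: of_nat_diff)
      have "(g\<^sup>2) powr (- (real (n \<phi> b) - 1 / 2)) = g powr (2 * - (real (n \<phi> b) - 1 / 2))"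
        using g by (simp add: powr_powr flip: powr_numeral)
      also have "2 * - (real (n \<phi> b) - 1 / 2) = 1 - 2 * real (n \<phi> b)" by simp
      finally show "(\<integral>\<^sup>+y. ennreal y ^ (n \<phi> b - 1) * ennreal (exp (- g\<^sup>2 * y)) \<partial>sblevy)
        = ennreal (Gamma (real (n \<phi> b) - 1 / 2) / (2 * sqrt pi) * g powr (1 - 2 * real (n \<phi> b)))"
        using sblevy_moment[of "g\<^sup>2" "n \<phi> b - 1"] g unfolding r by simp
    qed
    also have "\<dots> = ennreal (\<Prod>b<k. Gamma (real (n \<phi> b) - 1 / 2) / (2 * sqrt pi) * g powr (1 - 2 * real (n \<phi> b)))"
    proof (rule prod_ennreal)
      fix b assume "b \<in> {..<k}"
      then have "0 < real (n \<phi> b) - 1 / 2" using n_pos[OF \<phi>, of b] by simp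
      then show "0 \<le> Gamma (real (n \<phi> b) - 1 / 2) / (2 * sqrt pi) * g powr (1 - 2 * real (n \<phi> b))"
        by (simp add: less_imp_le Gamma_real_pos)
    qed
    also have "(\<Prod>b<k. Gamma (real (n \<phi> b) - 1 / 2) / (2 * sqrt pi) * g powr (1 - 2 * real (n \<phi> b))) = c\<phi> \<phi> * g powr (real k - 2 * real m)"
    proof -
      have "(\<Sum>b<k. n \<phi> b) = m"
        using \<phi> sum.group[of "{1..m}" "{..<k}" \<phi> "\<lambda>_. 1 :: nat"] by (simp add: n_def surjections_def)
      then have "(\<Sum>b<k. 1 - 2 * real (n \<phi> b)) = real k - 2 * real m"
        by (simp add: sum_subtractf sum_distrib_left[symmetric] flip: of_nat_sum)
      then have "(\<Prod>b<k. g powr (1 - 2 * real (n \<phi> b))) = g powr (real k - 2 * real m)"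
        using g by (simp add: powr_sum[symmetric])
      then show ?thesis unfolding c\<phi>_def prod.distrib by simp
    qed
    finally show ?thesis using c\<phi>0[OF \<phi>] by (simp add: ennreal_mult[symmetric])
  qed
  define c where "c = (\<Sum>\<phi>\<in>surjections m k. c\<phi> \<phi>) / fact k"
  show ?thesis
  proof (rule that[of c])
    show "0 \<le> c" unfolding c_def by (intro divide_nonneg_pos sum_nonneg c\<phi>0) auto
    fix g :: real assume g: "0 < g"
    let ?X = "\<integral>\<^sup>+\<omega>. ennreal (exp (- g\<^sup>2 * S \<omega>)) * block_weight m k (A \<omega>) \<partial>M"
    have bm: "(\<lambda>\<omega>. block_weight m k (A \<omega>)) \<in> borel_measurable M"
      by (rule measurable_compose[OF A_measurable block_weight_measurable])
    have im: "(\<lambda>\<omega>. \<integral>\<^sup>+\<kappa>. (if inj_on \<kappa> {..<k} then \<Prod>b<k. ennreal (A \<omega> (\<kappa> b)) ^ n \<phi> b else 0) \<partial>count_space (tuples k)) \<in> borel_measurable M" for \<phi>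
      by (rule borel_measurable_nn_integral_countable[OF countable_tuples]) measurable
    have "fact k * ?X = (\<integral>\<^sup>+\<omega>. ennreal (exp (- g\<^sup>2 * S \<omega>)) * (fact k * block_weight m k (A \<omega>)) \<partial>M)"
      using bm by (subst nn_integral_cmult[symmetric]) (auto simp: mult_ac)
    also have "\<dots> = (\<integral>\<^sup>+\<omega>. (\<Sum>\<phi>\<in>surjections m k. ennreal (exp (- g\<^sup>2 * S \<omega>)) * (?W \<phi> \<omega>)) \<partial>M)"
      unfolding block_weight_surjections sum_distrib_left n_def ..
    also have "\<dots> = (\<Sum>\<phi>\<in>surjections m k. \<integral>\<^sup>+\<omega>. ennreal (exp (- g\<^sup>2 * S \<omega>)) * (?W \<phi> \<omega>) \<partial>M)"
      using im by (intro nn_integral_sum) measurable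
    also have "\<dots> = (\<Sum>\<phi>\<in>surjections m k. ennreal (c\<phi> \<phi> * g powr (real k - 2 * real m) * exp (- g)))"
      by (intro sum.cong refl factor g)
    also have "\<dots> = ennreal (\<Sum>\<phi>\<in>surjections m k. c\<phi> \<phi> * g powr (real k - 2 * real m) * exp (- g))"
      by (intro sum_ennreal mult_nonneg_nonneg c\<phi>0) auto
    also have "(\<Sum>\<phi>\<in>surjections m k. c\<phi> \<phi> * g powr (real k - 2 * real m) * exp (- g)) = fact k * (c * g powr (real k - 2 * real m) * exp (- g))"
      by (simp add: c_def sum_distrib_right)
    finally have eq: "ennreal (fact k) * ?X = ennreal (fact k * (c * g powr (real k - 2 * real m) * exp (- g)))"
      by (metis ennreal_of_nat_eq_real_of_nat of_nat_fact)
    have "?X = ennreal (1 / fact k) * (ennreal (fact k) * ?X)"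
      by (simp add: mult.assoc[symmetric] ennreal_mult[symmetric])
    also have "\<dots> = ennreal (c * g powr (real k - 2 * real m) * exp (- g))"
      unfolding eq using \<open>0 \<le> c\<close> by (simp add: ennreal_mult[symmetric])
    finally show "?X = ennreal (c * g powr (real k - 2 * real m) * exp (- g))" .
  qed
qed

end

section \<open>Mixing over the number of blocks\<close>

lemma distr_nat_density:
  fixes \<kappa> :: "nat measure"
  assumes "sets \<kappa> = UNIV"
  shows "\<kappa> = density (count_space UNIV) (\<lambda>k. emeasure \<kappa> {k})"
proof (rule measure_eqI_countable[of _ UNIV])
  fix k :: nat
  have "emeasure (density (count_space UNIV) (\<lambda>k. emeasure \<kappa> {k})) {k} = (\<integral>\<^sup>+l. emeasure \<kappa> {l} * indicator {k} l \<partial>count_space UNIV)"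
    by (rule emeasure_density) auto
  also have "\<dots> = emeasure \<kappa> {k}" by (subst nn_integral_indicator_singleton) auto
  finally show "emeasure \<kappa> {k} = emeasure (density (count_space UNIV) (\<lambda>k. emeasure \<kappa> {k})) {k}" by simp
qed (use assms in auto)

text \<open>For a shape \<open>a \<le> 0\<close> this is not a probability density, and the value of \<open>Gamma a\<close> is without
  significance.  Such a shape is met only for \<open>k = 0 < m\<close>, a number of blocks of probability \<open>0\<close>.\<close>

definition gamma_density :: "real \<Rightarrow> real \<Rightarrow> real" where
  "gamma_density a x = (if x > 0 then x powr (a - 1) * exp (- x) / Gamma a else 0)"

lemma gamma_density_measurable[measurable]: "gamma_density a \<in> borel_measurable borel"
  unfolding gamma_density_def[abs_def] by measurable

context stable_half
begin

lemma sum_A: "AE \<omega> in M. (\<integral>\<^sup>+k. ennreal (A \<omega> k) \<partial>count_space UNIV) = ennreal (S \<omega>) \<and> 0 < S \<omega> \<and> (\<forall>k. 0 \<le> A \<omega> k)"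
  using AE_pure_jump_path
proof eventually_elim
  case (elim \<omega>)
  then obtain \<tau> where "pure_jump_path (\<lambda>t. \<xi> t \<omega>) (A \<omega>) \<tau> (S \<omega>)" by blast
  then interpret pure_jump_path "\<lambda>t. \<xi> t \<omega>" "A \<omega>" \<tau> "S \<omega>" .
  show ?case using ennreal_sum_a s_pos a_pos by (auto intro: less_imp_le)
qed

end

locale mixed_setting = stable_half_PD M S f \<xi> A PD_cond
  for M :: "'w measure" and S f \<xi> A PD_cond +
  fixes m :: nat and \<theta> :: real
  assumes \<theta>: "- 1 / 2 < \<theta>" "0 < real m + \<theta>"
begin

definition c\<theta> :: real where "c\<theta> = (\<integral>\<omega>. S \<omega> powr (- \<theta>) \<partial>M)"

lemma c\<theta>_nonneg: "0 \<le> c\<theta>" unfolding c\<theta>_def by simp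

text \<open>Up to the factor \<open>g\<^bsup>2(m+\<theta>)-1\<^esup>\<close> and a constant this is the joint density of \<open>(K, G)\<close> at \<open>(k, g)\<close>.\<close>

definition D :: "nat \<Rightarrow> real \<Rightarrow> ennreal" where
  "D k g = (\<integral>\<^sup>+\<omega>. ennreal (exp (- g\<^sup>2 * S \<omega>)) * block_weight m k (A \<omega>) \<partial>M)"

lemma block_weight_A[measurable]: "(\<lambda>\<omega>. block_weight m k (A \<omega>)) \<in> borel_measurable M"
  by (rule measurable_compose[OF A_measurable block_weight_measurable])

lemma D_zero: "0 < m \<Longrightarrow> D 0 g = 0"
  unfolding D_def by (simp add: block_weight_zero)

lemma D_measurable[measurable]: "D k \<in> borel_measurable borel"
  unfolding D_def[abs_def] by measurable

lemma sum_D: "(\<integral>\<^sup>+k. D k g \<partial>count_space UNIV) = (\<integral>\<^sup>+\<omega>. ennreal (S \<omega> ^ m * exp (- g\<^sup>2 * S \<omega>)) \<partial>M)"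
proof -
  interpret MC: pair_sigma_finite M "count_space (UNIV :: nat set)"
    by (intro pair_sigma_finite.intro sigma_finite_measure_axioms sigma_finite_measure_count_space)
  have "(\<integral>\<^sup>+k. D k g \<partial>count_space UNIV) = (\<integral>\<^sup>+\<omega>. \<integral>\<^sup>+k. ennreal (exp (- g\<^sup>2 * S \<omega>)) * block_weight m k (A \<omega>) \<partial>count_space UNIV \<partial>M)"
    unfolding D_def by (rule MC.Fubini', rule measurable_pair_countable2) auto
  also have "\<dots> = (\<integral>\<^sup>+\<omega>. ennreal (S \<omega> ^ m * exp (- g\<^sup>2 * S \<omega>)) \<partial>M)"
  proof (rule nn_integral_cong_AE)
    show "AE \<omega> in M. (\<integral>\<^sup>+k. ennreal (exp (- g\<^sup>2 * S \<omega>)) * block_weight m k (A \<omega>) \<partial>count_space UNIV) = ennreal (S \<omega> ^ m * exp (- g\<^sup>2 * S \<omega>))"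
      using sum_A
    proof eventually_elim
      case (elim \<omega>)
      have "(\<integral>\<^sup>+k. ennreal (exp (- g\<^sup>2 * S \<omega>)) * block_weight m k (A \<omega>) \<partial>count_space UNIV)
        = ennreal (exp (- g\<^sup>2 * S \<omega>)) * (\<integral>\<^sup>+k. block_weight m k (A \<omega>) \<partial>count_space UNIV)"
        by (rule nn_integral_cmult) simp
      also have "\<dots> = ennreal (S \<omega> ^ m * exp (- g\<^sup>2 * S \<omega>))"
        using elim by (simp add: sum_block_weight ennreal_power ennreal_mult[symmetric] mult.commute)
      finally show ?case .
    qed
  qed
  finally show ?thesis .
qed

lemma norm_const_pos:
  assumes g: "0 < g"
  shows "ennreal (norm_const m (g\<^sup>2)) = (\<integral>\<^sup>+\<omega>. ennreal (S \<omega> ^ m * exp (- g\<^sup>2 * S \<omega>)) \<partial>M)" and "0 < norm_const m (g\<^sup>2)"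
proof -
  have bnd: "AE \<omega> in M. norm (S \<omega> ^ m * exp (- g\<^sup>2 * S \<omega>)) \<le> fact m / (g\<^sup>2) ^ m"
    using S_pos
  proof eventually_elim
    case (elim \<omega>)
    have "(g\<^sup>2 * S \<omega>) ^ m \<le> fact m * exp (g\<^sup>2 * S \<omega>)" using elim by (intro power_le_fact_exp) auto
    then show ?case using elim g by (simp add: power_mult_distrib exp_minus field_simps)
  qed
  then have int: "integrable M (\<lambda>\<omega>. S \<omega> ^ m * exp (- g\<^sup>2 * S \<omega>))" by (intro integrable_const_bound) auto
  have nn: "AE \<omega> in M. 0 \<le> S \<omega> ^ m * exp (- g\<^sup>2 * S \<omega>)" using S_pos by (auto elim!: eventually_mono)
  show "ennreal (norm_const m (g\<^sup>2)) = (\<integral>\<^sup>+\<omega>. ennreal (S \<omega> ^ m * exp (- g\<^sup>2 * S \<omega>)) \<partial>M)"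
    unfolding norm_const_def using nn_integral_eq_integral[OF int nn] by simp
  have "norm_const m (g\<^sup>2) \<noteq> 0"
  proof
    assume "norm_const m (g\<^sup>2) = 0"
    then have "AE \<omega> in M. S \<omega> ^ m * exp (- g\<^sup>2 * S \<omega>) = 0"
      unfolding norm_const_def using integral_nonneg_eq_0_iff_AE[OF int nn] by simp
    with S_pos have "AE \<omega> in M. False" by eventually_elim auto
    then show False by (simp add: AE_False)
  qed
  then show "0 < norm_const m (g\<^sup>2)" using norm_const_nonneg[of m "g\<^sup>2"] by simp
qed

text \<open>The constant in the representation of \<open>t\<^bsup>-(m+\<theta>)\<^esup>\<close> as the integral of \<open>g\<^bsup>2(m+\<theta>)-1\<^esup> exp (- g\<^sup>2 t)\<close> over \<open>g > 0\<close>.\<close>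

definition \<gamma> :: ennreal where "\<gamma> = ennreal (Gamma (real m + \<theta>) / 2)"

lemma \<gamma>: "\<gamma> \<noteq> 0" "\<gamma> \<noteq> \<infinity>"
  unfolding \<gamma>_def using Gamma_real_pos[OF \<theta>(2)] by auto

lemma \<gamma>_integral:
  assumes "0 < t"
  shows "(\<integral>\<^sup>+g. ennreal (g powr (2 * (real m + \<theta>) - 1)) * ennreal (exp (- g\<^sup>2 * t)) * indicator {0<..} g \<partial>lborel)
    = \<gamma> * ennreal (t powr (- (real m + \<theta>)))"
  using nn_integral_gauss_moment[OF \<theta>(2) assms] Gamma_real_pos[OF \<theta>(2)]
  unfolding \<gamma>_def by (simp add: ennreal_mult[symmetric] less_imp_le)

text \<open>The masses under \<open>PD(1/2, \<theta>)\<close> are those of \<open>A / S\<close> under the weight \<open>S\<^bsup>-\<theta>\<^esup>\<close>; scaling by \<open>S\<close> in a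
  sample of size \<open>m\<close> contributes \<open>S\<^bsup>-m\<^esup>\<close>.\<close>

lemma block_count_law:
  assumes sp: "species_sample N (PD_half M S f PD_cond \<theta>) P U Y"
  shows "emeasure N {\<omega> \<in> space N. card (partition_blocks m (Y \<omega>)) = k}
    = (\<integral>\<^sup>+\<omega>. ennreal (S \<omega> powr (- (real m + \<theta>)) / c\<theta>) * block_weight m k (A \<omega>) \<partial>M)"
    and "Y \<in> measurable N seq_space"
proof -
  have dP: "distr N seq_space P = PD_half M S f PD_cond \<theta>" using sp by (simp add: species_sample_def)
  have P: "P \<in> measurable N seq_space" using sp by (simp add: species_sample_def indep_rv_def)
  have law: "(\<integral>\<^sup>+\<omega>. \<Phi> (P \<omega>) \<partial>N) = (\<integral>\<^sup>+\<omega>. ennreal (S \<omega> powr (- \<theta>) / c\<theta>) * \<Phi> (\<lambda>k. A \<omega> k / S \<omega>) \<partial>M)"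
    if \<Phi>: "\<Phi> \<in> borel_measurable seq_space" for \<Phi>
  proof -
    have "(\<integral>\<^sup>+\<omega>. \<Phi> (P \<omega>) \<partial>N) = (\<integral>\<^sup>+p. \<Phi> p \<partial>distr N seq_space P)"
      by (rule nn_integral_distr[symmetric]) (use P \<Phi> in auto)
    also have "\<dots> = (\<integral>\<^sup>+\<omega>. ennreal (S \<omega> powr (- \<theta>) / c\<theta>) * \<Phi> (\<lambda>k. A \<omega> k / S \<omega>) \<partial>M)"
      unfolding dP PD_half_def c\<theta>_def[symmetric]
      by (rule nn_integral_tilt_bind) (auto simp: c\<theta>_nonneg \<Phi>)
    finally show ?thesis .
  qed
  define Q where "Q p = (\<integral>\<^sup>+k. ennreal (p k) \<partial>count_space UNIV)" for p :: "nat \<Rightarrow> real"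
  have Q[measurable]: "Q \<in> borel_measurable seq_space"
    unfolding Q_def by (rule borel_measurable_nn_integral_countable) (auto intro: measurable_compose[OF seq_component_measurable])
  \<comment> \<open>the event that the masses do not add up to \<open>1\<close>, which is null for \<open>A / S\<close> and hence for \<open>P\<close>\<close>
  define B where "B p = (if Q p = 1 then 0 else 1 :: ennreal)" for p
  have B[measurable]: "B \<in> borel_measurable seq_space" unfolding B_def by measurable
  have BA: "AE \<omega> in M. B (\<lambda>k. A \<omega> k / S \<omega>) = 0"
    using sum_A
  proof eventually_elim
    case (elim \<omega>)
    have "Q (\<lambda>k. A \<omega> k / S \<omega>) = (\<integral>\<^sup>+k. ennreal (1 / S \<omega>) * ennreal (A \<omega> k) \<partial>count_space UNIV)"
      unfolding Q_def using elim by (intro nn_integral_cong) (simp add: ennreal_mult[symmetric])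
    also have "\<dots> = ennreal (1 / S \<omega>) * ennreal (S \<omega>)"
      using elim by (subst nn_integral_cmult) simp_all
    also have "\<dots> = 1" using elim by (simp add: ennreal_mult[symmetric])
    finally show ?case by (simp add: B_def)
  qed
  have "(\<integral>\<^sup>+\<omega>. B (P \<omega>) \<partial>N) = (\<integral>\<^sup>+\<omega>. 0 \<partial>M)"
    unfolding law[OF B] by (rule nn_integral_cong_AE) (use BA in \<open>auto elim!: eventually_mono\<close>)
  then have "(\<integral>\<^sup>+\<omega>. B (P \<omega>) \<partial>N) = 0" by simp
  then have "AE \<omega> in N. B (P \<omega>) = 0"
    using measurable_compose[OF P B] by (simp add: nn_integral_0_iff_AE)
  then have P1: "AE \<omega> in N. (\<integral>\<^sup>+k. ennreal (P \<omega> k) \<partial>count_space UNIV) = 1"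
    by (rule eventually_mono) (auto simp: B_def Q_def split: if_splits)
  show "Y \<in> measurable N seq_space" by (rule species_sample_block_count(2)[OF sp P1 P])
  have "emeasure N {\<omega> \<in> space N. card (partition_blocks m (Y \<omega>)) = k} = (\<integral>\<^sup>+\<omega>. block_weight m k (P \<omega>) \<partial>N)"
    by (rule species_sample_block_count(1)[OF sp P1 P])
  also have "\<dots> = (\<integral>\<^sup>+\<omega>. ennreal (S \<omega> powr (- \<theta>) / c\<theta>) * block_weight m k (\<lambda>k. A \<omega> k / S \<omega>) \<partial>M)"
    by (rule law) simp
  also have "\<dots> = (\<integral>\<^sup>+\<omega>. ennreal (S \<omega> powr (- (real m + \<theta>)) / c\<theta>) * block_weight m k (A \<omega>) \<partial>M)"
  proof (rule nn_integral_cong_AE)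
    show "AE \<omega> in M. ennreal (S \<omega> powr (- \<theta>) / c\<theta>) * block_weight m k (\<lambda>k. A \<omega> k / S \<omega>)
      = ennreal (S \<omega> powr (- (real m + \<theta>)) / c\<theta>) * block_weight m k (A \<omega>)"
      using sum_A
    proof eventually_elim
      case (elim \<omega>)
      have "S \<omega> powr (- (real m + \<theta>)) = S \<omega> powr (- \<theta>) * S \<omega> powr (- real m)"
        unfolding powr_add[symmetric] by (rule arg_cong[where f="\<lambda>z. S \<omega> powr z"]) simp
      then have "ennreal (S \<omega> powr (- (real m + \<theta>)) / c\<theta>) = ennreal (S \<omega> powr (- \<theta>) / c\<theta>) * ennreal (S \<omega> powr (- real m))"
        using c\<theta>_nonneg by (simp add: ennreal_mult[symmetric])
      then show ?case using elim block_weight_scale[of "S \<omega>" "A \<omega>" m k] by (simp add: mult.assoc)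
    qed
  qed
  finally show "emeasure N {\<omega> \<in> space N. card (partition_blocks m (Y \<omega>)) = k}
    = (\<integral>\<^sup>+\<omega>. ennreal (S \<omega> powr (- (real m + \<theta>)) / c\<theta>) * block_weight m k (A \<omega>) \<partial>M)" .
qed

text \<open>Writing \<open>S\<^bsup>-(m+\<theta>)\<^esup>\<close> as an integral over \<open>h\<close> turns the probability \<open>p\<close> of \<open>k\<close> blocks, up to a constant, into
  \<open>\<integral> h\<^bsup>2(m+\<theta>)-1\<^esup> D k h dh\<close>.  Since \<open>h\<^bsup>2(m+\<theta>)-1\<^esup> D k h\<close> is a multiple of \<open>h\<^bsup>2\<theta>+k-1\<^esup> e\<^bsup>-h\<^esup>\<close>, normalising it
  gives exactly the Gamma density of \<open>G\<close> given \<open>K = k\<close>.\<close>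

lemma block_count_gamma:
  assumes p: "p = (\<integral>\<^sup>+\<omega>. ennreal (S \<omega> powr (- (real m + \<theta>)) / c\<theta>) * block_weight m k (A \<omega>) \<partial>M)"
    and g: "0 < g"
  shows "\<gamma> * (p * ennreal (gamma_density (2 * \<theta> + real k) g))
    = ennreal (1 / c\<theta>) * (ennreal (g powr (2 * (real m + \<theta>) - 1)) * D k g)"
proof -
  define e where "e = 2 * (real m + \<theta>) - 1"
  let ?E = "\<lambda>h \<omega>. (ennreal (h powr e) * ennreal (exp (- h\<^sup>2 * S \<omega>)) * indicator {0<..} h) * block_weight m k (A \<omega>)"
  interpret LM: pair_sigma_finite lborel M
    by (intro pair_sigma_finite.intro sigma_finite_lborel sigma_finite_measure_axioms)
  have \<gamma>p: "\<gamma> * p = ennreal (1 / c\<theta>) * (\<integral>\<^sup>+h. ennreal (h powr e) * D k h * indicator {0<..} h \<partial>lborel)"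
  proof -
    have "\<gamma> * p = (\<integral>\<^sup>+\<omega>. \<gamma> * (ennreal (S \<omega> powr (- (real m + \<theta>)) / c\<theta>) * block_weight m k (A \<omega>)) \<partial>M)"
      unfolding p by (rule nn_integral_cmult[symmetric]) measurable
    also have "\<dots> = (\<integral>\<^sup>+\<omega>. ennreal (1 / c\<theta>) * (\<integral>\<^sup>+h. (?E h \<omega>) \<partial>lborel) \<partial>M)"
    proof (rule nn_integral_cong_AE)
      show "AE \<omega> in M. \<gamma> * (ennreal (S \<omega> powr (- (real m + \<theta>)) / c\<theta>) * block_weight m k (A \<omega>))
        = ennreal (1 / c\<theta>) * (\<integral>\<^sup>+h. (?E h \<omega>) \<partial>lborel)"
        using S_pos
      proof eventually_elim
        case (elim \<omega>)
        have "(\<integral>\<^sup>+h. (?E h \<omega>) \<partial>lborel)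
          = \<gamma> * ennreal (S \<omega> powr (- (real m + \<theta>))) * block_weight m k (A \<omega>)"
          unfolding e_def \<gamma>_integral[OF elim, symmetric] by (rule nn_integral_multc) measurable
        moreover have "ennreal (S \<omega> powr (- (real m + \<theta>)) / c\<theta>) = ennreal (1 / c\<theta>) * ennreal (S \<omega> powr (- (real m + \<theta>)))"
          using c\<theta>_nonneg by (simp add: ennreal_mult[symmetric])
        ultimately show ?case by (simp add: mult_ac)
      qed
    qed
    also have "\<dots> = ennreal (1 / c\<theta>) * (\<integral>\<^sup>+\<omega>. \<integral>\<^sup>+h. (?E h \<omega>) \<partial>lborel \<partial>M)"
      by (rule nn_integral_cmult) measurable
    also have "(\<integral>\<^sup>+\<omega>. \<integral>\<^sup>+h. (?E h \<omega>) \<partial>lborel \<partial>M)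
      = (\<integral>\<^sup>+h. \<integral>\<^sup>+\<omega>. (?E h \<omega>) \<partial>M \<partial>lborel)"
      by (rule LM.Fubini') measurable
    also have "\<dots> = (\<integral>\<^sup>+h. ennreal (h powr e) * D k h * indicator {0<..} h \<partial>lborel)"
    proof (rule nn_integral_cong)
      fix h :: real
      have "(\<integral>\<^sup>+\<omega>. (?E h \<omega>) \<partial>M)
        = (\<integral>\<^sup>+\<omega>. (ennreal (h powr e) * indicator {0<..} h) * (ennreal (exp (- h\<^sup>2 * S \<omega>)) * block_weight m k (A \<omega>)) \<partial>M)"
        by (intro nn_integral_cong) (simp add: mult_ac)
      also have "\<dots> = (ennreal (h powr e) * indicator {0<..} h) * D k h"
        unfolding D_def by (rule nn_integral_cmult) measurable
      finally show "(\<integral>\<^sup>+\<omega>. (?E h \<omega>) \<partial>M)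
        = ennreal (h powr e) * D k h * indicator {0<..} h" by (simp add: mult_ac)
    qed
    finally show ?thesis .
  qed
  show ?thesis
  proof (cases "0 < 2 * \<theta> + real k")
    case False
    \<comment> \<open>a shape \<open>2 \<theta> + k \<le> 0\<close> forces \<open>\<theta> \<le> 0\<close>, thus \<open>m > 0\<close>, and then there is at least one block\<close>
    then have "k = 0" using \<theta>(1) by (cases k) auto
    then have "0 < m" using False \<theta>(2) by (cases m) auto
    then have "p = 0" "D k g = 0" using \<open>k = 0\<close> by (simp_all add: p block_weight_zero D_zero)
    then show ?thesis by simp
  next
    case True
    obtain c where c: "0 \<le> c" and Dc: "\<And>g. 0 < g \<Longrightarrow> D k g = ennreal (c * g powr (real k - 2 * real m) * exp (- g))"
      using block_laplace[of m k] unfolding D_def by blast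
    have eD: "ennreal (h powr e) * D k h = ennreal (c * (h powr (2 * \<theta> + real k - 1) * exp (- h)))" if h: "0 < h" for h
    proof -
      have "h powr (2 * \<theta> + real k - 1) = h powr e * h powr (real k - 2 * real m)"
        unfolding powr_add[symmetric] by (rule arg_cong[where f="\<lambda>z. h powr z"]) (simp add: e_def)
      then show ?thesis using c h by (simp add: Dc ennreal_mult[symmetric] mult_ac)
    qed
    have "(\<integral>\<^sup>+h. ennreal (h powr e) * D k h * indicator {0<..} h \<partial>lborel)
      = (\<integral>\<^sup>+h. ennreal c * (ennreal (h powr (2 * \<theta> + real k - 1) * exp (- 1 * h)) * indicator {0<..} h) \<partial>lborel)"
      using c by (intro nn_integral_cong) (simp add: indicator_def eD ennreal_mult)
    also have "\<dots> = ennreal c * ennreal (Gamma (2 * \<theta> + real k))"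
      using nn_integral_Gamma_scaled[OF True, of 1] by (subst nn_integral_cmult) simp_all
    finally have gp: "\<gamma> * p = ennreal (1 / c\<theta> * (c * Gamma (2 * \<theta> + real k)))"
      unfolding \<gamma>p using c c\<theta>_nonneg Gamma_real_pos[OF True] by (simp add: ennreal_mult[symmetric] less_imp_le)
    have "\<gamma> * (p * ennreal (gamma_density (2 * \<theta> + real k) g)) = ennreal (1 / c\<theta> * (c * Gamma (2 * \<theta> + real k))) * ennreal (gamma_density (2 * \<theta> + real k) g)"
      unfolding gp[symmetric] by (simp add: mult.assoc)
    also have "\<dots> = ennreal (1 / c\<theta> * (c * Gamma (2 * \<theta> + real k)) * gamma_density (2 * \<theta> + real k) g)"
      using c c\<theta>_nonneg Gamma_real_pos[OF True] by (intro ennreal_mult[symmetric]) (auto simp: gamma_density_def less_imp_le)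
    also have "1 / c\<theta> * (c * Gamma (2 * \<theta> + real k)) * gamma_density (2 * \<theta> + real k) g = 1 / c\<theta> * (c * (g powr (2 * \<theta> + real k - 1) * exp (- g)))"
      using g Gamma_real_pos[OF True] by (simp add: gamma_density_def)
    also have "ennreal \<dots> = ennreal (1 / c\<theta>) * (ennreal (g powr e) * D k g)"
      unfolding eD[OF g] using c c\<theta>_nonneg by (intro ennreal_mult) auto
    finally show ?thesis unfolding e_def .
  qed
qed

text \<open>Summing the joint density of \<open>(K, G)\<close> over \<open>k\<close> gives the density of \<open>G\<close>, which carries the factor
  \<open>E[S\<^sup>m exp (- g\<^sup>2 S)]\<close>.  This is the normalising constant of the density of \<open>S\<^bsub>1/2,m\<^esub>(g\<^sup>2)\<close>, and the integral over \<open>g\<close>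
  of what remains is a multiple of \<open>t\<^bsup>-\<theta>\<^esup>\<close>.\<close>

lemma mixed_L_law:
  assumes sp: "species_sample N (PD_half M S f PD_cond \<theta>) P U Y"
    and N': "prob_space N'" and K[measurable]: "K \<in> measurable N' (count_space UNIV)"
    and lawK: "distr N' (count_space UNIV) K = distr N (count_space UNIV) (\<lambda>\<omega>. card (partition_blocks m (Y \<omega>)))"
    and condG: "conditional_law N' (count_space UNIV) K borel G (\<lambda>k. gamma_law (2 * \<theta> + real k))"
    and condL: "conditional_law N' borel (\<lambda>\<omega>. (G \<omega>)\<^sup>2) borel L (L_law M S f m)"
  shows "distr N' borel L = distr (density levy_law (\<lambda>t. ennreal (t powr (- \<theta>) / c\<theta>))) borel (\<lambda>t. t powr (- 1 / 2) / sqrt 2)"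
proof (rule measure_eqI)
  interpret levy: prob_space levy_law by (rule prob_space_levy_law)
  interpret LL: pair_sigma_finite lborel levy_law
    by (intro pair_sigma_finite.intro sigma_finite_lborel levy.sigma_finite_measure_axioms)
  have G[measurable]: "G \<in> borel_measurable N'" and L[measurable]: "L \<in> borel_measurable N'"
    using condG condL by (auto simp: conditional_law_def)
  fix C assume "C \<in> sets (distr N' borel L)"
  then have C[measurable]: "C \<in> sets borel" by simp
  define \<psi> where "\<psi> t = t powr (- 1 / 2) / sqrt 2" for t :: real
  have \<psi>[measurable]: "\<psi> \<in> borel_measurable borel" unfolding \<psi>_def by measurable
  define p where "p k = emeasure (distr N' (count_space UNIV) K) {k}" for k
  define e where "e = 2 * (real m + \<theta>) - 1"
  let ?mix = "\<lambda>g. (\<integral>\<^sup>+k. p k * ennreal (gamma_density (2 * \<theta> + real k) g) \<partial>count_space UNIV)"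
  let ?E = "\<lambda>g t. (ennreal (g powr e) * ennreal (exp (- g\<^sup>2 * t)) * indicator {0<..} g) * (ennreal (t ^ m) * indicator C (\<psi> t))"
  have pk: "p k = (\<integral>\<^sup>+\<omega>. ennreal (S \<omega> powr (- (real m + \<theta>)) / c\<theta>) * block_weight m k (A \<omega>) \<partial>M)" for k
  proof -
    have "(\<lambda>\<omega>. card (partition_blocks m (Y \<omega>))) \<in> measurable N (count_space UNIV)"
      by (rule measurable_compose[OF block_count_law(2)[OF sp] measurable_card_partition_blocks])
    then have "p k = emeasure N {\<omega> \<in> space N. card (partition_blocks m (Y \<omega>)) = k}"
      unfolding p_def lawK by (subst emeasure_distr) (auto intro!: arg_cong[where f="emeasure N"])
    then show ?thesis using block_count_law(1)[OF sp] by simp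
  qed
  have norm_m[measurable]: "(\<lambda>z. norm_const m z) \<in> borel_measurable borel"
    unfolding norm_const_def by measurable
  define H where "H z = (\<integral>\<^sup>+t. ennreal (t ^ m * exp (- z * t) / norm_const m z) * indicator C (\<psi> t) \<partial>levy_law)" for z
  have H[measurable]: "H \<in> borel_measurable borel" unfolding H_def by measurable
  have emeasure_tilt: "emeasure (distr (density levy_law w) borel \<psi>) C = (\<integral>\<^sup>+t. w t * indicator C (\<psi> t) \<partial>levy_law)"
    if [measurable]: "w \<in> borel_measurable borel" for w
  proof -
    have "emeasure (distr (density levy_law w) borel \<psi>) C = (\<integral>\<^sup>+l. indicator C l \<partial>distr (density levy_law w) borel \<psi>)"
      by simp
    also have "\<dots> = (\<integral>\<^sup>+t. indicator C (\<psi> t) \<partial>density levy_law w)" by (rule nn_integral_distr) measurable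
    also have "\<dots> = (\<integral>\<^sup>+t. w t * indicator C (\<psi> t) \<partial>levy_law)" by (rule nn_integral_density) measurable
    finally show ?thesis .
  qed
  have HL: "emeasure (L_law M S f m z) C = H z" for z
    unfolding L_law_def tilted_law_eq \<psi>_def[symmetric] H_def by (rule emeasure_tilt) measurable
  have lawG: "distr N' borel G = density lborel (\<lambda>g. \<integral>\<^sup>+k. p k * ennreal (gamma_density (2 * \<theta> + real k) g) \<partial>count_space UNIV)"
  proof (rule measure_eqI)
    interpret LC: pair_sigma_finite lborel "count_space (UNIV :: nat set)"
      by (intro pair_sigma_finite.intro sigma_finite_lborel sigma_finite_measure_count_space)
    fix B assume "B \<in> sets (distr N' borel G)"
    then have B[measurable]: "B \<in> sets borel" by simp
    have "emeasure (distr N' borel G) B = emeasure N' {\<omega> \<in> space N'. K \<omega> \<in> UNIV \<and> G \<omega> \<in> B}"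
      by (subst emeasure_distr) (auto intro!: arg_cong[where f="emeasure N'"])
    also have "\<dots> = (\<integral>\<^sup>+k\<in>UNIV. emeasure (gamma_law (2 * \<theta> + real k)) B \<partial>distr N' (count_space UNIV) K)"
      by (rule condG[unfolded conditional_law_def, THEN conjunct2, THEN conjunct2, rule_format]) auto
    also have "\<dots> = (\<integral>\<^sup>+k. p k * emeasure (gamma_law (2 * \<theta> + real k)) B \<partial>count_space UNIV)"
      by (subst distr_nat_density) (auto simp: nn_integral_density p_def)
    also have "\<dots> = (\<integral>\<^sup>+k. \<integral>\<^sup>+g. p k * ennreal (gamma_density (2 * \<theta> + real k) g) * indicator B g \<partial>lborel \<partial>count_space UNIV)"
      unfolding gamma_law_def gamma_density_def[symmetric]
      by (intro nn_integral_cong) (auto simp: emeasure_density nn_integral_cmult[symmetric] mult.assoc)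
    also have "\<dots> = (\<integral>\<^sup>+g. \<integral>\<^sup>+k. p k * ennreal (gamma_density (2 * \<theta> + real k) g) * indicator B g \<partial>count_space UNIV \<partial>lborel)"
      by (rule LC.Fubini', rule measurable_pair_countable2) auto
    also have "\<dots> = emeasure (density lborel (\<lambda>g. \<integral>\<^sup>+k. p k * ennreal (gamma_density (2 * \<theta> + real k) g) \<partial>count_space UNIV)) B"
      by (subst emeasure_density) (auto intro!: borel_measurable_nn_integral_countable nn_integral_cong nn_integral_multc)
    finally show "emeasure (distr N' borel G) B = emeasure (density lborel (\<lambda>g. \<integral>\<^sup>+k. p k * ennreal (gamma_density (2 * \<theta> + real k) g) \<partial>count_space UNIV)) B" .
  qed simp
  have pm[measurable]: "(\<lambda>g. \<integral>\<^sup>+k. p k * ennreal (gamma_density (2 * \<theta> + real k) g) \<partial>count_space UNIV) \<in> borel_measurable borel"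
    by (rule borel_measurable_nn_integral_countable) auto
  have inner: "\<gamma> * ((?mix g) * H (g\<^sup>2))
     = ennreal (1 / c\<theta>) * (\<integral>\<^sup>+t. (?E g t) \<partial>levy_law)" for g
  proof (cases "0 < g")
    case False
    then show ?thesis by (simp add: gamma_density_def)
  next
    case True
    note nc = norm_const_pos[OF True]
    have "\<gamma> * (?mix g)
      = (\<integral>\<^sup>+k. \<gamma> * (p k * ennreal (gamma_density (2 * \<theta> + real k) g)) \<partial>count_space UNIV)"
      by (rule nn_integral_cmult[symmetric]) simp
    also have "\<dots> = (\<integral>\<^sup>+k. (ennreal (1 / c\<theta>) * ennreal (g powr e)) * D k g \<partial>count_space UNIV)"
      unfolding e_def by (intro nn_integral_cong) (simp only: block_count_gamma[OF pk True] mult.assoc)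
    also have "\<dots> = (ennreal (1 / c\<theta>) * ennreal (g powr e)) * (\<integral>\<^sup>+k. D k g \<partial>count_space UNIV)"
      by (rule nn_integral_cmult) simp
    also have "\<dots> = (ennreal (1 / c\<theta>) * ennreal (g powr e)) * ennreal (norm_const m (g\<^sup>2))"
      unfolding sum_D nc(1) ..
    finally have 1: "\<gamma> * ((?mix g) * H (g\<^sup>2))
      = (ennreal (1 / c\<theta>) * ennreal (g powr e)) * (ennreal (norm_const m (g\<^sup>2)) * H (g\<^sup>2))"
      by (simp only: mult.assoc[symmetric])
    have "ennreal (norm_const m (g\<^sup>2)) * H (g\<^sup>2) = (\<integral>\<^sup>+t. ennreal (norm_const m (g\<^sup>2)) * (ennreal (t ^ m * exp (- g\<^sup>2 * t) / norm_const m (g\<^sup>2)) * indicator C (\<psi> t)) \<partial>levy_law)"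
      unfolding H_def by (rule nn_integral_cmult[symmetric]) measurable
    also have "\<dots> = (\<integral>\<^sup>+t. ennreal (exp (- g\<^sup>2 * t)) * (ennreal (t ^ m) * indicator C (\<psi> t)) \<partial>levy_law)"
    proof (rule nn_integral_cong_AE, use levy_law_pos in eventually_elim)
      fix t :: real assume t: "0 < t"
      have "ennreal (norm_const m (g\<^sup>2)) * ennreal (t ^ m * exp (- g\<^sup>2 * t) / norm_const m (g\<^sup>2)) = ennreal (exp (- g\<^sup>2 * t)) * ennreal (t ^ m)"
        using nc(2) t by (simp add: ennreal_mult[symmetric] ennreal_mult'[symmetric] mult.commute)
      then show "ennreal (norm_const m (g\<^sup>2)) * (ennreal (t ^ m * exp (- g\<^sup>2 * t) / norm_const m (g\<^sup>2)) * indicator C (\<psi> t))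
        = ennreal (exp (- g\<^sup>2 * t)) * (ennreal (t ^ m) * indicator C (\<psi> t))"
        by (simp only: mult.assoc[symmetric])
    qed
    finally have 2: "ennreal (norm_const m (g\<^sup>2)) * H (g\<^sup>2) = (\<integral>\<^sup>+t. ennreal (exp (- g\<^sup>2 * t)) * (ennreal (t ^ m) * indicator C (\<psi> t)) \<partial>levy_law)" .
    have "ennreal (g powr e) * (ennreal (norm_const m (g\<^sup>2)) * H (g\<^sup>2))
      = (\<integral>\<^sup>+t. (?E g t) \<partial>levy_law)"
      unfolding 2 using True by (subst nn_integral_cmult[symmetric]) (auto simp: mult.assoc)
    then show ?thesis unfolding 1 by (simp only: mult.assoc)
  qed
  have "emeasure (distr N' borel L) C = emeasure N' {\<omega> \<in> space N'. (G \<omega>)\<^sup>2 \<in> UNIV \<and> L \<omega> \<in> C}"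
    by (subst emeasure_distr) (auto intro!: arg_cong[where f="emeasure N'"])
  also have "\<dots> = (\<integral>\<^sup>+z\<in>UNIV. emeasure (L_law M S f m z) C \<partial>distr N' borel (\<lambda>\<omega>. (G \<omega>)\<^sup>2))"
    by (rule condL[unfolded conditional_law_def, THEN conjunct2, THEN conjunct2, rule_format]) auto
  also have "\<dots> = (\<integral>\<^sup>+\<omega>. H ((G \<omega>)\<^sup>2) \<partial>N')"
    unfolding HL by (subst nn_integral_distr) auto
  also have "\<dots> = (\<integral>\<^sup>+g. H (g\<^sup>2) \<partial>distr N' borel G)"
    by (subst nn_integral_distr) auto
  also have "\<dots> = (\<integral>\<^sup>+g. (?mix g) * H (g\<^sup>2) \<partial>lborel)"
    unfolding lawG by (rule nn_integral_density) measurable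
  finally have "\<gamma> * emeasure (distr N' borel L) C
    = (\<integral>\<^sup>+g. \<gamma> * ((?mix g) * H (g\<^sup>2)) \<partial>lborel)"
    by (subst nn_integral_cmult) auto
  also have "\<dots> = ennreal (1 / c\<theta>) * (\<integral>\<^sup>+g. \<integral>\<^sup>+t. (?E g t) \<partial>levy_law \<partial>lborel)"
    unfolding inner by (rule nn_integral_cmult) measurable
  also have "(\<integral>\<^sup>+g. \<integral>\<^sup>+t. (?E g t) \<partial>levy_law \<partial>lborel)
    = (\<integral>\<^sup>+t. \<integral>\<^sup>+g. (?E g t) \<partial>lborel \<partial>levy_law)"
    by (rule LL.Fubini'[symmetric]) measurable
  also have "\<dots> = (\<integral>\<^sup>+t. \<gamma> * (ennreal (t powr (- \<theta>)) * indicator C (\<psi> t)) \<partial>levy_law)"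
  proof (rule nn_integral_cong_AE, use levy_law_pos in eventually_elim)
    fix t :: real assume t: "0 < t"
    have "t powr (- \<theta>) = t powr (- (real m + \<theta>)) * t powr (real m)" unfolding powr_add[symmetric] by simp
    then have "ennreal (t powr (- (real m + \<theta>))) * ennreal (t ^ m) = ennreal (t powr (- \<theta>))"
      using t by (simp add: ennreal_mult[symmetric] powr_realpow)
    moreover have "(\<integral>\<^sup>+g. (?E g t) \<partial>lborel)
      = (\<gamma> * ennreal (t powr (- (real m + \<theta>)))) * (ennreal (t ^ m) * indicator C (\<psi> t))"
      unfolding e_def \<gamma>_integral[OF t, symmetric] by (rule nn_integral_multc) measurable
    ultimately show "(\<integral>\<^sup>+g. (?E g t) \<partial>lborel)
      = \<gamma> * (ennreal (t powr (- \<theta>)) * indicator C (\<psi> t))"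
      by (metis mult.assoc)
  qed
  also have "\<dots> = \<gamma> * (\<integral>\<^sup>+t. ennreal (t powr (- \<theta>)) * indicator C (\<psi> t) \<partial>levy_law)"
    by (rule nn_integral_cmult) measurable
  also have "ennreal (1 / c\<theta>) * \<dots> = \<gamma> * (ennreal (1 / c\<theta>) * (\<integral>\<^sup>+t. ennreal (t powr (- \<theta>)) * indicator C (\<psi> t) \<partial>levy_law))"
    by (simp add: mult_ac)
  finally have "emeasure (distr N' borel L) C = ennreal (1 / c\<theta>) * (\<integral>\<^sup>+t. ennreal (t powr (- \<theta>)) * indicator C (\<psi> t) \<partial>levy_law)"
    using \<gamma> by (simp add: ennreal_mult_cancel_left)
  also have "\<dots> = (\<integral>\<^sup>+t. ennreal (t powr (- \<theta>) / c\<theta>) * indicator C (\<psi> t) \<partial>levy_law)"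
    using c\<theta>_nonneg by (subst nn_integral_cmult[symmetric]) (auto intro!: nn_integral_cong simp: ennreal_mult[symmetric] mult.assoc[symmetric])
  also have "\<dots> = emeasure (distr (density levy_law (\<lambda>t. ennreal (t powr (- \<theta>) / c\<theta>))) borel \<psi>) C"
    by (rule emeasure_tilt[symmetric]) measurable
  finally show "emeasure (distr N' borel L) C = emeasure (distr (density levy_law (\<lambda>t. ennreal (t powr (- \<theta>) / c\<theta>))) borel (\<lambda>t. t powr (- 1 / 2) / sqrt 2)) C"
    unfolding \<psi>_def .
qed simp

end

section \<open>Beta-gamma algebra\<close>

text \<open>The Gamma density with shape \<open>a\<close> and rate \<open>1/2\<close>; squared normal variables have shape \<open>1/2\<close>.\<close>

definition half_rate_gamma :: "real \<Rightarrow> real \<Rightarrow> real" where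
  "half_rate_gamma a v = (if 0 < v then v powr (a - 1) * exp (- v / 2) / (Gamma a * 2 powr a) else 0)"

abbreviation half_rate_gamma_law :: "real \<Rightarrow> real measure" where
  "half_rate_gamma_law a \<equiv> density lborel (\<lambda>v. ennreal (half_rate_gamma a v))"

lemma half_rate_gamma_measurable[measurable]: "half_rate_gamma a \<in> borel_measurable borel"
  unfolding half_rate_gamma_def[abs_def] by measurable

lemma half_rate_gamma_nonneg: "0 < a \<Longrightarrow> 0 \<le> half_rate_gamma a v"
  using Gamma_real_pos[of a] by (simp add: half_rate_gamma_def less_imp_le)

lemma prob_space_half_rate_gamma_law:
  assumes a: "0 < a"
  shows "prob_space (half_rate_gamma_law a)"
proof (rule prob_spaceI)
  have "emeasure (half_rate_gamma_law a) (space (half_rate_gamma_law a)) = (\<integral>\<^sup>+v. ennreal (half_rate_gamma a v) \<partial>lborel)"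
    by (simp add: emeasure_density)
  also have "\<dots> = (\<integral>\<^sup>+v. ennreal (1 / (Gamma a * 2 powr a)) * (ennreal (v powr (a - 1) * exp (- (1 / 2) * v)) * indicator {0<..} v) \<partial>lborel)"
    using Gamma_real_pos[OF a] by (intro nn_integral_cong) (simp add: half_rate_gamma_def ennreal_mult[symmetric] indicator_def less_imp_le)
  also have "\<dots> = ennreal (1 / (Gamma a * 2 powr a)) * ennreal (Gamma a * (1 / 2) powr (- a))"
    using a by (subst nn_integral_cmult, simp, subst nn_integral_Gamma_scaled) simp_all
  also have "\<dots> = ennreal (1 / (Gamma a * 2 powr a) * (Gamma a * (1 / 2) powr (- a)))"
    using Gamma_real_pos[OF a] by (intro ennreal_mult[symmetric]) (auto simp: less_imp_le)
  also have "1 / (Gamma a * 2 powr a) * (Gamma a * (1 / 2) powr (- a)) = 1"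
    using Gamma_real_pos[OF a] by (simp add: powr_minus powr_divide)
  finally show "emeasure (half_rate_gamma_law a) (space (half_rate_gamma_law a)) = 1" by simp
qed

definition beta_half_density :: "real \<Rightarrow> real \<Rightarrow> real" where
  "beta_half_density a x = (if 0 < x \<and> x < 1 then x powr (a - 1) * (1 - x) powr (1 / 2 - 1) / Beta a (1 / 2) else 0)"

lemma beta_half_density_measurable[measurable]: "beta_half_density a \<in> borel_measurable borel"
  unfolding beta_half_density_def[abs_def] by measurable

lemma beta_law_half: "beta_law a (1 / 2) = density lborel (\<lambda>x. ennreal (beta_half_density a x))"
  unfolding beta_law_def beta_half_density_def ..

lemma sets_beta_law[simp, measurable_cong]: "sets (beta_law a b) = sets borel"
  by (simp add: beta_law_def)

lemma beta_half_density_nonneg: "0 < a \<Longrightarrow> 0 \<le> beta_half_density a x"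
  using Gamma_real_pos[of a] Gamma_real_pos[of "a + 1 / 2"]
  by (simp add: beta_half_density_def Beta_def Gamma_one_half_real less_imp_le)

lemma beta_gamma_identity:
  assumes a: "0 < a" and z: "0 < z"
  shows "z * (half_rate_gamma a (z * w) * chisq_density (z - z * w)) = beta_half_density a w * half_rate_gamma (a + 1 / 2) z"
proof (cases "0 < w \<and> w < 1")
  case True
  have G: "0 < Gamma a" "0 < Gamma (a + 1 / 2)" using a by (auto intro!: Gamma_real_pos)
  have zw: "0 < z * w" "0 < z - z * w" using True z by (auto simp: algebra_simps)
  have e: "exp (- (z * w) / 2) * exp (- (z - z * w) / 2) = exp (- z / 2)"
    unfolding exp_add[symmetric] by (rule arg_cong[where f=exp]) (simp add: field_simps)
  have p1: "(z * w) powr (a - 1) = z powr (a - 1) * w powr (a - 1)" using z True by (simp add: powr_mult)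
  have p2: "(z - z * w) powr (- 1 / 2) = z powr (- 1 / 2) * (1 - w) powr (- 1 / 2)"
  proof -
    have "z - z * w = z * (1 - w)" by (simp add: algebra_simps)
    then show ?thesis using z True by (simp add: powr_mult)
  qed
  have p3: "z * (z powr (a - 1) * z powr (- 1 / 2)) = z powr (a + 1 / 2 - 1)"
  proof -
    have "z * (z powr (a - 1) * z powr (- 1 / 2)) = z powr 1 * z powr (a - 1) * z powr (- 1 / 2)" using z by simp
    also have "\<dots> = z powr (1 + (a - 1) + - 1 / 2)" unfolding powr_add by simp
    finally show ?thesis by (simp add: add.commute)
  qed
  have p4: "(2::real) powr (a + 1 / 2) = 2 powr a * sqrt 2" by (simp add: powr_add powr_half_sqrt)
  have L: "z * (half_rate_gamma a (z * w) * chisq_density (z - z * w))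
     = (z * (z powr (a - 1) * z powr (- 1 / 2))) * (w powr (a - 1) * (1 - w) powr (- 1 / 2)) * (exp (- (z * w) / 2) * exp (- (z - z * w) / 2))
       / (Gamma a * 2 powr a * sqrt (2 * pi))"
    using zw unfolding half_rate_gamma_def chisq_density_def p1 p2 by (simp add: mult_ac)
  have R: "beta_half_density a w * half_rate_gamma (a + 1 / 2) z
     = z powr (a + 1 / 2 - 1) * (w powr (a - 1) * (1 - w) powr (1 / 2 - 1)) * exp (- z / 2) / (Gamma a * 2 powr a * sqrt (2 * pi))"
  proof -
    have "Beta a (1 / 2) = Gamma a * sqrt pi / Gamma (a + 1 / 2)" by (simp add: Beta_def Gamma_one_half_real)
    then have "beta_half_density a w * half_rate_gamma (a + 1 / 2) z
      = (w powr (a - 1) * (1 - w) powr (1 / 2 - 1)) / (Gamma a * sqrt pi / Gamma (a + 1 / 2))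
        * (z powr (a + 1 / 2 - 1) * exp (- z / 2) / (Gamma (a + 1 / 2) * (2 powr a * sqrt 2)))"
      using True z by (simp only: beta_half_density_def half_rate_gamma_def p4 if_True simp_thms)
    moreover have "u / (A * B / C) * (v * x / (C * (E * F))) = v * u * x / (A * E * (F * B))"
      if "C \<noteq> 0" for u v x A B C E F :: real
      using that by (simp add: divide_simps)
    ultimately show ?thesis using G(2) unfolding real_sqrt_mult by (metis less_irrefl)
  qed
  show ?thesis unfolding L R e p3 by simp
next
  case False
  then have "beta_half_density a w = 0" by (auto simp: beta_half_density_def)
  moreover have "half_rate_gamma a (z * w) * chisq_density (z - z * w) = 0"
  proof (cases "0 < w")
    case True
    then have "1 \<le> w" using False by simp
    then have "z \<le> z * w" using z by simp
    then show ?thesis by (simp add: chisq_density_def)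
  next
    case False
    then have "z * w \<le> 0" using z by (simp add: mult_nonneg_nonpos)
    then show ?thesis by (simp add: half_rate_gamma_def)
  qed
  ultimately show ?thesis by simp
qed

text \<open>For independent Gamma variables \<open>v\<close> and \<open>x\<close> with a common rate the ratio \<open>v / (v + x)\<close> and the sum \<open>v + x\<close> are independent, with Beta
  and Gamma laws.\<close>

lemma beta_gamma_step:
  fixes F :: "real \<Rightarrow> real \<Rightarrow> ennreal"
  assumes a: "0 < a" and F: "(\<lambda>(w, z). F w z) \<in> borel_measurable (borel \<Otimes>\<^sub>M borel)"
  shows "(\<integral>\<^sup>+v. \<integral>\<^sup>+x. F (v / (v + x)) (v + x) \<partial>sq_normal_law \<partial>half_rate_gamma_law a)
    = (\<integral>\<^sup>+w. \<integral>\<^sup>+z. F w z \<partial>half_rate_gamma_law (a + 1 / 2) \<partial>beta_law a (1 / 2))"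
proof -
  have Fp[measurable (raw)]: "(\<lambda>x. F (f x) (g x)) \<in> borel_measurable N" if "f \<in> borel_measurable N" "g \<in> borel_measurable N" for f g N
    using measurable_compose[OF measurable_Pair[OF that] F] by simp
  let ?B = "\<lambda>z w. ennreal (beta_half_density a w) * (ennreal (half_rate_gamma (a + 1 / 2) z) * F w z)"
  let ?G = "\<lambda>z v. ennreal (half_rate_gamma a v) * (ennreal (chisq_density (z - v)) * F (v / z) z)"
  have "(\<integral>\<^sup>+v. \<integral>\<^sup>+x. F (v / (v + x)) (v + x) \<partial>sq_normal_law \<partial>half_rate_gamma_law a)
    = (\<integral>\<^sup>+v. \<integral>\<^sup>+x. ennreal (half_rate_gamma a v) * (ennreal (chisq_density x) * F (v / (v + x)) (v + x)) \<partial>lborel \<partial>lborel)"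
    unfolding sq_normal_law_eq
    by (subst nn_integral_density) (auto simp: nn_integral_density nn_integral_cmult)
  also have "\<dots> = (\<integral>\<^sup>+v. \<integral>\<^sup>+z. (?G z v) \<partial>lborel \<partial>lborel)"
  proof (rule nn_integral_cong)
    fix v :: real
    show "(\<integral>\<^sup>+x. ennreal (half_rate_gamma a v) * (ennreal (chisq_density x) * F (v / (v + x)) (v + x)) \<partial>lborel)
      = (\<integral>\<^sup>+z. (?G z v) \<partial>lborel)"
      by (subst nn_integral_real_affine[where c=1 and t="- v"]) auto
  qed
  also have "\<dots> = (\<integral>\<^sup>+z. \<integral>\<^sup>+v. (?G z v) \<partial>lborel \<partial>lborel)"
    by (rule lborel_pair.Fubini') measurable
  also have "\<dots> = (\<integral>\<^sup>+z. \<integral>\<^sup>+w. (?B z w) \<partial>lborel \<partial>lborel)"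
  proof (rule nn_integral_cong)
    fix z :: real
    show "(\<integral>\<^sup>+v. (?G z v) \<partial>lborel)
      = (\<integral>\<^sup>+w. (?B z w) \<partial>lborel)"
    proof (cases "0 < z")
      case False
      have "(?G z v) = 0" for v
        using False by (cases "0 < v") (auto simp: half_rate_gamma_def chisq_density_def)
      then have "(\<integral>\<^sup>+v. (?G z v) \<partial>lborel) = 0"
        by (simp only: nn_integral_const mult_zero_left)
      then show ?thesis using False by (simp add: half_rate_gamma_def)
    next
      case True
      have "(\<integral>\<^sup>+v. (?G z v) \<partial>lborel)
        = ennreal z * (\<integral>\<^sup>+w. ennreal (half_rate_gamma a (z * w)) * (ennreal (chisq_density (z - z * w)) * F w z) \<partial>lborel)"
        using True by (subst nn_integral_real_affine[where c=z and t=0]) (auto simp: mult.commute)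
      also have "\<dots> = (\<integral>\<^sup>+w. ennreal z * (ennreal (half_rate_gamma a (z * w)) * (ennreal (chisq_density (z - z * w)) * F w z)) \<partial>lborel)"
        by (rule nn_integral_cmult[symmetric]) measurable
      also have "\<dots> = (\<integral>\<^sup>+w. (?B z w) \<partial>lborel)"
      proof (rule nn_integral_cong)
        fix w :: real
        have "ennreal z * (ennreal (half_rate_gamma a (z * w)) * ennreal (chisq_density (z - z * w)))
          = ennreal (z * (half_rate_gamma a (z * w) * chisq_density (z - z * w)))"
          using True half_rate_gamma_nonneg[OF a] by (simp add: ennreal_mult)
        also have "\<dots> = ennreal (beta_half_density a w) * ennreal (half_rate_gamma (a + 1 / 2) z)"
          unfolding beta_gamma_identity[OF a True] using a by (intro ennreal_mult beta_half_density_nonneg half_rate_gamma_nonneg) auto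
        finally show "ennreal z * (ennreal (half_rate_gamma a (z * w)) * (ennreal (chisq_density (z - z * w)) * F w z))
          = (?B z w)"
          by (metis mult.assoc)
      qed
      finally show ?thesis .
    qed
  qed
  also have "\<dots> = (\<integral>\<^sup>+w. \<integral>\<^sup>+z. (?B z w) \<partial>lborel \<partial>lborel)"
    by (rule lborel_pair.Fubini') measurable
  also have "\<dots> = (\<integral>\<^sup>+w. \<integral>\<^sup>+z. F w z \<partial>half_rate_gamma_law (a + 1 / 2) \<partial>beta_law a (1 / 2))"
    unfolding beta_law_half by (subst nn_integral_density) (auto simp: nn_integral_density nn_integral_cmult)
  finally show ?thesis .
qed

lemma prob_space_beta_half:
  assumes a: "0 < a"
  shows "prob_space (beta_law a (1 / 2))"
proof (rule prob_spaceI)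
  interpret g1: prob_space "half_rate_gamma_law a" by (rule prob_space_half_rate_gamma_law[OF a])
  interpret g2: prob_space "half_rate_gamma_law (a + 1 / 2)" by (rule prob_space_half_rate_gamma_law) (use a in simp)
  interpret chi: prob_space sq_normal_law by (rule prob_space_sq_normal_law)
  have "(\<integral>\<^sup>+v. \<integral>\<^sup>+x. 1 \<partial>sq_normal_law \<partial>half_rate_gamma_law a) = (\<integral>\<^sup>+w. \<integral>\<^sup>+z. 1 \<partial>half_rate_gamma_law (a + 1 / 2) \<partial>beta_law a (1 / 2))"
    by (rule beta_gamma_step[OF a, of "\<lambda>_ _. 1"]) simp
  then show "emeasure (beta_law a (1 / 2)) (space (beta_law a (1 / 2))) = 1"
    using g1.emeasure_space_1 g2.emeasure_space_1 chi.emeasure_space_1 by simp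
qed

definition partial_sum :: "real \<Rightarrow> (nat \<Rightarrow> real) \<Rightarrow> nat \<Rightarrow> real" where
  "partial_sum v x i = v + (\<Sum>j<i. x j)"

definition ratios :: "real \<Rightarrow> (nat \<Rightarrow> real) \<Rightarrow> nat \<Rightarrow> nat \<Rightarrow> real" where
  "ratios v x n = (\<lambda>i\<in>{..<n}. partial_sum v x i / partial_sum v x (Suc i))"

text \<open>By iterated use of \<open>beta_gamma_step\<close> the ratios of successive partial sums are independent Beta variables, independent of
  the last partial sum; each squared normal step raises the shape by \<open>1/2\<close>.\<close>

lemma ratio_chain:
  fixes F :: "(nat \<Rightarrow> real) \<Rightarrow> real \<Rightarrow> ennreal"
  assumes a: "0 < a" and F: "(\<lambda>(w, z). F w z) \<in> borel_measurable (PiM {..<n} (\<lambda>_. borel) \<Otimes>\<^sub>M borel)"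
  shows "(\<integral>\<^sup>+v. \<integral>\<^sup>+x. F (ratios v x n) (partial_sum v x n) \<partial>PiM {..<n} (\<lambda>_. sq_normal_law) \<partial>half_rate_gamma_law a)
    = (\<integral>\<^sup>+w. \<integral>\<^sup>+z. F w z \<partial>half_rate_gamma_law (a + real n / 2) \<partial>PiM {..<n} (\<lambda>i. beta_law (a + real i / 2) (1 / 2)))"
  using F
proof (induction n arbitrary: F)
  case 0
  then show ?case by (simp add: ratios_def partial_sum_def PiM_empty nn_integral_count_space_finite)
next
  case (Suc n)
  have F[measurable]: "(\<lambda>(w, z). F w z) \<in> borel_measurable (PiM {..<Suc n} (\<lambda>_. borel) \<Otimes>\<^sub>M borel)" by (rule Suc.prems)
  interpret chi: prob_space sq_normal_law by (rule prob_space_sq_normal_law)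
  interpret chip: product_sigma_finite "\<lambda>_::nat. sq_normal_law" using chi.sigma_finite_measure_axioms by (simp add: product_sigma_finite_def)
  let ?B = "\<lambda>i::nat. beta_law (a + real i / 2) (1 / 2)"
  have pB: "prob_space (?B i)" for i using a by (intro prob_space_beta_half) simp
  interpret beta: product_sigma_finite ?B using pB by (simp add: product_sigma_finite_def prob_space_imp_sigma_finite)
  interpret gS: prob_space "half_rate_gamma_law (a + real (Suc n) / 2)"
    by (rule prob_space_half_rate_gamma_law, rule add_pos_nonneg) (use a in auto)
  have ins: "{..<Suc n} = insert n {..<n}" by auto
  let ?P = "PiM {..<n} (\<lambda>_. borel :: real measure)" and ?PS = "PiM {..<Suc n} (\<lambda>_. borel :: real measure)"
  have upd: "(\<lambda>(w, u). w(n := u)) \<in> measurable (?P \<Otimes>\<^sub>M borel) ?PS"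
    unfolding ins by (rule measurable_add_dim)
  have Fu: "(\<lambda>p. F ((f p)(n := g p)) (h p)) \<in> borel_measurable N"
    if "f \<in> measurable N ?P" "g \<in> borel_measurable N" "h \<in> borel_measurable N" for f g h and N :: "'z measure"
  proof -
    have "(\<lambda>p. ((f p)(n := g p), h p)) \<in> measurable N (?PS \<Otimes>\<^sub>M borel)"
      using measurable_compose[OF measurable_Pair[OF that(1,2)] upd] that(3) by (intro measurable_Pair) simp_all
    from measurable_compose[OF this F] show ?thesis by simp
  qed
  have setsX: "sets (PiM {..<Suc n} (\<lambda>_. sq_normal_law)) = sets ?PS" "sets (PiM {..<n} (\<lambda>_. sq_normal_law)) = sets ?P"
    by (intro sets_PiM_cong; simp)+
  have setsB: "sets (PiM {..<Suc n} ?B) = sets ?PS" "sets (PiM {..<n} ?B) = sets ?P"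
    by (intro sets_PiM_cong; simp)+
  define F' where "F' w z = (\<integral>\<^sup>+y. F (w(n := z / (z + y))) (z + y) \<partial>sq_normal_law)" for w z
  have F': "(\<lambda>(w, z). F' w z) \<in> borel_measurable (?P \<Otimes>\<^sub>M borel)"
  proof -
    have "(\<lambda>p. F ((fst (fst p))(n := snd (fst p) / (snd (fst p) + snd p))) (snd (fst p) + snd p)) \<in> borel_measurable ((?P \<Otimes>\<^sub>M borel) \<Otimes>\<^sub>M borel)"
      by (rule Fu) measurable
    then have "(\<lambda>p. \<integral>\<^sup>+y. F ((fst p)(n := snd p / (snd p + y))) (snd p + y) \<partial>sq_normal_law) \<in> borel_measurable (?P \<Otimes>\<^sub>M borel)"
      by (intro chi.borel_measurable_nn_integral) (simp add: case_prod_beta' cong: measurable_cong_sets)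
    then show ?thesis by (simp add: F'_def case_prod_beta')
  qed
  have ps: "partial_sum v (x(n := y)) i = partial_sum v x i" if "i \<le> n" for v x y i
    using that by (simp add: partial_sum_def)
  have psS: "partial_sum v (x(n := y)) (Suc n) = partial_sum v x n + y" for v x y
    by (simp add: partial_sum_def)
  have rat: "ratios v (x(n := y)) (Suc n) = (ratios v x n)(n := partial_sum v x n / (partial_sum v x n + y))" for v x y
    by (auto simp: ratios_def fun_eq_iff ps psS less_Suc_eq restrict_def)
  have "(\<integral>\<^sup>+v. \<integral>\<^sup>+x. F (ratios v x (Suc n)) (partial_sum v x (Suc n)) \<partial>PiM {..<Suc n} (\<lambda>_. sq_normal_law) \<partial>half_rate_gamma_law a)
    = (\<integral>\<^sup>+v. \<integral>\<^sup>+x. F' (ratios v x n) (partial_sum v x n) \<partial>PiM {..<n} (\<lambda>_. sq_normal_law) \<partial>half_rate_gamma_law a)"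
  proof (rule nn_integral_cong)
    fix v :: real
    define Q where "Q x = F (ratios v x (Suc n)) (partial_sum v x (Suc n))" for x
    have "Q \<in> borel_measurable ?PS"
    proof -
      have ps': "(\<lambda>x. partial_sum v x i) \<in> borel_measurable ?PS" if "i \<le> Suc n" for i
        unfolding partial_sum_def using that
        by (intro borel_measurable_add borel_measurable_const borel_measurable_sum measurable_component_singleton) auto
      have "(\<lambda>x. (ratios v x (Suc n), partial_sum v x (Suc n))) \<in> measurable ?PS (?PS \<Otimes>\<^sub>M borel)"
        unfolding ratios_def by (intro measurable_Pair measurable_restrict borel_measurable_divide ps') auto
      from measurable_compose[OF this F] show ?thesis unfolding Q_def by simp
    qed
    then have "Q \<in> borel_measurable (PiM (insert n {..<n}) (\<lambda>_. sq_normal_law))"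
      unfolding ins[symmetric] using setsX(1) by (simp cong: measurable_cong_sets)
    then have "(\<integral>\<^sup>+x. Q x \<partial>PiM {..<Suc n} (\<lambda>_. sq_normal_law)) = (\<integral>\<^sup>+x. \<integral>\<^sup>+y. Q (x(n := y)) \<partial>sq_normal_law \<partial>PiM {..<n} (\<lambda>_. sq_normal_law))"
      unfolding ins by (intro chip.product_nn_integral_insert) auto
    then show "(\<integral>\<^sup>+x. F (ratios v x (Suc n)) (partial_sum v x (Suc n)) \<partial>PiM {..<Suc n} (\<lambda>_. sq_normal_law))
      = (\<integral>\<^sup>+x. F' (ratios v x n) (partial_sum v x n) \<partial>PiM {..<n} (\<lambda>_. sq_normal_law))"
      unfolding Q_def F'_def rat psS .
  qed
  also have "\<dots> = (\<integral>\<^sup>+w. \<integral>\<^sup>+z. F' w z \<partial>half_rate_gamma_law (a + real n / 2) \<partial>PiM {..<n} ?B)"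
    by (rule Suc.IH[OF F'])
  also have "\<dots> = (\<integral>\<^sup>+w. \<integral>\<^sup>+u. \<integral>\<^sup>+z. F (w(n := u)) z \<partial>half_rate_gamma_law (a + real (Suc n) / 2) \<partial>?B n \<partial>PiM {..<n} ?B)"
  proof (rule nn_integral_cong)
    fix w assume "w \<in> space (PiM {..<n} ?B)"
    then have w: "w \<in> space ?P" by (simp add: sets_eq_imp_space_eq[OF setsB(2)])
    have "(\<lambda>p. F (((\<lambda>_. w) p)(n := fst p)) (snd p)) \<in> borel_measurable (borel \<Otimes>\<^sub>M borel)"
      by (rule Fu) (use w in measurable)
    then have m: "(\<lambda>(u, z). F (w(n := u)) z) \<in> borel_measurable (borel \<Otimes>\<^sub>M borel)" by (simp add: case_prod_beta')
    have e: "a + real n / 2 + 1 / 2 = a + real (Suc n) / 2" by (simp add: add_divide_distrib)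
    have "0 < a + real n / 2" using a by simp
    from beta_gamma_step[OF this m] show "(\<integral>\<^sup>+z. F' w z \<partial>half_rate_gamma_law (a + real n / 2)) = (\<integral>\<^sup>+u. \<integral>\<^sup>+z. F (w(n := u)) z \<partial>half_rate_gamma_law (a + real (Suc n) / 2) \<partial>?B n)"
      unfolding F'_def e .
  qed
  also have "\<dots> = (\<integral>\<^sup>+w. \<integral>\<^sup>+z. F w z \<partial>half_rate_gamma_law (a + real (Suc n) / 2) \<partial>PiM {..<Suc n} ?B)"
  proof -
    have "(\<lambda>w. \<integral>\<^sup>+z. F w z \<partial>half_rate_gamma_law (a + real (Suc n) / 2)) \<in> borel_measurable ?PS"
      using F by (intro gS.borel_measurable_nn_integral) (simp cong: measurable_cong_sets)
    then have "(\<lambda>w. \<integral>\<^sup>+z. F w z \<partial>half_rate_gamma_law (a + real (Suc n) / 2)) \<in> borel_measurable (PiM (insert n {..<n}) ?B)"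
      unfolding ins[symmetric] using setsB(1) by (simp cong: measurable_cong_sets)
    then show ?thesis unfolding ins by (intro beta.product_nn_integral_insert[symmetric]) auto
  qed
  finally show ?case .
qed

text \<open>The product of the first \<open>i\<close> ratios telescopes to \<open>v / (v + x\<^sub>0 + \<dots> + x\<^bsub>i-1\<^esub>)\<close>.\<close>

lemma P_hat_ratios:
  assumes v: "0 < v" and l: "l\<^sup>2 = v" and x: "\<And>j. j < n \<Longrightarrow> 0 \<le> x j" and i: "i < n"
  shows "P_hat l x i = (1 - ratios v x n i) * (\<Prod>j<i. ratios v x n j)"
proof -
  have pos: "0 < partial_sum v x j" if "j \<le> n" for j
    unfolding partial_sum_def using v x that by (intro add_pos_nonneg sum_nonneg) auto
  have prod: "(\<Prod>j<k. ratios v x n j) = v / partial_sum v x k" if "k \<le> n" for k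
    using that
  proof (induction k)
    case 0
    then show ?case using v by (simp add: partial_sum_def)
  next
    case (Suc k)
    then show ?case using pos[of k] by (simp add: ratios_def)
  qed
  have "(1 - ratios v x n i) * (\<Prod>j<i. ratios v x n j) = (\<Prod>j<i. ratios v x n j) - (\<Prod>j<Suc i. ratios v x n j)"
    by (simp add: algebra_simps)
  also have "\<dots> = v / partial_sum v x i - v / partial_sum v x (Suc i)"
    using i by (simp only: prod less_imp_le Suc_le_eq)
  finally show ?thesis unfolding P_hat_def l partial_sum_def by (simp add: add.commute)
qed

lemma AE_PiM_sq_normal_nonneg: "AE x in PiM {..<n::nat} (\<lambda>_. sq_normal_law). \<forall>j\<in>{..<n}. 0 \<le> x j"
proof (intro AE_finite_allI)
  interpret chi: prob_space sq_normal_law by (rule prob_space_sq_normal_law)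
  interpret P: product_prob_space "\<lambda>_::nat. sq_normal_law" "{..<n}"
    by (simp add: product_prob_space_def product_prob_space_axioms_def product_sigma_finite_def chi.prob_space_axioms chi.sigma_finite_measure_axioms)
  fix j assume j: "j \<in> {..<n}"
  have "AE z in sq_normal_law. 0 \<le> z"
    unfolding sq_normal_law_eq by (auto simp: AE_density chisq_density_def)
  then have "AE z in distr (PiM {..<n} (\<lambda>_. sq_normal_law)) sq_normal_law (\<lambda>x. x j). 0 \<le> z"
    unfolding P.PiM_component[OF j] .
  then show "AE x in PiM {..<n} (\<lambda>_. sq_normal_law). 0 \<le> x j"
    by (rule AE_distrD[rotated]) (use j in simp)
qed simp

lemma GEM_cylinder:
  assumes \<theta>: "- 1 / 2 < \<theta>" and C[measurable]: "\<And>i. C i \<in> sets borel"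
  shows "(\<integral>\<^sup>+p. (\<Prod>i<n. indicator (C i) (p i)) \<partial>GEM_half \<theta>)
    = (\<integral>\<^sup>+v. \<integral>\<^sup>+x. (\<Prod>i<n. indicator (C i) (P_hat (sqrt v) x i)) \<partial>PiM {..<n} (\<lambda>_. sq_normal_law) \<partial>half_rate_gamma_law (\<theta> + 1 / 2))"
proof -
  let ?B = "\<lambda>i::nat. beta_law (\<theta> + real (Suc i) / 2) (1 / 2)"
  define a where "a = \<theta> + 1 / 2"
  have a: "0 < a" using \<theta> by (simp add: a_def)
  \<comment> \<open>the Beta parameters of \<open>GEM(1/2, \<theta>)\<close> start at \<open>\<theta> + 1/2\<close>, the shape of the Gamma law of \<open>L\<^sup>2\<close>\<close>
  have "\<theta> + real (Suc i) / 2 = a + real i / 2" for i by (simp add: a_def add_divide_distrib)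
  then have B: "?B i = beta_law (a + real i / 2) (1 / 2)" for i by (simp only:)
  have pB: "prob_space (?B i)" for i unfolding B using a by (intro prob_space_beta_half) simp
  interpret P: product_prob_space ?B UNIV
    using pB by (simp add: product_prob_space_def product_prob_space_axioms_def product_sigma_finite_def prob_space_imp_sigma_finite)
  interpret g: prob_space "half_rate_gamma_law (a + real n / 2)" by (rule prob_space_half_rate_gamma_law) (use a in simp)
  define J where "J w = (\<Prod>i<n. indicator (C i) ((1 - w i) * (\<Prod>j<i. w j)) :: ennreal)" for w :: "nat \<Rightarrow> real"
  have setsn: "sets (PiM {..<n} ?B) = sets (PiM {..<n} (\<lambda>_. borel :: real measure))" by (intro sets_PiM_cong) auto
  have setsU: "sets (PiM UNIV ?B) = sets seq_space" by (intro sets_PiM_cong) auto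
  have Jn: "J \<in> borel_measurable (PiM {..<n} (\<lambda>_. borel))"
  proof -
    have "(\<lambda>w. (1 - w i) * (\<Prod>j<i. w j)) \<in> borel_measurable (PiM {..<n} (\<lambda>_. borel :: real measure))" if "i < n" for i
      using that by (intro borel_measurable_times borel_measurable_diff borel_measurable_const borel_measurable_prod measurable_component_singleton) auto
    then show ?thesis unfolding J_def
      by (intro borel_measurable_prod_ennreal measurable_compose[OF _ borel_measurable_indicator[OF C]]) simp
  qed
  have stick: "(\<lambda>w l. (1 - w l) * (\<Prod>i<l. w i)) \<in> measurable (PiM UNIV ?B) seq_space"
  proof -
    have c: "(\<lambda>w. w i) \<in> borel_measurable (seq_space :: (nat \<Rightarrow> real) measure)" for i by (rule measurable_component_singleton) simp
    have "(\<lambda>w. \<lambda>l\<in>UNIV. (1 - w l) * (\<Prod>i<l. w i)) \<in> measurable seq_space (seq_space :: (nat \<Rightarrow> real) measure)"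
      by (intro measurable_restrict borel_measurable_times borel_measurable_diff borel_measurable_const borel_measurable_prod c)
    then show ?thesis using setsU by (simp add: restrict_UNIV cong: measurable_cong_sets)
  qed
  have "(\<integral>\<^sup>+p. (\<Prod>i<n. indicator (C i) (p i)) \<partial>GEM_half \<theta>) = (\<integral>\<^sup>+w. J w \<partial>PiM UNIV ?B)"
    unfolding GEM_half_def J_def
    by (rule nn_integral_distr[OF stick])
       (auto intro!: borel_measurable_prod_ennreal measurable_compose[OF seq_component_measurable borel_measurable_indicator[OF C]])
  also have "\<dots> = (\<integral>\<^sup>+w. J (restrict w {..<n}) \<partial>PiM UNIV ?B)"
  proof (rule nn_integral_cong)
    fix w :: "nat \<Rightarrow> real"
    have "(\<Prod>j<i. restrict w {..<n} j) = (\<Prod>j<i. w j)" if "i < n" for i using that by (intro prod.cong) auto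
    then show "J w = J (restrict w {..<n})" unfolding J_def by (intro prod.cong) auto
  qed
  also have "\<dots> = (\<integral>\<^sup>+w. J w \<partial>distr (PiM UNIV ?B) (PiM {..<n} ?B) (\<lambda>w. restrict w {..<n}))"
  proof (rule nn_integral_distr[symmetric])
    show "(\<lambda>w. restrict w {..<n}) \<in> measurable (PiM UNIV ?B) (PiM {..<n} ?B)" by (rule measurable_restrict_subset) simp
    have "J \<in> borel_measurable (PiM {..<n} ?B)" unfolding measurable_cong_sets[OF setsn refl] by (rule Jn)
    then show "J \<in> borel_measurable (distr (PiM UNIV ?B) (PiM {..<n} ?B) (\<lambda>w. restrict w {..<n}))" by simp
  qed
  also have "\<dots> = (\<integral>\<^sup>+w. J w \<partial>PiM {..<n} ?B)"
    by (subst P.distr_PiM_restrict_finite) auto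
  also have "\<dots> = (\<integral>\<^sup>+w. \<integral>\<^sup>+z. J w \<partial>half_rate_gamma_law (a + real n / 2) \<partial>PiM {..<n} (\<lambda>i. beta_law (a + real i / 2) (1 / 2)))"
    unfolding B using g.emeasure_space_1 by simp
  also have "\<dots> = (\<integral>\<^sup>+v. \<integral>\<^sup>+x. J (ratios v x n) \<partial>PiM {..<n} (\<lambda>_. sq_normal_law) \<partial>half_rate_gamma_law a)"
    by (rule ratio_chain[OF a, symmetric, of "\<lambda>w z. J w"]) (use measurable_compose[OF measurable_fst Jn] in \<open>simp add: case_prod_beta'\<close>)
  also have "\<dots> = (\<integral>\<^sup>+v. \<integral>\<^sup>+x. (\<Prod>i<n. indicator (C i) (P_hat (sqrt v) x i)) \<partial>PiM {..<n} (\<lambda>_. sq_normal_law) \<partial>half_rate_gamma_law a)"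
  proof (rule nn_integral_cong_AE)
    have "AE v in half_rate_gamma_law a. 0 < v" by (auto simp: AE_density half_rate_gamma_def)
    then show "AE v in half_rate_gamma_law a. (\<integral>\<^sup>+x. J (ratios v x n) \<partial>PiM {..<n} (\<lambda>_. sq_normal_law))
      = (\<integral>\<^sup>+x. (\<Prod>i<n. indicator (C i) (P_hat (sqrt v) x i)) \<partial>PiM {..<n} (\<lambda>_. sq_normal_law))"
    proof (rule eventually_mono)
      fix v :: real assume v: "0 < v"
      show "(\<integral>\<^sup>+x. J (ratios v x n) \<partial>PiM {..<n} (\<lambda>_. sq_normal_law))
        = (\<integral>\<^sup>+x. (\<Prod>i<n. indicator (C i) (P_hat (sqrt v) x i)) \<partial>PiM {..<n} (\<lambda>_. sq_normal_law))"
      proof (rule nn_integral_cong_AE, use AE_PiM_sq_normal_nonneg in eventually_elim)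
        fix x :: "nat \<Rightarrow> real" assume x: "\<forall>j\<in>{..<n}. 0 \<le> x j"
        show "J (ratios v x n) = (\<Prod>i<n. indicator (C i) (P_hat (sqrt v) x i))"
          unfolding J_def
          by (intro prod.cong refl) (use v x in \<open>simp add: P_hat_ratios[where v=v and n=n]\<close>)
      qed
    qed
  qed
  finally show ?thesis unfolding a_def .
qed

section \<open>The stick-breaking law\<close>

text \<open>The events generated by \<open>L\<close> are among those generated by the pair \<open>(Z, L)\<close>.\<close>

lemma indep_rv_snd:
  assumes N: "prob_space N" and ind: "indep_rv N (borel \<Otimes>\<^sub>M borel) (\<lambda>\<omega>. (Z \<omega>, L \<omega>)) T X"
  shows "indep_rv N borel L T X"
proof -
  interpret prob_space N by fact
  have ZL: "(\<lambda>\<omega>. (Z \<omega>, L \<omega>)) \<in> measurable N (borel \<Otimes>\<^sub>M borel)" and X: "X \<in> measurable N T"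
    and iset: "indep_set {(\<lambda>\<omega>. (Z \<omega>, L \<omega>)) -` A \<inter> space N |A. A \<in> sets (borel \<Otimes>\<^sub>M borel)} {X -` B \<inter> space N |B. B \<in> sets T}"
    using ind by (auto simp: indep_rv_def)
  have L: "L \<in> borel_measurable N" using measurable_compose[OF ZL measurable_snd] by simp
  have sub: "{L -` A \<inter> space N |A. A \<in> sets borel} \<subseteq> {(\<lambda>\<omega>. (Z \<omega>, L \<omega>)) -` A \<inter> space N |A. A \<in> sets (borel \<Otimes>\<^sub>M borel)}"
  proof safe
    fix A :: "'c set" assume A: "A \<in> sets borel"
    then have "UNIV \<times> A \<in> sets (borel \<Otimes>\<^sub>M borel)" by (intro pair_measureI) auto
    moreover have "L -` A \<inter> space N = (\<lambda>\<omega>. (Z \<omega>, L \<omega>)) -` (UNIV \<times> A) \<inter> space N" by auto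
    ultimately show "\<exists>B. L -` A \<inter> space N = (\<lambda>\<omega>. (Z \<omega>, L \<omega>)) -` B \<inter> space N \<and> B \<in> sets (borel \<Otimes>\<^sub>M borel)" by blast
  qed
  have "indep_set {L -` A \<inter> space N |A. A \<in> sets borel} {X -` B \<inter> space N |B. B \<in> sets T}"
    using iset unfolding indep_set_def by (rule indep_sets_mono_sets) (use sub in \<open>auto split: bool.splits\<close>)
  with L X show ?thesis by (simp add: indep_rv_def)
qed

lemma chisq_density_tilt:
  assumes v: "0 < v"
  shows "chisq_density v * (1 / (2 * v)) powr (- \<theta>) = 2 powr \<theta> / sqrt (2 * pi) * (v powr (\<theta> + 1 / 2 - 1) * exp (- (1 / 2) * v))"
proof -
  have "(1 / (2 * v)) powr (- \<theta>) = 2 powr \<theta> * v powr \<theta>"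
    using v by (simp add: powr_minus powr_divide powr_mult)
  moreover have "v powr (- 1 / 2) * v powr \<theta> = v powr (\<theta> + 1 / 2 - 1)"
    unfolding powr_add[symmetric] by simp
  ultimately show ?thesis using v by (simp add: chisq_density_def mult_ac)
qed

context mixed_setting
begin

text \<open>With \<open>v = 1 / (2 S)\<close> a squared normal variable, \<open>S\<^bsup>-\<theta>\<^esup>\<close> is \<open>(2 v)\<^sup>\<theta>\<close>, which has a Gamma integral as its
  expectation.\<close>

lemma c\<theta>_eq: "c\<theta> = 2 powr \<theta> / sqrt (2 * pi) * (Gamma (\<theta> + 1 / 2) * 2 powr (\<theta> + 1 / 2))"
proof -
  have a: "0 < \<theta> + 1 / 2" using \<theta>(1) by simp
  have "(\<integral>\<^sup>+\<omega>. ennreal (S \<omega> powr (- \<theta>)) \<partial>M) = (\<integral>\<^sup>+t. ennreal (t powr (- \<theta>)) \<partial>levy_law)"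
    unfolding law_S[symmetric] by (rule nn_integral_distr[symmetric]) measurable
  also have "\<dots> = (\<integral>\<^sup>+v. ennreal (chisq_density v) * ennreal ((1 / (2 * v)) powr (- \<theta>)) \<partial>lborel)"
    by (rule nn_integral_levy_law) measurable
  also have "\<dots> = (\<integral>\<^sup>+v. ennreal (2 powr \<theta> / sqrt (2 * pi)) * (ennreal (v powr (\<theta> + 1 / 2 - 1) * exp (- (1 / 2) * v)) * indicator {0<..} v) \<partial>lborel)"
  proof (rule nn_integral_cong)
    fix v :: real
    show "ennreal (chisq_density v) * ennreal ((1 / (2 * v)) powr (- \<theta>))
      = ennreal (2 powr \<theta> / sqrt (2 * pi)) * (ennreal (v powr (\<theta> + 1 / 2 - 1) * exp (- (1 / 2) * v)) * indicator {0<..} v)"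
    proof (cases "0 < v")
      case True
      have "ennreal (chisq_density v) * ennreal ((1 / (2 * v)) powr (- \<theta>)) = ennreal (chisq_density v * (1 / (2 * v)) powr (- \<theta>))"
        by (rule ennreal_mult[symmetric]) auto
      also have "\<dots> = ennreal (2 powr \<theta> / sqrt (2 * pi)) * ennreal (v powr (\<theta> + 1 / 2 - 1) * exp (- (1 / 2) * v))"
        unfolding chisq_density_tilt[OF True] by (rule ennreal_mult) auto
      finally show ?thesis using True by simp
    qed (simp add: chisq_density_def)
  qed
  also have "\<dots> = ennreal (2 powr \<theta> / sqrt (2 * pi)) * ennreal (Gamma (\<theta> + 1 / 2) * (1 / 2) powr (- (\<theta> + 1 / 2)))"
    by (subst nn_integral_cmult, measurable, subst nn_integral_Gamma_scaled[OF a]) simp_all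
  also have "\<dots> = ennreal (2 powr \<theta> / sqrt (2 * pi) * (Gamma (\<theta> + 1 / 2) * (1 / 2) powr (- (\<theta> + 1 / 2))))"
    using Gamma_real_pos[OF a] by (intro ennreal_mult[symmetric]) auto
  also have "(1 / 2 :: real) powr (- (\<theta> + 1 / 2)) = 2 powr (\<theta> + 1 / 2)"
    unfolding powr_minus by (simp add: powr_divide)
  finally have nn: "(\<integral>\<^sup>+\<omega>. ennreal (S \<omega> powr (- \<theta>)) \<partial>M) = ennreal (2 powr \<theta> / sqrt (2 * pi) * (Gamma (\<theta> + 1 / 2) * 2 powr (\<theta> + 1 / 2)))" .
  have "c\<theta> = enn2real (\<integral>\<^sup>+\<omega>. ennreal (S \<omega> powr (- \<theta>)) \<partial>M)"
    unfolding c\<theta>_def by (rule integral_eq_nn_integral) auto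
  then show ?thesis unfolding nn using Gamma_real_pos[OF a] by simp
qed

text \<open>The tilt by \<open>t\<^bsup>-\<theta>\<^esup>\<close> becomes a tilt of the squared normal law of \<open>v = 1 / (2 t)\<close> by \<open>v\<^sup>\<theta>\<close>, raising
  its shape from \<open>1/2\<close> to \<open>\<theta> + 1/2\<close>.\<close>

lemma nn_integral_mixed_L:
  assumes J[measurable]: "J \<in> borel_measurable borel"
  shows "(\<integral>\<^sup>+l. J l \<partial>distr (density levy_law (\<lambda>t. ennreal (t powr (- \<theta>) / c\<theta>))) borel (\<lambda>t. t powr (- 1 / 2) / sqrt 2))
    = (\<integral>\<^sup>+v. J (sqrt v) \<partial>half_rate_gamma_law (\<theta> + 1 / 2))"
proof -
  have a: "0 < \<theta> + 1 / 2" using \<theta>(1) by simp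
  have "(\<integral>\<^sup>+l. J l \<partial>distr (density levy_law (\<lambda>t. ennreal (t powr (- \<theta>) / c\<theta>))) borel (\<lambda>t. t powr (- 1 / 2) / sqrt 2))
    = (\<integral>\<^sup>+t. ennreal (t powr (- \<theta>) / c\<theta>) * J (t powr (- 1 / 2) / sqrt 2) \<partial>levy_law)"
    by (subst nn_integral_distr) (auto simp: nn_integral_density)
  also have "\<dots> = (\<integral>\<^sup>+v. ennreal (chisq_density v) * (ennreal ((1 / (2 * v)) powr (- \<theta>) / c\<theta>) * J ((1 / (2 * v)) powr (- 1 / 2) / sqrt 2)) \<partial>lborel)"
    by (rule nn_integral_levy_law) measurable
  also have "\<dots> = (\<integral>\<^sup>+v. ennreal (half_rate_gamma (\<theta> + 1 / 2) v) * J (sqrt v) \<partial>lborel)"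
  proof (rule nn_integral_cong)
    fix v :: real
    show "ennreal (chisq_density v) * (ennreal ((1 / (2 * v)) powr (- \<theta>) / c\<theta>) * J ((1 / (2 * v)) powr (- 1 / 2) / sqrt 2))
      = ennreal (half_rate_gamma (\<theta> + 1 / 2) v) * J (sqrt v)"
    proof (cases "0 < v")
      case True
      have "(1 / (2 * v)) powr (- 1 / 2) = sqrt (2 * v)"
        using True by (simp add: powr_minus powr_divide powr_half_sqrt)
      then have s: "(1 / (2 * v)) powr (- 1 / 2) / sqrt 2 = sqrt v" by (simp add: real_sqrt_mult)
      have c: "x * u / (x * (G * P)) = u / (G * P)" if "x \<noteq> 0" for x u G P :: real using that by simp
      have x: "2 powr \<theta> / sqrt (2 * pi) \<noteq> 0" by simp
      have "chisq_density v * ((1 / (2 * v)) powr (- \<theta>) / c\<theta>) = chisq_density v * (1 / (2 * v)) powr (- \<theta>) / c\<theta>"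
        by simp
      also have "\<dots> = (v powr (\<theta> + 1 / 2 - 1) * exp (- (1 / 2) * v)) / (Gamma (\<theta> + 1 / 2) * 2 powr (\<theta> + 1 / 2))"
        unfolding chisq_density_tilt[OF True] c\<theta>_eq by (rule c[OF x])
      also have "\<dots> = half_rate_gamma (\<theta> + 1 / 2) v" using True by (simp add: half_rate_gamma_def)
      finally have d: "chisq_density v * ((1 / (2 * v)) powr (- \<theta>) / c\<theta>) = half_rate_gamma (\<theta> + 1 / 2) v" .
      have "ennreal (chisq_density v) * ennreal ((1 / (2 * v)) powr (- \<theta>) / c\<theta>) = ennreal (half_rate_gamma (\<theta> + 1 / 2) v)"
        unfolding d[symmetric] by (rule ennreal_mult[symmetric]) (auto simp: c\<theta>_nonneg)
      then show ?thesis unfolding s by (simp only: mult.assoc[symmetric])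
    qed (simp add: chisq_density_def half_rate_gamma_def)
  qed
  also have "\<dots> = (\<integral>\<^sup>+v. J (sqrt v) \<partial>half_rate_gamma_law (\<theta> + 1 / 2))"
    by (subst nn_integral_density) auto
  finally show ?thesis .
qed

lemma P_hat_mixed_GEM:
  assumes sp: "species_sample N (PD_half M S f PD_cond \<theta>) P U Y"
    and N': "prob_space N'" and K: "K \<in> measurable N' (count_space UNIV)"
    and lawK: "distr N' (count_space UNIV) K = distr N (count_space UNIV) (\<lambda>\<omega>. card (partition_blocks m (Y \<omega>)))"
    and condG: "conditional_law N' (count_space UNIV) K borel G (\<lambda>k. gamma_law (2 * \<theta> + real k))"
    and condL: "conditional_law N' borel (\<lambda>\<omega>. (G \<omega>)\<^sup>2) borel L (L_law M S f m)"
    and X: "iid_seq N' sq_normal_law X" and ind: "indep_rv N' borel L seq_space X"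
  shows "distr N' seq_space (\<lambda>\<omega>. P_hat (L \<omega>) (X \<omega>)) = GEM_half \<theta>"
proof (rule measure_eqI_seq_space)
  interpret N': prob_space N' by fact
  have L: "L \<in> borel_measurable N'" and X': "X \<in> measurable N' seq_space"
    using ind by (auto simp: indep_rv_def)
  note PX[measurable] = P_hat_random_measurable[OF L X']
  show "finite_measure (distr N' seq_space (\<lambda>\<omega>. P_hat (L \<omega>) (X \<omega>)))"
    by (intro prob_space.finite_measure N'.prob_space_distr) simp
  fix n and C :: "nat \<Rightarrow> real set" assume C: "\<And>i. C i \<in> sets borel"
  define J where "J l = (\<integral>\<^sup>+x. (\<Prod>i<n. indicator (C i) (P_hat l x i)) \<partial>PiM {..<n} (\<lambda>_. sq_normal_law) :: ennreal)" for l
  have "(\<integral>\<^sup>+p. (\<Prod>i<n. indicator (C i) (p i)) \<partial>distr N' seq_space (\<lambda>\<omega>. P_hat (L \<omega>) (X \<omega>)))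
     = (\<integral>\<^sup>+\<omega>. (\<Prod>i<n. indicator (C i) (P_hat (L \<omega>) (X \<omega>) i)) \<partial>N')"
    by (rule nn_integral_distr[OF PX])
       (auto intro!: borel_measurable_prod_ennreal measurable_compose[OF seq_component_measurable borel_measurable_indicator[OF C]])
  also have "\<dots> = (\<integral>\<^sup>+l. J l \<partial>distr N' borel L)"
    unfolding J_def by (rule P_hat_cylinder[OF N' X ind C])
  also have "\<dots> = (\<integral>\<^sup>+v. J (sqrt v) \<partial>half_rate_gamma_law (\<theta> + 1 / 2))"
    unfolding mixed_L_law[OF sp N' K lawK condG condL] J_def
    by (rule nn_integral_mixed_L) (rule P_hat_cylinder_measurable[OF C])
  also have "\<dots> = (\<integral>\<^sup>+p. (\<Prod>i<n. indicator (C i) (p i)) \<partial>GEM_half \<theta>)"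
    unfolding J_def by (rule GEM_cylinder[OF \<theta>(1) C, symmetric])
  finally show "(\<integral>\<^sup>+p. (\<Prod>i<n. indicator (C i) (p i)) \<partial>distr N' seq_space (\<lambda>\<omega>. P_hat (L \<omega>) (X \<omega>)))
     = (\<integral>\<^sup>+p. (\<Prod>i<n. indicator (C i) (p i)) \<partial>GEM_half \<theta>)" .
qed (auto simp: GEM_half_def)

end

theorem corollary4p4:
  fixes M :: "'w measure"
    and S :: "'w \<Rightarrow> real"
    and f :: "real \<Rightarrow> real"
    and \<xi> :: "real \<Rightarrow> 'w \<Rightarrow> real"
    and A :: "'w \<Rightarrow> nat \<Rightarrow> real"
    and PD_cond :: "real \<Rightarrow> (nat \<Rightarrow> real) measure"
    and m :: nat
  assumes subordinator: "stable_subordinator M (1 / 2) \<xi>"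
    and jumps: "ranked_jumps M \<xi> A"
    and S_sum: "AE \<omega> in M. A \<omega> sums S \<omega>"
    and S_pos: "AE \<omega> in M. 0 < S \<omega>"
    and S_laplace: "\<And>u. 0 < u \<Longrightarrow> (\<integral>\<omega>. exp (- u * S \<omega>) \<partial>M) = exp (- sqrt u)"
    and S_density: "distributed M lborel S (\<lambda>t. ennreal (f t))"
    and f_nonneg: "\<And>t. 0 \<le> f t"
    and PD_cond_kernel: "PD_cond \<in> measurable borel (prob_algebra seq_space)"
    and PD_cond: "conditional_law M borel S seq_space (\<lambda>\<omega> k. A \<omega> k / S \<omega>) PD_cond"
  shows
    "(\<forall>lam>0. \<forall>(N :: 'a measure) P P' (N' :: 'b measure) L X.
        prob_space N \<and>
        P \<in> measurable N seq_space \<and>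
        distr N seq_space P = tilted_PD M S f PD_cond m lam \<and>
        size_biased_rearrangement N P P' \<and>
        prob_space N' \<and>
        (AE \<omega> in N'. 0 < L \<omega>) \<and>
        distr N' borel L = L_law M S f m lam \<and>
        iid_seq N' sq_normal_law X \<and>
        indep_rv N' borel L seq_space X
        \<longrightarrow> distr N seq_space P' = distr N' seq_space (\<lambda>\<omega>. P_hat (L \<omega>) (X \<omega>)))
     \<and>
     (\<forall>\<theta>. - 1 / 2 < \<theta> \<and> 0 < real m + \<theta> \<longrightarrow>
       (\<forall>(N :: 'c measure) P U Y (N' :: 'd measure) (K :: 'd \<Rightarrow> nat) G L X.
         species_sample N (PD_half M S f PD_cond \<theta>) P U Y \<and>
         prob_space N' \<and>
         K \<in> measurable N' (count_space UNIV) \<and>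
         distr N' (count_space UNIV) K
           = distr N (count_space UNIV) (\<lambda>\<omega>. card (partition_blocks m (Y \<omega>))) \<and>
         conditional_law N' (count_space UNIV) K borel G (\<lambda>k. gamma_law (2 * \<theta> + real k)) \<and>
         (AE \<omega> in N'. 0 < L \<omega>) \<and>
         conditional_law N' borel (\<lambda>\<omega>. (G \<omega>)\<^sup>2) borel L (L_law M S f m) \<and>
         iid_seq N' sq_normal_law X \<and>
         indep_rv N' (borel \<Otimes>\<^sub>M borel) (\<lambda>\<omega>. ((G \<omega>)\<^sup>2, L \<omega>)) seq_space X
         \<longrightarrow> distr N' seq_space (\<lambda>\<omega>. P_hat (L \<omega>) (X \<omega>)) = GEM_half \<theta>))"
proof -
  interpret stable_half_PD M S f \<xi> A PD_cond
    by unfold_locales (fact assms)+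
  show ?thesis
  proof (intro conjI allI impI; elim conjE)
    fix lam :: real and N :: "'a measure" and P P' and N' :: "'b measure" and L X
    assume "prob_space N" "P \<in> measurable N seq_space" "distr N seq_space P = tilted_PD M S f PD_cond m lam"
      "size_biased_rearrangement N P P'" "prob_space N'" "distr N' borel L = L_law M S f m lam"
      "iid_seq N' sq_normal_law X" "indep_rv N' borel L seq_space X"
    then show "distr N seq_space P' = distr N' seq_space (\<lambda>\<omega>. P_hat (L \<omega>) (X \<omega>))"
      by (rule size_biased_tilted_PD)
  next
    fix \<theta> :: real and N :: "'c measure" and P U Y and N' :: "'d measure" and K :: "'d \<Rightarrow> nat" and G L X
    assume \<theta>: "- 1 / 2 < \<theta>" "0 < real m + \<theta>"
      and sp: "species_sample N (PD_half M S f PD_cond \<theta>) P U Y"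
      and N': "prob_space N'" and K: "K \<in> measurable N' (count_space UNIV)"
      and laws: "distr N' (count_space UNIV) K = distr N (count_space UNIV) (\<lambda>\<omega>. card (partition_blocks m (Y \<omega>)))"
        "conditional_law N' (count_space UNIV) K borel G (\<lambda>k. gamma_law (2 * \<theta> + real k))"
        "conditional_law N' borel (\<lambda>\<omega>. (G \<omega>)\<^sup>2) borel L (L_law M S f m)"
      and X: "iid_seq N' sq_normal_law X"
      and ind: "indep_rv N' (borel \<Otimes>\<^sub>M borel) (\<lambda>\<omega>. ((G \<omega>)\<^sup>2, L \<omega>)) seq_space X"
    interpret mixed_setting M S f \<xi> A PD_cond m \<theta>
      by unfold_locales (fact \<theta>)+
    show "distr N' seq_space (\<lambda>\<omega>. P_hat (L \<omega>) (X \<omega>)) = GEM_half \<theta>"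
      by (rule P_hat_mixed_GEM[OF sp N' K laws X indep_rv_snd[OF N' ind]])
  qed
qed

end
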